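(* Let $A$ and $B$ be two $A_\infty$-algebras. Then the simplicial set $\mathrm{HOM}_{A_\infty}(A,B)_\bullet$, whose $n$-simplices are the $n$-morphisms from $A$ to $B$, i.e. $\mathrm{HOM}_{A_\infty}(A,B)_n=\mathrm{Hom}_{\mathsf{dg-Cog}}(\pmb{\Delta}^n\otimes\overline{T}(sA),\overline{T}(sB))$, is a Kan complex (every horn $\mathsf{\Lambda}^k_n\to \mathrm{HOM}_{A_\infty}(A,B)_\bullet$, $n\geqslant 1$, $0\leqslant k\leqslant n$, extends to $\Delta^n$).
   Context: Everything is over $\mathbb{Z}$, with cohomological grading (differentials of degree $+1$) and the Koszul sign rule. For a graded module $A$, $sA$ is the suspension, $(sA)^i:=A^{i+1}$. For a graded module $V$, $\overline{T}(V)=\bigoplus_{m\geqslant 1}V^{\otimes m}$ with the deconcatenation coproduct. An $A_\infty$-algebra structure on $A$ is a degree $+1$ coderivation $D_A$ of $\overline{T}(sA)$ with $D_A^2=0$; equivalently, a family of degree $+1$ maps $b_m:(sA)^{\otimes m}\to sA$, $m\geqslant 1$, with $\sum_{i_1+i_2+i_3=m}b_{i_1+1+i_3}(\mathrm{id}^{\otimes i_1}\otimes b_{i_2}\otimes \mathrm{id}^{\otimes i_3})=0$ for all $m\ge 1$. An $A_\infty$-morphism $A\to B$ is a morphism of dg-coalgebras $(\overline{T}(sA),D_A)\to(\overline{T}(sB),D_B)$. $\pmb{\Delta}^n$ is the dg-coalgebra freely generated as a graded $\mathbb Z$-module by the faces $I=[i_0<\dots<i_k]$ of the standard $n$-simplex,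 with $|I|=-\dim I=-k$, differential $\partial[i_0<\dots<i_k]=\sum_{j}(-1)^j[i_0<\dots<\widehat{i_j}<\dots<i_k]$ and Alexander–Whitney coproduct $[i_0<\dots<i_k]\mapsto\sum_j[i_0<\dots<i_j]\otimes[i_j<\dots<i_k]$. The $\pmb{\Delta}^n$, $n\geqslant0$, form a cosimplicial dg-coalgebra: the cofaces are induced by the face inclusions, and the codegeneracy $\sigma_i:\pmb\Delta^{n+1}\to\pmb\Delta^n$ is induced by the map of vertices collapsing $i,i+1$ (faces containing both $i$ and $i+1$ are sent to $0$). This gives the simplicial structure on $\mathrm{HOM}_{A_\infty}(A,B)_\bullet$. $\mathsf{dg-Cog}$ is the category of dg-coalgebras; the tensor product carries the usual dg-coalgebra structure. *)

theory Defs
  imports "HOL-Algebra.Free_Abelian_Groups"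
begin

section \<open>Abelian groups by generators and relators\<close>

text \<open>Abelian groups (that is, \<open>\<int>\<close>-modules) are written multiplicatively, as in HOL-Algebra:
  the sum of \<open>x\<close> and \<open>y\<close> is \<open>x \<otimes>\<^bsub>G\<^esub> y\<close>, the zero is \<open>\<one>\<^bsub>G\<^esub>\<close>, and \<open>z \<cdot> x\<close> for an integer \<open>z\<close> is
  \<open>x [^]\<^bsub>G\<^esub> z\<close>.\<close>

definition presented :: "'s set \<Rightarrow> ('s \<Rightarrow>\<^sub>0 int) set \<Rightarrow> ('s \<Rightarrow>\<^sub>0 int) set monoid" where
  "presented S R = free_Abelian_group S Mod generate (free_Abelian_group S) R"

definition gen_class :: "'s set \<Rightarrow> ('s \<Rightarrow>\<^sub>0 int) set \<Rightarrow> 's \<Rightarrow> ('s \<Rightarrow>\<^sub>0 int) set" where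
  "gen_class S R s = generate (free_Abelian_group S) R #>\<^bsub>free_Abelian_group S\<^esub> frag_of s"

definition free_lift :: "('g, 'm) monoid_scheme \<Rightarrow> ('s \<Rightarrow> 'g) \<Rightarrow> ('s \<Rightarrow>\<^sub>0 int) \<Rightarrow> 'g" where
  "free_lift G b x = finprod G (\<lambda>s. b s [^]\<^bsub>G\<^esub> Poly_Mapping.lookup x s) (Poly_Mapping.keys x)"

text \<open>If \<open>b\<close> respects the relators, then \<open>free_lift G b\<close> is constant on each coset, and
  \<open>lift G b\<close> is the unique homomorphism out of the presented group with values \<open>b s\<close> on the
  classes of the generators \<open>s\<close>. It is only used for such \<open>b\<close>.\<close>

definition lift :: "('g, 'm) monoid_scheme \<Rightarrow> ('s \<Rightarrow> 'g) \<Rightarrow> ('s \<Rightarrow>\<^sub>0 int) set \<Rightarrow> 'g" where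
  "lift G b X = the_elem (free_lift G b ` X)"


section \<open>Graded modules and their tensor products\<close>

type_synonym 'a grmod = "int \<Rightarrow> 'a monoid"

definition graded_module :: "'a grmod \<Rightarrow> bool" where
  "graded_module M \<longleftrightarrow> (\<forall>i. comm_group (M i))"

definition graded_maps :: "int \<Rightarrow> 'a grmod \<Rightarrow> 'b grmod \<Rightarrow> (int \<Rightarrow> 'a \<Rightarrow> 'b) set" where
  "graded_maps p M N = {f. \<forall>i. f i \<in> hom (M i) (N (i + p))}"

definition suspension :: "'a grmod \<Rightarrow> 'a grmod" where
  "suspension M = (\<lambda>i. M (i + 1))"

definition sgn_pow :: "int \<Rightarrow> int" where
  "sgn_pow z = (if even z then 1 else -1)"

text \<open>A homogeneous element is tagged with its degree. The degree \<open>n\<close> part of \<open>M \<otimes> N\<close> is generated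
  by the symbols \<open>x \<otimes> y\<close> with \<open>x, y\<close> homogeneous and \<open>|x| + |y| = n\<close>, subject to biadditivity.\<close>

type_synonym ('a, 'b) tens = "((int \<times> 'a) \<times> (int \<times> 'b) \<Rightarrow>\<^sub>0 int) set"

definition tensor_gens :: "'a grmod \<Rightarrow> 'b grmod \<Rightarrow> int \<Rightarrow> ((int \<times> 'a) \<times> (int \<times> 'b)) set" where
  "tensor_gens M N n =
     {((i, x), (j, y)) | i x j y. i + j = n \<and> x \<in> carrier (M i) \<and> y \<in> carrier (N j)}"

definition tensor_rels ::
    "'a grmod \<Rightarrow> 'b grmod \<Rightarrow> int \<Rightarrow> ((int \<times> 'a) \<times> (int \<times> 'b) \<Rightarrow>\<^sub>0 int) set" where
  "tensor_rels M N n =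
     {frag_of ((i, x \<otimes>\<^bsub>M i\<^esub> x'), (j, y)) - frag_of ((i, x), (j, y)) - frag_of ((i, x'), (j, y))
        | i x x' j y. i + j = n \<and> x \<in> carrier (M i) \<and> x' \<in> carrier (M i) \<and> y \<in> carrier (N j)}
     \<union> {frag_of ((i, x), (j, y \<otimes>\<^bsub>N j\<^esub> y')) - frag_of ((i, x), (j, y)) - frag_of ((i, x), (j, y'))
        | i x j y y'. i + j = n \<and> x \<in> carrier (M i) \<and> y \<in> carrier (N j) \<and> y' \<in> carrier (N j)}"

definition tensor :: "'a grmod \<Rightarrow> 'b grmod \<Rightarrow> ('a, 'b) tens grmod" where
  "tensor M N = (\<lambda>n. presented (tensor_gens M N n) (tensor_rels M N n))"

definition tensor_pure ::
    "'a grmod \<Rightarrow> 'b grmod \<Rightarrow> int \<times> 'a \<Rightarrow> int \<times> 'b \<Rightarrow> ('a, 'b) tens" where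
  "tensor_pure M N u v =
     gen_class (tensor_gens M N (fst u + fst v)) (tensor_rels M N (fst u + fst v)) (u, v)"

text \<open>Koszul rule: for \<open>f : M \<rightarrow> M'\<close> of degree \<open>p\<close> and \<open>g : N \<rightarrow> N'\<close> of degree \<open>q\<close>,
  \<open>(f \<otimes> g)(x \<otimes> y) = (-1)^(q |x|) f x \<otimes> g y\<close>. The last integer argument is the degree of the
  source element.\<close>

definition tensor_map ::
    "'c grmod \<Rightarrow> 'd grmod \<Rightarrow> int \<Rightarrow> int \<Rightarrow> (int \<Rightarrow> 'a \<Rightarrow> 'c) \<Rightarrow> (int \<Rightarrow> 'b \<Rightarrow> 'd)
      \<Rightarrow> int \<Rightarrow> ('a, 'b) tens \<Rightarrow> ('c, 'd) tens" where
  "tensor_map M' N' p q f g n =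
     lift (tensor M' N' (n + p + q))
       (\<lambda>((i, x), (j, y)).
          tensor_pure M' N' (i + p, f i x) (j + q, g j y)
            [^]\<^bsub>tensor M' N' (n + p + q)\<^esub> sgn_pow (q * i))"

abbreviation graded_id :: "int \<Rightarrow> 'a \<Rightarrow> 'a" where
  "graded_id \<equiv> \<lambda>i x. x"


section \<open>Differential graded coalgebras\<close>

text \<open>Coalgebras have no counits. The record holds the structure maps of a dg-coalgebra
  \<open>(C, \<partial>, \<Delta>)\<close>, where \<open>\<partial>\<close> has degree \<open>+1\<close> and \<open>\<Delta> : C \<rightarrow> C \<otimes> C\<close> has degree \<open>0\<close>.\<close>

record 'a dgcoalg =
  module :: "'a grmod"
  diff :: "int \<Rightarrow> 'a \<Rightarrow> 'a"
  coprod :: "int \<Rightarrow> 'a \<Rightarrow> ('a, 'a) tens"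

text \<open>The graded components of a morphism are taken extensional, so that equality of morphisms is
  equality of functions.\<close>

definition dgcog_Hom :: "'a dgcoalg \<Rightarrow> 'b dgcoalg \<Rightarrow> (int \<Rightarrow> 'a \<Rightarrow> 'b) set" where
  "dgcog_Hom C E =
     {f \<in> graded_maps 0 (module C) (module E).
        \<forall>n. f n \<in> extensional (carrier (module C n)) \<and>
          (\<forall>x \<in> carrier (module C n).
             f (n + 1) (diff C n x) = diff E n (f n x) \<and>
             tensor_map (module E) (module E) 0 0 f f n (coprod C n x) = coprod E n (f n x))}"

text \<open>The coproduct of \<open>C \<otimes> E\<close> is \<open>(id \<otimes> \<tau> \<otimes> id) (\<Delta> \<otimes> \<Delta>)\<close> with \<open>\<tau>\<close> the signed swap; with Sweedler
  indices, \<open>x \<otimes> y\<close> goes to the sum of the \<open>(-1)^(|x2| |y1|) (x1 \<otimes> y1) \<otimes> (x2 \<otimes> y2)\<close>.\<close>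

definition dgcog_tensor :: "'a dgcoalg \<Rightarrow> 'b dgcoalg \<Rightarrow> ('a, 'b) tens dgcoalg" where
  "dgcog_tensor C E =
     (let M = module C; N = module E; MN = tensor M N in
      \<lparr>module = MN,
       diff = (\<lambda>n t. tensor_map M N 1 0 (diff C) graded_id n t
                       \<otimes>\<^bsub>MN (n + 1)\<^esub> tensor_map M N 0 1 graded_id (diff E) n t),
       coprod = (\<lambda>n. lift (tensor MN MN n)
         (\<lambda>((i, x), (j, y)).
            lift (tensor MN MN n)
              (\<lambda>((i1, x1), (i2, x2)).
                 lift (tensor MN MN n)
                   (\<lambda>((j1, y1), (j2, y2)).
                      tensor_pure MN MN
                        (i1 + j1, tensor_pure M N (i1, x1) (j1, y1))
                        (i2 + j2, tensor_pure M N (i2, x2) (j2, y2))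
                      [^]\<^bsub>tensor MN MN n\<^esub> sgn_pow (i2 * j1))
                   (coprod E j y))
              (coprod C i x)))\<rparr>)"


section \<open>The reduced tensor coalgebra and A-infinity algebras\<close>

text \<open>The sum of all \<open>V\<^sup>\<otimes>\<^sup>m\<close>, \<open>m \<ge> 1\<close>: the generators of degree \<open>n\<close> are the nonempty words
  of homogeneous elements of total degree \<open>n\<close>, and the relators (additivity in each letter) preserve
  word length. The letter in which additivity is imposed sits between \<open>us\<close> and \<open>vs\<close>.\<close>

type_synonym 'a words = "((int \<times> 'a) list \<Rightarrow>\<^sub>0 int) set"

definition word_degree :: "(int \<times> 'a) list \<Rightarrow> int" where
  "word_degree w = sum_list (map fst w)"

definition word_gens :: "'a grmod \<Rightarrow> int \<Rightarrow> (int \<times> 'a) list set" where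
  "word_gens V n =
     {w. w \<noteq> [] \<and> (\<forall>(i, x) \<in> set w. x \<in> carrier (V i)) \<and> word_degree w = n}"

definition word_rels :: "'a grmod \<Rightarrow> int \<Rightarrow> ((int \<times> 'a) list \<Rightarrow>\<^sub>0 int) set" where
  "word_rels V n =
     {frag_of (us @ (i, x \<otimes>\<^bsub>V i\<^esub> y) # vs) - frag_of (us @ (i, x) # vs) - frag_of (us @ (i, y) # vs)
        | us i x y vs. us @ (i, x) # vs \<in> word_gens V n \<and> us @ (i, y) # vs \<in> word_gens V n}"

definition Tbar :: "'a grmod \<Rightarrow> 'a words grmod" where
  "Tbar V = (\<lambda>n. presented (word_gens V n) (word_rels V n))"

definition word_class :: "'a grmod \<Rightarrow> (int \<times> 'a) list \<Rightarrow> int \<times> 'a words" where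
  "word_class V w =
     (word_degree w, gen_class (word_gens V (word_degree w)) (word_rels V (word_degree w)) w)"

definition deconcat :: "'a grmod \<Rightarrow> int \<Rightarrow> 'a words \<Rightarrow> ('a words, 'a words) tens" where
  "deconcat V n =
     lift (tensor (Tbar V) (Tbar V) n)
       (\<lambda>w. finprod (tensor (Tbar V) (Tbar V) n)
              (\<lambda>r. tensor_pure (Tbar V) (Tbar V)
                      (word_class V (take r w)) (word_class V (drop r w)))
              {1..<length w})"

definition coderivation ::
    "int \<Rightarrow> 'a grmod \<Rightarrow> (int \<Rightarrow> 'a \<Rightarrow> ('a, 'a) tens) \<Rightarrow> (int \<Rightarrow> 'a \<Rightarrow> 'a) \<Rightarrow> bool" where
  "coderivation p C \<Delta> D \<longleftrightarrow>
     D \<in> graded_maps p C C \<and>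
     (\<forall>n. \<forall>x \<in> carrier (C n).
        \<Delta> (n + p) (D n x) =
          tensor_map C C p 0 D graded_id n (\<Delta> n x)
            \<otimes>\<^bsub>tensor C C (n + p)\<^esub> tensor_map C C 0 p graded_id D n (\<Delta> n x))"

record 'a ainf =
  underlying :: "'a grmod"
  codiff :: "int \<Rightarrow> 'a words \<Rightarrow> 'a words"

definition A_infinity_algebra :: "'a ainf \<Rightarrow> bool" where
  "A_infinity_algebra A \<longleftrightarrow>
     (let V = suspension (underlying A) in
      graded_module (underlying A) \<and>
      coderivation 1 (Tbar V) (deconcat V) (codiff A) \<and>
      (\<forall>n. \<forall>x \<in> carrier (Tbar V n). codiff A (n + 1) (codiff A n x) = \<one>\<^bsub>Tbar V (n + 2)\<^esub>))"

definition bar :: "'a ainf \<Rightarrow> 'a words dgcoalg" where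
  "bar A = \<lparr>module = Tbar (suspension (underlying A)), diff = codiff A,
            coprod = deconcat (suspension (underlying A))\<rparr>"


section \<open>Simplicial sets and Kan complexes\<close>

text \<open>Simplicial sets are functors on the opposite of the category of the ordinals \<open>[n] = {0..n}\<close>;
  for \<open>\<theta> : [m] \<rightarrow> [n]\<close>, \<open>act X m n \<theta>\<close> is the induced map from \<open>n\<close>-simplices to \<open>m\<close>-simplices.\<close>

definition ord_maps :: "nat \<Rightarrow> nat \<Rightarrow> (nat \<Rightarrow> nat) set" where
  "ord_maps m n = {\<theta> \<in> {0..m} \<rightarrow>\<^sub>E {0..n}. mono_on {0..m} \<theta>}"

record 'x sset =
  simplices :: "nat \<Rightarrow> 'x set"
  act :: "nat \<Rightarrow> nat \<Rightarrow> (nat \<Rightarrow> nat) \<Rightarrow> 'x \<Rightarrow> 'x"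

definition simplicial_set :: "'x sset \<Rightarrow> bool" where
  "simplicial_set X \<longleftrightarrow>
     (\<forall>m n. \<forall>\<theta> \<in> ord_maps m n. act X m n \<theta> \<in> simplices X n \<rightarrow> simplices X m) \<and>
     (\<forall>n. \<forall>x \<in> simplices X n. act X n n (restrict id {0..n}) x = x) \<and>
     (\<forall>l m n. \<forall>\<eta> \<in> ord_maps l m. \<forall>\<theta> \<in> ord_maps m n. \<forall>x \<in> simplices X n.
        act X l n (compose {0..l} \<theta> \<eta>) x = act X l m \<eta> (act X m n \<theta> x))"

definition simplicial_map :: "'x sset \<Rightarrow> 'y sset \<Rightarrow> (nat \<Rightarrow> 'x \<Rightarrow> 'y) \<Rightarrow> bool" where
  "simplicial_map X Y F \<longleftrightarrow>
     (\<forall>n. F n \<in> simplices X n \<rightarrow> simplices Y n) \<and>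
     (\<forall>m n. \<forall>\<theta> \<in> ord_maps m n. \<forall>x \<in> simplices X n. F m (act X m n \<theta> x) = act Y m n \<theta> (F n x))"

definition std_simplex :: "nat \<Rightarrow> (nat \<Rightarrow> nat) sset" where
  "std_simplex n = \<lparr>simplices = (\<lambda>m. ord_maps m n), act = (\<lambda>l m \<eta> \<theta>. compose {0..l} \<theta> \<eta>)\<rparr>"

text \<open>The \<open>k\<close>-th horn is the union of the faces of \<open>\<Delta>\<^sup>n\<close> opposite to the vertices other than \<open>k\<close>:
  a simplex of \<open>\<Delta>\<^sup>n\<close> lies in it iff it misses some vertex \<open>i \<noteq> k\<close>.\<close>

definition horn :: "nat \<Rightarrow> nat \<Rightarrow> (nat \<Rightarrow> nat) sset" where
  "horn n k = (std_simplex n)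
     \<lparr>simplices := (\<lambda>m. {\<theta> \<in> ord_maps m n. \<exists>i \<in> {0..n}. i \<noteq> k \<and> i \<notin> \<theta> ` {0..m}})\<rparr>"

definition kan_complex :: "'x sset \<Rightarrow> bool" where
  "kan_complex X \<longleftrightarrow>
     simplicial_set X \<and>
     (\<forall>n k g. 1 \<le> n \<and> k \<le> n \<and> simplicial_map (horn n k) X g \<longrightarrow>
        (\<exists>G. simplicial_map (std_simplex n) X G \<and>
             (\<forall>m. \<forall>\<theta> \<in> simplices (horn n k) m. G m \<theta> = g m \<theta>)))"


section \<open>The cosimplicial dg-coalgebra of the simplices\<close>

text \<open>The face \<open>[i0 < \<dots> < ik]\<close> is encoded as the set \<open>{i0, \<dots>, ik}\<close>, so that the position of a
  vertex \<open>v\<close> in \<open>I\<close> is the number of elements of \<open>I\<close> below \<open>v\<close>. Faces of dimension \<open>k\<close> have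
  degree \<open>- k\<close>.\<close>

definition face_degree :: "nat set \<Rightarrow> int" where
  "face_degree I = 1 - int (card I)"

definition simplex_module :: "nat \<Rightarrow> (nat set \<Rightarrow>\<^sub>0 int) grmod" where
  "simplex_module n = (\<lambda>d. free_Abelian_group {I. I \<noteq> {} \<and> I \<subseteq> {0..n} \<and> face_degree I = d})"

definition face_boundary :: "nat set \<Rightarrow> (nat set \<Rightarrow>\<^sub>0 int)" where
  "face_boundary I =
     (if card I = 1 then 0
      else \<Sum>v\<in>I. frag_cmul ((-1) ^ card {u \<in> I. u < v}) (frag_of (I - {v})))"

definition alexander_whitney :: "nat \<Rightarrow> nat set \<Rightarrow> (nat set \<Rightarrow>\<^sub>0 int, nat set \<Rightarrow>\<^sub>0 int) tens" where
  "alexander_whitney n I =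
     (let M = simplex_module n;
          face = (\<lambda>J. (face_degree J, frag_of J)) in
      finprod (tensor M M (face_degree I))
        (\<lambda>v. tensor_pure M M (face {u \<in> I. u \<le> v}) (face {u \<in> I. v \<le> u})) I)"

definition simplex_dgcog :: "nat \<Rightarrow> (nat set \<Rightarrow>\<^sub>0 int) dgcoalg" where
  "simplex_dgcog n =
     \<lparr>module = simplex_module n,
      diff = (\<lambda>d. frag_extend face_boundary),
      coprod = (\<lambda>d. free_lift (tensor (simplex_module n) (simplex_module n) d)
                      (alexander_whitney n))\<rparr>"

text \<open>The map of dg-coalgebras induced by a monotone map of vertices: degenerate images are sent to
  \<open>0\<close>. For the monotone injections \<open>[n] \<rightarrow> [n+1]\<close> these are the cofaces, for the monotone
  surjections \<open>[n+1] \<rightarrow> [n]\<close> the codegeneracies.\<close>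

definition simplex_push :: "(nat \<Rightarrow> nat) \<Rightarrow> int \<Rightarrow> (nat set \<Rightarrow>\<^sub>0 int) \<Rightarrow> (nat set \<Rightarrow>\<^sub>0 int)" where
  "simplex_push \<theta> d = frag_extend (\<lambda>I. if inj_on \<theta> I then frag_of (\<theta> ` I) else 0)"


section \<open>The simplicial set of higher morphisms\<close>

definition n_morphisms ::
    "'a ainf \<Rightarrow> 'b ainf \<Rightarrow> nat \<Rightarrow> (int \<Rightarrow> (nat set \<Rightarrow>\<^sub>0 int, 'a words) tens \<Rightarrow> 'b words) set" where
  "n_morphisms A B n = dgcog_Hom (dgcog_tensor (simplex_dgcog n) (bar A)) (bar B)"

definition HOM_ainf ::
    "'a ainf \<Rightarrow> 'b ainf \<Rightarrow> (int \<Rightarrow> (nat set \<Rightarrow>\<^sub>0 int, 'a words) tens \<Rightarrow> 'b words) sset" where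
  "HOM_ainf A B =
     \<lparr>simplices = n_morphisms A B,
      act = (\<lambda>m n \<theta> f d.
        restrict
          (\<lambda>t. f d (tensor_map (simplex_module n) (module (bar A)) 0 0
                      (simplex_push \<theta>) graded_id d t))
          (carrier (tensor (simplex_module m) (module (bar A)) d)))\<rparr>"

end

theory Submission
  imports Defs
begin


text \<open>Write \<open>T A\<close> for the reduced tensor coalgebra on the suspension of \<open>A\<close>, with its codifferential. An
  \<open>n\<close>-morphism \<open>f\<close> is the same as a family of maps \<open>F I : T A \<rightarrow> T B\<close>, indexed by the faces \<open>I\<close> of the
  simplex, that satisfies two rules: the coproduct of \<open>F I x\<close> is the sum, over the vertices of \<open>I\<close>, of
  the tensor products of the two corresponding members of the family, applied to the coproduct of \<open>x\<close>;
  and the differential of \<open>F I x\<close> is \<open>F (\<partial> I) x\<close> plus, up to sign, \<open>F I\<close> of the differential of \<open>x\<close>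
  (\<open>dgcog_Hom_iff\<close>). A horn of higher morphisms is the same as a family on the faces of the horn
  (\<open>horn_family_simplex\<close>, \<open>horn_family_morphism\<close>), and filling it means extending this family to the
  top face \<open>\<tau>\<close> and to the missing face \<open>\<kappa>\<close>.

  The tensor coalgebra \<open>T B\<close> is cofree. An element is determined by its one-letter part and its coproduct
  (\<open>reconstruct\<close>); therefore the one-letter parts of the \<open>F I\<close> can be prescribed arbitrarily, the rest of
  \<open>F I\<close> on a word is then forced by the values on shorter words, and the coproduct rule holds
  (\<open>cofreeness\<close>).

  The one-letter part of \<open>F \<tau>\<close> is chosen to be zero. The one-letter part of the differential rule for
  \<open>\<tau>\<close> then contains the one-letter part of \<open>F \<kappa>\<close>, with coefficient \<open>1\<close> or \<open>-1\<close>, and otherwise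
  only known terms. Solving for it defines the family by recursion on word length
  (\<open>missing_head\<close>, \<open>fill\<close>). This is where it matters that exactly one face of \<open>\<tau>\<close> is missing.

  It remains to prove the differential rule on all of \<open>T B\<close>, by induction on word length. If it holds on
  shorter words, then the two sides have equal coproducts, because the differentials are coderivations
  and the Alexander--Whitney coproduct is a chain map (\<open>differential_rule_deconcat\<close>). For \<open>\<tau>\<close> the
  one-letter parts agree by construction, so that the rule holds. For \<open>\<kappa>\<close> it follows from the rule
  for \<open>\<tau>\<close>, since both differentials and the boundary square to zero (\<open>differential_rule_missing\<close>);
  this uses that the differential of \<open>T A\<close> does not increase word length
  (\<open>coderivation_length_part_word\<close>).\<close>

section \<open>Integer combinations in abelian groups\<close>

text \<open>Evaluating formal combinations with \<open>free_lift\<close> is linear in the combination and compatible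
  with substitution. Identities between signed sums of faces are therefore proved once, in a free
  abelian group, where they are statements about a type class, and are then evaluated in groups that
  are only given by a carrier.\<close>

context comm_group
begin

lemma free_lift_superset:
  assumes "finite K" "Poly_Mapping.keys a \<subseteq> K" "b \<in> K \<rightarrow> carrier G"
  shows "free_lift G b a = finprod G (\<lambda>s. b s [^] Poly_Mapping.lookup a s) K"
  unfolding free_lift_def
  by (rule finprod_mono_neutral_cong_left) (use assms in \<open>auto simp: in_keys_iff\<close>)

lemma free_lift_closed [simp]:
  assumes "\<And>s. s \<in> Poly_Mapping.keys a \<Longrightarrow> b s \<in> carrier G"
  shows "free_lift G b a \<in> carrier G"
  unfolding free_lift_def using assms by (intro finprod_closed) auto

lemma free_lift_zero [simp]: "free_lift G b 0 = \<one>"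
  by (simp add: free_lift_def)

lemma free_lift_frag_of [simp]: "b s \<in> carrier G \<Longrightarrow> free_lift G b (frag_of s) = b s"
  by (simp add: free_lift_def)

lemma free_lift_cong:
  assumes "\<And>s. s \<in> Poly_Mapping.keys a \<Longrightarrow> b s = c s" "\<And>s. s \<in> Poly_Mapping.keys a \<Longrightarrow> c s \<in> carrier G"
  shows "free_lift G b a = free_lift G c a"
  unfolding free_lift_def using assms by (intro finprod_cong') auto

lemma free_lift_add:
  assumes "\<And>s. s \<in> Poly_Mapping.keys x \<union> Poly_Mapping.keys y \<Longrightarrow> b s \<in> carrier G"
  shows "free_lift G b (x + y) = free_lift G b x \<otimes> free_lift G b y"
proof -
  let ?K = "Poly_Mapping.keys x \<union> Poly_Mapping.keys y"
  have "free_lift G b (x + y) = finprod G (\<lambda>s. b s [^] Poly_Mapping.lookup (x + y) s) ?K"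
    by (rule free_lift_superset) (use assms in \<open>auto dest: subsetD[OF keys_add]\<close>)
  also have "\<dots> = finprod G (\<lambda>s. b s [^] Poly_Mapping.lookup x s \<otimes> b s [^] Poly_Mapping.lookup y s) ?K"
    by (rule finprod_cong') (use assms in \<open>auto simp: lookup_add int_pow_mult\<close>)
  also have "\<dots> = finprod G (\<lambda>s. b s [^] Poly_Mapping.lookup x s) ?K
                 \<otimes> finprod G (\<lambda>s. b s [^] Poly_Mapping.lookup y s) ?K"
    by (rule finprod_multf) (use assms in auto)
  also have "\<dots> = free_lift G b x \<otimes> free_lift G b y"
    by (subst (1 2) free_lift_superset[of ?K]) (use assms in auto)
  finally show ?thesis .
qed

lemma free_lift_minus:
  assumes "\<And>s. s \<in> Poly_Mapping.keys x \<Longrightarrow> b s \<in> carrier G"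
  shows "free_lift G b (- x) = inv (free_lift G b x)"
proof -
  have "free_lift G b (- x) \<otimes> free_lift G b x = \<one>"
    by (subst free_lift_add[symmetric]) (use assms in auto)
  then show ?thesis
    using assms by (metis free_lift_closed inv_equality keys_minus)
qed

lemma free_lift_diff:
  assumes "\<And>s. s \<in> Poly_Mapping.keys x \<union> Poly_Mapping.keys y \<Longrightarrow> b s \<in> carrier G"
  shows "free_lift G b (x - y) = free_lift G b x \<otimes> inv (free_lift G b y)"
  using free_lift_add[of x "- y" b] free_lift_minus[of y b] assms by simp

lemma free_lift_cmul:
  assumes "\<And>s. s \<in> Poly_Mapping.keys x \<Longrightarrow> b s \<in> carrier G"
  shows "free_lift G b (frag_cmul z x) = free_lift G b x [^] z"
proof -
  have *: "free_lift G b (frag_cmul (int n) x) = free_lift G b x [^] int n" for n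
  proof (induction n)
    case (Suc n)
    have "frag_cmul (int (Suc n)) x = frag_cmul (int n) x + x"
      using frag_cmul_distrib[of "int n" 1 x] by (simp add: algebra_simps)
    then have "free_lift G b (frag_cmul (int (Suc n)) x)
        = free_lift G b (frag_cmul (int n) x) \<otimes> free_lift G b x"
      using assms by (simp only:) (rule free_lift_add, auto)
    moreover have "free_lift G b x [^] int (Suc n) = free_lift G b x [^] int n \<otimes> free_lift G b x"
      using assms int_pow_mult[of "free_lift G b x" "int n" 1] by (simp add: algebra_simps)
    ultimately show ?case using Suc by simp
  qed simp
  show ?thesis
  proof (cases z)
    case (nonneg n) then show ?thesis using * by simp
  next
    case (neg n)
    have "frag_cmul z x = - frag_cmul (int (Suc n)) x" by (simp add: neg)
    then have "free_lift G b (frag_cmul z x) = inv (free_lift G b (frag_cmul (int (Suc n)) x))"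
      using assms by (metis free_lift_minus keys_cmul_iff)
    then show ?thesis using *[of "Suc n"] assms
      by (simp only: neg) (rule int_pow_neg[symmetric], simp)
  qed
qed

lemma free_lift_sum:
  assumes "finite I" "\<And>i s. i \<in> I \<Longrightarrow> s \<in> Poly_Mapping.keys (x i) \<Longrightarrow> b s \<in> carrier G"
  shows "free_lift G b (\<Sum>i\<in>I. x i) = finprod G (\<lambda>i. free_lift G b (x i)) I"
  using assms
proof (induction I rule: finite_induct)
  case (insert i I)
  have "free_lift G b (x i + sum x I) = free_lift G b (x i) \<otimes> free_lift G b (sum x I)"
    by (rule free_lift_add) (use insert.prems keys_sum[of x I] in \<open>blast\<close>)
  moreover have "free_lift G b (sum x I) = finprod G (\<lambda>i. free_lift G b (x i)) I"
    using insert by auto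
  moreover have "(\<lambda>i. free_lift G b (x i)) \<in> I \<rightarrow> carrier G" "free_lift G b (x i) \<in> carrier G"
    by (intro Pi_I free_lift_closed; blast intro: insert.prems)+
  ultimately show ?case using insert.hyps by simp
qed simp

lemma free_lift_extend:
  assumes "\<And>s t. s \<in> Poly_Mapping.keys x \<Longrightarrow> t \<in> Poly_Mapping.keys (c s) \<Longrightarrow> b t \<in> carrier G"
  shows "free_lift G b (frag_extend c x) = free_lift G (\<lambda>s. free_lift G b (c s)) x"
  unfolding frag_extend_def
  by (subst free_lift_sum)
     (use assms in \<open>auto simp: free_lift_def[of G "\<lambda>s. free_lift G b (c s)"] free_lift_cmul
                         intro!: finprod_cong'\<close>)

lemma free_lift_mult:
  assumes "\<And>s. s \<in> Poly_Mapping.keys a \<Longrightarrow> b s \<in> carrier G"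
    "\<And>s. s \<in> Poly_Mapping.keys a \<Longrightarrow> c s \<in> carrier G"
  shows "free_lift G (\<lambda>s. b s \<otimes> c s) a = free_lift G b a \<otimes> free_lift G c a"
proof -
  have "free_lift G (\<lambda>s. b s \<otimes> c s) a
      = finprod G (\<lambda>s. b s [^] Poly_Mapping.lookup a s \<otimes> c s [^] Poly_Mapping.lookup a s) (Poly_Mapping.keys a)"
    unfolding free_lift_def using assms by (intro finprod_cong') (auto simp: int_pow_distrib)
  then show ?thesis unfolding free_lift_def using assms by (simp add: Pi_def)
qed

lemma free_lift_one [simp]: "free_lift G (\<lambda>s. \<one>) a = \<one>"
  by (simp add: free_lift_def)

lemma int_pow_hom: "(\<lambda>x. x [^] (z::int)) \<in> hom G G"
  by (auto simp: hom_def int_pow_distrib)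

end

lemma hom_finprod:
  assumes G: "comm_group G" and H: "comm_group H" and h: "h \<in> hom G H" and f: "f \<in> A \<rightarrow> carrier G"
  shows "h (finprod G f A) = finprod H (\<lambda>i. h (f i)) A"
proof -
  interpret G: comm_group G by fact
  interpret H: comm_group H by fact
  show ?thesis using f
  proof (induction A rule: infinite_finite_induct)
    case (insert a A)
    then have "(\<lambda>i. h (f i)) \<in> A \<rightarrow> carrier H" using h by (auto simp: hom_def)
    with insert h show ?case by (auto simp: hom_def Pi_def)
  qed (use h in \<open>auto intro: hom_one\<close>)
qed

lemma hom_free_lift:
  assumes G: "comm_group G" and H: "comm_group H" and h: "h \<in> hom G H"
    and b: "\<And>s. s \<in> Poly_Mapping.keys a \<Longrightarrow> b s \<in> carrier G"
  shows "h (free_lift G b a) = free_lift H (\<lambda>s. h (b s)) a"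
proof -
  interpret G: comm_group G by fact
  interpret H: comm_group H by fact
  show ?thesis unfolding free_lift_def
    by (subst hom_finprod[OF G H h])
       (use b h in \<open>auto simp: hom_int_pow[OF h] hom_def intro!: H.finprod_cong' H.int_pow_closed\<close>)
qed

lemma hom_mult_pointwise:
  assumes "comm_group H" "f \<in> hom G H" "g \<in> hom G H"
  shows "(\<lambda>x. f x \<otimes>\<^bsub>H\<^esub> g x) \<in> hom G H"
proof -
  interpret H: comm_group H by fact
  show ?thesis using assms(2,3) by (auto simp: hom_def Pi_def H.m_ac)
qed

lemma hom_pow_pointwise:
  assumes "comm_group H" "f \<in> hom G H"
  shows "(\<lambda>x. f x [^]\<^bsub>H\<^esub> (z::int)) \<in> hom G H"
proof -
  interpret H: comm_group H by fact
  show ?thesis using assms(2) by (auto simp: hom_def Pi_def H.int_pow_distrib)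
qed

lemma hom_one_pointwise: "group H \<Longrightarrow> (\<lambda>x. \<one>\<^bsub>H\<^esub>) \<in> hom G H"
  by (auto simp: hom_def group.is_monoid)

lemma hom_finprod_pointwise:
  assumes "comm_group H" "\<And>i. i \<in> A \<Longrightarrow> f i \<in> hom G H"
  shows "(\<lambda>x. finprod H (\<lambda>i. f i x) A) \<in> hom G H"
proof -
  interpret H: comm_group H by fact
  show ?thesis
  proof (rule homI)
    fix x y assume "x \<in> carrier G" "y \<in> carrier G"
    moreover from this have "finprod H (\<lambda>i. f i (x \<otimes>\<^bsub>G\<^esub> y)) A = finprod H (\<lambda>i. f i x \<otimes>\<^bsub>H\<^esub> f i y) A"
      using assms(2) by (intro H.finprod_cong') (auto simp: hom_def Pi_def)
    ultimately show "finprod H (\<lambda>i. f i (x \<otimes>\<^bsub>G\<^esub> y)) A = finprod H (\<lambda>i. f i x) A \<otimes>\<^bsub>H\<^esub> finprod H (\<lambda>i. f i y) A"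
      using assms(2) by (simp add: hom_def Pi_def H.finprod_multf)
  qed (use assms(2) in \<open>auto simp: hom_def Pi_def intro!: H.finprod_closed\<close>)
qed

lemma hom_free_lift_pointwise:
  assumes "comm_group H" "\<And>s. s \<in> Poly_Mapping.keys a \<Longrightarrow> f s \<in> hom G H"
  shows "(\<lambda>x. free_lift H (\<lambda>s. f s x) a) \<in> hom G H"
  unfolding free_lift_def
  by (intro hom_finprod_pointwise hom_pow_pointwise assms)

lemma hom_comp: "f \<in> hom G H \<Longrightarrow> g \<in> hom H K \<Longrightarrow> (\<lambda>x. g (f x)) \<in> hom G K"
  using hom_compose[of f G H g K] by (simp add: comp_def)

lemma free_lift_hom:
  assumes "comm_group G" "b \<in> S \<rightarrow> carrier G"
  shows "free_lift G b \<in> hom (free_Abelian_group S) G"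
proof -
  interpret comm_group G by fact
  show ?thesis
    by (rule homI) (use assms(2) in \<open>auto intro!: free_lift_add free_lift_closed\<close>)
qed

lemma (in comm_group) finprod_swap:
  assumes "finite A" "finite B" "\<And>a b. a \<in> A \<Longrightarrow> b \<in> B \<Longrightarrow> f a b \<in> carrier G"
  shows "finprod G (\<lambda>a. finprod G (f a) B) A = finprod G (\<lambda>b. finprod G (\<lambda>a. f a b) A) B"
  using assms(1,3)
proof (induction A rule: finite_induct)
  case (insert a A)
  then have "finprod G (\<lambda>b. finprod G (\<lambda>a. f a b) (insert a A)) B
      = finprod G (\<lambda>b. f a b \<otimes> finprod G (\<lambda>a. f a b) A) B"
    by (intro finprod_cong') (auto simp: Pi_def)
  with insert show ?case by (simp add: finprod_multf Pi_def)
qed simp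

section \<open>Groups given by generators and relators\<close>

text \<open>The relators are required to lie in the free group on the generators, since otherwise the subgroup
  generated by them is meaningless.\<close>

locale presentation =
  fixes S :: "'s set" and R :: "('s \<Rightarrow>\<^sub>0 int) set"
  assumes relators: "R \<subseteq> carrier (free_Abelian_group S)"
begin

sublocale free: comm_group "free_Abelian_group S" by (rule abelian_free_Abelian_group)

abbreviation "N \<equiv> generate (free_Abelian_group S) R"

lemma subgroup_relators: "subgroup N (free_Abelian_group S)"
  by (rule free.generate_is_subgroup[OF relators])

lemma normal_relators: "normal N (free_Abelian_group S)"
  by (rule free.subgroup_imp_normal[OF subgroup_relators])

lemma comm_group_presented: "comm_group (presented S R)"
  unfolding presented_def by (rule free.abelian_FactGroup[OF subgroup_relators])

lemma class_hom: "(\<lambda>a. N #>\<^bsub>free_Abelian_group S\<^esub> a) \<in> hom (free_Abelian_group S) (presented S R)"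
  unfolding presented_def by (rule normal.r_coset_hom_Mod[OF normal_relators])

lemma gen_class_closed: "s \<in> S \<Longrightarrow> gen_class S R s \<in> carrier (presented S R)"
  using class_hom unfolding gen_class_def hom_def by auto

lemma class_eq_free_lift:
  assumes "Poly_Mapping.keys a \<subseteq> S"
  shows "N #>\<^bsub>free_Abelian_group S\<^esub> a = free_lift (presented S R) (gen_class S R) a"
proof -
  interpret Q: comm_group "presented S R" by (rule comm_group_presented)
  let ?F = "free_Abelian_group S"
  have "free_lift ?F frag_of a = a"
  proof -
    have "free_lift ?F frag_of a = (\<Sum>i\<in>I. frag_cmul (Poly_Mapping.lookup a i) (frag_of i))"
      if "I = Poly_Mapping.keys a" for I
    proof -
      have "finite K \<Longrightarrow> K \<subseteq> S \<Longrightarrow> finprod ?F (\<lambda>s. frag_of s [^]\<^bsub>?F\<^esub> Poly_Mapping.lookup a s) K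
          = (\<Sum>i\<in>K. frag_cmul (Poly_Mapping.lookup a i) (frag_of i))" for K
      proof (induction K rule: finite_induct)
        case (insert k K)
        have "(\<lambda>s. frag_of s [^]\<^bsub>?F\<^esub> Poly_Mapping.lookup a s) \<in> K \<rightarrow> carrier ?F"
          using insert by (auto intro!: free.int_pow_closed simp del: carrier_free_Abelian_group_iff)
        moreover have "frag_of k [^]\<^bsub>?F\<^esub> Poly_Mapping.lookup a k \<in> carrier ?F"
          using insert by (intro free.int_pow_closed) auto
        ultimately show ?case using insert by (simp add: free.finprod_insert)
      qed simp
      then show ?thesis using assms that by (simp add: free_lift_def)
    qed
    then show ?thesis using frag_expansion[of a] by (simp add: frag_extend_def)
  qed
  then have "N #>\<^bsub>?F\<^esub> a = N #>\<^bsub>?F\<^esub> (free_lift ?F frag_of a)" by simp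
  also have "\<dots> = free_lift (presented S R) (\<lambda>s. N #>\<^bsub>?F\<^esub> frag_of s) a"
    by (rule hom_free_lift[OF free.comm_group_axioms Q.comm_group_axioms class_hom])
       (use assms in auto)
  finally show ?thesis by (simp add: gen_class_def[abs_def])
qed

lemma presented_cases:
  assumes "X \<in> carrier (presented S R)"
  obtains a where "Poly_Mapping.keys a \<subseteq> S" "X = N #>\<^bsub>free_Abelian_group S\<^esub> a"
  using assms unfolding presented_def carrier_FactGroup by auto

lemma presented_hom_eq:
  assumes H: "comm_group H" and f: "f \<in> hom (presented S R) H" and g: "g \<in> hom (presented S R) H"
    and eq: "\<And>s. s \<in> S \<Longrightarrow> f (gen_class S R s) = g (gen_class S R s)"
    and X: "X \<in> carrier (presented S R)"
  shows "f X = g X"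
proof -
  interpret H: comm_group H by fact
  obtain a where a: "Poly_Mapping.keys a \<subseteq> S" "X = N #>\<^bsub>free_Abelian_group S\<^esub> a"
    using presented_cases[OF X] .
  have c: "gen_class S R s \<in> carrier (presented S R)" if "s \<in> Poly_Mapping.keys a" for s
    using that a(1) gen_class_closed by auto
  have "free_lift H (\<lambda>s. f (gen_class S R s)) a = free_lift H (\<lambda>s. g (gen_class S R s)) a"
    by (rule H.free_lift_cong) (use a(1) eq c g in \<open>auto simp: hom_def\<close>)
  then show ?thesis
    using a c by (simp add: class_eq_free_lift hom_free_lift[OF comm_group_presented H f]
        hom_free_lift[OF comm_group_presented H g])
qed

lemma presented_induct:
  assumes X: "X \<in> carrier (presented S R)"
    and H: "subgroup H (presented S R)" "\<And>s. s \<in> S \<Longrightarrow> gen_class S R s \<in> H"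
  shows "X \<in> H"
proof -
  interpret Q: comm_group "presented S R" by (rule comm_group_presented)
  obtain a where a: "Poly_Mapping.keys a \<subseteq> S" "X = N #>\<^bsub>free_Abelian_group S\<^esub> a"
    using presented_cases[OF X] .
  have "N #>\<^bsub>free_Abelian_group S\<^esub> a \<in> H"
  proof (rule free_Abelian_group_induct[where P = "\<lambda>a. N #>\<^bsub>free_Abelian_group S\<^esub> a \<in> H", OF a(1)])
    fix x y assume *: "Poly_Mapping.keys x \<subseteq> S" "Poly_Mapping.keys y \<subseteq> S"
      "N #>\<^bsub>free_Abelian_group S\<^esub> x \<in> H" "N #>\<^bsub>free_Abelian_group S\<^esub> y \<in> H"
    have "Poly_Mapping.keys (x - y) \<subseteq> S" using * keys_diff[of x y] by auto
    moreover have "free_lift (presented S R) (gen_class S R) (x - y)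
       = free_lift (presented S R) (gen_class S R) x \<otimes>\<^bsub>presented S R\<^esub>
         inv\<^bsub>presented S R\<^esub> free_lift (presented S R) (gen_class S R) y"
      by (rule Q.free_lift_diff) (use * gen_class_closed in auto)
    ultimately show "N #>\<^bsub>free_Abelian_group S\<^esub> (x - y) \<in> H"
      using * H by (simp add: class_eq_free_lift subgroup.m_closed subgroup.m_inv_closed)
  qed (use H gen_class_closed in \<open>auto simp: class_eq_free_lift subgroup.one_closed\<close>)
  with a show ?thesis by simp
qed

end

locale presentation_lift = presentation S R + target: comm_group G
  for S :: "'s set" and R :: "('s \<Rightarrow>\<^sub>0 int) set" and G :: "('g, 'm) monoid_scheme" +
  fixes b :: "'s \<Rightarrow> 'g"
  assumes b_closed: "b \<in> S \<rightarrow> carrier G"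
    and respects: "\<And>r. r \<in> R \<Longrightarrow> free_lift G b r = \<one>\<^bsub>G\<^esub>"
begin

lemma free_lift_relators: "n \<in> N \<Longrightarrow> free_lift G b n = \<one>\<^bsub>G\<^esub>"
proof -
  have h: "free_lift G b \<in> hom (free_Abelian_group S) G"
    using free_lift_hom[OF target.comm_group_axioms b_closed] .
  have "subgroup (kernel (free_Abelian_group S) G (free_lift G b)) (free_Abelian_group S)"
    using h by (intro group_hom.subgroup_kernel group_hom.intro group_hom_axioms.intro) auto
  moreover have "R \<subseteq> kernel (free_Abelian_group S) G (free_lift G b)"
    using respects relators unfolding kernel_def by blast
  ultimately show "n \<in> N \<Longrightarrow> free_lift G b n = \<one>\<^bsub>G\<^esub>"
    using free.generate_subgroup_incl by (auto simp: kernel_def)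
qed

lemma lift_class:
  assumes a: "Poly_Mapping.keys a \<subseteq> S"
  shows "lift G b (N #>\<^bsub>free_Abelian_group S\<^esub> a) = free_lift G b a"
proof -
  have "free_lift G b (n + a) = free_lift G b a" if "n \<in> N" for n
  proof -
    have k: "Poly_Mapping.keys n \<subseteq> S"
      using that free.generate_in_carrier[OF relators] by auto
    have "free_lift G b (n + a) = free_lift G b n \<otimes>\<^bsub>G\<^esub> free_lift G b a"
      using k a b_closed by (intro target.free_lift_add) auto
    moreover have "free_lift G b a \<in> carrier G"
      using a b_closed by (intro target.free_lift_closed) auto
    ultimately show ?thesis using free_lift_relators[OF that] by simp
  qed
  moreover have "0 \<in> N"
    using generate.one[of "free_Abelian_group S"] by simp
  ultimately have "free_lift G b ` (N #>\<^bsub>free_Abelian_group S\<^esub> a) = {free_lift G b a}"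
    by (force simp: r_coset_def)
  then show ?thesis by (simp add: lift_def)
qed

lemma lift_gen_class: "s \<in> S \<Longrightarrow> lift G b (gen_class S R s) = b s"
  using lift_class[of "frag_of s"] b_closed by (auto simp: gen_class_def Pi_def)

lemma lift_hom: "lift G b \<in> hom (presented S R) G"
proof (rule homI)
  fix X assume "X \<in> carrier (presented S R)"
  then obtain a where a: "Poly_Mapping.keys a \<subseteq> S" "X = N #>\<^bsub>free_Abelian_group S\<^esub> a"
    by (rule presented_cases)
  then show "lift G b X \<in> carrier G"
    using b_closed by (auto simp: lift_class intro!: target.free_lift_closed)
  fix Y assume "Y \<in> carrier (presented S R)"
  then obtain c where c: "Poly_Mapping.keys c \<subseteq> S" "Y = N #>\<^bsub>free_Abelian_group S\<^esub> c"
    by (rule presented_cases)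
  have "X \<otimes>\<^bsub>presented S R\<^esub> Y = N #>\<^bsub>free_Abelian_group S\<^esub> (a + c)"
    using class_hom a c unfolding hom_def by auto
  moreover have "Poly_Mapping.keys (a + c) \<subseteq> S"
    using a c keys_add[of a c] by auto
  moreover have "free_lift G b (a + c) = free_lift G b a \<otimes>\<^bsub>G\<^esub> free_lift G b c"
    using a c b_closed by (intro target.free_lift_add) auto
  ultimately show "lift G b (X \<otimes>\<^bsub>presented S R\<^esub> Y) = lift G b X \<otimes>\<^bsub>G\<^esub> lift G b Y"
    using a c by (simp add: lift_class)
qed

end


lemma (in presentation) relator_vanishes:
  assumes "r \<in> R" shows "free_lift (presented S R) (gen_class S R) r = \<one>\<^bsub>presented S R\<^esub>"
proof -
  have r: "Poly_Mapping.keys r \<subseteq> S" using assms relators by fastforce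
  have "r \<in> N" using assms by (rule generate.incl)
  then have "N #>\<^bsub>free_Abelian_group S\<^esub> r = N"
    by (intro free.coset_join2 subgroup_relators) (use r in auto)
  then show ?thesis unfolding class_eq_free_lift[OF r] by (simp add: presented_def)
qed

text \<open>All relators of tensor products and of tensor coalgebras have this shape, so that respecting them
  amounts to additivity in one variable.\<close>

lemma (in comm_group) free_lift_relator:
  assumes "b u \<in> carrier G" "b v \<in> carrier G" "b w \<in> carrier G"
  shows "free_lift G b (frag_of u - frag_of v - frag_of w) = \<one> \<longleftrightarrow> b u = b v \<otimes> b w"
proof -
  have "free_lift G b (frag_of u - frag_of v - frag_of w) = free_lift G b (frag_of u - (frag_of v + frag_of w))"
    by (simp add: algebra_simps)
  also have "\<dots> = free_lift G b (frag_of u) \<otimes> inv (free_lift G b (frag_of v + frag_of w))"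
    by (rule free_lift_diff) (use assms keys_add[of "frag_of v" "frag_of w"] in \<open>auto split: if_splits\<close>)
  also have "\<dots> = b u \<otimes> inv (b v \<otimes> b w)"
    using assms by (subst free_lift_add) (auto split: if_splits)
  finally show ?thesis using assms
    by (metis inv_closed inv_equality inv_inv m_closed r_inv)
qed

lemma keys_relator: "Poly_Mapping.keys (frag_of u - frag_of v - frag_of w) \<subseteq> {u, v, w}"
  using keys_diff[of "frag_of u - frag_of v" "frag_of w"] keys_diff[of "frag_of u" "frag_of v"]
  by (auto split: if_splits)

section \<open>Graded modules and their tensor products\<close>

lemma sgn_pow_add: "sgn_pow a * sgn_pow b = sgn_pow (a + b)"
  by (auto simp: sgn_pow_def)

lemma sgn_pow_0 [simp]: "sgn_pow 0 = 1"
  by (simp add: sgn_pow_def)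

lemma sgn_pow_cong: "even (a + b) \<Longrightarrow> sgn_pow a = sgn_pow b"
  by (auto simp: sgn_pow_def)

lemma (in group) int_pow_sgn_pow:
  "x \<in> carrier G \<Longrightarrow> (x [^] sgn_pow a) [^] sgn_pow b = x [^] sgn_pow (a + b)"
  by (simp add: int_pow_pow sgn_pow_add)

lemma graded_moduleD: "graded_module M \<Longrightarrow> comm_group (M i)"
  by (simp add: graded_module_def)

lemma graded_module_group: "graded_module M \<Longrightarrow> group (M i)"
  by (simp add: graded_module_def comm_group.axioms)

lemma graded_maps_hom: "f \<in> graded_maps p M N \<Longrightarrow> j = i + p \<Longrightarrow> f i \<in> hom (M i) (N j)"
  by (simp add: graded_maps_def)

lemma graded_maps_closed:
  "f \<in> graded_maps p M N \<Longrightarrow> x \<in> carrier (M i) \<Longrightarrow> j = i + p \<Longrightarrow> f i x \<in> carrier (N j)"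
  by (auto simp: graded_maps_def hom_def)

lemma graded_maps_one:
  "f \<in> graded_maps p M N \<Longrightarrow> graded_module M \<Longrightarrow> graded_module N \<Longrightarrow> j = i + p
    \<Longrightarrow> f i \<one>\<^bsub>M i\<^esub> = \<one>\<^bsub>N j\<^esub>"
  by (auto simp: graded_maps_def intro!: hom_one graded_module_group)

lemma graded_maps_id: "graded_id \<in> graded_maps 0 M M"
  by (simp add: graded_maps_def hom_def)

lemma graded_maps_comp:
  assumes "f \<in> graded_maps p L M" "g \<in> graded_maps q M N" "r = p + q"
  shows "(\<lambda>i x. g (i + p) (f i x)) \<in> graded_maps r L N"
  using assms hom_comp unfolding graded_maps_def by (fastforce simp: add.assoc)

lemma graded_maps_times:
  assumes "f \<in> graded_maps p L M" "g \<in> graded_maps p L M" "graded_module M"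
  shows "(\<lambda>i x. f i x \<otimes>\<^bsub>M (i + p)\<^esub> g i x) \<in> graded_maps p L M"
  using assms by (auto simp: graded_maps_def intro!: hom_mult_pointwise graded_moduleD)

lemma graded_maps_power:
  assumes "f \<in> graded_maps p L M" "graded_module M"
  shows "(\<lambda>i x. f i x [^]\<^bsub>M (i + p)\<^esub> (z::int)) \<in> graded_maps p L M"
  using assms by (auto simp: graded_maps_def intro!: hom_pow_pointwise graded_moduleD)

lemma graded_maps_combination:
  assumes "\<And>s. s \<in> Poly_Mapping.keys a \<Longrightarrow> f s \<in> graded_maps p L M" "graded_module M"
  shows "(\<lambda>i x. free_lift (M (i + p)) (\<lambda>s. f s i x) a) \<in> graded_maps p L M"
  using assms by (auto simp: graded_maps_def intro!: hom_free_lift_pointwise graded_moduleD)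

lemma graded_maps_sum:
  assumes "\<And>s. s \<in> A \<Longrightarrow> f s \<in> graded_maps p L M" "graded_module M"
  shows "(\<lambda>i x. finprod (M (i + p)) (\<lambda>s. f s i x) A) \<in> graded_maps p L M"
  using assms by (auto simp: graded_maps_def intro!: hom_finprod_pointwise graded_moduleD)

locale graded_pair =
  fixes M :: "'a grmod" and N :: "'b grmod"
  assumes M: "graded_module M" and N: "graded_module N"
begin

lemma M_mult_closed: "x \<in> carrier (M i) \<Longrightarrow> y \<in> carrier (M i) \<Longrightarrow> x \<otimes>\<^bsub>M i\<^esub> y \<in> carrier (M i)"
  using graded_module_group[OF M, of i] by (simp add: group.is_monoid monoid.m_closed)

lemma N_mult_closed: "x \<in> carrier (N i) \<Longrightarrow> y \<in> carrier (N i) \<Longrightarrow> x \<otimes>\<^bsub>N i\<^esub> y \<in> carrier (N i)"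
  using graded_module_group[OF N, of i] by (simp add: group.is_monoid monoid.m_closed)

sublocale tens: presentation "tensor_gens M N n" "tensor_rels M N n" for n
proof
  show "tensor_rels M N n \<subseteq> carrier (free_Abelian_group (tensor_gens M N n))"
    unfolding tensor_rels_def
    by (safe; unfold carrier_free_Abelian_group_iff; rule order_trans[OF keys_relator])
       (use M_mult_closed N_mult_closed in \<open>auto simp: tensor_gens_def\<close>)
qed

lemma graded_module_tensor: "graded_module (tensor M N)"
  by (simp add: graded_module_def tensor_def tens.comm_group_presented)

lemma tensor_group: "comm_group (tensor M N n)"
  using graded_module_tensor by (rule graded_moduleD)

lemma tensor_pure_closed:
  assumes "x \<in> carrier (M i)" "y \<in> carrier (N j)" "n = i + j"
  shows "tensor_pure M N (i, x) (j, y) \<in> carrier (tensor M N n)"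
proof -
  have "((i, x), (j, y)) \<in> tensor_gens M N n" using assms by (auto simp: tensor_gens_def)
  from tens.gen_class_closed[OF this] show ?thesis
    using assms(3) by (simp add: tensor_pure_def tensor_def)
qed

lemma tensor_pure_mult_left:
  assumes x: "x \<in> carrier (M i)" "x' \<in> carrier (M i)" and y: "y \<in> carrier (N j)" and n: "n = i + j"
  shows "tensor_pure M N (i, x \<otimes>\<^bsub>M i\<^esub> x') (j, y)
    = tensor_pure M N (i, x) (j, y) \<otimes>\<^bsub>tensor M N n\<^esub> tensor_pure M N (i, x') (j, y)"
proof -
  interpret T: comm_group "tensor M N n" by (rule tensor_group)
  let ?b = "gen_class (tensor_gens M N n) (tensor_rels M N n)"
  have b: "?b ((i, u), (j, y)) \<in> carrier (tensor M N n)" if "u \<in> carrier (M i)" for u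
    using tensor_pure_closed[OF that y n] n by (simp add: tensor_pure_def)
  have "free_lift (tensor M N n) ?b
      (frag_of ((i, x \<otimes>\<^bsub>M i\<^esub> x'), (j, y)) - frag_of ((i, x), (j, y)) - frag_of ((i, x'), (j, y)))
      = \<one>\<^bsub>tensor M N n\<^esub>"
    unfolding tensor_def by (rule tens.relator_vanishes) (use x y n in \<open>auto simp: tensor_rels_def\<close>)
  then show ?thesis
    unfolding T.free_lift_relator[of ?b, OF b[OF M_mult_closed[OF x]] b[OF x(1)] b[OF x(2)]]
    by (simp add: tensor_pure_def n)
qed

lemma tensor_pure_mult_right:
  assumes x: "x \<in> carrier (M i)" and y: "y \<in> carrier (N j)" "y' \<in> carrier (N j)" and n: "n = i + j"
  shows "tensor_pure M N (i, x) (j, y \<otimes>\<^bsub>N j\<^esub> y')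
    = tensor_pure M N (i, x) (j, y) \<otimes>\<^bsub>tensor M N n\<^esub> tensor_pure M N (i, x) (j, y')"
proof -
  interpret T: comm_group "tensor M N n" by (rule tensor_group)
  let ?b = "gen_class (tensor_gens M N n) (tensor_rels M N n)"
  have b: "?b ((i, x), (j, u)) \<in> carrier (tensor M N n)" if "u \<in> carrier (N j)" for u
    using tensor_pure_closed[OF x that n] n by (simp add: tensor_pure_def)
  have "free_lift (tensor M N n) ?b
      (frag_of ((i, x), (j, y \<otimes>\<^bsub>N j\<^esub> y')) - frag_of ((i, x), (j, y)) - frag_of ((i, x), (j, y')))
      = \<one>\<^bsub>tensor M N n\<^esub>"
    unfolding tensor_def by (rule tens.relator_vanishes) (use x y n in \<open>auto simp: tensor_rels_def\<close>)
  then show ?thesis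
    unfolding T.free_lift_relator[of ?b, OF b[OF N_mult_closed[OF y]] b[OF y(1)] b[OF y(2)]]
    by (simp add: tensor_pure_def n)
qed

lemma tensor_pure_hom_left:
  "y \<in> carrier (N j) \<Longrightarrow> n = i + j \<Longrightarrow> (\<lambda>x. tensor_pure M N (i, x) (j, y)) \<in> hom (M i) (tensor M N n)"
  by (rule homI) (simp_all add: tensor_pure_closed tensor_pure_mult_left)

lemma tensor_pure_hom_right:
  "x \<in> carrier (M i) \<Longrightarrow> n = i + j \<Longrightarrow> (\<lambda>y. tensor_pure M N (i, x) (j, y)) \<in> hom (N j) (tensor M N n)"
  by (rule homI) (simp_all add: tensor_pure_closed tensor_pure_mult_right)

lemma tensor_pure_one_left: "y \<in> carrier (N j) \<Longrightarrow> n = i + j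
    \<Longrightarrow> tensor_pure M N (i, \<one>\<^bsub>M i\<^esub>) (j, y) = \<one>\<^bsub>tensor M N n\<^esub>"
  by (intro hom_one[OF tensor_pure_hom_left] graded_module_group graded_module_tensor M)

lemma tensor_pure_one_right: "x \<in> carrier (M i) \<Longrightarrow> n = i + j
    \<Longrightarrow> tensor_pure M N (i, x) (j, \<one>\<^bsub>N j\<^esub>) = \<one>\<^bsub>tensor M N n\<^esub>"
  by (intro hom_one[OF tensor_pure_hom_right] graded_module_group graded_module_tensor N)

lemma tensor_pure_pow_left: "x \<in> carrier (M i) \<Longrightarrow> y \<in> carrier (N j) \<Longrightarrow> n = i + j
    \<Longrightarrow> tensor_pure M N (i, x [^]\<^bsub>M i\<^esub> (z::int)) (j, y) = tensor_pure M N (i, x) (j, y) [^]\<^bsub>tensor M N n\<^esub> z"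
  by (rule hom_int_pow[OF tensor_pure_hom_left _ graded_module_group[OF M] graded_module_group[OF graded_module_tensor]])

lemma tensor_pure_pow_right: "x \<in> carrier (M i) \<Longrightarrow> y \<in> carrier (N j) \<Longrightarrow> n = i + j
    \<Longrightarrow> tensor_pure M N (i, x) (j, y [^]\<^bsub>N j\<^esub> (z::int)) = tensor_pure M N (i, x) (j, y) [^]\<^bsub>tensor M N n\<^esub> z"
  by (rule hom_int_pow[OF tensor_pure_hom_right _ graded_module_group[OF N] graded_module_group[OF graded_module_tensor]])

lemma tensor_hom_eq:
  assumes "comm_group H" "f \<in> hom (tensor M N n) H" "g \<in> hom (tensor M N n) H"
    and "\<And>i x j y. i + j = n \<Longrightarrow> x \<in> carrier (M i) \<Longrightarrow> y \<in> carrier (N j)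
      \<Longrightarrow> f (tensor_pure M N (i, x) (j, y)) = g (tensor_pure M N (i, x) (j, y))"
    and "t \<in> carrier (tensor M N n)"
  shows "f t = g t"
proof (rule tens.presented_hom_eq[of H f n g t])
  show "f (gen_class (tensor_gens M N n) (tensor_rels M N n) s)
      = g (gen_class (tensor_gens M N n) (tensor_rels M N n) s)" if "s \<in> tensor_gens M N n" for s
    using that assms(4) by (auto simp: tensor_gens_def tensor_pure_def)
qed (use assms in \<open>auto simp: tensor_def\<close>)

lemma tensor_lift:
  assumes H: "comm_group H"
    and left: "\<And>i j y. i + j = n \<Longrightarrow> y \<in> carrier (N j) \<Longrightarrow> (\<lambda>x. b ((i, x), (j, y))) \<in> hom (M i) H"
    and right: "\<And>i j x. i + j = n \<Longrightarrow> x \<in> carrier (M i) \<Longrightarrow> (\<lambda>y. b ((i, x), (j, y))) \<in> hom (N j) H"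
  shows tensor_lift_hom: "lift H b \<in> hom (tensor M N n) H"
    and tensor_lift_pure: "i + j = n \<Longrightarrow> x \<in> carrier (M i) \<Longrightarrow> y \<in> carrier (N j)
      \<Longrightarrow> lift H b (tensor_pure M N (i, x) (j, y)) = b ((i, x), (j, y))"
proof -
  interpret H: comm_group H by fact
  have c: "b ((i, x), (j, y)) \<in> carrier H"
    if "i + j = n" "x \<in> carrier (M i)" "y \<in> carrier (N j)" for i x j y
    using left that by (auto simp: hom_def)
  interpret L: presentation_lift "tensor_gens M N n" "tensor_rels M N n" H b
  proof
    show "b \<in> tensor_gens M N n \<rightarrow> carrier H"
      using c by (auto simp: tensor_gens_def)
    fix r assume "r \<in> tensor_rels M N n"
    then consider (left) i x x' j y where "i + j = n" "x \<in> carrier (M i)" "x' \<in> carrier (M i)" "y \<in> carrier (N j)"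
        "r = frag_of ((i, x \<otimes>\<^bsub>M i\<^esub> x'), (j, y)) - frag_of ((i, x), (j, y)) - frag_of ((i, x'), (j, y))"
      | (right) i x j y y' where "i + j = n" "x \<in> carrier (M i)" "y \<in> carrier (N j)" "y' \<in> carrier (N j)"
        "r = frag_of ((i, x), (j, y \<otimes>\<^bsub>N j\<^esub> y')) - frag_of ((i, x), (j, y)) - frag_of ((i, x), (j, y'))"
      unfolding tensor_rels_def by blast
    then show "free_lift H b r = \<one>\<^bsub>H\<^esub>"
    proof cases
      case (left i x x' j y)
      then show ?thesis
        using hom_mult[OF assms(2)[of i j y], of x x'] by (simp add: H.free_lift_relator c M_mult_closed)
    next
      case (right i x j y y')
      then show ?thesis
        using hom_mult[OF assms(3)[of i j x], of y y'] by (simp add: H.free_lift_relator c N_mult_closed)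
    qed
  qed
  show "lift H b \<in> hom (tensor M N n) H" unfolding tensor_def by (rule L.lift_hom)
  show "i + j = n \<Longrightarrow> x \<in> carrier (M i) \<Longrightarrow> y \<in> carrier (N j)
      \<Longrightarrow> lift H b (tensor_pure M N (i, x) (j, y)) = b ((i, x), (j, y))"
    unfolding tensor_pure_def by (simp, intro L.lift_gen_class) (auto simp: tensor_gens_def)
qed

end

locale graded_pair_maps = graded_pair M N + target: graded_pair M' N'
  for M :: "'a grmod" and N :: "'b grmod" and M' :: "'c grmod" and N' :: "'d grmod"
begin

lemma tensor_map:
  assumes f: "f \<in> graded_maps p M M'" and g: "g \<in> graded_maps q N N'" and m: "m = n + p + q"
  shows tensor_map_hom: "tensor_map M' N' p q f g n \<in> hom (tensor M N n) (tensor M' N' m)"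
    and tensor_map_pure: "i + j = n \<Longrightarrow> x \<in> carrier (M i) \<Longrightarrow> y \<in> carrier (N j)
      \<Longrightarrow> tensor_map M' N' p q f g n (tensor_pure M N (i, x) (j, y))
        = tensor_pure M' N' (i + p, f i x) (j + q, g j y) [^]\<^bsub>tensor M' N' m\<^esub> sgn_pow (q * i)"
proof -
  let ?b = "\<lambda>((i, x), (j, y)). tensor_pure M' N' (i + p, f i x) (j + q, g j y)
            [^]\<^bsub>tensor M' N' (n + p + q)\<^esub> sgn_pow (q * i)"
  have l: "(\<lambda>x. ?b ((i, x), (j, y))) \<in> hom (M i) (tensor M' N' (n + p + q))"
    if "i + j = n" "y \<in> carrier (N j)" for i j y
    using that by (simp, intro hom_pow_pointwise target.tensor_group
        hom_comp[OF graded_maps_hom[OF f refl] target.tensor_pure_hom_left] graded_maps_closed[OF g]) auto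
  have r: "(\<lambda>y. ?b ((i, x), (j, y))) \<in> hom (N j) (tensor M' N' (n + p + q))"
    if "i + j = n" "x \<in> carrier (M i)" for i j x
    using that by (simp, intro hom_pow_pointwise target.tensor_group
        hom_comp[OF graded_maps_hom[OF g refl] target.tensor_pure_hom_right] graded_maps_closed[OF f]) auto
  show "tensor_map M' N' p q f g n \<in> hom (tensor M N n) (tensor M' N' m)"
    unfolding tensor_map_def m using l r by (intro tensor_lift_hom target.tensor_group)
  show "i + j = n \<Longrightarrow> x \<in> carrier (M i) \<Longrightarrow> y \<in> carrier (N j)
      \<Longrightarrow> tensor_map M' N' p q f g n (tensor_pure M N (i, x) (j, y))
        = tensor_pure M' N' (i + p, f i x) (j + q, g j y) [^]\<^bsub>tensor M' N' m\<^esub> sgn_pow (q * i)"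
    unfolding tensor_map_def m using tensor_lift_pure[OF target.tensor_group l r] by simp
qed

lemma tensor_map_graded:
  "f \<in> graded_maps p M M' \<Longrightarrow> g \<in> graded_maps q N N' \<Longrightarrow> r = p + q
    \<Longrightarrow> tensor_map M' N' p q f g \<in> graded_maps r (tensor M N) (tensor M' N')"
  unfolding graded_maps_def[of r] by (auto intro!: tensor_map_hom)

lemma tensor_map_closed:
  "f \<in> graded_maps p M M' \<Longrightarrow> g \<in> graded_maps q N N' \<Longrightarrow> t \<in> carrier (tensor M N n) \<Longrightarrow> m = n + p + q
    \<Longrightarrow> tensor_map M' N' p q f g n t \<in> carrier (tensor M' N' m)"
  using tensor_map_hom by (auto simp: hom_def Pi_def)

lemma tensor_map_times_left:
  assumes f: "f \<in> graded_maps p M M'" "f' \<in> graded_maps p M M'" and g: "g \<in> graded_maps q N N'"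
    and t: "t \<in> carrier (tensor M N n)" and m: "m = n + p + q"
  shows "tensor_map M' N' p q (\<lambda>i x. f i x \<otimes>\<^bsub>M' (i + p)\<^esub> f' i x) g n t
    = tensor_map M' N' p q f g n t \<otimes>\<^bsub>tensor M' N' m\<^esub> tensor_map M' N' p q f' g n t"
proof (rule tensor_hom_eq[OF target.tensor_group _ _ _ t])
  note ff = graded_maps_times[OF f target.M]
  interpret T: comm_group "tensor M' N' m" by (rule target.tensor_group)
  show "tensor_map M' N' p q (\<lambda>i x. f i x \<otimes>\<^bsub>M' (i + p)\<^esub> f' i x) g n \<in> hom (tensor M N n) (tensor M' N' m)"
    by (rule tensor_map_hom[OF ff g m])
  show "(\<lambda>t. tensor_map M' N' p q f g n t \<otimes>\<^bsub>tensor M' N' m\<^esub> tensor_map M' N' p q f' g n t)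
      \<in> hom (tensor M N n) (tensor M' N' m)"
    by (intro hom_mult_pointwise target.tensor_group tensor_map_hom f g m)
  fix i x j y assume *: "i + j = n" "x \<in> carrier (M i)" "y \<in> carrier (N j)"
  then have "tensor_pure M' N' (i + p, h i x) (j + q, g j y) \<in> carrier (tensor M' N' m)"
    if "h \<in> graded_maps p M M'" for h
    using m by (intro target.tensor_pure_closed graded_maps_closed[OF that] graded_maps_closed[OF g]) auto
  note c = this[OF f(1)] this[OF f(2)]
  have mm: "m = (i + p) + (j + q)" using * m by simp
  show "tensor_map M' N' p q (\<lambda>i x. f i x \<otimes>\<^bsub>M' (i + p)\<^esub> f' i x) g n (tensor_pure M N (i, x) (j, y))
    = tensor_map M' N' p q f g n (tensor_pure M N (i, x) (j, y))
      \<otimes>\<^bsub>tensor M' N' m\<^esub> tensor_map M' N' p q f' g n (tensor_pure M N (i, x) (j, y))"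
    using * by (simp add: tensor_map_pure[OF ff g m] tensor_map_pure[OF f(1) g m] tensor_map_pure[OF f(2) g m]
      target.tensor_pure_mult_left[OF _ _ _ mm] graded_maps_closed[OF f(1)] graded_maps_closed[OF f(2)]
      graded_maps_closed[OF g] T.int_pow_distrib[OF c])
qed

lemma tensor_map_times_right:
  assumes f: "f \<in> graded_maps p M M'" and g: "g \<in> graded_maps q N N'" "g' \<in> graded_maps q N N'"
    and t: "t \<in> carrier (tensor M N n)" and m: "m = n + p + q"
  shows "tensor_map M' N' p q f (\<lambda>i x. g i x \<otimes>\<^bsub>N' (i + q)\<^esub> g' i x) n t
    = tensor_map M' N' p q f g n t \<otimes>\<^bsub>tensor M' N' m\<^esub> tensor_map M' N' p q f g' n t"
proof (rule tensor_hom_eq[OF target.tensor_group _ _ _ t])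
  note gg = graded_maps_times[OF g target.N]
  interpret T: comm_group "tensor M' N' m" by (rule target.tensor_group)
  show "tensor_map M' N' p q f (\<lambda>i x. g i x \<otimes>\<^bsub>N' (i + q)\<^esub> g' i x) n \<in> hom (tensor M N n) (tensor M' N' m)"
    by (rule tensor_map_hom[OF f gg m])
  show "(\<lambda>t. tensor_map M' N' p q f g n t \<otimes>\<^bsub>tensor M' N' m\<^esub> tensor_map M' N' p q f g' n t)
      \<in> hom (tensor M N n) (tensor M' N' m)"
    by (intro hom_mult_pointwise target.tensor_group tensor_map_hom f g m)
  fix i x j y assume *: "i + j = n" "x \<in> carrier (M i)" "y \<in> carrier (N j)"
  then have "tensor_pure M' N' (i + p, f i x) (j + q, h j y) \<in> carrier (tensor M' N' m)"
    if "h \<in> graded_maps q N N'" for h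
    using m by (intro target.tensor_pure_closed graded_maps_closed[OF that] graded_maps_closed[OF f]) auto
  note c = this[OF g(1)] this[OF g(2)]
  have mm: "m = (i + p) + (j + q)" using * m by simp
  show "tensor_map M' N' p q f (\<lambda>i x. g i x \<otimes>\<^bsub>N' (i + q)\<^esub> g' i x) n (tensor_pure M N (i, x) (j, y))
    = tensor_map M' N' p q f g n (tensor_pure M N (i, x) (j, y))
      \<otimes>\<^bsub>tensor M' N' m\<^esub> tensor_map M' N' p q f g' n (tensor_pure M N (i, x) (j, y))"
    using * by (simp add: tensor_map_pure[OF f gg m] tensor_map_pure[OF f g(1) m] tensor_map_pure[OF f g(2) m]
      target.tensor_pure_mult_right[OF _ _ _ mm] graded_maps_closed[OF g(1)] graded_maps_closed[OF g(2)]
      graded_maps_closed[OF f] T.int_pow_distrib[OF c])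
qed

lemma tensor_map_combination_left:
  assumes f: "\<And>s. s \<in> Poly_Mapping.keys a \<Longrightarrow> f s \<in> graded_maps p M M'" and g: "g \<in> graded_maps q N N'"
    and t: "t \<in> carrier (tensor M N n)" and m: "m = n + p + q"
  shows "tensor_map M' N' p q (\<lambda>i x. free_lift (M' (i + p)) (\<lambda>s. f s i x) a) g n t
    = free_lift (tensor M' N' m) (\<lambda>s. tensor_map M' N' p q (f s) g n t) a"
proof (rule tensor_hom_eq[OF target.tensor_group _ _ _ t])
  note ff = graded_maps_combination[where f = f, OF f target.M, simplified]
  interpret T: comm_group "tensor M' N' m" by (rule target.tensor_group)
  show "tensor_map M' N' p q (\<lambda>i x. free_lift (M' (i + p)) (\<lambda>s. f s i x) a) g n
      \<in> hom (tensor M N n) (tensor M' N' m)"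
    by (rule tensor_map_hom[OF ff g m])
  show "(\<lambda>t. free_lift (tensor M' N' m) (\<lambda>s. tensor_map M' N' p q (f s) g n t) a)
      \<in> hom (tensor M N n) (tensor M' N' m)"
    by (intro hom_free_lift_pointwise target.tensor_group tensor_map_hom f g m)
  fix i x j y assume *: "i + j = n" "x \<in> carrier (M i)" "y \<in> carrier (N j)"
  have c: "g j y \<in> carrier (N' (j + q))" using graded_maps_closed[OF g] * by auto
  have "tensor_map M' N' p q (\<lambda>i x. free_lift (M' (i + p)) (\<lambda>s. f s i x) a) g n (tensor_pure M N (i, x) (j, y))
     = tensor_pure M' N' (i + p, free_lift (M' (i + p)) (\<lambda>s. f s i x) a) (j + q, g j y)
         [^]\<^bsub>tensor M' N' m\<^esub> sgn_pow (q * i)"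
    using * by (simp add: tensor_map_pure[OF ff g m])
  also have "\<dots> = free_lift (tensor M' N' m) (\<lambda>s. tensor_pure M' N' (i + p, f s i x) (j + q, g j y)
      [^]\<^bsub>tensor M' N' m\<^esub> sgn_pow (q * i)) a"
    by (rule hom_free_lift[OF graded_moduleD[OF target.M] T.comm_group_axioms
          hom_pow_pointwise[OF T.comm_group_axioms target.tensor_pure_hom_left[OF c]]])
       (use * m f in \<open>auto intro!: graded_maps_closed[of "f s" for s]\<close>)
  also have "\<dots> = free_lift (tensor M' N' m) (\<lambda>s. tensor_map M' N' p q (f s) g n (tensor_pure M N (i, x) (j, y))) a"
  proof (rule T.free_lift_cong)
    fix s assume s: "s \<in> Poly_Mapping.keys a"
    show "tensor_pure M' N' (i + p, f s i x) (j + q, g j y) [^]\<^bsub>tensor M' N' m\<^esub> sgn_pow (q * i) = tensor_map M' N' p q (f s) g n (tensor_pure M N (i, x) (j, y))"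
      using * by (simp add: tensor_map_pure[OF f[OF s] g m])
    show "tensor_map M' N' p q (f s) g n (tensor_pure M N (i, x) (j, y)) \<in> carrier (tensor M' N' m)"
      by (rule tensor_map_closed[OF f[OF s] g tensor_pure_closed[OF *(2,3) *(1)[symmetric]] m])
  qed
  finally show "tensor_map M' N' p q (\<lambda>i x. free_lift (M' (i + p)) (\<lambda>s. f s i x) a) g n (tensor_pure M N (i, x) (j, y))
    = \<dots>" .
qed

lemma tensor_map_combination_right:
  assumes f: "f \<in> graded_maps p M M'" and g: "\<And>s. s \<in> Poly_Mapping.keys a \<Longrightarrow> g s \<in> graded_maps q N N'"
    and t: "t \<in> carrier (tensor M N n)" and m: "m = n + p + q"
  shows "tensor_map M' N' p q f (\<lambda>i x. free_lift (N' (i + q)) (\<lambda>s. g s i x) a) n t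
    = free_lift (tensor M' N' m) (\<lambda>s. tensor_map M' N' p q f (g s) n t) a"
proof (rule tensor_hom_eq[OF target.tensor_group _ _ _ t])
  note gg = graded_maps_combination[where f = g, OF g target.N, simplified]
  interpret T: comm_group "tensor M' N' m" by (rule target.tensor_group)
  show "tensor_map M' N' p q f (\<lambda>i x. free_lift (N' (i + q)) (\<lambda>s. g s i x) a) n
      \<in> hom (tensor M N n) (tensor M' N' m)"
    by (rule tensor_map_hom[OF f gg m])
  show "(\<lambda>t. free_lift (tensor M' N' m) (\<lambda>s. tensor_map M' N' p q f (g s) n t) a)
      \<in> hom (tensor M N n) (tensor M' N' m)"
    by (intro hom_free_lift_pointwise target.tensor_group tensor_map_hom f g m)
  fix i x j y assume *: "i + j = n" "x \<in> carrier (M i)" "y \<in> carrier (N j)"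
  have c: "f i x \<in> carrier (M' (i + p))" using graded_maps_closed[OF f] * by auto
  have "tensor_map M' N' p q f (\<lambda>i x. free_lift (N' (i + q)) (\<lambda>s. g s i x) a) n (tensor_pure M N (i, x) (j, y))
     = tensor_pure M' N' (i + p, f i x) (j + q, free_lift (N' (j + q)) (\<lambda>s. g s j y) a)
         [^]\<^bsub>tensor M' N' m\<^esub> sgn_pow (q * i)"
    using * by (simp add: tensor_map_pure[OF f gg m])
  also have "\<dots> = free_lift (tensor M' N' m) (\<lambda>s. tensor_pure M' N' (i + p, f i x) (j + q, g s j y)
      [^]\<^bsub>tensor M' N' m\<^esub> sgn_pow (q * i)) a"
    by (rule hom_free_lift[OF graded_moduleD[OF target.N] T.comm_group_axioms
          hom_pow_pointwise[OF T.comm_group_axioms target.tensor_pure_hom_right[OF c]]])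
       (use * m g in \<open>auto intro!: graded_maps_closed[of "g s" for s]\<close>)
  also have "\<dots> = free_lift (tensor M' N' m) (\<lambda>s. tensor_map M' N' p q f (g s) n (tensor_pure M N (i, x) (j, y))) a"
  proof (rule T.free_lift_cong)
    fix s assume s: "s \<in> Poly_Mapping.keys a"
    show "tensor_pure M' N' (i + p, f i x) (j + q, g s j y) [^]\<^bsub>tensor M' N' m\<^esub> sgn_pow (q * i) = tensor_map M' N' p q f (g s) n (tensor_pure M N (i, x) (j, y))"
      using * by (simp add: tensor_map_pure[OF f g[OF s] m])
    show "tensor_map M' N' p q f (g s) n (tensor_pure M N (i, x) (j, y)) \<in> carrier (tensor M' N' m)"
      by (rule tensor_map_closed[OF f g[OF s] tensor_pure_closed[OF *(2,3) *(1)[symmetric]] m])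
  qed
  finally show "tensor_map M' N' p q f (\<lambda>i x. free_lift (N' (i + q)) (\<lambda>s. g s i x) a) n (tensor_pure M N (i, x) (j, y))
    = \<dots>" .
qed

end

lemma graded_pair_mapsI:
  "graded_module M \<Longrightarrow> graded_module N \<Longrightarrow> graded_module M' \<Longrightarrow> graded_module N' \<Longrightarrow> graded_pair_maps M N M' N'"
  by (intro graded_pair_maps.intro graded_pair.intro)

text \<open>The Koszul sign of a composite: \<open>g'\<close> is moved past \<open>f\<close>.\<close>

lemma tensor_map_comp:
  assumes "graded_module L" "graded_module K" "graded_module L'" "graded_module K'"
    "graded_module L''" "graded_module K''"
    and f: "f \<in> graded_maps p L L'" and g: "g \<in> graded_maps q K K'"
    and f': "f' \<in> graded_maps p' L' L''" and g': "g' \<in> graded_maps q' K' K''"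
    and t: "t \<in> carrier (tensor L K n)" and m: "m = n + p + q" and l: "l = m + p' + q'"
    and r: "r = p + p'" and s: "s = q + q'"
  shows "tensor_map L'' K'' p' q' f' g' m (tensor_map L' K' p q f g n t)
    = tensor_map L'' K'' r s (\<lambda>i x. f' (i + p) (f i x)) (\<lambda>i x. g' (i + q) (g i x)) n t
        [^]\<^bsub>tensor L'' K'' l\<^esub> sgn_pow (q' * p)"
proof -
  interpret A: graded_pair_maps L K L' K' by (rule graded_pair_mapsI; fact)
  interpret B: graded_pair_maps L' K' L'' K'' by (rule graded_pair_mapsI; fact)
  interpret C: graded_pair_maps L K L'' K'' by (rule graded_pair_mapsI; fact)
  interpret T: comm_group "tensor L'' K'' l" by (rule B.target.tensor_group)
  interpret T': group "tensor L' K' m" using A.target.tensor_group by (rule comm_group.axioms)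
  note ff = graded_maps_comp[OF f f' r] and gg = graded_maps_comp[OF g g' s]
  have l': "l = n + r + s" using m l r s by simp
  show ?thesis
  proof (rule A.tensor_hom_eq[OF T.comm_group_axioms _ _ _ t])
    show "(\<lambda>t. tensor_map L'' K'' p' q' f' g' m (tensor_map L' K' p q f g n t)) \<in> hom (tensor L K n) (tensor L'' K'' l)"
      by (rule hom_comp[OF A.tensor_map_hom[OF f g m] B.tensor_map_hom[OF f' g' l]])
    show "(\<lambda>t. tensor_map L'' K'' r s (\<lambda>i x. f' (i + p) (f i x)) (\<lambda>i x. g' (i + q) (g i x)) n t
        [^]\<^bsub>tensor L'' K'' l\<^esub> sgn_pow (q' * p)) \<in> hom (tensor L K n) (tensor L'' K'' l)"
      by (rule hom_pow_pointwise[OF T.comm_group_axioms C.tensor_map_hom[OF ff gg l']])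
    fix i x j y assume *: "i + j = n" "x \<in> carrier (L i)" "y \<in> carrier (K j)"
    have c: "f i x \<in> carrier (L' (i + p))" "g j y \<in> carrier (K' (j + q))"
      using * graded_maps_closed[OF f] graded_maps_closed[OF g] by auto
    have c': "tensor_pure L' K' (i + p, f i x) (j + q, g j y) \<in> carrier (tensor L' K' m)"
      using c * m by (intro A.target.tensor_pure_closed) auto
    have c'': "tensor_pure L'' K'' (i + r, f' (i + p) (f i x)) (j + s, g' (j + q) (g j y)) \<in> carrier (tensor L'' K'' l)"
      using c * m l r s by (intro B.target.tensor_pure_closed graded_maps_closed[OF f'] graded_maps_closed[OF g']) auto
    have "even (q * i + q' * (i + p) + (s * i + q' * p))" using s by (simp add: algebra_simps)
    then have sg: "sgn_pow (q * i + q' * (i + p)) = sgn_pow (s * i + q' * p)" by (rule sgn_pow_cong)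
    have "tensor_map L'' K'' p' q' f' g' m (tensor_map L' K' p q f g n (tensor_pure L K (i, x) (j, y)))
      = tensor_map L'' K'' p' q' f' g' m (tensor_pure L' K' (i + p, f i x) (j + q, g j y)
         [^]\<^bsub>tensor L' K' m\<^esub> sgn_pow (q * i))"
      using * by (simp add: A.tensor_map_pure[OF f g m])
    also have "\<dots> = tensor_map L'' K'' p' q' f' g' m (tensor_pure L' K' (i + p, f i x) (j + q, g j y))
         [^]\<^bsub>tensor L'' K'' l\<^esub> sgn_pow (q * i)"
      by (rule hom_int_pow[OF B.tensor_map_hom[OF f' g' l] c' T'.is_group T.is_group])
    also have "\<dots> = tensor_pure L'' K'' (i + r, f' (i + p) (f i x)) (j + s, g' (j + q) (g j y))
         [^]\<^bsub>tensor L'' K'' l\<^esub> sgn_pow (q * i + q' * (i + p))"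
    proof -
      have e: "i + p + p' = i + r" "j + q + q' = j + s" "(i + p) + (j + q) = m" using * m r s by auto
      show ?thesis unfolding B.tensor_map_pure[OF f' g' l e(3) c] e(1,2)
        by (simp add: T.int_pow_sgn_pow[OF c''] add_ac)
    qed
    also have "\<dots> = tensor_map L'' K'' r s (\<lambda>i x. f' (i + p) (f i x)) (\<lambda>i x. g' (i + q) (g i x)) n
          (tensor_pure L K (i, x) (j, y)) [^]\<^bsub>tensor L'' K'' l\<^esub> sgn_pow (q' * p)"
      using c'' * by (simp add: C.tensor_map_pure[OF ff gg l'] T.int_pow_sgn_pow sg)
    finally show "tensor_map L'' K'' p' q' f' g' m (tensor_map L' K' p q f g n (tensor_pure L K (i, x) (j, y)))
      = \<dots>" .
  qed
qed


section \<open>The reduced tensor coalgebra\<close>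

definition word_elem :: "'a grmod \<Rightarrow> (int \<times> 'a) list \<Rightarrow> 'a words" where
  "word_elem V w = gen_class (word_gens V (word_degree w)) (word_rels V (word_degree w)) w"

lemma word_class_eq: "word_class V w = (word_degree w, word_elem V w)"
  by (simp add: word_class_def word_elem_def)

lemma word_degree_append [simp]: "word_degree (u @ w) = word_degree u + word_degree w"
  by (simp add: word_degree_def)

lemma word_degree_Cons [simp]: "word_degree (l # w) = fst l + word_degree w"
  by (simp add: word_degree_def)

lemma word_degree_Nil [simp]: "word_degree [] = 0"
  by (simp add: word_degree_def)

lemma word_degree_split: "word_degree (take r w) + word_degree (drop r w) = word_degree w"
  by (metis append_take_drop_id word_degree_append)

text \<open>\<open>head_word\<close> is the projection onto words with one letter, followed by the inclusion of these
  words, and \<open>attach\<close> puts the one-letter part of the first factor in front of the second factor.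
  Together with the deconcatenation coproduct they reconstruct every element, which is what makes the
  tensor coalgebra cofree. Keeping only one letter of the first factor is essential: full concatenation
  after deconcatenation multiplies a word of length \<open>m\<close> by \<open>m - 1\<close>, which is not invertible over the
  integers. \<open>attach_left\<close> acts on the first two of three factors.\<close>

definition head_word :: "'a grmod \<Rightarrow> int \<Rightarrow> 'a words \<Rightarrow> 'a words" where
  "head_word V n = lift (Tbar V n) (\<lambda>w. if length w = 1 then word_elem V w else \<one>\<^bsub>Tbar V n\<^esub>)"

definition attach :: "'a grmod \<Rightarrow> int \<Rightarrow> ('a words, 'a words) tens \<Rightarrow> 'a words" where
  "attach V n = lift (Tbar V n) (\<lambda>((i, x), (j, y)). lift (Tbar V n) (\<lambda>u.
     if length u = 1 then lift (Tbar V n) (\<lambda>w. word_elem V (u @ w)) y else \<one>\<^bsub>Tbar V n\<^esub>) x)"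

definition attach_left ::
    "'a grmod \<Rightarrow> int \<Rightarrow> ('a words, ('a words, 'a words) tens) tens \<Rightarrow> ('a words, 'a words) tens" where
  "attach_left V n = lift (tensor (Tbar V) (Tbar V) n) (\<lambda>((i, x), (j, t)).
     tensor_map (Tbar V) (Tbar V) i 0 (\<lambda>k y. attach V (k + i) (tensor_pure (Tbar V) (Tbar V) (i, x) (k, y)))
       graded_id j t)"

locale graded_words =
  fixes V :: "'a grmod"
  assumes V: "graded_module V"
begin

abbreviation T where "T \<equiv> Tbar V"
abbreviation TT where "TT \<equiv> tensor T T"
abbreviation \<Delta> where "\<Delta> \<equiv> deconcat V"

lemma V_mult_closed: "x \<in> carrier (V i) \<Longrightarrow> y \<in> carrier (V i) \<Longrightarrow> x \<otimes>\<^bsub>V i\<^esub> y \<in> carrier (V i)"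
  using graded_module_group[OF V, of i] by (simp add: group.is_monoid monoid.m_closed)

lemma word_gens_letter: "us @ (i, x) # vs \<in> word_gens V n \<Longrightarrow> us @ (i, y) # vs \<in> word_gens V n
   \<Longrightarrow> us @ (i, x \<otimes>\<^bsub>V i\<^esub> y) # vs \<in> word_gens V n"
  by (auto simp: word_gens_def V_mult_closed)

sublocale word: presentation "word_gens V n" "word_rels V n" for n
proof
  show "word_rels V n \<subseteq> carrier (free_Abelian_group (word_gens V n))"
    unfolding word_rels_def
    by (safe; unfold carrier_free_Abelian_group_iff; rule order_trans[OF keys_relator])
       (use word_gens_letter in auto)
qed

lemma graded_module_Tbar: "graded_module T"
  by (simp add: graded_module_def Tbar_def word.comm_group_presented)

sublocale TP: graded_pair T T
  by unfold_locales (rule graded_module_Tbar)+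

lemma Tbar_group: "comm_group (T n)"
  using graded_module_Tbar by (rule graded_moduleD)

lemma word_elem_closed:
  assumes "w \<in> word_gens V n" shows "word_elem V w \<in> carrier (T n)"
proof -
  have "word_degree w = n" using assms by (simp add: word_gens_def)
  then show ?thesis unfolding word_elem_def Tbar_def using word.gen_class_closed[OF assms] by simp
qed

lemma word_elem_letter:
  assumes "us @ (i, x) # vs \<in> word_gens V n" "us @ (i, y) # vs \<in> word_gens V n"
  shows "word_elem V (us @ (i, x \<otimes>\<^bsub>V i\<^esub> y) # vs)
    = word_elem V (us @ (i, x) # vs) \<otimes>\<^bsub>T n\<^esub> word_elem V (us @ (i, y) # vs)"
proof -
  interpret Tn: comm_group "T n" by (rule Tbar_group)
  let ?b = "gen_class (word_gens V n) (word_rels V n)"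
  have n: "word_degree us + (i + word_degree vs) = n" using assms(1) by (simp add: word_gens_def)
  have b: "?b u \<in> carrier (T n)" if "u \<in> word_gens V n" for u
    using word.gen_class_closed[OF that] by (simp add: Tbar_def)
  have "free_lift (T n) ?b (frag_of (us @ (i, x \<otimes>\<^bsub>V i\<^esub> y) # vs) - frag_of (us @ (i, x) # vs)
      - frag_of (us @ (i, y) # vs)) = \<one>\<^bsub>T n\<^esub>"
    unfolding Tbar_def by (rule word.relator_vanishes) (unfold word_rels_def, use assms in blast)
  then show ?thesis
    unfolding Tn.free_lift_relator[of ?b, OF b[OF word_gens_letter[OF assms]] b[OF assms(1)] b[OF assms(2)]]
    by (simp add: word_elem_def n)
qed

lemma word_hom_eq:
  assumes "comm_group H" "f \<in> hom (T n) H" "g \<in> hom (T n) H"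
    and "\<And>w. w \<in> word_gens V n \<Longrightarrow> f (word_elem V w) = g (word_elem V w)"
    and "x \<in> carrier (T n)"
  shows "f x = g x"
proof (rule word.presented_hom_eq[of H f n g x])
  show "f (gen_class (word_gens V n) (word_rels V n) s) = g (gen_class (word_gens V n) (word_rels V n) s)"
    if "s \<in> word_gens V n" for s
    using assms(4)[OF that] that by (simp add: word_elem_def word_gens_def)
qed (use assms in \<open>auto simp: Tbar_def\<close>)

lemma word_induct:
  assumes "x \<in> carrier (T n)" "subgroup H (T n)" "\<And>w. w \<in> word_gens V n \<Longrightarrow> word_elem V w \<in> H"
  shows "x \<in> H"
proof (rule word.presented_induct[of x n H])
  show "gen_class (word_gens V n) (word_rels V n) s \<in> H" if "s \<in> word_gens V n" for s
    using assms(3)[OF that] that by (simp add: word_elem_def word_gens_def)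
qed (use assms in \<open>auto simp: Tbar_def\<close>)

lemma word_lift:
  assumes H: "comm_group H" and c: "\<And>w. w \<in> word_gens V n \<Longrightarrow> b w \<in> carrier H"
    and letter: "\<And>us i x y vs. us @ (i, x) # vs \<in> word_gens V n \<Longrightarrow> us @ (i, y) # vs \<in> word_gens V n
      \<Longrightarrow> b (us @ (i, x \<otimes>\<^bsub>V i\<^esub> y) # vs) = b (us @ (i, x) # vs) \<otimes>\<^bsub>H\<^esub> b (us @ (i, y) # vs)"
  shows word_lift_hom: "lift H b \<in> hom (T n) H"
    and word_lift_elem: "w \<in> word_gens V n \<Longrightarrow> lift H b (word_elem V w) = b w"
proof -
  interpret H: comm_group H by fact
  interpret L: presentation_lift "word_gens V n" "word_rels V n" H b
  proof
    show "b \<in> word_gens V n \<rightarrow> carrier H" using c by auto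
    fix r assume "r \<in> word_rels V n"
    then obtain us i x y vs where r: "us @ (i, x) # vs \<in> word_gens V n" "us @ (i, y) # vs \<in> word_gens V n"
      "r = frag_of (us @ (i, x \<otimes>\<^bsub>V i\<^esub> y) # vs) - frag_of (us @ (i, x) # vs) - frag_of (us @ (i, y) # vs)"
      unfolding word_rels_def by blast
    then show "free_lift H b r = \<one>\<^bsub>H\<^esub>"
      using letter[OF r(1,2)] by (simp add: H.free_lift_relator c word_gens_letter)
  qed
  show "lift H b \<in> hom (T n) H" unfolding Tbar_def by (rule L.lift_hom)
  show "w \<in> word_gens V n \<Longrightarrow> lift H b (word_elem V w) = b w"
    using L.lift_gen_class[of w] by (simp add: word_elem_def word_gens_def)
qed

lemma word_gens_take: "w \<in> word_gens V n \<Longrightarrow> 1 \<le> r \<Longrightarrow> r < length w \<Longrightarrow> take r w \<in> word_gens V (word_degree (take r w))"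
  by (auto simp: word_gens_def dest: in_set_takeD)

lemma word_gens_drop: "w \<in> word_gens V n \<Longrightarrow> r < length w \<Longrightarrow> drop r w \<in> word_gens V (word_degree (drop r w))"
  by (auto simp: word_gens_def dest: in_set_dropD)

lemma word_gens_append: "u \<in> word_gens V i \<Longrightarrow> w \<in> word_gens V j \<Longrightarrow> n = i + j \<Longrightarrow> u @ w \<in> word_gens V n"
  by (auto simp: word_gens_def)

abbreviation cut where
  "cut r w \<equiv> tensor_pure T T (word_degree (take r w), word_elem V (take r w)) (word_degree (drop r w), word_elem V (drop r w))"

lemma cut_closed: "w \<in> word_gens V n \<Longrightarrow> 1 \<le> r \<Longrightarrow> r < length w \<Longrightarrow> cut r w \<in> carrier (TT n)"
  by (intro TP.tensor_pure_closed word_elem_closed word_gens_take word_gens_drop)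
     (auto simp: word_degree_split word_gens_def)

text \<open>The varied letter lies in exactly one of the two pieces, and the other piece does not change.\<close>

lemma cut_letter:
  assumes w: "us @ (i, x) # vs \<in> word_gens V n" "us @ (i, y) # vs \<in> word_gens V n"
    and r: "1 \<le> r" "r < length (us @ (i, x) # vs)"
  shows "cut r (us @ (i, x \<otimes>\<^bsub>V i\<^esub> y) # vs) = cut r (us @ (i, x) # vs) \<otimes>\<^bsub>TT n\<^esub> cut r (us @ (i, y) # vs)"
proof (cases "r \<le> length us")
  case True
  have d: "drop r us @ (i, z) # vs \<in> word_gens V (word_degree (drop r us @ (i, x) # vs))"
    if "us @ (i, z) # vs \<in> word_gens V n" for z
    using that by (auto simp: word_gens_def dest: in_set_dropD)
  have t: "take r us \<in> word_gens V (word_degree (take r us))"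
    using w(1) r True by (auto simp: word_gens_def dest: in_set_takeD)
  have n: "n = word_degree (take r us) + word_degree (drop r us @ (i, x) # vs)"
    using w(1) word_degree_split[of r us] by (simp add: word_gens_def)
  show ?thesis using True
    word_elem_letter[OF d[OF w(1)] d[OF w(2)]]
    TP.tensor_pure_mult_right[OF word_elem_closed[OF t] word_elem_closed[OF d[OF w(1)]] word_elem_closed[OF d[OF w(2)]] n]
    by simp
next
  case False
  then obtain k where k: "r = length us + Suc k" by (metis add_Suc_right less_imp_Suc_add not_le)
  have t: "us @ (i, z) # take k vs \<in> word_gens V (word_degree (us @ (i, x) # take k vs))"
    if "us @ (i, z) # vs \<in> word_gens V n" for z
    using that by (auto simp: word_gens_def dest: in_set_takeD)
  have d: "drop k vs \<in> word_gens V (word_degree (drop k vs))"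
    using w(1) r k by (auto simp: word_gens_def dest: in_set_dropD)
  have n: "n = word_degree (us @ (i, x) # take k vs) + word_degree (drop k vs)"
    using w(1) word_degree_split[of k vs] by (simp add: word_gens_def)
  show ?thesis using
    word_elem_letter[OF t[OF w(1)] t[OF w(2)]]
    TP.tensor_pure_mult_left[OF word_elem_closed[OF t[OF w(1)]] word_elem_closed[OF t[OF w(2)]] word_elem_closed[OF d] n]
    by (simp add: k)
qed

lemma deconcat:
  shows deconcat_hom: "\<Delta> n \<in> hom (T n) (TT n)"
    and deconcat_word: "w \<in> word_gens V n \<Longrightarrow> \<Delta> n (word_elem V w) = finprod (TT n) (\<lambda>r. cut r w) {1..<length w}"
proof -
  interpret TT: comm_group "TT n" by (rule TP.tensor_group)
  have c: "finprod (TT n) (\<lambda>r. cut r w) {1..<length w} \<in> carrier (TT n)" if "w \<in> word_gens V n" for w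
    using that by (intro TT.finprod_closed) (auto intro: cut_closed)
  have l: "finprod (TT n) (\<lambda>r. cut r (us @ (i, x \<otimes>\<^bsub>V i\<^esub> y) # vs)) {1..<length (us @ (i, x \<otimes>\<^bsub>V i\<^esub> y) # vs)}
    = finprod (TT n) (\<lambda>r. cut r (us @ (i, x) # vs)) {1..<length (us @ (i, x) # vs)}
      \<otimes>\<^bsub>TT n\<^esub> finprod (TT n) (\<lambda>r. cut r (us @ (i, y) # vs)) {1..<length (us @ (i, y) # vs)}"
    if w: "us @ (i, x) # vs \<in> word_gens V n" "us @ (i, y) # vs \<in> word_gens V n" for us i x y vs
  proof -
    let ?L = "{1..<length (us @ (i, x) # vs)}"
    have "finprod (TT n) (\<lambda>r. cut r (us @ (i, x \<otimes>\<^bsub>V i\<^esub> y) # vs)) ?L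
       = finprod (TT n) (\<lambda>r. cut r (us @ (i, x) # vs) \<otimes>\<^bsub>TT n\<^esub> cut r (us @ (i, y) # vs)) ?L"
      by (rule TT.finprod_cong')
         (use cut_letter[OF w] cut_closed[OF w(1)] cut_closed[OF w(2)] in \<open>auto simp del: take_append drop_append\<close>)
    also have "\<dots> = finprod (TT n) (\<lambda>r. cut r (us @ (i, x) # vs)) ?L
        \<otimes>\<^bsub>TT n\<^esub> finprod (TT n) (\<lambda>r. cut r (us @ (i, y) # vs)) ?L"
      by (rule TT.finprod_multf)
         (use cut_closed[OF w(1)] cut_closed[OF w(2)] in \<open>auto simp del: take_append drop_append\<close>)
    finally show ?thesis by simp
  qed
  show "\<Delta> n \<in> hom (T n) (TT n)"
    unfolding deconcat_def word_class_eq by (rule word_lift_hom[OF TT.comm_group_axioms c l])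
  show "w \<in> word_gens V n \<Longrightarrow> \<Delta> n (word_elem V w) = finprod (TT n) (\<lambda>r. cut r w) {1..<length w}"
    unfolding deconcat_def word_class_eq by (rule word_lift_elem[OF TT.comm_group_axioms c l])
qed

lemma deconcat_graded: "\<Delta> \<in> graded_maps 0 T TT"
  using deconcat_hom by (simp add: graded_maps_def)

lemma deconcat_closed: "x \<in> carrier (T n) \<Longrightarrow> \<Delta> n x \<in> carrier (TT n)"
  using deconcat_hom by (auto simp: hom_def)

lemma head_word:
  shows head_word_hom: "head_word V n \<in> hom (T n) (T n)"
    and head_word_elem: "w \<in> word_gens V n
      \<Longrightarrow> head_word V n (word_elem V w) = (if length w = 1 then word_elem V w else \<one>\<^bsub>T n\<^esub>)"
proof -
  interpret Tn: comm_group "T n" by (rule Tbar_group)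
  let ?b = "\<lambda>w. if length w = 1 then word_elem V w else \<one>\<^bsub>T n\<^esub>"
  have c: "?b w \<in> carrier (T n)" if "w \<in> word_gens V n" for w
    using word_elem_closed[OF that] by simp
  have l: "?b (us @ (i, x \<otimes>\<^bsub>V i\<^esub> y) # vs) = ?b (us @ (i, x) # vs) \<otimes>\<^bsub>T n\<^esub> ?b (us @ (i, y) # vs)"
    if "us @ (i, x) # vs \<in> word_gens V n" "us @ (i, y) # vs \<in> word_gens V n" for us i x y vs
    using word_elem_letter[OF that] by auto
  show "head_word V n \<in> hom (T n) (T n)"
    unfolding head_word_def by (rule word_lift_hom[OF Tn.comm_group_axioms c l])
  show "w \<in> word_gens V n \<Longrightarrow> head_word V n (word_elem V w) = ?b w"
    unfolding head_word_def by (rule word_lift_elem[OF Tn.comm_group_axioms c l])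
qed

lemma head_word_graded: "head_word V \<in> graded_maps 0 T T"
  using head_word_hom by (simp add: graded_maps_def)

lemma attach:
  shows attach_hom: "attach V n \<in> hom (TT n) (T n)"
    and attach_words: "u \<in> word_gens V i \<Longrightarrow> w \<in> word_gens V j \<Longrightarrow> i + j = n
      \<Longrightarrow> attach V n (tensor_pure T T (i, word_elem V u) (j, word_elem V w))
        = (if length u = 1 then word_elem V (u @ w) else \<one>\<^bsub>T n\<^esub>)"
proof -
  interpret Tn: comm_group "T n" by (rule Tbar_group)
  let ?r = "\<lambda>u. lift (T n) (\<lambda>w. word_elem V (u @ w))"
  let ?l = "\<lambda>y u. if length u = 1 then ?r u y else \<one>\<^bsub>T n\<^esub>"
  have rc: "word_elem V (u @ w) \<in> carrier (T n)"
    if "i + j = n" "u \<in> word_gens V i" "w \<in> word_gens V j" for u w i j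
    using that by (intro word_elem_closed word_gens_append) auto
  have rl: "word_elem V (u @ us @ (k, x \<otimes>\<^bsub>V k\<^esub> y) # vs)
      = word_elem V (u @ us @ (k, x) # vs) \<otimes>\<^bsub>T n\<^esub> word_elem V (u @ us @ (k, y) # vs)"
    if "i + j = n" "u \<in> word_gens V i" "us @ (k, x) # vs \<in> word_gens V j" "us @ (k, y) # vs \<in> word_gens V j"
    for u us k x y vs i j
    using word_elem_letter[of "u @ us" k x vs n y] that word_gens_append[OF that(2,3)] word_gens_append[OF that(2,4)]
    by simp
  have r_hom: "?r u \<in> hom (T j) (T n)" if "i + j = n" "u \<in> word_gens V i" for u i j
    by (rule word_lift_hom[OF Tn.comm_group_axioms rc[OF that] rl[OF that]])
  have r_elem: "?r u (word_elem V w) = word_elem V (u @ w)"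
    if "i + j = n" "u \<in> word_gens V i" "w \<in> word_gens V j" for u w i j
    by (rule word_lift_elem[OF Tn.comm_group_axioms rc[OF that(1,2)] rl[OF that(1,2)] that(3)])
  have lc: "?l y u \<in> carrier (T n)" if "i + j = n" "y \<in> carrier (T j)" "u \<in> word_gens V i" for y u i j
    using r_hom[OF that(1,3)] that(2) by (auto simp: hom_def)
  have ll: "?l z (us @ (k, x \<otimes>\<^bsub>V k\<^esub> y) # vs) = ?l z (us @ (k, x) # vs) \<otimes>\<^bsub>T n\<^esub> ?l z (us @ (k, y) # vs)"
    if n: "i + j = n" and z: "z \<in> carrier (T j)"
      and u: "us @ (k, x) # vs \<in> word_gens V i" "us @ (k, y) # vs \<in> word_gens V i" for z us k x y vs i j
  proof (cases "length (us @ (k, x) # vs) = 1")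
    case True
    have "?r (us @ (k, x \<otimes>\<^bsub>V k\<^esub> y) # vs) z = ?r (us @ (k, x) # vs) z \<otimes>\<^bsub>T n\<^esub> ?r (us @ (k, y) # vs) z"
    proof (rule word_hom_eq[OF Tn.comm_group_axioms _ _ _ z])
      note u' = word_gens_letter[OF u]
      show "?r (us @ (k, x \<otimes>\<^bsub>V k\<^esub> y) # vs) \<in> hom (T j) (T n)" by (rule r_hom[OF n u'])
      show "(\<lambda>z. ?r (us @ (k, x) # vs) z \<otimes>\<^bsub>T n\<^esub> ?r (us @ (k, y) # vs) z) \<in> hom (T j) (T n)"
        by (intro hom_mult_pointwise Tn.comm_group_axioms r_hom[OF n u(1)] r_hom[OF n u(2)])
      fix w assume w: "w \<in> word_gens V j"
      show "?r (us @ (k, x \<otimes>\<^bsub>V k\<^esub> y) # vs) (word_elem V w)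
        = ?r (us @ (k, x) # vs) (word_elem V w) \<otimes>\<^bsub>T n\<^esub> ?r (us @ (k, y) # vs) (word_elem V w)"
        unfolding r_elem[OF n u' w] r_elem[OF n u(1) w] r_elem[OF n u(2) w]
        using word_elem_letter[of us k x "vs @ w" n y] word_gens_append[OF u(1) w] word_gens_append[OF u(2) w] n
        by simp
    qed
    then show ?thesis using True by auto
  qed auto
  let ?b = "\<lambda>((i, x), (j, y)). lift (T n) (?l y) x"
  have left: "(\<lambda>x. ?b ((i, x), (j, y))) \<in> hom (T i) (T n)" if "i + j = n" "y \<in> carrier (T j)" for i j y
    using word_lift_hom[OF Tn.comm_group_axioms lc[OF that] ll[OF that]] by simp
  have l_elem: "lift (T n) (?l y) (word_elem V u) = ?l y u"
    if "i + j = n" "y \<in> carrier (T j)" "u \<in> word_gens V i" for i j y u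
    using word_lift_elem[OF Tn.comm_group_axioms lc[OF that(1,2)] ll[OF that(1,2)] that(3)] by simp
  have right: "(\<lambda>y. ?b ((i, x), (j, y))) \<in> hom (T j) (T n)" if n: "i + j = n" and x: "x \<in> carrier (T i)" for i j x
  proof (unfold prod.case, rule homI)
    show lcl: "lift (T n) (?l y) x \<in> carrier (T n)" if "y \<in> carrier (T j)" for y
      using left[OF n that] x by (auto simp: hom_def)
    fix y z assume yz: "y \<in> carrier (T j)" "z \<in> carrier (T j)"
    interpret Tj: comm_group "T j" by (rule Tbar_group)
    have m: "y \<otimes>\<^bsub>T j\<^esub> z \<in> carrier (T j)" using yz by simp
    show "lift (T n) (?l (y \<otimes>\<^bsub>T j\<^esub> z)) x = lift (T n) (?l y) x \<otimes>\<^bsub>T n\<^esub> lift (T n) (?l z) x"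
    proof (rule word_hom_eq[OF Tn.comm_group_axioms _ _ _ x])
      show "lift (T n) (?l (y \<otimes>\<^bsub>T j\<^esub> z)) \<in> hom (T i) (T n)" using left[OF n m] by simp
      show "(\<lambda>x. lift (T n) (?l y) x \<otimes>\<^bsub>T n\<^esub> lift (T n) (?l z) x) \<in> hom (T i) (T n)"
        using hom_mult_pointwise[OF Tn.comm_group_axioms left[OF n yz(1)] left[OF n yz(2)]] by simp
      fix u assume u: "u \<in> word_gens V i"
      show "lift (T n) (?l (y \<otimes>\<^bsub>T j\<^esub> z)) (word_elem V u)
        = lift (T n) (?l y) (word_elem V u) \<otimes>\<^bsub>T n\<^esub> lift (T n) (?l z) (word_elem V u)"
        unfolding l_elem[OF n m u] l_elem[OF n yz(1) u] l_elem[OF n yz(2) u]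
        using hom_mult[OF r_hom[OF n u] yz] by simp
    qed
  qed
  show "attach V n \<in> hom (TT n) (T n)"
    unfolding attach_def by (rule TP.tensor_lift_hom[OF Tn.comm_group_axioms left right])
  show "attach V n (tensor_pure T T (i, word_elem V u) (j, word_elem V w))
        = (if length u = 1 then word_elem V (u @ w) else \<one>\<^bsub>T n\<^esub>)"
    if u: "u \<in> word_gens V i" and w: "w \<in> word_gens V j" and n: "i + j = n"
  proof -
    have "attach V n (tensor_pure T T (i, word_elem V u) (j, word_elem V w))
      = lift (T n) (?l (word_elem V w)) (word_elem V u)"
      unfolding attach_def
      by (subst TP.tensor_lift_pure[OF Tn.comm_group_axioms left right n])
         (use u w word_elem_closed in auto)
    then show ?thesis using l_elem[OF n word_elem_closed[OF w] u] r_elem[OF n u w] by simp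
  qed
qed

lemma attach_graded: "attach V \<in> graded_maps 0 TT T"
  using attach_hom by (simp add: graded_maps_def)

end


lemma (in graded_pair_maps) tensor_map_cong:
  assumes f: "f \<in> graded_maps p M M'" "f' \<in> graded_maps p M M'"
    and g: "g \<in> graded_maps q N N'" "g' \<in> graded_maps q N N'"
    and ff: "\<And>i x. x \<in> carrier (M i) \<Longrightarrow> f i x = f' i x" and gg: "\<And>j y. y \<in> carrier (N j) \<Longrightarrow> g j y = g' j y"
    and t: "t \<in> carrier (tensor M N n)"
  shows "tensor_map M' N' p q f g n t = tensor_map M' N' p q f' g' n t"
proof (rule tensor_hom_eq[OF target.tensor_group tensor_map_hom[OF f(1) g(1) refl] tensor_map_hom[OF f(2) g(2) refl] _ t])
  fix i x j y assume "i + j = n" "x \<in> carrier (M i)" "y \<in> carrier (N j)"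
  then show "tensor_map M' N' p q f g n (tensor_pure M N (i, x) (j, y)) = tensor_map M' N' p q f' g' n (tensor_pure M N (i, x) (j, y))"
    by (simp add: tensor_map_pure[OF f(1) g(1) refl] tensor_map_pure[OF f(2) g(2) refl] ff gg)
qed

lemma subgroup_preimage:
  assumes "group G" "group H" "h \<in> hom G H" "subgroup K H"
  shows "subgroup {x \<in> carrier G. h x \<in> K} G"
proof -
  interpret group_hom G H h using assms by (simp add: group_hom_def group_hom_axioms_def)
  show ?thesis
    by unfold_locales (use assms(4) in \<open>auto simp: subgroup.m_closed subgroup.one_closed subgroup.m_inv_closed\<close>)
qed

context graded_words
begin

sublocale TTP: graded_pair T TT
  by unfold_locales (rule graded_module_Tbar TP.graded_module_tensor)+

sublocale TM: graded_pair_maps T T T T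
  by (rule graded_pair_mapsI) (rule graded_module_Tbar)+

sublocale TTM: graded_pair_maps T T T TT
  by (rule graded_pair_mapsI) (rule graded_module_Tbar TP.graded_module_tensor)+

lemma tensor_words_hom_eq:
  assumes H: "comm_group H" and f: "f \<in> hom (TT n) H" and g: "g \<in> hom (TT n) H"
    and eq: "\<And>i u j w. i + j = n \<Longrightarrow> u \<in> word_gens V i \<Longrightarrow> w \<in> word_gens V j
      \<Longrightarrow> f (tensor_pure T T (i, word_elem V u) (j, word_elem V w)) = g (tensor_pure T T (i, word_elem V u) (j, word_elem V w))"
    and t: "t \<in> carrier (TT n)"
  shows "f t = g t"
proof (rule TP.tensor_hom_eq[OF H f g _ t])
  fix i x j y assume n: "i + j = n" and x: "x \<in> carrier (T i)" and y: "y \<in> carrier (T j)"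
  show "f (tensor_pure T T (i, x) (j, y)) = g (tensor_pure T T (i, x) (j, y))"
  proof (rule word_hom_eq[OF H _ _ _ x])
    fix u assume u: "u \<in> word_gens V i"
    show "f (tensor_pure T T (i, word_elem V u) (j, y)) = g (tensor_pure T T (i, word_elem V u) (j, y))"
      by (rule word_hom_eq[OF H hom_comp[OF TP.tensor_pure_hom_right f] hom_comp[OF TP.tensor_pure_hom_right g] _ y])
         (use n u eq word_elem_closed in auto)
  qed (rule hom_comp[OF TP.tensor_pure_hom_left f] hom_comp[OF TP.tensor_pure_hom_left g]; use n y in auto)+
qed

lemma attach_pure_graded:
  assumes x: "x \<in> carrier (T i)"
  shows "(\<lambda>k y. attach V (k + i) (tensor_pure T T (i, x) (k, y))) \<in> graded_maps i T T"
  using x by (auto simp: graded_maps_def intro!: hom_comp[OF TP.tensor_pure_hom_right attach_hom])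

lemma attach_left:
  shows attach_left_hom: "attach_left V n \<in> hom (tensor T TT n) (TT n)"
    and attach_left_pure: "i + (k + l) = n \<Longrightarrow> x \<in> carrier (T i) \<Longrightarrow> y \<in> carrier (T k) \<Longrightarrow> z \<in> carrier (T l)
      \<Longrightarrow> attach_left V n (tensor_pure T TT (i, x) (k + l, tensor_pure T T (k, y) (l, z)))
        = tensor_pure T T (i + k, attach V (i + k) (tensor_pure T T (i, x) (k, y))) (l, z)"
proof -
  let ?L = "\<lambda>i x k y. attach V (k + i) (tensor_pure T T (i, x) (k, y))"
  let ?b = "\<lambda>((i, x), (j, t)). tensor_map T T i 0 (?L i x) graded_id j t"
  interpret TT: comm_group "TT n" by (rule TP.tensor_group)
  have right: "(\<lambda>t. ?b ((i, x), (j, t))) \<in> hom (TT j) (TT n)" if "i + j = n" "x \<in> carrier (T i)" for i j x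
    using TM.tensor_map_hom[OF attach_pure_graded[OF that(2)] graded_maps_id, of n j] that(1) by simp
  have left: "(\<lambda>x. ?b ((i, x), (j, t))) \<in> hom (T i) (TT n)" if n: "i + j = n" and t: "t \<in> carrier (TT j)" for i j t
  proof (unfold prod.case, rule homI)
    fix x assume x: "x \<in> carrier (T i)"
    show "tensor_map T T i 0 (?L i x) graded_id j t \<in> carrier (TT n)"
      using right[OF n x] t by (auto simp: hom_def)
    fix x' assume x': "x' \<in> carrier (T i)"
    interpret Ti: comm_group "T i" by (rule Tbar_group)
    have xx: "x \<otimes>\<^bsub>T i\<^esub> x' \<in> carrier (T i)" using x x' by simp
    have "tensor_map T T i 0 (?L i (x \<otimes>\<^bsub>T i\<^esub> x')) graded_id j t
      = tensor_map T T i 0 (\<lambda>k y. ?L i x k y \<otimes>\<^bsub>T (k + i)\<^esub> ?L i x' k y) graded_id j t"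
    proof (rule TM.tensor_map_cong[OF attach_pure_graded[OF xx] _ graded_maps_id graded_maps_id _ refl t])
      show "(\<lambda>k y. ?L i x k y \<otimes>\<^bsub>T (k + i)\<^esub> ?L i x' k y) \<in> graded_maps i T T"
        by (rule graded_maps_times[OF attach_pure_graded[OF x] attach_pure_graded[OF x'] graded_module_Tbar])
      fix k y assume "y \<in> carrier (T k)"
      then show "?L i (x \<otimes>\<^bsub>T i\<^esub> x') k y = ?L i x k y \<otimes>\<^bsub>T (k + i)\<^esub> ?L i x' k y"
        using hom_mult[OF hom_comp[OF TP.tensor_pure_hom_left attach_hom], of y k "k + i" i x x'] x x' by simp
    qed
    also have "\<dots> = tensor_map T T i 0 (?L i x) graded_id j t \<otimes>\<^bsub>TT n\<^esub> tensor_map T T i 0 (?L i x') graded_id j t"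
      by (rule TM.tensor_map_times_left[OF attach_pure_graded[OF x] attach_pure_graded[OF x'] graded_maps_id t])
         (use n in simp)
    finally show "tensor_map T T i 0 (?L i (x \<otimes>\<^bsub>T i\<^esub> x')) graded_id j t = \<dots>" .
  qed
  show "attach_left V n \<in> hom (tensor T TT n) (TT n)"
    unfolding attach_left_def by (rule TTP.tensor_lift_hom[OF TT.comm_group_axioms left right])
  show "attach_left V n (tensor_pure T TT (i, x) (k + l, tensor_pure T T (k, y) (l, z)))
        = tensor_pure T T (i + k, attach V (i + k) (tensor_pure T T (i, x) (k, y))) (l, z)"
    if n: "i + (k + l) = n" and x: "x \<in> carrier (T i)" and y: "y \<in> carrier (T k)" and z: "z \<in> carrier (T l)"
  proof -
    have t: "tensor_pure T T (k, y) (l, z) \<in> carrier (TT (k + l))"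
      by (rule TP.tensor_pure_closed[OF y z refl])
    have a: "?L i x k y \<in> carrier (T (k + i))"
      by (rule graded_maps_closed[OF attach_pure_graded[OF x] y refl])
    have "attach_left V n (tensor_pure T TT (i, x) (k + l, tensor_pure T T (k, y) (l, z)))
      = tensor_map T T i 0 (?L i x) graded_id (k + l) (tensor_pure T T (k, y) (l, z))"
      unfolding attach_left_def
      by (subst TTP.tensor_lift_pure[OF TT.comm_group_axioms left right n x t]) auto
    also have "\<dots> = tensor_pure T T (k + i, ?L i x k y) (l, z) [^]\<^bsub>TT n\<^esub> sgn_pow (0 * k)"
      using TM.tensor_map_pure[OF attach_pure_graded[OF x] graded_maps_id _ refl y z, of n] n by simp
    also have "\<dots> = tensor_pure T T (k + i, ?L i x k y) (l, z)"
      using TP.tensor_pure_closed[OF a z, of n] n by simp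
    finally show ?thesis by (simp add: add.commute)
  qed
qed

section \<open>Cofreeness of the reduced tensor coalgebra\<close>

lemma deconcat_letter: "w \<in> word_gens V n \<Longrightarrow> length w = 1 \<Longrightarrow> \<Delta> n (word_elem V w) = \<one>\<^bsub>TT n\<^esub>"
  using deconcat_word[of w n] comm_group.axioms(1)[OF TP.tensor_group, of n]
  by (simp add: comm_monoid.finprod_empty)

lemma attach_deconcat_word:
  assumes w: "w \<in> word_gens V n"
  shows "attach V n (\<Delta> n (word_elem V w)) = (if length w = 1 then \<one>\<^bsub>T n\<^esub> else word_elem V w)"
proof -
  interpret Tn: comm_group "T n" by (rule Tbar_group)
  interpret TT: comm_group "TT n" by (rule TP.tensor_group)
  have a: "attach V n (cut r w) = (if r = 1 then word_elem V w else \<one>\<^bsub>T n\<^esub>)"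
    if "r \<in> {1..<length w}" for r
    using that attach_words[OF word_gens_take[OF w] word_gens_drop[OF w], of r r n] w
    by (auto simp: word_degree_split word_gens_def)
  have "attach V n (\<Delta> n (word_elem V w)) = finprod (T n) (\<lambda>r. attach V n (cut r w)) {1..<length w}"
    unfolding deconcat_word[OF w]
    by (rule hom_finprod[OF TT.comm_group_axioms Tn.comm_group_axioms attach_hom]) (auto intro: cut_closed[OF w])
  also have "\<dots> = finprod (T n) (\<lambda>r. if r = 1 then word_elem V w else \<one>\<^bsub>T n\<^esub>) {1..<length w}"
    by (rule Tn.finprod_cong') (use a word_elem_closed[OF w] in auto)
  also have "\<dots> = (if length w = 1 then \<one>\<^bsub>T n\<^esub> else word_elem V w)"
  proof (cases "length w = 1")
    case False
    have "w \<noteq> []" using w by (simp add: word_gens_def)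
    then have "1 < length w" using False by (cases w) (auto simp: Suc_lessI)
    then have "finprod (T n) (\<lambda>r. if r = 1 then word_elem V w else \<one>\<^bsub>T n\<^esub>) {1..<length w} = word_elem V w"
      using Tn.finprod_singleton_swap[of 1 "{1..<length w}" "\<lambda>_. word_elem V w"] word_elem_closed[OF w] by auto
    then show ?thesis using False by simp
  qed simp
  finally show ?thesis .
qed

text \<open>A letter has zero coproduct and is its own head. Of a longer word only the cut after the first
  letter survives \<open>attach\<close>, and gluing this cut gives back the word.\<close>

lemma reconstruct:
  assumes x: "x \<in> carrier (T n)"
  shows "x = head_word V n x \<otimes>\<^bsub>T n\<^esub> attach V n (\<Delta> n x)"
proof -
  interpret Tn: comm_group "T n" by (rule Tbar_group)
  have "head_word V n x \<otimes>\<^bsub>T n\<^esub> attach V n (\<Delta> n x) = x"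
  proof (rule word_hom_eq[OF Tn.comm_group_axioms hom_mult_pointwise[OF Tn.comm_group_axioms head_word_hom hom_comp[OF deconcat_hom attach_hom]] _ _ x])
    show "(\<lambda>x. x) \<in> hom (T n) (T n)" by (auto simp: hom_def)
    fix w assume w: "w \<in> word_gens V n"
    then show "head_word V n (word_elem V w) \<otimes>\<^bsub>T n\<^esub> attach V n (\<Delta> n (word_elem V w)) = word_elem V w"
      by (simp add: head_word_elem[OF w] attach_deconcat_word[OF w] word_elem_closed)
  qed
  then show ?thesis by simp
qed

lemma deconcat_head_word:
  assumes x: "x \<in> carrier (T n)" shows "\<Delta> n (head_word V n x) = \<one>\<^bsub>TT n\<^esub>"
proof -
  interpret TT: comm_group "TT n" by (rule TP.tensor_group)
  interpret Tn: comm_group "T n" by (rule Tbar_group)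
  have one: "\<Delta> n \<one>\<^bsub>T n\<^esub> = \<one>\<^bsub>TT n\<^esub>"
    by (rule hom_one[OF deconcat_hom Tn.is_group TT.is_group])
  show ?thesis
    by (rule word_hom_eq[OF TT.comm_group_axioms hom_comp[OF head_word_hom deconcat_hom] hom_one_pointwise[OF TT.is_group] _ x])
       (auto simp: head_word_elem deconcat_letter one)
qed

lemma head_word_head_word:
  assumes x: "x \<in> carrier (T n)" shows "head_word V n (head_word V n x) = head_word V n x"
proof -
  interpret Tn: comm_group "T n" by (rule Tbar_group)
  have one: "head_word V n \<one>\<^bsub>T n\<^esub> = \<one>\<^bsub>T n\<^esub>"
    by (rule hom_one[OF head_word_hom Tn.is_group Tn.is_group])
  show ?thesis
    by (rule word_hom_eq[OF Tn.comm_group_axioms hom_comp[OF head_word_hom head_word_hom] head_word_hom _ x])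
       (auto simp: head_word_elem one)
qed

lemma head_word_attach:
  assumes t: "t \<in> carrier (TT n)" shows "head_word V n (attach V n t) = \<one>\<^bsub>T n\<^esub>"
proof -
  interpret Tn: comm_group "T n" by (rule Tbar_group)
  have one: "head_word V n \<one>\<^bsub>T n\<^esub> = \<one>\<^bsub>T n\<^esub>"
    by (rule hom_one[OF head_word_hom Tn.is_group Tn.is_group])
  show ?thesis
  proof (rule tensor_words_hom_eq[OF Tn.comm_group_axioms hom_comp[OF attach_hom head_word_hom] hom_one_pointwise[OF Tn.is_group] _ t])
    fix i u j w assume *: "i + j = n" "u \<in> word_gens V i" "w \<in> word_gens V j"
    have "u @ w \<in> word_gens V n" using word_gens_append[OF *(2,3)] * by simp
    moreover have "length w \<noteq> 0" "length u \<noteq> 0" using * by (auto simp: word_gens_def)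
    ultimately show "head_word V n (attach V n (tensor_pure T T (i, word_elem V u) (j, word_elem V w))) = \<one>\<^bsub>T n\<^esub>"
      by (simp add: attach_words[OF *(2,3,1)] head_word_elem one)
  qed
qed

text \<open>The form in which reconstruction is used to prove equations by induction on word length.\<close>

lemma eq_from_head_word_and_deconcat:
  assumes "x \<in> carrier (T n)" "y \<in> carrier (T n)" "head_word V n x = head_word V n y" "\<Delta> n x = \<Delta> n y"
  shows "x = y"
  using reconstruct[OF assms(1)] reconstruct[OF assms(2)] assms(3,4) by simp

text \<open>A word that begins with the letter \<open>x\<close> is cut either directly after \<open>x\<close>, which gives the first
  factor, or later, and then \<open>x\<close> stays attached to the left piece.\<close>

lemma deconcat_attach:
  assumes t: "t \<in> carrier (TT n)"
  shows "\<Delta> n (attach V n t) = tensor_map T T 0 0 (head_word V) graded_id n t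
    \<otimes>\<^bsub>TT n\<^esub> attach_left V n (tensor_map T TT 0 0 graded_id \<Delta> n t)"
proof -
  interpret TT: comm_group "TT n" by (rule TP.tensor_group)
  interpret T3: comm_group "tensor T TT n" by (rule TTP.tensor_group)
  interpret Tn: comm_group "T n" by (rule Tbar_group)
  have h1: "tensor_map T T 0 0 (head_word V) graded_id n \<in> hom (TT n) (TT n)"
    by (rule TM.tensor_map_hom[OF head_word_graded graded_maps_id]) simp
  have h2: "tensor_map T TT 0 0 graded_id \<Delta> n \<in> hom (TT n) (tensor T TT n)"
    by (rule TTM.tensor_map_hom[OF graded_maps_id deconcat_graded]) simp
  show ?thesis
  proof (rule tensor_words_hom_eq[OF TT.comm_group_axioms hom_comp[OF attach_hom deconcat_hom]
        hom_mult_pointwise[OF TT.comm_group_axioms h1 hom_comp[OF h2 attach_left_hom]] _ t])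
    fix i u j w assume n: "i + j = n" and u: "u \<in> word_gens V i" and w: "w \<in> word_gens V j"
    let ?p = "tensor_pure T T (i, word_elem V u) (j, word_elem V w)"
    have pc: "?p \<in> carrier (TT n)"
      using n by (intro TP.tensor_pure_closed word_elem_closed u w) auto
    have uc: "word_elem V u \<in> carrier (T i)" and wc: "word_elem V w \<in> carrier (T j)"
      using u w word_elem_closed by auto
    interpret TTj: comm_group "TT j" by (rule TP.tensor_group)
    have e1: "tensor_map T T 0 0 (head_word V) graded_id n ?p = (if length u = 1 then ?p else \<one>\<^bsub>TT n\<^esub>)"
      using TM.tensor_map_pure[OF head_word_graded graded_maps_id _ n uc wc, of n] pc n
        TP.tensor_pure_one_left[OF wc, of n i] by (simp add: head_word_elem[OF u])
    have "tensor_map T TT 0 0 graded_id \<Delta> n ?p = tensor_pure T TT (i, word_elem V u) (j, \<Delta> j (word_elem V w))"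
      using TTM.tensor_map_pure[OF graded_maps_id deconcat_graded _ n uc wc, of n]
        TTP.tensor_pure_closed[OF uc deconcat_closed[OF wc], of n] n by simp
    also have "\<dots> = finprod (tensor T TT n) (\<lambda>r. tensor_pure T TT (i, word_elem V u) (j, cut r w)) {1..<length w}"
      unfolding deconcat_word[OF w]
      by (rule hom_finprod[OF TTj.comm_group_axioms T3.comm_group_axioms TTP.tensor_pure_hom_right[OF uc]])
         (use n in \<open>auto intro: cut_closed[OF w]\<close>)
    finally have "attach_left V n (tensor_map T TT 0 0 graded_id \<Delta> n ?p)
      = finprod (TT n) (\<lambda>r. attach_left V n (tensor_pure T TT (i, word_elem V u) (j, cut r w))) {1..<length w}"
      using hom_finprod[OF T3.comm_group_axioms TT.comm_group_axioms attach_left_hom,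
          of "\<lambda>r. tensor_pure T TT (i, word_elem V u) (j, cut r w)" "{1..<length w}"]
        TTP.tensor_pure_closed[OF uc cut_closed[OF w], of _ n] n
      by (auto simp: Pi_def)
    also have "\<dots> = finprod (TT n) (\<lambda>r. if length u = 1 then cut (Suc r) (u @ w) else \<one>\<^bsub>TT n\<^esub>) {1..<length w}"
    proof (rule TT.finprod_cong'[OF refl])
      have uw: "u @ w \<in> word_gens V n" using word_gens_append[OF u w] n by simp
      show "(\<lambda>r. if length u = 1 then cut (Suc r) (u @ w) else \<one>\<^bsub>TT n\<^esub>) \<in> {1..<length w} \<rightarrow> carrier (TT n)"
        using cut_closed[OF uw] by (auto simp del: take_append drop_append)
      fix r assume r: "r \<in> {1..<length w}"
      have j: "word_degree (take r w) + word_degree (drop r w) = j"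
        using w by (simp add: word_degree_split word_gens_def)
      have tk: "take r w \<in> word_gens V (word_degree (take r w))" and dr: "drop r w \<in> word_gens V (word_degree (drop r w))"
        using r by (auto intro: word_gens_take[OF w] word_gens_drop[OF w])
      have "attach_left V n (tensor_pure T TT (i, word_elem V u) (j, cut r w))
        = tensor_pure T T (i + word_degree (take r w), attach V (i + word_degree (take r w))
            (tensor_pure T T (i, word_elem V u) (word_degree (take r w), word_elem V (take r w))))
          (word_degree (drop r w), word_elem V (drop r w))"
        using attach_left_pure[OF _ uc word_elem_closed[OF tk] word_elem_closed[OF dr], of n] j n by simp
      also have "\<dots> = (if length u = 1 then cut (Suc r) (u @ w) else \<one>\<^bsub>TT n\<^esub>)"
      proof (cases "length u = 1")
        case True
        then have "take (Suc r) (u @ w) = u @ take r w" "drop (Suc r) (u @ w) = drop r w" by auto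
        moreover have "word_degree u = i" using u by (simp add: word_gens_def)
        ultimately show ?thesis using True attach_words[OF u tk refl] by simp
      next
        case False
        then show ?thesis using attach_words[OF u tk refl]
          TP.tensor_pure_one_left[OF word_elem_closed[OF dr], of n "i + word_degree (take r w)"] j n by simp
      qed
      finally show "attach_left V n (tensor_pure T TT (i, word_elem V u) (j, cut r w)) = \<dots>" .
    qed
    finally have e2: "attach_left V n (tensor_map T TT 0 0 graded_id \<Delta> n ?p)
      = finprod (TT n) (\<lambda>r. if length u = 1 then cut (Suc r) (u @ w) else \<one>\<^bsub>TT n\<^esub>) {1..<length w}" .
    show "\<Delta> n (attach V n ?p) = tensor_map T T 0 0 (head_word V) graded_id n ?p
      \<otimes>\<^bsub>TT n\<^esub> attach_left V n (tensor_map T TT 0 0 graded_id \<Delta> n ?p)"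
    proof (cases "length u = 1")
      case True
      have uw: "u @ w \<in> word_gens V n" using word_gens_append[OF u w] n by simp
      have w0: "length w \<noteq> 0" using w by (auto simp: word_gens_def)
      have I: "{1..<length (u @ w)} = insert 1 (Suc ` {1..<length w})"
        using True w0 by (auto simp: image_Suc_atLeastLessThan)
      have "\<Delta> n (attach V n ?p) = finprod (TT n) (\<lambda>r. cut r (u @ w)) {1..<length (u @ w)}"
        by (simp add: attach_words[OF u w n] True deconcat_word[OF uw] del: take_append drop_append)
      also have "\<dots> = cut 1 (u @ w) \<otimes>\<^bsub>TT n\<^esub> finprod (TT n) (\<lambda>r. cut r (u @ w)) (Suc ` {1..<length w})"
        unfolding I by (rule TT.finprod_insert) (use cut_closed[OF uw] True w0 in \<open>auto simp del: take_append drop_append\<close>)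
      also have "finprod (TT n) (\<lambda>r. cut r (u @ w)) (Suc ` {1..<length w})
          = finprod (TT n) (\<lambda>r. cut (Suc r) (u @ w)) {1..<length w}"
        by (rule TT.finprod_reindex) (use cut_closed[OF uw] True in \<open>auto simp del: take_append drop_append\<close>)
      also have "cut 1 (u @ w) = ?p" using True u w by (simp add: word_gens_def)
      finally show ?thesis unfolding e1 e2 using True by simp
    next
      case False
      have one: "\<Delta> n \<one>\<^bsub>T n\<^esub> = \<one>\<^bsub>TT n\<^esub>"
        by (rule hom_one[OF deconcat_hom Tn.is_group TT.is_group])
      show ?thesis unfolding e1 e2 using False by (simp add: attach_words[OF u w n] one)
    qed
  qed
qed

end


section \<open>The filtration by word length\<close>

text \<open>The subgroup generated by the words of length at most \<open>m\<close>. It is needed because a differential maps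
  a word to a combination of words, of different lengths.\<close>

definition length_part :: "'a grmod \<Rightarrow> nat \<Rightarrow> int \<Rightarrow> 'a words set" where
  "length_part V m n = generate (Tbar V n) {word_elem V w | w. w \<in> word_gens V n \<and> length w \<le> m}"

context graded_words
begin

lemma length_part_gens: "{word_elem V w | w. w \<in> word_gens V n \<and> length w \<le> m} \<subseteq> carrier (T n)"
  using word_elem_closed by auto

lemma subgroup_length_part: "subgroup (length_part V m n) (T n)"
  unfolding length_part_def
  by (rule group.generate_is_subgroup[OF graded_module_group[OF graded_module_Tbar] length_part_gens])

lemma length_part_closed: "x \<in> length_part V m n \<Longrightarrow> x \<in> carrier (T n)"
  using subgroup_length_part subgroup.mem_carrier by metis

lemma word_elem_length_part: "w \<in> word_gens V n \<Longrightarrow> length w \<le> m \<Longrightarrow> word_elem V w \<in> length_part V m n"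
  unfolding length_part_def by (rule generate.incl) auto

lemma length_part_induct:
  assumes "x \<in> length_part V m n" "subgroup H (T n)"
    "\<And>w. w \<in> word_gens V n \<Longrightarrow> length w \<le> m \<Longrightarrow> word_elem V w \<in> H"
  shows "x \<in> H"
  using assms group.generate_subgroup_incl[OF graded_module_group[OF graded_module_Tbar], of _ H n]
  unfolding length_part_def by (smt (verit) mem_Collect_eq subset_eq)

lemma length_part_mono: "x \<in> length_part V m n \<Longrightarrow> m \<le> m' \<Longrightarrow> x \<in> length_part V m' n"
  by (erule length_part_induct[OF _ subgroup_length_part]) (auto intro: word_elem_length_part)

lemma length_part_hom_eq:
  assumes H: "comm_group H" and f: "f \<in> hom (T n) H" and g: "g \<in> hom (T n) H"
    and eq: "\<And>w. w \<in> word_gens V n \<Longrightarrow> length w \<le> m \<Longrightarrow> f (word_elem V w) = g (word_elem V w)"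
    and x: "x \<in> length_part V m n"
  shows "f x = g x"
proof -
  interpret H: comm_group H by fact
  interpret Tn: comm_group "T n" by (rule Tbar_group)
  interpret f: group_hom "T n" H f using f by unfold_locales
  interpret g: group_hom "T n" H g using g by unfold_locales
  have "subgroup {x \<in> carrier (T n). f x = g x} (T n)"
    by unfold_locales auto
  from length_part_induct[OF x this] show ?thesis using eq word_elem_closed by auto
qed

lemma attach_length_part:
  assumes x: "x \<in> carrier (T i)" and y: "y \<in> length_part V m j" and n: "i + j = n"
  shows "attach V n (tensor_pure T T (i, x) (j, y)) \<in> length_part V (Suc m) n"
proof -
  note grp = graded_module_group[OF graded_module_Tbar]
  have yc: "y \<in> carrier (T j)" by (rule length_part_closed[OF y])
  have hx: "(\<lambda>x. attach V n (tensor_pure T T (i, x) (j, y))) \<in> hom (T i) (T n)"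
    using hom_comp[OF TP.tensor_pure_hom_left[OF yc n[symmetric]] attach_hom] by simp
  have "x \<in> {x \<in> carrier (T i). attach V n (tensor_pure T T (i, x) (j, y)) \<in> length_part V (Suc m) n}"
  proof (rule word_induct[OF x subgroup_preimage[OF grp grp hx subgroup_length_part]])
    fix u assume u: "u \<in> word_gens V i"
    have uc: "word_elem V u \<in> carrier (T i)" by (rule word_elem_closed[OF u])
    have hy: "(\<lambda>y. attach V n (tensor_pure T T (i, word_elem V u) (j, y))) \<in> hom (T j) (T n)"
      using hom_comp[OF TP.tensor_pure_hom_right[OF uc n[symmetric]] attach_hom] by simp
    have "y \<in> {y \<in> carrier (T j). attach V n (tensor_pure T T (i, word_elem V u) (j, y)) \<in> length_part V (Suc m) n}"
    proof (rule length_part_induct[OF y subgroup_preimage[OF grp grp hy subgroup_length_part]])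
      fix w assume w: "w \<in> word_gens V j" "length w \<le> m"
      have "u @ w \<in> word_gens V n" using word_gens_append[OF u w(1)] n by simp
      then show "word_elem V w \<in> {y \<in> carrier (T j). attach V n (tensor_pure T T (i, word_elem V u) (j, y)) \<in> length_part V (Suc m) n}"
        using w subgroup.one_closed[OF subgroup_length_part]
        by (auto simp: attach_words[OF u w(1) n] word_elem_closed intro!: word_elem_length_part)
    qed
    then show "word_elem V u \<in> {x \<in> carrier (T i). attach V n (tensor_pure T T (i, x) (j, y)) \<in> length_part V (Suc m) n}"
      using uc by auto
  qed
  then show ?thesis by simp
qed

lemma head_word_length_part:
  assumes x: "x \<in> carrier (T n)" shows "head_word V n x \<in> length_part V 1 n"
proof -
  note grp = graded_module_group[OF graded_module_Tbar]
  have "x \<in> {x \<in> carrier (T n). head_word V n x \<in> length_part V 1 n}"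
    by (rule word_induct[OF x subgroup_preimage[OF grp grp head_word_hom subgroup_length_part]])
       (use subgroup.one_closed[OF subgroup_length_part] in
          \<open>auto simp: head_word_elem word_elem_closed intro!: word_elem_length_part\<close>)
  then show ?thesis by simp
qed

end

lemma (in comm_group) finprod_subgroup:
  assumes "subgroup K G" "\<And>a. a \<in> A \<Longrightarrow> f a \<in> K" shows "finprod G f A \<in> K"
  using assms(2)
proof (induction A rule: infinite_finite_induct)
  case (insert a A)
  then have "f \<in> A \<rightarrow> carrier G" "f a \<in> carrier G" using subgroup.mem_carrier[OF assms(1)] by auto
  then show ?case using insert subgroup.m_closed[OF assms(1)] by auto
qed (use assms(1) subgroup.one_closed in auto)

lemma int_pow_subgroup: "group G \<Longrightarrow> subgroup K G \<Longrightarrow> x \<in> K \<Longrightarrow> x [^]\<^bsub>G\<^esub> sgn_pow z \<in> K"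
  by (auto simp: sgn_pow_def group.int_pow_neg group.int_pow_1 subgroup.m_inv_closed subgroup.mem_carrier)

text \<open>Maps of the form \<open>(f \<otimes> g) \<circ> \<Delta>\<close> out of a tensor coalgebra. On a word they are a sum over its cuts,
  and hence only depend on the values of \<open>f\<close> and \<open>g\<close> on shorter words. All recursions and inductions
  below rest on this.\<close>

locale words_to_pair = graded_words V + target: graded_pair M' N'
  for V :: "'a grmod" and M' :: "'c grmod" and N' :: "'d grmod"
begin

sublocale MP: graded_pair_maps T T M' N' by unfold_locales

abbreviation cut_map where
  "cut_map p q f g n r w \<equiv> tensor_pure M' N'
     (word_degree (take r w) + p, f (word_degree (take r w)) (word_elem V (take r w)))
     (word_degree (drop r w) + q, g (word_degree (drop r w)) (word_elem V (drop r w)))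
     [^]\<^bsub>tensor M' N' n\<^esub> sgn_pow (q * word_degree (take r w))"

lemma cut_map_closed:
  assumes f: "f \<in> graded_maps p T M'" and g: "g \<in> graded_maps q T N'"
    and w: "w \<in> word_gens V n" and r: "1 \<le> r" "r < length w" and m: "m = n + p + q"
  shows "cut_map p q f g m r w \<in> carrier (tensor M' N' m)"
proof -
  interpret G: comm_group "tensor M' N' m" by (rule target.tensor_group)
  show ?thesis
    using word_degree_split[of r w] w m
    by (intro G.int_pow_closed target.tensor_pure_closed graded_maps_closed[OF f] graded_maps_closed[OF g]
        word_elem_closed[OF word_gens_take[OF w r]] word_elem_closed[OF word_gens_drop[OF w r(2)]])
       (auto simp: word_gens_def)
qed

lemma tensor_map_deconcat_word:
  assumes f: "f \<in> graded_maps p T M'" and g: "g \<in> graded_maps q T N'"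
    and w: "w \<in> word_gens V n" and m: "m = n + p + q"
  shows "tensor_map M' N' p q f g n (\<Delta> n (word_elem V w)) = finprod (tensor M' N' m) (\<lambda>r. cut_map p q f g m r w) {1..<length w}"
proof -
  interpret G: comm_group "tensor M' N' m" by (rule target.tensor_group)
  interpret TT: comm_group "TT n" by (rule TP.tensor_group)
  have "tensor_map M' N' p q f g n (\<Delta> n (word_elem V w))
      = finprod (tensor M' N' m) (\<lambda>r. tensor_map M' N' p q f g n (cut r w)) {1..<length w}"
    unfolding deconcat_word[OF w]
    by (rule hom_finprod[OF TT.comm_group_axioms G.comm_group_axioms MP.tensor_map_hom[OF f g m]])
       (auto intro: cut_closed[OF w])
  also have "\<dots> = finprod (tensor M' N' m) (\<lambda>r. cut_map p q f g m r w) {1..<length w}"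
  proof (rule G.finprod_cong'[OF refl])
    show "(\<lambda>r. cut_map p q f g m r w) \<in> {1..<length w} \<rightarrow> carrier (tensor M' N' m)"
      using cut_map_closed[OF f g w _ _ m] by auto
    fix r assume r: "r \<in> {1..<length w}"
    have n: "word_degree (take r w) + word_degree (drop r w) = n"
      using w by (simp add: word_gens_def word_degree_split)
    show "tensor_map M' N' p q f g n (cut r w) = cut_map p q f g m r w"
      using r by (intro MP.tensor_map_pure[OF f g m n] word_elem_closed[OF word_gens_take[OF w]]
           word_elem_closed[OF word_gens_drop[OF w]]) auto
  qed
  finally show ?thesis .
qed

lemma tensor_map_deconcat_cong:
  assumes f: "f \<in> graded_maps p T M'" "f' \<in> graded_maps p T M'"
    and g: "g \<in> graded_maps q T N'" "g' \<in> graded_maps q T N'"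
    and w: "w \<in> word_gens V n"
    and eq: "\<And>i u. u \<in> word_gens V i \<Longrightarrow> length u < length w \<Longrightarrow> f i (word_elem V u) = f' i (word_elem V u)"
      "\<And>i u. u \<in> word_gens V i \<Longrightarrow> length u < length w \<Longrightarrow> g i (word_elem V u) = g' i (word_elem V u)"
  shows "tensor_map M' N' p q f g n (\<Delta> n (word_elem V w)) = tensor_map M' N' p q f' g' n (\<Delta> n (word_elem V w))"
proof -
  interpret G: comm_group "tensor M' N' (n + p + q)" by (rule target.tensor_group)
  show ?thesis
    unfolding tensor_map_deconcat_word[OF f(1) g(1) w refl] tensor_map_deconcat_word[OF f(2) g(2) w refl]
  proof (rule G.finprod_cong'[OF refl])
    show "(\<lambda>r. cut_map p q f' g' (n + p + q) r w) \<in> {1..<length w} \<rightarrow> carrier (tensor M' N' (n + p + q))"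
      using cut_map_closed[OF f(2) g(2) w] by auto
    fix r assume r: "r \<in> {1..<length w}"
    then show "cut_map p q f g (n + p + q) r w = cut_map p q f' g' (n + p + q) r w"
      using eq(1)[OF word_gens_take[OF w]] eq(2)[OF word_gens_drop[OF w]] by auto
  qed
qed

end

lemma words_to_pairI: "graded_module V \<Longrightarrow> graded_module M \<Longrightarrow> graded_module N \<Longrightarrow> words_to_pair V M N"
  by (intro words_to_pair.intro graded_words.intro graded_pair.intro)

context graded_words
begin

sublocale WT: words_to_pair V T T by (rule words_to_pairI; rule V graded_module_Tbar)

text \<open>A coderivation never increases word length: its component on a word is rebuilt, via
  \<open>reconstruct\<close>, from one letter and from its values on proper tails of the word.\<close>
lemma coderivation_length_part_word:
  assumes D: "coderivation 1 T \<Delta> D" and w: "w \<in> word_gens V n"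
  shows "D n (word_elem V w) \<in> length_part V (length w) (n + 1)"
  using w
proof (induction "length w" arbitrary: w n rule: less_induct)
  case less
  note w = \<open>w \<in> word_gens V n\<close>
  interpret TT1: comm_group "TT (n + 1)" by (rule TP.tensor_group)
  interpret T1: comm_group "T (n + 1)" by (rule Tbar_group)
  note sub = subgroup_length_part[of "length w" "n + 1"]
  have Dg: "D \<in> graded_maps 1 T T" using D by (simp add: coderivation_def)
  have wc: "word_elem V w \<in> carrier (T n)" by (rule word_elem_closed[OF w])
  have Dw: "D n (word_elem V w) \<in> carrier (T (n + 1))" by (rule graded_maps_closed[OF Dg wc refl])
  have w1: "1 \<le> length w" using w by (cases w) (auto simp: word_gens_def)
  have pieces: "attach V (n + 1) (tensor_map T T p q f g n (\<Delta> n (word_elem V w))) \<in> length_part V (length w) (n + 1)"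
    if f: "f \<in> graded_maps p T T" and g: "g \<in> graded_maps q T T" and pq: "n + 1 = n + p + q"
      and len: "\<And>j u. u \<in> word_gens V j \<Longrightarrow> length u < length w \<Longrightarrow> g j (word_elem V u) \<in> length_part V (length u) (j + q)"
    for p q f g
  proof -
    have "attach V (n + 1) (tensor_map T T p q f g n (\<Delta> n (word_elem V w)))
      = finprod (T (n + 1)) (\<lambda>r. attach V (n + 1) (WT.cut_map p q f g (n + 1) r w)) {1..<length w}"
      unfolding WT.tensor_map_deconcat_word[OF f g w pq]
      by (rule hom_finprod[OF TT1.comm_group_axioms T1.comm_group_axioms attach_hom])
         (use WT.cut_map_closed[OF f g w _ _ pq] in auto)
    also have "\<dots> \<in> length_part V (length w) (n + 1)"
    proof (rule T1.finprod_subgroup[OF sub])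
      fix r assume r: "r \<in> {1..<length w}"
      let ?i = "word_degree (take r w)" and ?j = "word_degree (drop r w)"
      have tk: "take r w \<in> word_gens V ?i" and dr: "drop r w \<in> word_gens V ?j"
        using r by (auto intro: word_gens_take[OF w] word_gens_drop[OF w])
      have n: "?i + ?j = n" using w by (simp add: word_gens_def word_degree_split)
      have fc: "f ?i (word_elem V (take r w)) \<in> carrier (T (?i + p))"
        by (rule graded_maps_closed[OF f word_elem_closed[OF tk] refl])
      have gc: "g ?j (word_elem V (drop r w)) \<in> length_part V (length (drop r w)) (?j + q)"
        by (rule len[OF dr]) (use r in auto)
      have deg: "(?i + p) + (?j + q) = n + 1" using n pq by simp
      have c: "tensor_pure T T (?i + p, f ?i (word_elem V (take r w))) (?j + q, g ?j (word_elem V (drop r w))) \<in> carrier (TT (n + 1))"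
        by (rule TP.tensor_pure_closed[OF fc length_part_closed[OF gc] deg[symmetric]])
      have "attach V (n + 1) (WT.cut_map p q f g (n + 1) r w)
        = attach V (n + 1) (tensor_pure T T (?i + p, f ?i (word_elem V (take r w))) (?j + q, g ?j (word_elem V (drop r w))))
           [^]\<^bsub>T (n + 1)\<^esub> sgn_pow (q * ?i)"
        by (rule hom_int_pow[OF attach_hom c TT1.is_group T1.is_group])
      also have "\<dots> \<in> length_part V (length w) (n + 1)"
        by (rule int_pow_subgroup[OF T1.is_group sub], rule length_part_mono[OF attach_length_part[OF fc gc deg]])
           (use r in auto)
      finally show "attach V (n + 1) (WT.cut_map p q f g (n + 1) r w) \<in> length_part V (length w) (n + 1)" .
    qed
    finally show ?thesis .
  qed
  have d: "\<Delta> (n + 1) (D n (word_elem V w))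
      = tensor_map T T 1 0 D graded_id n (\<Delta> n (word_elem V w))
        \<otimes>\<^bsub>TT (n + 1)\<^esub> tensor_map T T 0 1 graded_id D n (\<Delta> n (word_elem V w))"
    using D wc by (simp add: coderivation_def)
  have c: "tensor_map T T 1 0 D graded_id n (\<Delta> n (word_elem V w)) \<in> carrier (TT (n + 1))"
    "tensor_map T T 0 1 graded_id D n (\<Delta> n (word_elem V w)) \<in> carrier (TT (n + 1))"
    by (rule TM.tensor_map_closed[OF Dg graded_maps_id deconcat_closed[OF wc]], simp)
       (rule TM.tensor_map_closed[OF graded_maps_id Dg deconcat_closed[OF wc]], simp)
  have "attach V (n + 1) (\<Delta> (n + 1) (D n (word_elem V w))) \<in> length_part V (length w) (n + 1)"
    unfolding d hom_mult[OF attach_hom c]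
  proof (rule subgroup.m_closed[OF sub])
    show "attach V (n + 1) (tensor_map T T 1 0 D graded_id n (\<Delta> n (word_elem V w))) \<in> length_part V (length w) (n + 1)"
      by (rule pieces[OF Dg graded_maps_id]) (auto intro: word_elem_length_part)
    show "attach V (n + 1) (tensor_map T T 0 1 graded_id D n (\<Delta> n (word_elem V w))) \<in> length_part V (length w) (n + 1)"
      by (rule pieces[OF graded_maps_id Dg]) (auto intro: less.hyps)
  qed
  moreover have "head_word V (n + 1) (D n (word_elem V w)) \<in> length_part V (length w) (n + 1)"
    by (rule length_part_mono[OF head_word_length_part[OF Dw] w1])
  ultimately show ?case
    using reconstruct[OF Dw] subgroup.m_closed[OF sub] by metis
qed

end

section \<open>Coassociativity\<close>

lemma (in comm_group) finprod_shift:
  fixes r L :: nat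
  assumes g: "\<And>t. r < t \<Longrightarrow> t < L \<Longrightarrow> g t \<in> carrier G"
  shows "finprod G (\<lambda>s. g (r + s)) {1..<L - r} = finprod G (\<lambda>t. if r < t then g t else \<one>) {1..<L}"
proof -
  have "finprod G (\<lambda>s. g (r + s)) {1..<L - r} = finprod G g ((+) r ` {1..<L - r})"
    by (rule finprod_reindex[symmetric]) (auto intro!: g simp: inj_on_def)
  also have "\<dots> = finprod G (\<lambda>t. if r < t then g t else \<one>) {1..<L}"
    by (rule finprod_mono_neutral_cong_left)
       (use g in \<open>auto simp: image_iff intro!: bexI[of _ "_ - r"]\<close>)
  finally show ?thesis .
qed

locale words_pair = A: graded_words VA + B: graded_words VB
  for VA :: "'a grmod" and VB :: "'b grmod"
begin

sublocale AB: words_to_pair VA B.T B.T by (rule words_to_pairI; rule A.V B.graded_module_Tbar)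
sublocale ABB: words_to_pair VA B.T B.TT by (rule words_to_pairI; rule A.V B.graded_module_Tbar B.TP.graded_module_tensor)

lemma tensor_deconcat_graded:
  assumes "F \<in> graded_maps p A.T B.T" "G \<in> graded_maps q A.T B.T"
  shows "(\<lambda>i x. tensor_map B.T B.T p q F G i (A.\<Delta> i x)) \<in> graded_maps (p + q) A.T B.TT"
  using graded_maps_comp[OF A.deconcat_graded AB.MP.tensor_map_graded[OF assms refl]] by simp

lemma attach_tensor_graded:
  assumes "F \<in> graded_maps p A.T B.T" "G \<in> graded_maps q A.T B.T"
  shows "(\<lambda>i x. attach VB (i + (p + q)) (tensor_map B.T B.T p q F G i (A.\<Delta> i x))) \<in> graded_maps (p + q) A.T B.T"
  using graded_maps_comp[OF tensor_deconcat_graded[OF assms] B.attach_graded] by simp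

text \<open>Coassociativity of deconcatenation; concatenating the values of the first two maps absorbs the
  rebracketing of the factors. On a word both sides are the sum, over all pairs of cuts, of the same
  terms.\<close>

lemma coassociativity:
  assumes F: "F \<in> graded_maps p A.T B.T" and G: "G \<in> graded_maps q A.T B.T" and H: "H \<in> graded_maps h A.T B.T"
    and x: "x \<in> carrier (A.T n)" and m: "m = n + p + (q + h)"
  shows "attach_left VB m (tensor_map B.T B.TT p (q + h) F (\<lambda>i x. tensor_map B.T B.T q h G H i (A.\<Delta> i x)) n (A.\<Delta> n x))
    = tensor_map B.T B.T (p + q) h (\<lambda>i x. attach VB (i + (p + q)) (tensor_map B.T B.T p q F G i (A.\<Delta> i x))) H n (A.\<Delta> n x)"
    (is "?l x = ?r x")
proof -
  let ?GH = "\<lambda>i x. tensor_map B.T B.T q h G H i (A.\<Delta> i x)"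
  let ?FG = "\<lambda>i x. attach VB (i + (p + q)) (tensor_map B.T B.T p q F G i (A.\<Delta> i x))"
  note GH = tensor_deconcat_graded[OF G H]
  note FG = attach_tensor_graded[OF F G]
  have m': "m = n + (p + q) + h" using m by simp
  interpret K: comm_group "B.TT m" by (rule B.TP.tensor_group)
  interpret K3: comm_group "tensor B.T B.TT m" by (rule B.TTP.tensor_group)
  show ?thesis
  proof (rule A.word_hom_eq[OF K.comm_group_axioms _ _ _ x])
    show "?l \<in> hom (A.T n) (B.TT m)"
      by (rule hom_comp[OF hom_comp[OF A.deconcat_hom ABB.MP.tensor_map_hom[OF F GH m]] B.attach_left_hom])
    show "?r \<in> hom (A.T n) (B.TT m)"
      by (rule hom_comp[OF A.deconcat_hom AB.MP.tensor_map_hom[OF FG H m']])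
    fix w assume w: "w \<in> word_gens VA n"
    define L where "L = length w"
    define c where "c r t = tensor_pure B.T B.T
       (word_degree (take t w) + (p + q), attach VB (word_degree (take t w) + (p + q)) (tensor_pure B.T B.T
          (word_degree (take r w) + p, F (word_degree (take r w)) (word_elem VA (take r w)))
          (word_degree (drop r (take t w)) + q, G (word_degree (drop r (take t w))) (word_elem VA (drop r (take t w))))))
       (word_degree (drop t w) + h, H (word_degree (drop t w)) (word_elem VA (drop t w)))
       [^]\<^bsub>B.TT m\<^esub> sgn_pow (q * word_degree (take r w) + h * word_degree (take t w))" for r t
    (* Both sides are the sum of the c r t over 1 <= r < t < L. *)
    have aux: "tensor_pure B.T B.T
          (word_degree (take r w) + p, F (word_degree (take r w)) (word_elem VA (take r w)))
          (word_degree (drop r (take t w)) + q, G (word_degree (drop r (take t w))) (word_elem VA (drop r (take t w))))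
          \<in> carrier (B.TT (word_degree (take t w) + (p + q)))"
      "H (word_degree (drop t w)) (word_elem VA (drop t w)) \<in> carrier (B.T (word_degree (drop t w) + h))"
      "tensor_pure B.T B.T
       (word_degree (take t w) + (p + q), attach VB (word_degree (take t w) + (p + q)) (tensor_pure B.T B.T
          (word_degree (take r w) + p, F (word_degree (take r w)) (word_elem VA (take r w)))
          (word_degree (drop r (take t w)) + q, G (word_degree (drop r (take t w))) (word_elem VA (drop r (take t w))))))
       (word_degree (drop t w) + h, H (word_degree (drop t w)) (word_elem VA (drop t w))) \<in> carrier (B.TT m)"
      if "1 \<le> r" "r < t" "t < L" for r t
    proof -
      have g: "take r w \<in> word_gens VA (word_degree (take r w))"
        "drop r (take t w) \<in> word_gens VA (word_degree (drop r (take t w)))"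
        "drop t w \<in> word_gens VA (word_degree (drop t w))"
        using that w by (auto simp: L_def word_gens_def dest: in_set_takeD in_set_dropD)
      have "word_degree (take r w) + word_degree (drop r (take t w)) = word_degree (take t w)"
        using word_degree_split[of r "take t w"] that by (simp add: min_def)
      then show 1: "tensor_pure B.T B.T
          (word_degree (take r w) + p, F (word_degree (take r w)) (word_elem VA (take r w)))
          (word_degree (drop r (take t w)) + q, G (word_degree (drop r (take t w))) (word_elem VA (drop r (take t w))))
          \<in> carrier (B.TT (word_degree (take t w) + (p + q)))"
        by (intro B.TP.tensor_pure_closed graded_maps_closed[OF F] graded_maps_closed[OF G] A.word_elem_closed g) auto
      show 2: "H (word_degree (drop t w)) (word_elem VA (drop t w)) \<in> carrier (B.T (word_degree (drop t w) + h))"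
        by (intro graded_maps_closed[OF H] A.word_elem_closed g) auto
      have "word_degree (take t w) + word_degree (drop t w) = n"
        using w by (simp add: word_gens_def word_degree_split)
      then show "tensor_pure B.T B.T
       (word_degree (take t w) + (p + q), attach VB (word_degree (take t w) + (p + q)) (tensor_pure B.T B.T
          (word_degree (take r w) + p, F (word_degree (take r w)) (word_elem VA (take r w)))
          (word_degree (drop r (take t w)) + q, G (word_degree (drop r (take t w))) (word_elem VA (drop r (take t w))))))
       (word_degree (drop t w) + h, H (word_degree (drop t w)) (word_elem VA (drop t w))) \<in> carrier (B.TT m)"
        using m by (intro B.TP.tensor_pure_closed 2 graded_maps_closed[OF B.attach_graded 1]) auto
    qed
    have c_closed: "c r t \<in> carrier (B.TT m)" if "1 \<le> r" "r < t" "t < L" for r t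
      unfolding c_def by (rule K.int_pow_closed[OF aux(3)[OF that]])
    have "?l (word_elem VA w) = finprod (B.TT m) (\<lambda>r. attach_left VB m (ABB.cut_map p (q + h) F ?GH m r w)) {1..<L}"
      unfolding ABB.tensor_map_deconcat_word[OF F GH w m] L_def
      by (rule hom_finprod[OF K3.comm_group_axioms K.comm_group_axioms B.attach_left_hom])
         (use ABB.cut_map_closed[OF F GH w _ _ m] in auto)
    also have "\<dots> = finprod (B.TT m) (\<lambda>r. finprod (B.TT m) (\<lambda>t. if r < t then c r t else \<one>\<^bsub>B.TT m\<^esub>) {1..<L}) {1..<L}"
    proof (rule K.finprod_cong'[OF refl])
      show "(\<lambda>r. finprod (B.TT m) (\<lambda>t. if r < t then c r t else \<one>\<^bsub>B.TT m\<^esub>) {1..<L}) \<in> {1..<L} \<rightarrow> carrier (B.TT m)"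
        using c_closed by (auto intro!: K.finprod_closed)
      fix r assume r: "r \<in> {1..<L}"
      let ?i = "word_degree (take r w)" and ?j = "word_degree (drop r w)"
      have tk: "take r w \<in> word_gens VA ?i" and dr: "drop r w \<in> word_gens VA ?j"
        using r by (auto simp: L_def intro: A.word_gens_take[OF w] A.word_gens_drop[OF w])
      have n: "?i + ?j = n" using w by (simp add: word_gens_def word_degree_split)
      have Fc: "F ?i (word_elem VA (take r w)) \<in> carrier (B.T (?i + p))"
        by (rule graded_maps_closed[OF F A.word_elem_closed[OF tk] refl])
      have len: "length (drop r w) = L - r" by (simp add: L_def)
      interpret J: comm_group "B.TT (?j + (q + h))" by (rule B.TP.tensor_group)
      let ?s = "sgn_pow ((q + h) * ?i)"
      let ?P = "\<lambda>z. attach_left VB m (tensor_pure B.T B.TT (?i + p, F ?i (word_elem VA (take r w))) (?j + (q + h), z))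
           [^]\<^bsub>B.TT m\<^esub> ?s"
      have Phom: "?P \<in> hom (B.TT (?j + (q + h))) (B.TT m)"
        by (rule hom_pow_pointwise[OF K.comm_group_axioms
            hom_comp[OF B.TTP.tensor_pure_hom_right[OF Fc] B.attach_left_hom]]) (use n m in simp)
      have GHc: "?GH ?j (word_elem VA (drop r w)) \<in> carrier (B.TT (?j + (q + h)))"
        by (rule graded_maps_closed[OF GH A.word_elem_closed[OF dr] refl])
      have "attach_left VB m (ABB.cut_map p (q + h) F ?GH m r w) = ?P (?GH ?j (word_elem VA (drop r w)))"
        by (rule hom_int_pow[OF B.attach_left_hom B.TTP.tensor_pure_closed[OF Fc GHc] K3.is_group K.is_group])
           (use n m in simp)
      also have "\<dots> = ?P (finprod (B.TT (?j + (q + h))) (\<lambda>s. AB.cut_map q h G H (?j + (q + h)) s (drop r w)) {1..<L - r})"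
        using AB.tensor_map_deconcat_word[OF G H dr, of "?j + (q + h)"] len by simp
      also have "\<dots> = finprod (B.TT m) (\<lambda>s. ?P (AB.cut_map q h G H (?j + (q + h)) s (drop r w))) {1..<L - r}"
        by (rule hom_finprod[OF J.comm_group_axioms K.comm_group_axioms Phom])
           (use AB.cut_map_closed[OF G H dr _ _ add.assoc[symmetric]] len in auto)
      also have "\<dots> = finprod (B.TT m) (\<lambda>s. c r (r + s)) {1..<L - r}"
      proof (rule K.finprod_cong'[OF refl])
        show "(\<lambda>s. c r (r + s)) \<in> {1..<L - r} \<rightarrow> carrier (B.TT m)" using c_closed r by auto
        fix s assume s: "s \<in> {1..<L - r}"
        let ?k = "word_degree (take s (drop r w))" and ?l = "word_degree (drop s (drop r w))"
        have td: "drop r (take (r + s) w) = take s (drop r w)" "drop (r + s) w = drop s (drop r w)"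
          by (auto simp: take_drop add.commute)
        have ik: "word_degree (take (r + s) w) = ?i + ?k" by (simp add: take_add)
        have kl: "?k + ?l = ?j" by (rule word_degree_split)
        have gk: "take s (drop r w) \<in> word_gens VA ?k"
          by (rule A.word_gens_take[OF dr]) (use s len in auto)
        have gl: "drop s (drop r w) \<in> word_gens VA ?l"
          by (rule A.word_gens_drop[OF dr]) (use s len in auto)
        have Gc: "G ?k (word_elem VA (take s (drop r w))) \<in> carrier (B.T (?k + q))"
          by (rule graded_maps_closed[OF G A.word_elem_closed[OF gk] refl])
        have Hc: "H ?l (word_elem VA (drop s (drop r w))) \<in> carrier (B.T (?l + h))"
          by (rule graded_maps_closed[OF H A.word_elem_closed[OF gl] refl])
        let ?z = "tensor_pure B.T B.T (?k + q, G ?k (word_elem VA (take s (drop r w)))) (?l + h, H ?l (word_elem VA (drop s (drop r w))))"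
        have z: "?z \<in> carrier (B.TT (?j + (q + h)))"
          by (rule B.TP.tensor_pure_closed[OF Gc Hc]) (use kl in simp)
        let ?y = "attach_left VB m (tensor_pure B.T B.TT (?i + p, F ?i (word_elem VA (take r w))) (?j + (q + h), ?z))"
        have y: "?y = tensor_pure B.T B.T (?i + p + (?k + q), attach VB (?i + p + (?k + q))
             (tensor_pure B.T B.T (?i + p, F ?i (word_elem VA (take r w))) (?k + q, G ?k (word_elem VA (take s (drop r w))))))
             (?l + h, H ?l (word_elem VA (drop s (drop r w))))"
          using B.attach_left_pure[OF _ Fc Gc Hc, of m] kl[symmetric] n m by (simp add: add_ac)
        have rs: "1 \<le> r" "r < r + s" "r + s < L" using r s by auto
        have sw: "?i + p + (?k + q) = ?i + ?k + (p + q)" by simp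
        have yc: "?y \<in> carrier (B.TT m)"
          unfolding y sw using aux(3)[OF rs] unfolding td ik .
        have "?P (AB.cut_map q h G H (?j + (q + h)) s (drop r w)) = (?y [^]\<^bsub>B.TT m\<^esub> ?s) [^]\<^bsub>B.TT m\<^esub> sgn_pow (h * ?k)"
          by (rule hom_int_pow[OF Phom z J.is_group K.is_group])
        also have "\<dots> = ?y [^]\<^bsub>B.TT m\<^esub> sgn_pow (q * ?i + h * (?i + ?k))"
        proof -
          have e: "(q + h) * ?i + h * ?k = q * ?i + h * (?i + ?k)" by (simp add: algebra_simps)
          show ?thesis unfolding K.int_pow_sgn_pow[OF yc] e ..
        qed
        also have "\<dots> = c r (r + s)"
          unfolding c_def y td ik sw ..
        finally show "?P (AB.cut_map q h G H (?j + (q + h)) s (drop r w)) = c r (r + s)" .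
      qed
      also have "\<dots> = finprod (B.TT m) (\<lambda>t. if r < t then c r t else \<one>\<^bsub>B.TT m\<^esub>) {1..<L}"
        by (rule K.finprod_shift) (use r c_closed in auto)
      finally show "attach_left VB m (ABB.cut_map p (q + h) F ?GH m r w) = \<dots>" .
    qed
    also have "\<dots> = finprod (B.TT m) (\<lambda>t. finprod (B.TT m) (\<lambda>r. if r < t then c r t else \<one>\<^bsub>B.TT m\<^esub>) {1..<L}) {1..<L}"
      by (rule K.finprod_swap) (use c_closed in auto)
    also have "\<dots> = finprod (B.TT m) (\<lambda>t. AB.cut_map (p + q) h ?FG H m t w) {1..<L}"
    proof (rule K.finprod_cong'[OF refl])
      show "(\<lambda>t. AB.cut_map (p + q) h ?FG H m t w) \<in> {1..<L} \<rightarrow> carrier (B.TT m)"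
        using AB.cut_map_closed[OF FG H w _ _ m'] by (auto simp: L_def)
      fix t assume t: "t \<in> {1..<L}"
      let ?i = "word_degree (take t w)" and ?j = "word_degree (drop t w)"
      have tk: "take t w \<in> word_gens VA ?i" and dr: "drop t w \<in> word_gens VA ?j"
        using t by (auto simp: L_def intro: A.word_gens_take[OF w] A.word_gens_drop[OF w])
      have n: "?i + ?j = n" using w by (simp add: word_gens_def word_degree_split)
      have Hc: "H ?j (word_elem VA (drop t w)) \<in> carrier (B.T (?j + h))"
        by (rule graded_maps_closed[OF H A.word_elem_closed[OF dr] refl])
      have len: "length (take t w) = t" using t by (simp add: L_def)
      interpret J: comm_group "B.TT (?i + (p + q))" by (rule B.TP.tensor_group)
      let ?s = "sgn_pow (h * ?i)"
      let ?P = "\<lambda>z. tensor_pure B.T B.T (?i + (p + q), attach VB (?i + (p + q)) z) (?j + h, H ?j (word_elem VA (drop t w)))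
           [^]\<^bsub>B.TT m\<^esub> ?s"
      have Phom: "?P \<in> hom (B.TT (?i + (p + q))) (B.TT m)"
        by (rule hom_pow_pointwise[OF K.comm_group_axioms
            hom_comp[OF B.attach_hom B.TP.tensor_pure_hom_left[OF Hc]]]) (use n m in simp)
      have "AB.cut_map (p + q) h ?FG H m t w = ?P (finprod (B.TT (?i + (p + q))) (\<lambda>r. AB.cut_map p q F G (?i + (p + q)) r (take t w)) {1..<t})"
        using AB.tensor_map_deconcat_word[OF F G tk, of "?i + (p + q)"] len by simp
      also have "\<dots> = finprod (B.TT m) (\<lambda>r. ?P (AB.cut_map p q F G (?i + (p + q)) r (take t w))) {1..<t}"
        by (rule hom_finprod[OF J.comm_group_axioms K.comm_group_axioms Phom])
           (use AB.cut_map_closed[OF F G tk _ _ add.assoc[symmetric]] len in auto)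
      also have "\<dots> = finprod (B.TT m) (\<lambda>r. c r t) {1..<t}"
      proof (rule K.finprod_cong'[OF refl])
        show "(\<lambda>r. c r t) \<in> {1..<t} \<rightarrow> carrier (B.TT m)" using c_closed t by auto
        fix r assume r: "r \<in> {1..<t}"
        have tt: "take r (take t w) = take r w" using r by (simp add: min_def)
        have rt: "1 \<le> r" "r < t" "t < L" using r t by auto
        have "?P (AB.cut_map p q F G (?i + (p + q)) r (take t w))
          = (?P (tensor_pure B.T B.T
          (word_degree (take r w) + p, F (word_degree (take r w)) (word_elem VA (take r w)))
          (word_degree (drop r (take t w)) + q, G (word_degree (drop r (take t w))) (word_elem VA (drop r (take t w))))))
            [^]\<^bsub>B.TT m\<^esub> sgn_pow (q * word_degree (take r w))"
          unfolding tt by (rule hom_int_pow[OF Phom aux(1)[OF rt] J.is_group K.is_group])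
        also have "\<dots> = c r t"
          unfolding K.int_pow_sgn_pow[OF aux(3)[OF rt]] c_def add.commute[of "h * word_degree (take t w)"] ..
        finally show "?P (AB.cut_map p q F G (?i + (p + q)) r (take t w)) = c r t" .
      qed
      also have "\<dots> = finprod (B.TT m) (\<lambda>r. if r < t then c r t else \<one>\<^bsub>B.TT m\<^esub>) {1..<L}"
        by (rule K.finprod_mono_neutral_cong_left) (use t c_closed in auto)
      finally show "finprod (B.TT m) (\<lambda>r. if r < t then c r t else \<one>\<^bsub>B.TT m\<^esub>) {1..<L} = AB.cut_map (p + q) h ?FG H m t w"
        by (rule sym)
    qed
    also have "\<dots> = ?r (word_elem VA w)"
      unfolding AB.tensor_map_deconcat_word[OF FG H w m'] L_def ..
    finally show "?l (word_elem VA w) = ?r (word_elem VA w)" .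
  qed
qed

end


section \<open>Chains on the simplices\<close>

text \<open>The Alexander--Whitney coproduct as a formal sum of pairs of faces.\<close>

definition aw_chain :: "nat set \<Rightarrow> (nat set \<times> nat set \<Rightarrow>\<^sub>0 int)" where
  "aw_chain I = (\<Sum>v\<in>I. frag_of ({u \<in> I. u \<le> v}, {u \<in> I. v \<le> u}))"

definition push_face :: "(nat \<Rightarrow> nat) \<Rightarrow> nat set \<Rightarrow> (nat set \<Rightarrow>\<^sub>0 int)" where
  "push_face \<theta> I = (if inj_on \<theta> I then frag_of (\<theta> ` I) else 0)"

definition vertex_sign :: "nat \<Rightarrow> nat set \<Rightarrow> int" where
  "vertex_sign v I = (-1) ^ card {u \<in> I. u < v}"

text \<open>Sending the empty set to zero turns the boundary into one sum over all vertices that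
  also covers the boundary of a point.\<close>

definition nonempty_face :: "nat set \<Rightarrow> (nat set \<Rightarrow>\<^sub>0 int)" where
  "nonempty_face J = (if J = {} then 0 else frag_of J)"

lemma face_boundary_sum:
  assumes "finite I"
  shows "face_boundary I = (\<Sum>v\<in>I. frag_cmul (vertex_sign v I) (nonempty_face (I - {v})))"
proof (cases "card I = 1")
  case True
  then obtain v where "I = {v}" by (auto simp: card_1_singleton_iff)
  then show ?thesis by (simp add: face_boundary_def nonempty_face_def)
next
  case False
  have "I - {v} \<noteq> {}" if "v \<in> I" for v
    using False that by (metis card.empty card.insert finite.emptyI insert_Diff insert_absorb One_nat_def empty_iff)
  then show ?thesis using False
    by (auto simp: face_boundary_def nonempty_face_def vertex_sign_def intro!: sum.cong)
qed

lemma frag_extend_face_boundary: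
  assumes "finite I"
  shows "frag_extend f (face_boundary I)
    = (\<Sum>v\<in>I. frag_cmul (vertex_sign v I) (if I - {v} = {} then 0 else f (I - {v})))"
  unfolding face_boundary_sum[OF assms] frag_extend_sum[OF assms]
  by (intro sum.cong) (auto simp: frag_extend_cmul nonempty_face_def)

lemma frag_extend_aw_chain:
  "finite I \<Longrightarrow> frag_extend f (aw_chain I) = (\<Sum>v\<in>I. f ({u \<in> I. u \<le> v}, {u \<in> I. v \<le> u}))"
  by (simp add: aw_chain_def frag_extend_sum)

lemma vertex_sign_swap:
  assumes I: "finite I" and uv: "u \<in> I" "v \<in> I" "u \<noteq> v"
  shows "vertex_sign v I * vertex_sign u (I - {v}) = - (vertex_sign u I * vertex_sign v (I - {u}))"
proof -
  have *: "vertex_sign v I * vertex_sign u (I - {v}) = - (vertex_sign u I * vertex_sign v (I - {u}))"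
    if "u < v" "u \<in> I" for u v
  proof -
    have "{x \<in> I - {v}. x < u} = {x \<in> I. x < u}" using that by auto
    moreover have "{x \<in> I. x < v} = insert u {x \<in> I - {u}. x < v}" using that by auto
    moreover have "card (insert u {x \<in> I - {u}. x < v}) = Suc (card {x \<in> I - {u}. x < v})"
      using I by (intro card_insert_disjoint) auto
    ultimately show ?thesis by (simp add: vertex_sign_def)
  qed
  show ?thesis using *[of u v] *[of v u] uv by (cases "u < v") auto
qed

lemma frag_eq_minus_self:
  fixes x :: "'s \<Rightarrow>\<^sub>0 int"
  assumes "x = - x" shows "x = 0"
proof (rule poly_mapping_eqI)
  fix s
  have "Poly_Mapping.lookup x s = Poly_Mapping.lookup (- x) s" using assms by simp
  then show "Poly_Mapping.lookup x s = Poly_Mapping.lookup 0 s" by simp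
qed

text \<open>Exchanging the two removed vertices changes the sign of each term, so that the double boundary is
  its own negative. A free abelian group has no elements of order two.\<close>

lemma face_boundary_boundary:
  assumes I: "finite I"
  shows "frag_extend face_boundary (face_boundary I) = 0"
proof (rule frag_eq_minus_self)
  define g where "g v u = frag_cmul (vertex_sign v I * vertex_sign u (I - {v})) (nonempty_face (I - {v} - {u}))" for v u
  have "frag_extend face_boundary (face_boundary I) = (\<Sum>v\<in>I. \<Sum>u\<in>I - {v}. g v u)"
    unfolding frag_extend_face_boundary[OF I]
  proof (rule sum.cong[OF refl])
    fix v assume "v \<in> I"
    show "frag_cmul (vertex_sign v I) (if I - {v} = {} then 0 else face_boundary (I - {v})) = (\<Sum>u\<in>I - {v}. g v u)"
    proof (cases "I - {v} = {}")
      case True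
      then show ?thesis by (simp only: True sum.empty if_True frag_cmul_zero2)
    next
      case False
      then show ?thesis using I by (simp add: face_boundary_sum frag_cmul_sum g_def)
    qed
  qed
  also have "\<dots> = (\<Sum>(v, u)\<in>(SIGMA v:I. I - {v}). g v u)"
    using I by (simp add: sum.Sigma)
  finally have S: "frag_extend face_boundary (face_boundary I) = (\<Sum>(v, u)\<in>(SIGMA v:I. I - {v}). g v u)" .
  also have "\<dots> = (\<Sum>(v, u)\<in>(SIGMA v:I. I - {v}). g u v)"
    by (rule sum.reindex_bij_witness[of _ prod.swap prod.swap]) auto
  also have "\<dots> = (\<Sum>(v, u)\<in>(SIGMA v:I. I - {v}). - g v u)"
  proof (rule sum.cong[OF refl])
    fix x assume "x \<in> (SIGMA v:I. I - {v})"
    then obtain v u where x: "x = (v, u)" "v \<in> I" "u \<in> I" "u \<noteq> v" by auto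
    have "I - {v} - {u} = I - {u} - {v}" by auto
    then have "g u v = - g v u"
      using vertex_sign_swap[OF I x(2,3) x(4)[symmetric]] by (simp add: g_def)
    then show "(case x of (v, u) \<Rightarrow> g u v) = (case x of (v, u) \<Rightarrow> - g v u)" using x by simp
  qed
  also have "\<dots> = - (\<Sum>(v, u)\<in>(SIGMA v:I. I - {v}). g v u)"
    by (simp add: sum_negf case_prod_beta)
  finally show "frag_extend face_boundary (face_boundary I) = - frag_extend face_boundary (face_boundary I)"
    using S by simp
qed

text \<open>The Alexander--Whitney coproduct is a chain map. The terms in which the removed vertex is the
  cutting vertex cancel in pairs: cutting after \<open>u\<close> is the same as cutting before its successor.\<close>

lemma aw_cut_vertex_cancel:
  assumes I: "finite I"
  shows "(\<Sum>u\<in>I. frag_cmul (vertex_sign u I) (if {x \<in> I. x < u} = {} then 0 else frag_of ({x \<in> I. x < u}, {x \<in> I. u \<le> x})))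
       + (\<Sum>u\<in>I. frag_cmul (vertex_sign u I) (if {x \<in> I. u < x} = {} then 0 else frag_of ({x \<in> I. x \<le> u}, {x \<in> I. u < x}))) = 0"
proof -
  let ?A = "{u \<in> I. {x \<in> I. x < u} \<noteq> {}}" and ?B = "{u \<in> I. {x \<in> I. u < x} \<noteq> {}}"
  let ?f = "\<lambda>u. frag_cmul (vertex_sign u I) (frag_of ({x \<in> I. x < u}, {x \<in> I. u \<le> x}))"
  let ?g = "\<lambda>u. frag_cmul (vertex_sign u I) (frag_of ({x \<in> I. x \<le> u}, {x \<in> I. u < x}))"
  let ?s = "\<lambda>u. Min {x \<in> I. u < x}" and ?p = "\<lambda>u. Max {x \<in> I. x < u}"
  have p: "?p u \<in> I" "?p u < u" "\<And>x. x \<in> I \<Longrightarrow> x < u \<Longrightarrow> x \<le> ?p u" if "u \<in> ?A" for u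
  proof -
    have f: "finite {x \<in> I. x < u}" using I by simp
    have "?p u \<in> {x \<in> I. x < u}" by (rule Max_in[OF f]) (use that in blast)
    then show "?p u \<in> I" "?p u < u" by blast+
    show "x \<le> ?p u" if "x \<in> I" "x < u" for x by (rule Max_ge[OF f]) (use that in blast)
  qed
  have s: "?s u \<in> I" "u < ?s u" "\<And>x. x \<in> I \<Longrightarrow> u < x \<Longrightarrow> ?s u \<le> x" if "u \<in> ?B" for u
  proof -
    have f: "finite {x \<in> I. u < x}" using I by simp
    have "?s u \<in> {x \<in> I. u < x}" by (rule Min_in[OF f]) (use that in blast)
    then show "?s u \<in> I" "u < ?s u" by blast+
    show "?s u \<le> x" if "x \<in> I" "u < x" for x by (rule Min_le[OF f]) (use that in blast)
  qed
  have 1: "sum ?f ?A = (\<Sum>u\<in>?B. - ?g u)"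
  proof (rule sum.reindex_bij_witness[of _ ?s ?p])
    fix u assume u: "u \<in> ?A"
    show pB: "?p u \<in> ?B" using p(1,2)[OF u] u by blast
    have "u \<le> ?s (?p u)"
    proof (rule ccontr)
      assume "\<not> u \<le> ?s (?p u)"
      then have "?s (?p u) \<le> ?p u" by (intro p(3)[OF u s(1)[OF pB]]) (simp only: not_le)
      with s(2)[OF pB] show False by (simp only: not_le[symmetric])
    qed
    moreover have "?s (?p u) \<le> u" using s(3)[OF pB _ p(2)[OF u]] u by blast
    ultimately show "?s (?p u) = u" by simp
    define q where "q = ?p u"
    have q: "q \<in> I" "q < u" "\<And>x. x \<in> I \<Longrightarrow> x < u \<Longrightarrow> x \<le> q"
      unfolding q_def by (rule p[OF u])+
    have lt: "x < u \<longleftrightarrow> x \<le> q" if "x \<in> I" for x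
      by (rule iffI[OF q(3)[OF that] le_less_trans[OF _ q(2)]])
    have e1: "{x \<in> I. x < u} = {x \<in> I. x \<le> q}" using lt by blast
    have e2: "{x \<in> I. u \<le> x} = {x \<in> I. q < x}" unfolding not_less[symmetric] using lt by (auto simp: not_le)
    have "{x \<in> I. x \<le> q} = insert q {x \<in> I. x < q}" using q(1) by auto
    then have "card {x \<in> I. x \<le> q} = Suc (card {x \<in> I. x < q})" using I by simp
    then have "vertex_sign u I = - vertex_sign q I" by (simp add: vertex_sign_def e1)
    then have "- ?g q = ?f u" unfolding e1 e2 by simp
    then show "- ?g (?p u) = ?f u" unfolding q_def .
  next
    fix u assume u: "u \<in> ?B"
    show sA: "?s u \<in> ?A" using s(1,2)[OF u] u by blast
    have "u \<le> ?p (?s u)" using p(3)[OF sA _ s(2)[OF u]] u by blast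
    moreover have "?p (?s u) \<le> u"
    proof (rule ccontr)
      assume "\<not> ?p (?s u) \<le> u"
      then have "?s u \<le> ?p (?s u)" by (intro s(3)[OF u p(1)[OF sA]]) (simp only: not_le)
      with p(2)[OF sA] show False by (simp only: not_le[symmetric])
    qed
    ultimately show "?p (?s u) = u" by simp
  qed
  have 2: "(\<Sum>u\<in>I. frag_cmul (vertex_sign u I) (if {x \<in> I. x < u} = {} then 0 else frag_of ({x \<in> I. x < u}, {x \<in> I. u \<le> x}))) = sum ?f ?A"
    using I by (intro sum.mono_neutral_cong_right) auto
  have 3: "(\<Sum>u\<in>I. frag_cmul (vertex_sign u I) (if {x \<in> I. u < x} = {} then 0 else frag_of ({x \<in> I. x \<le> u}, {x \<in> I. u < x}))) = sum ?g ?B"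
    using I by (intro sum.mono_neutral_cong_right) auto
  show ?thesis unfolding 2 3 1 sum_negf by (rule ab_left_minus)
qed

lemma face_degree_sign:
  assumes "finite I" "u \<in> I"
  shows "sgn_pow (face_degree {x \<in> I. x \<le> u}) = vertex_sign u I"
proof -
  have "{x \<in> I. x \<le> u} = insert u {x \<in> I. x < u}" using assms(2) by auto
  then have "card {x \<in> I. x \<le> u} = Suc (card {x \<in> I. x < u})" using assms(1) by simp
  then show ?thesis by (simp add: sgn_pow_def face_degree_def vertex_sign_def)
qed

lemma aw_chain_boundary:
  assumes I: "finite I"
  shows "frag_extend aw_chain (face_boundary I)
    = frag_extend (\<lambda>(J, K). frag_extend (\<lambda>J'. frag_of (J', K)) (face_boundary J)
        + frag_cmul (sgn_pow (face_degree J)) (frag_extend (\<lambda>K'. frag_of (J, K')) (face_boundary K))) (aw_chain I)"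
proof -
  let ?L = "\<lambda>u. {x \<in> I. x \<le> u}" and ?R = "\<lambda>u. {x \<in> I. u \<le> x}"
  have fin: "finite (?L u)" "finite (?R u)" for u using I by auto
  let ?z = "\<lambda>J f. if J = {} then 0 else (f :: nat set \<times> nat set \<Rightarrow>\<^sub>0 int)"
  let ?l = "\<lambda>u v. frag_cmul (vertex_sign v (?L u)) (?z (?L u - {v}) (frag_of (?L u - {v}, ?R u)))"
  let ?r = "\<lambda>u v. frag_cmul (vertex_sign u I * vertex_sign v (?R u)) (?z (?R u - {v}) (frag_of (?L u, ?R u - {v})))"
  have left: "(\<Sum>v\<in>?L u. ?l u v) = ?l u u + (\<Sum>v\<in>{x \<in> I. x < u}. frag_cmul (vertex_sign v I) (frag_of (?L u - {v}, ?R u)))"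
    if u: "u \<in> I" for u
  proof -
    have "(\<Sum>v\<in>?L u. ?l u v) = ?l u u + (\<Sum>v\<in>?L u - {u}. ?l u v)"
      using u fin by (intro sum.remove) auto
    moreover have "(\<Sum>v\<in>?L u - {u}. ?l u v) = (\<Sum>v\<in>{x \<in> I. x < u}. frag_cmul (vertex_sign v I) (frag_of (?L u - {v}, ?R u)))"
    proof (rule sum.cong)
      show "?L u - {u} = {x \<in> I. x < u}" by auto
      fix v assume v: "v \<in> {x \<in> I. x < u}"
      then have "{x \<in> ?L u. x < v} = {x \<in> I. x < v}" by auto
      moreover have "?L u - {v} \<noteq> {}" using u v by auto
      ultimately show "?l u v = frag_cmul (vertex_sign v I) (frag_of (?L u - {v}, ?R u))"
        by (simp add: vertex_sign_def)
    qed
    ultimately show ?thesis by simp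
  qed
  have right: "(\<Sum>v\<in>?R u. ?r u v) = ?r u u + (\<Sum>v\<in>{x \<in> I. u < x}. frag_cmul (vertex_sign v I) (frag_of (?L u, ?R u - {v})))"
    if u: "u \<in> I" for u
  proof -
    have "(\<Sum>v\<in>?R u. ?r u v) = ?r u u + (\<Sum>v\<in>?R u - {u}. ?r u v)"
      using u fin by (intro sum.remove) auto
    moreover have "(\<Sum>v\<in>?R u - {u}. ?r u v) = (\<Sum>v\<in>{x \<in> I. u < x}. frag_cmul (vertex_sign v I) (frag_of (?L u, ?R u - {v})))"
    proof (rule sum.cong)
      show "?R u - {u} = {x \<in> I. u < x}" by auto
      fix v assume v: "v \<in> {x \<in> I. u < x}"
      then have "{x \<in> I. x < v} = {x \<in> I. x < u} \<union> {x \<in> ?R u. x < v}" by auto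
      then have "card {x \<in> I. x < v} = card {x \<in> I. x < u} + card {x \<in> ?R u. x < v}"
        using I by (simp add: card_Un_disjoint disjoint_iff)
      then have "vertex_sign v I = vertex_sign u I * vertex_sign v (?R u)"
        by (simp add: vertex_sign_def power_add)
      moreover have "?R u - {v} \<noteq> {}" using u v by auto
      ultimately show "?r u v = frag_cmul (vertex_sign v I) (frag_of (?L u, ?R u - {v}))"
        by simp
    qed
    ultimately show ?thesis by simp
  qed
  have diag: "(\<Sum>u\<in>I. ?l u u) + (\<Sum>u\<in>I. ?r u u) = 0"
  proof -
    have "(\<Sum>u\<in>I. ?l u u) = (\<Sum>u\<in>I. frag_cmul (vertex_sign u I) (if {x \<in> I. x < u} = {} then 0 else frag_of ({x \<in> I. x < u}, {x \<in> I. u \<le> x})))"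
    proof (rule sum.cong[OF refl])
      fix u assume "u \<in> I"
      have "?L u - {u} = {x \<in> I. x < u}" "{x \<in> ?L u. x < u} = {x \<in> I. x < u}" by auto
      then show "?l u u = frag_cmul (vertex_sign u I) (if {x \<in> I. x < u} = {} then 0 else frag_of ({x \<in> I. x < u}, {x \<in> I. u \<le> x}))"
        by (simp only: vertex_sign_def)
    qed
    moreover have "(\<Sum>u\<in>I. ?r u u) = (\<Sum>u\<in>I. frag_cmul (vertex_sign u I) (if {x \<in> I. u < x} = {} then 0 else frag_of ({x \<in> I. x \<le> u}, {x \<in> I. u < x})))"
    proof (rule sum.cong[OF refl])
      fix u assume "u \<in> I"
      have "?R u - {u} = {x \<in> I. u < x}" "{x \<in> ?R u. x < u} = {}" by auto
      then show "?r u u = frag_cmul (vertex_sign u I) (if {x \<in> I. u < x} = {} then 0 else frag_of ({x \<in> I. x \<le> u}, {x \<in> I. u < x}))"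
        by (simp only: vertex_sign_def[of u "?R u"] card.empty power_0 mult_1_right)
    qed
    ultimately show ?thesis using aw_cut_vertex_cancel[OF I] by simp
  qed
  let ?m = "\<lambda>v u. frag_cmul (vertex_sign v I) (frag_of ({x \<in> I - {v}. x \<le> u}, {x \<in> I - {v}. u \<le> x}))"
  have "frag_extend aw_chain (face_boundary I) = (\<Sum>v\<in>I. \<Sum>u\<in>I - {v}. ?m v u)"
    unfolding frag_extend_face_boundary[OF I]
  proof (rule sum.cong[OF refl])
    fix v assume "v \<in> I"
    show "frag_cmul (vertex_sign v I) (if I - {v} = {} then 0 else aw_chain (I - {v})) = (\<Sum>u\<in>I - {v}. ?m v u)"
    proof (cases "I - {v} = {}")
      case True
      then show ?thesis by (simp only: True sum.empty if_True frag_cmul_zero2)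
    next
      case False
      then show ?thesis by (simp only: aw_chain_def frag_cmul_sum if_False)
    qed
  qed
  also have "\<dots> = (\<Sum>(v, u)\<in>(SIGMA v:I. I - {v}). ?m v u)"
    using I by (simp add: sum.Sigma)
  also have "\<dots> = (\<Sum>(u, v)\<in>(SIGMA u:I. I - {u}). ?m v u)"
    by (rule sum.reindex_bij_witness[of _ prod.swap prod.swap]) auto
  also have "\<dots> = (\<Sum>u\<in>I. \<Sum>v\<in>I - {u}. ?m v u)"
    using I by (simp add: sum.Sigma)
  also have "\<dots> = (\<Sum>u\<in>I. (\<Sum>v\<in>{x \<in> I. x < u}. frag_cmul (vertex_sign v I) (frag_of (?L u - {v}, ?R u)))
      + (\<Sum>v\<in>{x \<in> I. u < x}. frag_cmul (vertex_sign v I) (frag_of (?L u, ?R u - {v}))))"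
  proof (rule sum.cong[OF refl])
    fix u assume "u \<in> I"
    have "I - {u} = {x \<in> I. x < u} \<union> {x \<in> I. u < x}" by auto
    then have "(\<Sum>v\<in>I - {u}. ?m v u) = (\<Sum>v\<in>{x \<in> I. x < u}. ?m v u) + (\<Sum>v\<in>{x \<in> I. u < x}. ?m v u)"
      using I by (simp add: sum.union_disjoint disjoint_iff)
    moreover have "{x \<in> I - {v}. x \<le> u} = ?L u - {v}" "{x \<in> I - {v}. u \<le> x} = ?R u - {v}" for v by auto
    moreover have "?R u - {v} = ?R u" if "v < u" for v using that by auto
    moreover have "?L u - {v} = ?L u" if "u < v" for v using that by auto
    ultimately show "(\<Sum>v\<in>I - {u}. ?m v u) = (\<Sum>v\<in>{x \<in> I. x < u}. frag_cmul (vertex_sign v I) (frag_of (?L u - {v}, ?R u)))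
      + (\<Sum>v\<in>{x \<in> I. u < x}. frag_cmul (vertex_sign v I) (frag_of (?L u, ?R u - {v})))"
      by simp
  qed
  also have "\<dots> = (\<Sum>u\<in>I. (\<Sum>v\<in>?L u. ?l u v) + (\<Sum>v\<in>?R u. ?r u v))"
  proof -
    have "(\<Sum>u\<in>I. (\<Sum>v\<in>?L u. ?l u v) + (\<Sum>v\<in>?R u. ?r u v))
      = (\<Sum>u\<in>I. (?l u u + ?r u u) + ((\<Sum>v\<in>{x \<in> I. x < u}. frag_cmul (vertex_sign v I) (frag_of (?L u - {v}, ?R u)))
      + (\<Sum>v\<in>{x \<in> I. u < x}. frag_cmul (vertex_sign v I) (frag_of (?L u, ?R u - {v})))))"
      by (rule sum.cong[OF refl]) (simp only: left right add.assoc add.left_commute add.commute)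
    then show ?thesis using diag by (simp only: sum.distrib add_0_left)
  qed
  also have "\<dots> = (\<Sum>u\<in>I. frag_extend (\<lambda>J'. frag_of (J', ?R u)) (face_boundary (?L u))
        + frag_cmul (sgn_pow (face_degree (?L u))) (frag_extend (\<lambda>K'. frag_of (?L u, K')) (face_boundary (?R u))))"
    by (rule sum.cong[OF refl])
       (simp only: frag_extend_face_boundary[OF fin(1)] frag_extend_face_boundary[OF fin(2)]
          face_degree_sign[OF I] frag_cmul_sum frag_cmul_cmul)
  finally show ?thesis unfolding frag_extend_aw_chain[OF I] prod.case .
qed

lemma mono_inj_le_iff:
  fixes \<theta> :: "nat \<Rightarrow> nat"
  assumes m: "mono_on S \<theta>" and IS: "I \<subseteq> S" and i: "inj_on \<theta> I" and u: "u \<in> I" and v: "v \<in> I"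
  shows "\<theta> u \<le> \<theta> v \<longleftrightarrow> u \<le> v"
  using mono_onD[OF m, of u v] mono_onD[OF m, of v u] inj_onD[OF i, of u v] u v IS
  by (metis nle_le subset_eq)

lemma mono_inj_less_iff:
  fixes \<theta> :: "nat \<Rightarrow> nat"
  assumes m: "mono_on S \<theta>" and IS: "I \<subseteq> S" and i: "inj_on \<theta> I" and u: "u \<in> I" and v: "v \<in> I"
  shows "\<theta> u < \<theta> v \<longleftrightarrow> u < v"
  using mono_inj_le_iff[OF m IS i v u] by (simp add: not_le[symmetric])

lemma not_inj_on_pair:
  fixes I :: "nat set"
  assumes "\<not> inj_on \<theta> I" obtains a b where "a \<in> I" "b \<in> I" "a < b" "\<theta> a = \<theta> b"
proof -
  obtain x y where "x \<in> I" "y \<in> I" "x \<noteq> y" "\<theta> x = \<theta> y" using assms unfolding inj_on_def by blast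
  then show ?thesis using that[of x y] that[of y x] by (cases "x < y") auto
qed

lemma image_remove_identified:
  assumes "c \<in> I" "d \<in> I" "c \<noteq> d" "\<theta> c = \<theta> d" shows "\<theta> ` (I - {c}) = \<theta> ` I"
proof -
  have "\<theta> c \<in> \<theta> ` (I - {c})" by (rule image_eqI[of _ _ d]) (use assms in auto)
  moreover have "\<theta> ` I = insert (\<theta> c) (\<theta> ` (I - {c}))"
    using assms(1) by (metis image_insert insert_Diff)
  ultimately show ?thesis by auto
qed

text \<open>Two identified vertices contribute faces with equal image and, if that image is not itself
  degenerate, of opposite sign.\<close>

lemma push_face_boundary:
  assumes I: "finite I" and m: "mono_on S \<theta>" and IS: "I \<subseteq> S"
  shows "frag_extend face_boundary (push_face \<theta> I) = frag_extend (push_face \<theta>) (face_boundary I)"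
proof (cases "inj_on \<theta> I")
  case True
  have "face_boundary (\<theta> ` I) = (\<Sum>v\<in>I. frag_cmul (vertex_sign (\<theta> v) (\<theta> ` I)) (nonempty_face (\<theta> ` I - {\<theta> v})))"
    using I True by (simp add: face_boundary_sum sum.reindex)
  also have "\<dots> = (\<Sum>v\<in>I. frag_cmul (vertex_sign v I) (if I - {v} = {} then 0 else push_face \<theta> (I - {v})))"
  proof (rule sum.cong[OF refl])
    fix v assume v: "v \<in> I"
    have "{w \<in> \<theta> ` I. w < \<theta> v} = \<theta> ` {u \<in> I. u < v}"
      using mono_inj_less_iff[OF m IS True _ v] by auto
    then have "vertex_sign (\<theta> v) (\<theta> ` I) = vertex_sign v I"
      using True by (simp add: vertex_sign_def card_image[OF inj_on_subset[OF True]])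
    moreover have "\<theta> ` I - {\<theta> v} = \<theta> ` (I - {v})" using True v by (auto simp: inj_on_def)
    moreover have "inj_on \<theta> (I - {v})" using True by (auto simp: inj_on_def)
    ultimately show "frag_cmul (vertex_sign (\<theta> v) (\<theta> ` I)) (nonempty_face (\<theta> ` I - {\<theta> v}))
      = frag_cmul (vertex_sign v I) (if I - {v} = {} then 0 else push_face \<theta> (I - {v}))"
      by (simp add: nonempty_face_def push_face_def)
  qed
  finally show ?thesis using True by (simp add: frag_extend_face_boundary[OF I] push_face_def)
next
  case False
  then obtain a b where ab: "a \<in> I" "b \<in> I" "a < b" "\<theta> a = \<theta> b"
    by (rule not_inj_on_pair)
  let ?h = "\<lambda>v. frag_cmul (vertex_sign v I) (push_face \<theta> (I - {v}))"
  have "frag_extend (push_face \<theta>) (face_boundary I) = (\<Sum>v\<in>I. ?h v)"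
    unfolding frag_extend_face_boundary[OF I]
    by (rule sum.cong[OF refl]) (use ab in auto)
  also have "\<dots> = (\<Sum>v\<in>{a, b}. ?h v)"
    by (rule sum.mono_neutral_right) (use I ab in \<open>auto simp: push_face_def inj_on_def\<close>)
  also have "\<dots> = ?h a + ?h b" using ab by simp
  also have "\<dots> = 0"
  proof -
    have img: "\<theta> ` (I - {a}) = \<theta> ` (I - {b})"
      using image_remove_identified[of a I b \<theta>] image_remove_identified[of b I a \<theta>] ab by simp
    moreover have "card (I - {a}) = card (I - {b})" using ab I by simp
    ultimately have ia: "inj_on \<theta> (I - {a}) \<longleftrightarrow> inj_on \<theta> (I - {b})"
      using I by (simp add: inj_on_iff_eq_card)
    show ?thesis
    proof (cases "inj_on \<theta> (I - {a})")
      case True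
      have "\<not> (a < c \<and> c < b)" if "c \<in> I" for c
      proof
        assume c: "a < c \<and> c < b"
        have S: "a \<in> S" "b \<in> S" "c \<in> S" using that ab IS by auto
        have "\<theta> c = \<theta> b"
          using mono_onD[OF m S(1,3)] mono_onD[OF m S(3,2)] c ab(4) by auto
        then show False using inj_onD[OF True, of c b] c that ab by auto
      qed
      then have "{u \<in> I. u < b} = insert a {u \<in> I. u < a}" using ab by force
      then have "vertex_sign b I = - vertex_sign a I" using I by (simp add: vertex_sign_def)
      then show ?thesis using True ia img by (simp add: push_face_def frag_cmul_distrib[symmetric])
    qed (use ia in \<open>simp add: push_face_def\<close>)
  qed
  finally show ?thesis using False by (simp add: push_face_def)
qed

text \<open>If \<open>\<theta>\<close> identifies two vertices of \<open>I\<close>, then for every cutting vertex one of the two pieces contains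
  two identified vertices.\<close>

lemma push_face_aw:
  assumes I: "finite I" and m: "mono_on S \<theta>" and IS: "I \<subseteq> S"
  shows "frag_extend aw_chain (push_face \<theta> I)
    = frag_extend (\<lambda>(J, K). if inj_on \<theta> J \<and> inj_on \<theta> K then frag_of (\<theta> ` J, \<theta> ` K) else 0) (aw_chain I)"
proof (cases "inj_on \<theta> I")
  case True
  have "aw_chain (\<theta> ` I) = (\<Sum>v\<in>I. frag_of ({w \<in> \<theta> ` I. w \<le> \<theta> v}, {w \<in> \<theta> ` I. \<theta> v \<le> w}))"
    using I True by (simp add: aw_chain_def sum.reindex)
  also have "\<dots> = (\<Sum>v\<in>I. frag_of (\<theta> ` {u \<in> I. u \<le> v}, \<theta> ` {u \<in> I. v \<le> u}))"
  proof (rule sum.cong[OF refl])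
    fix v assume v: "v \<in> I"
    have "{w \<in> \<theta> ` I. w \<le> \<theta> v} = \<theta> ` {u \<in> I. u \<le> v}" "{w \<in> \<theta> ` I. \<theta> v \<le> w} = \<theta> ` {u \<in> I. v \<le> u}"
      using mono_inj_le_iff[OF m IS True _ v] mono_inj_le_iff[OF m IS True v] by auto
    then show "frag_of ({w \<in> \<theta> ` I. w \<le> \<theta> v}, {w \<in> \<theta> ` I. \<theta> v \<le> w})
      = frag_of (\<theta> ` {u \<in> I. u \<le> v}, \<theta> ` {u \<in> I. v \<le> u})" by simp
  qed
  finally show ?thesis
    unfolding frag_extend_aw_chain[OF I]
    using True inj_on_subset[OF True] by (simp add: push_face_def)
next
  case False
  then obtain a b where ab: "a \<in> I" "b \<in> I" "a < b" "\<theta> a = \<theta> b"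
    by (rule not_inj_on_pair)
  have "\<not> (inj_on \<theta> {u \<in> I. u \<le> v} \<and> inj_on \<theta> {u \<in> I. v \<le> u})" if "v \<in> I" for v
  proof
    assume i: "inj_on \<theta> {u \<in> I. u \<le> v} \<and> inj_on \<theta> {u \<in> I. v \<le> u}"
    consider "v \<le> a" | "b \<le> v" | "a < v" "v < b" by linarith
    then show False
    proof cases
      case 1 then show False using inj_onD[OF conjunct2[OF i] ab(4)] ab by auto
    next
      case 2 then show False using inj_onD[OF conjunct1[OF i] ab(4)] ab by auto
    next
      case 3
      have S: "a \<in> S" "b \<in> S" "v \<in> S" using that ab IS by auto
      have "\<theta> a = \<theta> v"
        using mono_onD[OF m S(1,3)] mono_onD[OF m S(3,2)] 3 ab(4) by auto
      then show False using inj_onD[OF conjunct1[OF i], of a v] 3 ab that by auto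
    qed
  qed
  then have "(\<Sum>v\<in>I. if inj_on \<theta> {u \<in> I. u \<le> v} \<and> inj_on \<theta> {u \<in> I. v \<le> u}
      then frag_of (\<theta> ` {u \<in> I. u \<le> v}, \<theta> ` {u \<in> I. v \<le> u}) else 0) = (0 :: nat set \<times> nat set \<Rightarrow>\<^sub>0 int)"
    by (intro sum.neutral ballI) (simp del: de_Morgan_conj)
  then show ?thesis
    unfolding frag_extend_aw_chain[OF I] prod.case using False by (simp add: push_face_def)
qed


section \<open>The coproduct of a tensor product of coalgebras\<close>

lemma free_hom_eq:
  assumes H: "comm_group H" and f: "f \<in> hom (free_Abelian_group S) H" and g: "g \<in> hom (free_Abelian_group S) H"
    and eq: "\<And>s. s \<in> S \<Longrightarrow> f (frag_of s) = g (frag_of s)" and a: "Poly_Mapping.keys a \<subseteq> S"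
  shows "f a = g a"
proof -
  interpret H: comm_group H by fact
  interpret f: group_hom "free_Abelian_group S" H f
    by (intro group_hom.intro group_hom_axioms.intro group_free_Abelian_group H.is_group f)
  interpret g: group_hom "free_Abelian_group S" H g
    by (intro group_hom.intro group_hom_axioms.intro group_free_Abelian_group H.is_group g)
  have d: "h (x - y) = h x \<otimes>\<^bsub>H\<^esub> inv\<^bsub>H\<^esub> h y"
    if "group_hom (free_Abelian_group S) H h" "Poly_Mapping.keys x \<subseteq> S" "Poly_Mapping.keys y \<subseteq> S" for h x y
  proof -
    interpret h: group_hom "free_Abelian_group S" H h by fact
    have "h (x + - y) = h x \<otimes>\<^bsub>H\<^esub> h (- y)" using h.hom_mult[of x "- y"] that by simp
    moreover have "h (- y) = inv\<^bsub>H\<^esub> h y" using h.hom_inv[of y] that by simp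
    ultimately show ?thesis by simp
  qed
  show ?thesis using a
  proof (rule free_Abelian_group_induct)
    show "f 0 = g 0" using f.hom_one g.hom_one by simp
    show "f (x - y) = g (x - y)" if "Poly_Mapping.keys x \<subseteq> S" "Poly_Mapping.keys y \<subseteq> S" "f x = g x" "f y = g y" for x y
      using that by (simp add: d[OF f.group_hom_axioms] d[OF g.group_hom_axioms])
  qed (rule eq)
qed

text \<open>The signed exchange of the two middle factors of \<open>M \<otimes> M \<otimes> N \<otimes> N\<close>, as a map of two variables, the
  first two factors and the last two factors. With coproducts inserted it is the coproduct of a tensor
  product of coalgebras.\<close>

definition exchange_pure where
  "exchange_pure M N n u v = lift (tensor (tensor M N) (tensor M N) n) (\<lambda>((j1, y1), (j2, y2)).
      tensor_pure (tensor M N) (tensor M N) (fst u + j1, tensor_pure M N u (j1, y1)) (fst v + j2, tensor_pure M N v (j2, y2))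
        [^]\<^bsub>tensor (tensor M N) (tensor M N) n\<^esub> sgn_pow (fst v * j1))"

definition exchange where
  "exchange M N n s t = lift (tensor (tensor M N) (tensor M N) n) (\<lambda>(u, v). exchange_pure M N n u v t) s"

locale exchange_pair = graded_pair M N for M :: "'a grmod" and N :: "'b grmod"
begin

sublocale MM: graded_pair M M by unfold_locales (rule M)+
sublocale NN: graded_pair N N by unfold_locales (rule N)+

abbreviation "MN \<equiv> tensor M N"

sublocale Q: graded_pair MN MN by unfold_locales (rule graded_module_tensor)+

lemma exchange_pure_lift:
  assumes x: "x1 \<in> carrier (M i1)" "x2 \<in> carrier (M i2)" and n: "i1 + i2 + j = n"
  shows exchange_pure_hom: "exchange_pure M N n (i1, x1) (i2, x2) \<in> hom (tensor N N j) (tensor MN MN n)"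
    and exchange_pure_pure: "j1 + j2 = j \<Longrightarrow> y1 \<in> carrier (N j1) \<Longrightarrow> y2 \<in> carrier (N j2)
      \<Longrightarrow> exchange_pure M N n (i1, x1) (i2, x2) (tensor_pure N N (j1, y1) (j2, y2))
        = tensor_pure MN MN (i1 + j1, tensor_pure M N (i1, x1) (j1, y1)) (i2 + j2, tensor_pure M N (i2, x2) (j2, y2))
            [^]\<^bsub>tensor MN MN n\<^esub> sgn_pow (i2 * j1)"
proof -
  interpret K: comm_group "tensor MN MN n" by (rule Q.tensor_group)
  let ?b = "\<lambda>((j1, y1), (j2, y2)).
      tensor_pure MN MN (i1 + j1, tensor_pure M N (i1, x1) (j1, y1)) (i2 + j2, tensor_pure M N (i2, x2) (j2, y2))
        [^]\<^bsub>tensor MN MN n\<^esub> sgn_pow (i2 * j1)"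
  have l: "(\<lambda>y1. ?b ((j1, y1), (j2, y2))) \<in> hom (N j1) (tensor MN MN n)" if "j1 + j2 = j" "y2 \<in> carrier (N j2)" for j1 j2 y2
    unfolding prod.case
    by (rule hom_pow_pointwise[OF K.comm_group_axioms hom_comp[OF tensor_pure_hom_right[OF x(1) refl]
          Q.tensor_pure_hom_left[OF tensor_pure_closed[OF x(2) that(2) refl]]]]) (use n that in simp)
  have r: "(\<lambda>y2. ?b ((j1, y1), (j2, y2))) \<in> hom (N j2) (tensor MN MN n)" if "j1 + j2 = j" "y1 \<in> carrier (N j1)" for j1 j2 y1
    unfolding prod.case
    by (rule hom_pow_pointwise[OF K.comm_group_axioms hom_comp[OF tensor_pure_hom_right[OF x(2) refl]
          Q.tensor_pure_hom_right[OF tensor_pure_closed[OF x(1) that(2) refl]]]]) (use n that in simp)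
  show "exchange_pure M N n (i1, x1) (i2, x2) \<in> hom (tensor N N j) (tensor MN MN n)"
    unfolding exchange_pure_def fst_conv by (rule NN.tensor_lift_hom[OF K.comm_group_axioms l r])
  show "exchange_pure M N n (i1, x1) (i2, x2) (tensor_pure N N (j1, y1) (j2, y2))
        = tensor_pure MN MN (i1 + j1, tensor_pure M N (i1, x1) (j1, y1)) (i2 + j2, tensor_pure M N (i2, x2) (j2, y2))
            [^]\<^bsub>tensor MN MN n\<^esub> sgn_pow (i2 * j1)"
    if "j1 + j2 = j" "y1 \<in> carrier (N j1)" "y2 \<in> carrier (N j2)"
    unfolding exchange_pure_def fst_conv using NN.tensor_lift_pure[OF K.comm_group_axioms l r that] by simp
qed

lemma exchange_pure_hom_first:
  assumes x2: "x2 \<in> carrier (M i2)" and t: "t \<in> carrier (tensor N N j)" and n: "i1 + i2 + j = n"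
  shows "(\<lambda>x1. exchange_pure M N n (i1, x1) (i2, x2) t) \<in> hom (M i1) (tensor MN MN n)"
proof (rule homI)
  interpret K: comm_group "tensor MN MN n" by (rule Q.tensor_group)
  fix x assume x: "x \<in> carrier (M i1)"
  show "exchange_pure M N n (i1, x) (i2, x2) t \<in> carrier (tensor MN MN n)"
    using exchange_pure_hom[OF x x2 n] t by (auto simp: hom_def)
  fix x' assume x': "x' \<in> carrier (M i1)"
  have xx: "x \<otimes>\<^bsub>M i1\<^esub> x' \<in> carrier (M i1)" using M_mult_closed x x' by blast
  show "exchange_pure M N n (i1, x \<otimes>\<^bsub>M i1\<^esub> x') (i2, x2) t
    = exchange_pure M N n (i1, x) (i2, x2) t \<otimes>\<^bsub>tensor MN MN n\<^esub> exchange_pure M N n (i1, x') (i2, x2) t"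
  proof (rule NN.tensor_hom_eq[OF K.comm_group_axioms exchange_pure_hom[OF xx x2 n]
        hom_mult_pointwise[OF K.comm_group_axioms exchange_pure_hom[OF x x2 n] exchange_pure_hom[OF x' x2 n]] _ t])
    fix j1 y1 j2 y2 assume j: "j1 + j2 = j" and y: "y1 \<in> carrier (N j1)" "y2 \<in> carrier (N j2)"
    have nn: "n = (i1 + j1) + (i2 + j2)" using n j by simp
    note c2 = tensor_pure_closed[OF x2 y(2) refl]
    note c = Q.tensor_pure_closed[OF tensor_pure_closed[OF x y(1) refl] c2 nn]
      Q.tensor_pure_closed[OF tensor_pure_closed[OF x' y(1) refl] c2 nn]
    show "exchange_pure M N n (i1, x \<otimes>\<^bsub>M i1\<^esub> x') (i2, x2) (tensor_pure N N (j1, y1) (j2, y2))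
      = exchange_pure M N n (i1, x) (i2, x2) (tensor_pure N N (j1, y1) (j2, y2))
        \<otimes>\<^bsub>tensor MN MN n\<^esub> exchange_pure M N n (i1, x') (i2, x2) (tensor_pure N N (j1, y1) (j2, y2))"
      unfolding exchange_pure_pure[OF xx x2 n j y] exchange_pure_pure[OF x x2 n j y] exchange_pure_pure[OF x' x2 n j y]
        tensor_pure_mult_left[OF x x' y(1) refl]
        Q.tensor_pure_mult_left[OF tensor_pure_closed[OF x y(1) refl] tensor_pure_closed[OF x' y(1) refl] c2 nn]
      by (rule K.int_pow_distrib[OF c])
  qed
qed

lemma exchange_pure_hom_second:
  assumes x1: "x1 \<in> carrier (M i1)" and t: "t \<in> carrier (tensor N N j)" and n: "i1 + i2 + j = n"
  shows "(\<lambda>x2. exchange_pure M N n (i1, x1) (i2, x2) t) \<in> hom (M i2) (tensor MN MN n)"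
proof (rule homI)
  interpret K: comm_group "tensor MN MN n" by (rule Q.tensor_group)
  fix x assume x: "x \<in> carrier (M i2)"
  show "exchange_pure M N n (i1, x1) (i2, x) t \<in> carrier (tensor MN MN n)"
    using exchange_pure_hom[OF x1 x n] t by (auto simp: hom_def)
  fix x' assume x': "x' \<in> carrier (M i2)"
  have xx: "x \<otimes>\<^bsub>M i2\<^esub> x' \<in> carrier (M i2)" using M_mult_closed x x' by blast
  show "exchange_pure M N n (i1, x1) (i2, x \<otimes>\<^bsub>M i2\<^esub> x') t
    = exchange_pure M N n (i1, x1) (i2, x) t \<otimes>\<^bsub>tensor MN MN n\<^esub> exchange_pure M N n (i1, x1) (i2, x') t"
  proof (rule NN.tensor_hom_eq[OF K.comm_group_axioms exchange_pure_hom[OF x1 xx n]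
        hom_mult_pointwise[OF K.comm_group_axioms exchange_pure_hom[OF x1 x n] exchange_pure_hom[OF x1 x' n]] _ t])
    fix j1 y1 j2 y2 assume j: "j1 + j2 = j" and y: "y1 \<in> carrier (N j1)" "y2 \<in> carrier (N j2)"
    have nn: "n = (i1 + j1) + (i2 + j2)" using n j by simp
    note c1 = tensor_pure_closed[OF x1 y(1) refl]
    note c = Q.tensor_pure_closed[OF c1 tensor_pure_closed[OF x y(2) refl] nn]
      Q.tensor_pure_closed[OF c1 tensor_pure_closed[OF x' y(2) refl] nn]
    show "exchange_pure M N n (i1, x1) (i2, x \<otimes>\<^bsub>M i2\<^esub> x') (tensor_pure N N (j1, y1) (j2, y2))
      = exchange_pure M N n (i1, x1) (i2, x) (tensor_pure N N (j1, y1) (j2, y2))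
        \<otimes>\<^bsub>tensor MN MN n\<^esub> exchange_pure M N n (i1, x1) (i2, x') (tensor_pure N N (j1, y1) (j2, y2))"
      unfolding exchange_pure_pure[OF x1 xx n j y] exchange_pure_pure[OF x1 x n j y] exchange_pure_pure[OF x1 x' n j y]
        tensor_pure_mult_left[OF x x' y(2) refl]
        Q.tensor_pure_mult_right[OF c1 tensor_pure_closed[OF x y(2) refl] tensor_pure_closed[OF x' y(2) refl] nn]
      by (rule K.int_pow_distrib[OF c])
  qed
qed

lemma exchange_lift:
  assumes t: "t \<in> carrier (tensor N N j)" and n: "i + j = n"
  shows exchange_hom_left: "(\<lambda>s. exchange M N n s t) \<in> hom (tensor M M i) (tensor MN MN n)"
    and exchange_tensor_pure: "i1 + i2 = i \<Longrightarrow> x1 \<in> carrier (M i1) \<Longrightarrow> x2 \<in> carrier (M i2)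
      \<Longrightarrow> exchange M N n (tensor_pure M M (i1, x1) (i2, x2)) t = exchange_pure M N n (i1, x1) (i2, x2) t"
proof -
  interpret K: comm_group "tensor MN MN n" by (rule Q.tensor_group)
  let ?b = "\<lambda>(u, v). exchange_pure M N n u v t"
  have l: "(\<lambda>x1. ?b ((i1, x1), (i2, x2))) \<in> hom (M i1) (tensor MN MN n)" if "i1 + i2 = i" "x2 \<in> carrier (M i2)" for i1 i2 x2
    unfolding prod.case by (rule exchange_pure_hom_first[OF that(2) t]) (use n that in simp)
  have r: "(\<lambda>x2. ?b ((i1, x1), (i2, x2))) \<in> hom (M i2) (tensor MN MN n)" if "i1 + i2 = i" "x1 \<in> carrier (M i1)" for i1 i2 x1
    unfolding prod.case by (rule exchange_pure_hom_second[OF that(2) t]) (use n that in simp)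
  show "(\<lambda>s. exchange M N n s t) \<in> hom (tensor M M i) (tensor MN MN n)"
    unfolding exchange_def by (rule MM.tensor_lift_hom[OF K.comm_group_axioms l r])
  show "exchange M N n (tensor_pure M M (i1, x1) (i2, x2)) t = exchange_pure M N n (i1, x1) (i2, x2) t"
    if "i1 + i2 = i" "x1 \<in> carrier (M i1)" "x2 \<in> carrier (M i2)"
    unfolding exchange_def using MM.tensor_lift_pure[OF K.comm_group_axioms l r that] by simp
qed

lemma exchange_hom_right:
  assumes s: "s \<in> carrier (tensor M M i)" and n: "i + j = n"
  shows "exchange M N n s \<in> hom (tensor N N j) (tensor MN MN n)"
proof (rule homI)
  interpret K: comm_group "tensor MN MN n" by (rule Q.tensor_group)
  interpret J: comm_group "tensor N N j" by (rule NN.tensor_group)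
  fix t assume t: "t \<in> carrier (tensor N N j)"
  show "exchange M N n s t \<in> carrier (tensor MN MN n)"
    using exchange_hom_left[OF t n] s by (auto simp: hom_def)
  fix t' assume t': "t' \<in> carrier (tensor N N j)"
  have tt: "t \<otimes>\<^bsub>tensor N N j\<^esub> t' \<in> carrier (tensor N N j)" using t t' by simp
  show "exchange M N n s (t \<otimes>\<^bsub>tensor N N j\<^esub> t') = exchange M N n s t \<otimes>\<^bsub>tensor MN MN n\<^esub> exchange M N n s t'"
  proof (rule MM.tensor_hom_eq[OF K.comm_group_axioms exchange_hom_left[OF tt n]
        hom_mult_pointwise[OF K.comm_group_axioms exchange_hom_left[OF t n] exchange_hom_left[OF t' n]] _ s])
    fix i1 x1 i2 x2 assume *: "i1 + i2 = i" "x1 \<in> carrier (M i1)" "x2 \<in> carrier (M i2)"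
    have n': "i1 + i2 + j = n" using n * by simp
    show "exchange M N n (tensor_pure M M (i1, x1) (i2, x2)) (t \<otimes>\<^bsub>tensor N N j\<^esub> t')
      = exchange M N n (tensor_pure M M (i1, x1) (i2, x2)) t \<otimes>\<^bsub>tensor MN MN n\<^esub> exchange M N n (tensor_pure M M (i1, x1) (i2, x2)) t'"
      unfolding exchange_tensor_pure[OF tt n *] exchange_tensor_pure[OF t n *] exchange_tensor_pure[OF t' n *]
      by (rule hom_mult[OF exchange_pure_hom[OF *(2,3) n'] t t'])
  qed
qed

end

lemma dgcog_tensor_coprod:
  "coprod (dgcog_tensor C E) n = lift (tensor (tensor (module C) (module E)) (tensor (module C) (module E)) n)
     (\<lambda>((i, x), (j, y)). exchange (module C) (module E) n (coprod C i x) (coprod E j y))"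
  unfolding dgcog_tensor_def exchange_def exchange_pure_def
  by (simp add: Let_def case_prod_unfold)

lemma dgcog_tensor_module: "module (dgcog_tensor C E) = tensor (module C) (module E)"
  by (simp add: dgcog_tensor_def Let_def)

lemma dgcog_tensor_diff:
  "diff (dgcog_tensor C E) n t = tensor_map (module C) (module E) 1 0 (diff C) graded_id n t
     \<otimes>\<^bsub>tensor (module C) (module E) (n + 1)\<^esub> tensor_map (module C) (module E) 0 1 graded_id (diff E) n t"
  by (simp add: dgcog_tensor_def Let_def)

lemma (in exchange_pair) dgcog_tensor_coprod_lift:
  assumes C: "module C = M" "coprod C \<in> graded_maps 0 M (tensor M M)"
    and E: "module E = N" "coprod E \<in> graded_maps 0 N (tensor N N)"
  shows dgcog_tensor_coprod_hom: "coprod (dgcog_tensor C E) n \<in> hom (tensor M N n) (tensor MN MN n)"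
    and dgcog_tensor_coprod_pure: "i + j = n \<Longrightarrow> x \<in> carrier (M i) \<Longrightarrow> y \<in> carrier (N j)
      \<Longrightarrow> coprod (dgcog_tensor C E) n (tensor_pure M N (i, x) (j, y)) = exchange M N n (coprod C i x) (coprod E j y)"
proof -
  interpret K: comm_group "tensor MN MN n" by (rule Q.tensor_group)
  let ?b = "\<lambda>((i, x), (j, y)). exchange M N n (coprod C i x) (coprod E j y)"
  have Ch: "coprod C i \<in> hom (M i) (tensor M M i)" for i by (rule graded_maps_hom[OF C(2)]) simp
  have Eh: "coprod E i \<in> hom (N i) (tensor N N i)" for i by (rule graded_maps_hom[OF E(2)]) simp
  have l: "(\<lambda>x. ?b ((i, x), (j, y))) \<in> hom (M i) (tensor MN MN n)" if "i + j = n" "y \<in> carrier (N j)" for i j y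
    unfolding prod.case by (rule hom_comp[OF Ch exchange_hom_left[OF _ that(1)]])
      (use Eh[of j] that in \<open>auto simp: hom_def\<close>)
  have r: "(\<lambda>y. ?b ((i, x), (j, y))) \<in> hom (N j) (tensor MN MN n)" if "i + j = n" "x \<in> carrier (M i)" for i j x
    unfolding prod.case by (rule hom_comp[OF Eh exchange_hom_right[OF _ that(1)]])
      (use Ch[of i] that in \<open>auto simp: hom_def\<close>)
  show "coprod (dgcog_tensor C E) n \<in> hom (tensor M N n) (tensor MN MN n)"
    unfolding dgcog_tensor_coprod C(1) E(1) by (rule tensor_lift_hom[OF K.comm_group_axioms l r])
  show "coprod (dgcog_tensor C E) n (tensor_pure M N (i, x) (j, y)) = exchange M N n (coprod C i x) (coprod E j y)"
    if "i + j = n" "x \<in> carrier (M i)" "y \<in> carrier (N j)"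
    unfolding dgcog_tensor_coprod C(1) E(1) using tensor_lift_pure[OF K.comm_group_axioms l r that] by simp
qed

section \<open>The simplex coalgebras\<close>

definition faces :: "nat \<Rightarrow> nat set set" where
  "faces n = {I. I \<noteq> {} \<and> I \<subseteq> {0..n}}"

lemma finite_face: "I \<in> faces n \<Longrightarrow> finite I"
  by (auto simp: faces_def finite_subset)

lemma faces_subset: "I \<in> faces n \<Longrightarrow> J \<subseteq> I \<Longrightarrow> J \<noteq> {} \<Longrightarrow> J \<in> faces n"
  by (auto simp: faces_def)

lemma simplex_module_faces: "simplex_module n d = free_Abelian_group {I \<in> faces n. face_degree I = d}"
proof -
  have "{I. I \<noteq> {} \<and> I \<subseteq> {0..n} \<and> face_degree I = d} = {I \<in> faces n. face_degree I = d}"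
    by (auto simp: faces_def)
  then show ?thesis by (simp add: simplex_module_def)
qed

lemma graded_module_simplex: "graded_module (simplex_module n)"
  by (simp add: graded_module_def simplex_module_def abelian_free_Abelian_group)

lemma simplex_module_carrier: "a \<in> carrier (simplex_module n d) \<longleftrightarrow> Poly_Mapping.keys a \<subseteq> {I \<in> faces n. face_degree I = d}"
  by (simp add: simplex_module_faces)

lemma frag_of_simplex: "I \<in> faces n \<Longrightarrow> frag_of I \<in> carrier (simplex_module n (face_degree I))"
  by (simp add: simplex_module_carrier)

lemma keys_face_boundary:
  assumes I: "finite I" and J: "J \<in> Poly_Mapping.keys (face_boundary I)"
  shows "J \<subseteq> I" "J \<noteq> {}" "face_degree J = face_degree I + 1"
proof -
  obtain v where v: "v \<in> I" "J \<in> Poly_Mapping.keys (frag_cmul (vertex_sign v I) (nonempty_face (I - {v})))"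
    using J keys_sum unfolding face_boundary_sum[OF I] by fastforce
  then have "J \<in> Poly_Mapping.keys (nonempty_face (I - {v}))" by auto
  then have e: "J = I - {v}" "J \<noteq> {}" by (auto simp: nonempty_face_def split: if_splits)
  moreover have "card I = Suc (card (I - {v}))" using I v by (metis card_Suc_Diff1)
  ultimately show "J \<subseteq> I" "J \<noteq> {}" "face_degree J = face_degree I + 1"
    by (auto simp: face_degree_def)
qed

lemma aw_face_degree:
  assumes I: "finite I" and v: "v \<in> I"
  shows "face_degree {u \<in> I. u \<le> v} + face_degree {u \<in> I. v \<le> u} = face_degree I"
proof -
  have "card {u \<in> I. u \<le> v} + card {u \<in> I. v \<le> u}
      = card ({u \<in> I. u \<le> v} \<union> {u \<in> I. v \<le> u}) + card ({u \<in> I. u \<le> v} \<inter> {u \<in> I. v \<le> u})"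
    by (rule card_Un_Int) (use I in auto)
  moreover have "{u \<in> I. u \<le> v} \<union> {u \<in> I. v \<le> u} = I" "{u \<in> I. u \<le> v} \<inter> {u \<in> I. v \<le> u} = {v}"
    using v by auto
  ultimately show ?thesis by (simp add: face_degree_def)
qed

lemma keys_aw_chain:
  assumes I: "finite I" and JK: "(J, K) \<in> Poly_Mapping.keys (aw_chain I)"
  obtains v where "v \<in> I" "J = {u \<in> I. u \<le> v}" "K = {u \<in> I. v \<le> u}"
  using JK keys_sum unfolding aw_chain_def by (fastforce split: if_splits)

lemma keys_aw_chain_props:
  assumes I: "finite I" and JK: "(J, K) \<in> Poly_Mapping.keys (aw_chain I)"
  shows "J \<subseteq> I" "K \<subseteq> I" "J \<noteq> {}" "K \<noteq> {}" "face_degree J + face_degree K = face_degree I"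
  using keys_aw_chain[OF I JK] aw_face_degree[OF I] by auto

lemma simplex_diff_graded: "diff (simplex_dgcog n) \<in> graded_maps 1 (simplex_module n) (simplex_module n)"
  unfolding graded_maps_def mem_Collect_eq
proof (intro allI homI)
  fix i a b assume a: "a \<in> carrier (simplex_module n i)"
  have "J \<in> faces n \<and> face_degree J = i + 1" if J: "J \<in> Poly_Mapping.keys (frag_extend face_boundary a)" for J
  proof -
    obtain I where I: "I \<in> Poly_Mapping.keys a" "J \<in> Poly_Mapping.keys (face_boundary I)"
      using subsetD[OF keys_frag_extend J] by blast
    then have "I \<in> faces n" "face_degree I = i" using a by (auto simp: simplex_module_carrier)
    then show ?thesis using keys_face_boundary[OF finite_face I(2)] faces_subset by auto
  qed
  then show "diff (simplex_dgcog n) i a \<in> carrier (simplex_module n (i + 1))"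
    by (auto simp: simplex_module_carrier simplex_dgcog_def)
  show "diff (simplex_dgcog n) i (a \<otimes>\<^bsub>simplex_module n i\<^esub> b)
    = diff (simplex_dgcog n) i a \<otimes>\<^bsub>simplex_module n (i + 1)\<^esub> diff (simplex_dgcog n) i b"
    by (simp add: simplex_dgcog_def simplex_module_def frag_extend_add)
qed

lemma alexander_whitney_closed:
  assumes I: "I \<in> faces n" and d: "d = face_degree I"
  shows "alexander_whitney n I \<in> carrier (tensor (simplex_module n) (simplex_module n) d)"
proof -
  interpret P: graded_pair "simplex_module n" "simplex_module n"
    by unfold_locales (rule graded_module_simplex)+
  interpret K: comm_group "tensor (simplex_module n) (simplex_module n) d" by (rule P.tensor_group)
  show ?thesis
    unfolding alexander_whitney_def Let_def d[symmetric]
    by (rule K.finprod_closed)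
       (use aw_face_degree[OF finite_face[OF I]] d I in
        \<open>auto intro!: P.tensor_pure_closed frag_of_simplex faces_subset[OF I]\<close>)
qed

lemma simplex_coprod_graded:
  "coprod (simplex_dgcog n) \<in> graded_maps 0 (simplex_module n) (tensor (simplex_module n) (simplex_module n))"
proof -
  interpret P: graded_pair "simplex_module n" "simplex_module n"
    by unfold_locales (rule graded_module_simplex)+
  show ?thesis
    by (auto simp: graded_maps_def simplex_dgcog_def simplex_module_faces[of n]
        intro!: free_lift_hom P.tensor_group alexander_whitney_closed)
qed

lemma simplex_coprod_face:
  assumes I: "I \<in> faces n"
  shows "coprod (simplex_dgcog n) (face_degree I) (frag_of I) = alexander_whitney n I"
proof -
  interpret P: graded_pair "simplex_module n" "simplex_module n"
    by unfold_locales (rule graded_module_simplex)+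
  interpret K: comm_group "tensor (simplex_module n) (simplex_module n) (face_degree I)" by (rule P.tensor_group)
  show ?thesis using alexander_whitney_closed[OF I refl] by (simp add: simplex_dgcog_def K.free_lift_frag_of)
qed


section \<open>Higher morphisms as families indexed by faces\<close>

lemma hom_transfer:
  assumes "group G" "f \<in> hom G H" "\<And>x. x \<in> carrier G \<Longrightarrow> f x = g x" shows "g \<in> hom G H"
proof -
  interpret group G by fact
  show ?thesis using assms(2,3) by (auto simp: hom_def Pi_def)
qed

locale bar_pair = words_pair VA VB
  for VA :: "'a grmod" and VB :: "'b grmod" +
  fixes DA :: "int \<Rightarrow> 'a words \<Rightarrow> 'a words" and DB :: "int \<Rightarrow> 'b words \<Rightarrow> 'b words"
  assumes DA: "coderivation 1 (Tbar VA) (deconcat VA) DA" and DB: "coderivation 1 (Tbar VB) (deconcat VB) DB"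
    and DA_DA: "\<And>i x. x \<in> carrier (Tbar VA i) \<Longrightarrow> DA (i + 1) (DA i x) = \<one>\<^bsub>Tbar VA (i + 2)\<^esub>"
    and DB_DB: "\<And>i x. x \<in> carrier (Tbar VB i) \<Longrightarrow> DB (i + 1) (DB i x) = \<one>\<^bsub>Tbar VB (i + 2)\<^esub>"
begin

lemma DA_graded: "DA \<in> graded_maps 1 A.T A.T" using DA by (simp add: coderivation_def)
lemma DB_graded: "DB \<in> graded_maps 1 B.T B.T" using DB by (simp add: coderivation_def)

abbreviation CA where "CA \<equiv> \<lparr>module = A.T, diff = DA, coprod = A.\<Delta>\<rparr>"
abbreviation CB where "CB \<equiv> \<lparr>module = B.T, diff = DB, coprod = B.\<Delta>\<rparr>"

abbreviation S where "S n \<equiv> simplex_module n"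
abbreviation C where "C n \<equiv> dgcog_tensor (simplex_dgcog n) CA"

sublocale X: exchange_pair "S n" A.T for n
  by unfold_locales (rule graded_module_simplex A.graded_module_Tbar)+

sublocale XX: graded_pair_maps "tensor (S n) A.T" "tensor (S n) A.T" B.T B.T for n
  by (rule graded_pair_mapsI; rule X.graded_module_tensor B.graded_module_Tbar)

sublocale XS: graded_pair_maps "S n" A.T "S m" A.T for n m
  by (rule graded_pair_mapsI; rule graded_module_simplex A.graded_module_Tbar)

lemma C_module: "module (C n) = tensor (S n) A.T"
  by (simp add: dgcog_tensor_module simplex_dgcog_def)

lemma simplex_dgcog_module: "module (simplex_dgcog n) = S n"
  by (simp add: simplex_dgcog_def)

abbreviation pair_map where
  "pair_map F J K \<equiv> tensor_map B.T B.T (face_degree J) (face_degree K) (F J) (F K)"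

text \<open>A degree zero map \<open>f\<close> on the tensor product with a simplex is the same as a family of maps
  \<open>F I = f (I \<otimes> -)\<close>, one for each face \<open>I\<close> and of the degree of \<open>I\<close>. Compatibility of \<open>f\<close> with the
  coproducts and with the differentials becomes the following two equations. They only mention faces
  of \<open>I\<close>, which is why families on a horn and on the whole simplex can be compared.\<close>

definition coproduct_rule :: "(nat set \<Rightarrow> int \<Rightarrow> 'a words \<Rightarrow> 'b words) \<Rightarrow> nat set \<Rightarrow> int \<Rightarrow> 'a words \<Rightarrow> bool" where
  "coproduct_rule F I d x \<longleftrightarrow> B.\<Delta> (d + face_degree I) (F I d x)
     = free_lift (B.TT (d + face_degree I)) (\<lambda>(J, K). pair_map F J K d (A.\<Delta> d x))
         (aw_chain I)"

definition differential_rule :: "(nat set \<Rightarrow> int \<Rightarrow> 'a words \<Rightarrow> 'b words) \<Rightarrow> nat set \<Rightarrow> int \<Rightarrow> 'a words \<Rightarrow> bool" where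
  "differential_rule F I d x \<longleftrightarrow> DB (d + face_degree I) (F I d x)
     = free_lift (B.T (d + face_degree I + 1)) (\<lambda>J. F J d x) (face_boundary I)
       \<otimes>\<^bsub>B.T (d + face_degree I + 1)\<^esub> F I (d + 1) (DA d x) [^]\<^bsub>B.T (d + face_degree I + 1)\<^esub> sgn_pow (face_degree I)"

definition family :: "nat set set \<Rightarrow> (nat set \<Rightarrow> int \<Rightarrow> 'a words \<Rightarrow> 'b words) \<Rightarrow> bool" where
  "family Is F \<longleftrightarrow> (\<forall>I\<in>Is. F I \<in> graded_maps (face_degree I) A.T B.T)"

definition represents :: "nat \<Rightarrow> (int \<Rightarrow> (nat set \<Rightarrow>\<^sub>0 int, 'a words) tens \<Rightarrow> 'b words)
     \<Rightarrow> (nat set \<Rightarrow> int \<Rightarrow> 'a words \<Rightarrow> 'b words) \<Rightarrow> bool" where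
  "represents n f F \<longleftrightarrow> (\<forall>d. f d \<in> hom (tensor (S n) A.T d) (B.T d)) \<and>
     (\<forall>I\<in>faces n. \<forall>j. \<forall>x\<in>carrier (A.T j).
        f (face_degree I + j) (tensor_pure (S n) A.T (face_degree I, frag_of I) (j, x)) = F I j x)"

lemma represents_graded: "represents n f F \<Longrightarrow> f \<in> graded_maps 0 (tensor (S n) A.T) B.T"
  by (simp add: represents_def graded_maps_def)

lemma represents_face:
  "represents n f F \<Longrightarrow> I \<in> faces n \<Longrightarrow> x \<in> carrier (A.T j) \<Longrightarrow> e = face_degree I + j
    \<Longrightarrow> f e (tensor_pure (S n) A.T (face_degree I, frag_of I) (j, x)) = F I j x"
  by (simp add: represents_def)

lemma represents_family:
  assumes r: "represents n f F" shows "family (faces n) F"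
  unfolding family_def graded_maps_def
proof (intro ballI CollectI allI)
  fix I j assume I: "I \<in> faces n"
  show "F I j \<in> hom (A.T j) (B.T (j + face_degree I))"
  proof (rule hom_transfer[OF graded_module_group[OF A.graded_module_Tbar]])
    show "(\<lambda>x. f (j + face_degree I) (tensor_pure (S n) A.T (face_degree I, frag_of I) (j, x))) \<in> hom (A.T j) (B.T (j + face_degree I))"
      by (rule hom_comp[where H = "tensor (S n) A.T (j + face_degree I)", OF X.tensor_pure_hom_right[OF frag_of_simplex[OF I]]])
         (use r in \<open>auto simp: represents_def\<close>)
    show "f (j + face_degree I) (tensor_pure (S n) A.T (face_degree I, frag_of I) (j, x)) = F I j x" if "x \<in> carrier (A.T j)" for x
      by (rule represents_face[OF r I that]) simp
  qed
qed

lemma family_graded: "family Is F \<Longrightarrow> I \<in> Is \<Longrightarrow> F I \<in> graded_maps (face_degree I) A.T B.T"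
  by (simp add: family_def)

lemma family_closed: "family Is F \<Longrightarrow> I \<in> Is \<Longrightarrow> x \<in> carrier (A.T d) \<Longrightarrow> e = d + face_degree I \<Longrightarrow> F I d x \<in> carrier (B.T e)"
  by (rule graded_maps_closed[OF family_graded])

text \<open>Both sides are additive in the chain and agree on faces.\<close>

lemma represents_chain:
  assumes r: "represents n f F" and a: "a \<in> carrier (S n k)" and x: "x \<in> carrier (A.T j)" and e: "e = k + j"
  shows "f e (tensor_pure (S n) A.T (k, a) (j, x)) = free_lift (B.T e) (\<lambda>I. F I j x) a"
proof (rule free_hom_eq)
  show "comm_group (B.T e)" by (rule B.Tbar_group)
  show "Poly_Mapping.keys a \<subseteq> {I \<in> faces n. face_degree I = k}" using a by (simp add: simplex_module_carrier)
  show "(\<lambda>a. f e (tensor_pure (S n) A.T (k, a) (j, x))) \<in> hom (free_Abelian_group {I \<in> faces n. face_degree I = k}) (B.T e)"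
    unfolding simplex_module_faces[symmetric]
    by (rule hom_comp[OF X.tensor_pure_hom_left[OF x e]]) (use r in \<open>simp add: represents_def\<close>)
  have c: "(\<lambda>I. F I j x) \<in> {I \<in> faces n. face_degree I = k} \<rightarrow> carrier (B.T e)"
    using family_closed[OF represents_family[OF r] _ x] e by (auto simp: add.commute)
  show "free_lift (B.T e) (\<lambda>I. F I j x) \<in> hom (free_Abelian_group {I \<in> faces n. face_degree I = k}) (B.T e)"
    by (rule free_lift_hom[OF B.Tbar_group c])
  interpret K: comm_group "B.T e" by (rule B.Tbar_group)
  fix I assume I: "I \<in> {I \<in> faces n. face_degree I = k}"
  then have I': "I \<in> faces n" and k: "k = face_degree I" and Fc: "F I j x \<in> carrier (B.T e)"
    using c by auto
  show "f e (tensor_pure (S n) A.T (k, frag_of I) (j, x)) = free_lift (B.T e) (\<lambda>I. F I j x) (frag_of I)"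
  proof -
    have ee: "e = face_degree I + j" using e k by simp
    show ?thesis unfolding k using represents_face[OF r I' x ee] K.free_lift_frag_of[of "\<lambda>I. F I j x", OF Fc] by simp
  qed
qed

text \<open>The tensor product with a simplex is generated by the tensors of a face with an element.\<close>

lemma simplex_tensor_hom_eq:
  assumes H: "comm_group H" and f: "f \<in> hom (tensor (S n) A.T d) H" and g: "g \<in> hom (tensor (S n) A.T d) H"
    and eq: "\<And>I j x. I \<in> faces n \<Longrightarrow> face_degree I + j = d \<Longrightarrow> x \<in> carrier (A.T j)
      \<Longrightarrow> f (tensor_pure (S n) A.T (face_degree I, frag_of I) (j, x)) = g (tensor_pure (S n) A.T (face_degree I, frag_of I) (j, x))"
    and t: "t \<in> carrier (tensor (S n) A.T d)"
  shows "f t = g t"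
proof (rule X.tensor_hom_eq[OF H f g _ t])
  fix k a j x assume *: "k + j = d" "a \<in> carrier (S n k)" "x \<in> carrier (A.T j)"
  have h: "(\<lambda>a. h (tensor_pure (S n) A.T (k, a) (j, x))) \<in> hom (free_Abelian_group {I \<in> faces n. face_degree I = k}) H"
    if "h \<in> hom (tensor (S n) A.T d) H" for h
    unfolding simplex_module_faces[symmetric]
    using hom_comp[OF X.tensor_pure_hom_left[OF *(3), of d k] that] * by simp
  show "f (tensor_pure (S n) A.T (k, a) (j, x)) = g (tensor_pure (S n) A.T (k, a) (j, x))"
    by (rule free_hom_eq[OF H h[OF f] h[OF g]])
       (use * eq in \<open>auto simp: simplex_module_carrier\<close>)
qed

lemma represents_unique:
  assumes "represents n f F" "represents n g F" "t \<in> carrier (tensor (S n) A.T d)"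
  shows "f d t = g d t"
  by (rule simplex_tensor_hom_eq[OF B.Tbar_group, where f = "f d" and g = "g d"])
     (use assms in \<open>auto simp: represents_def\<close>)

lemma represents_exists:
  assumes F: "family (faces n) F"
  obtains f where "represents n f F" "\<And>d. f d \<in> extensional (carrier (tensor (S n) A.T d))"
proof -
  let ?b = "\<lambda>d ((k :: int, a), (j, x)). free_lift (B.T d) (\<lambda>I. F I j x) a"
  have l: "(\<lambda>a. ?b d ((k, a), (j, x))) \<in> hom (S n k) (B.T d)" if "k + j = d" "x \<in> carrier (A.T j)" for d k j x
    unfolding prod.case simplex_module_faces
  proof (rule free_lift_hom[OF B.Tbar_group], rule Pi_I)
    fix I assume I: "I \<in> {I \<in> faces n. face_degree I = k}"
    show "F I j x \<in> carrier (B.T d)" by (rule family_closed[OF F _ that(2)]) (use I that in auto)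
  qed
  have r: "(\<lambda>x. ?b d ((k, a), (j, x))) \<in> hom (A.T j) (B.T d)" if "k + j = d" "a \<in> carrier (S n k)" for d k j a
    unfolding prod.case
    by (rule hom_free_lift_pointwise[OF B.Tbar_group])
       (use that in \<open>auto simp: simplex_module_carrier intro!: graded_maps_hom[OF family_graded[OF F]]\<close>)
  define f where "f d = restrict (lift (B.T d) (?b d)) (carrier (tensor (S n) A.T d))" for d
  have "represents n f F"
    unfolding represents_def
  proof (intro conjI allI ballI)
    fix d show "f d \<in> hom (tensor (S n) A.T d) (B.T d)"
      by (rule hom_transfer[OF graded_module_group[OF X.graded_module_tensor] X.tensor_lift_hom[OF B.Tbar_group l r]])
         (auto simp: f_def)
  next
    fix I j x assume I: "I \<in> faces n" and x: "x \<in> carrier (A.T j)"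
    interpret K: comm_group "B.T (face_degree I + j)" by (rule B.Tbar_group)
    have "lift (B.T (face_degree I + j)) (?b (face_degree I + j)) (tensor_pure (S n) A.T (face_degree I, frag_of I) (j, x))
      = free_lift (B.T (face_degree I + j)) (\<lambda>I. F I j x) (frag_of I)"
      using X.tensor_lift_pure[OF B.Tbar_group l r refl frag_of_simplex[OF I] x] by simp
    also have "\<dots> = F I j x"
      by (rule K.free_lift_frag_of[of "\<lambda>I. F I j x"], rule family_closed[OF F I x]) simp
    finally show "f (face_degree I + j) (tensor_pure (S n) A.T (face_degree I, frag_of I) (j, x)) = F I j x"
      using X.tensor_pure_closed[OF frag_of_simplex[OF I] x refl] by (simp add: f_def)
  qed
  then show ?thesis using that[of f] by (simp add: f_def)
qed

lemma C_diff_face: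
  assumes I: "I \<in> faces n" and x: "x \<in> carrier (A.T j)" and d: "d = face_degree I + j"
  shows "diff (C n) d (tensor_pure (S n) A.T (face_degree I, frag_of I) (j, x))
    = tensor_pure (S n) A.T (face_degree I + 1, face_boundary I) (j, x)
      \<otimes>\<^bsub>tensor (S n) A.T (d + 1)\<^esub> tensor_pure (S n) A.T (face_degree I, frag_of I) (j + 1, DA j x)
        [^]\<^bsub>tensor (S n) A.T (d + 1)\<^esub> sgn_pow (face_degree I)"
proof -
  interpret K: comm_group "tensor (S n) A.T (d + 1)" by (rule X.tensor_group)
  have b: "diff (simplex_dgcog n) (face_degree I) (frag_of I) = face_boundary I"
    by (simp add: simplex_dgcog_def)
  have bc: "face_boundary I \<in> carrier (S n (face_degree I + 1))"
    using graded_maps_closed[OF simplex_diff_graded frag_of_simplex[OF I] refl] unfolding b .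
  have "tensor_map (S n) A.T 1 0 (diff (simplex_dgcog n)) graded_id d (tensor_pure (S n) A.T (face_degree I, frag_of I) (j, x))
    = tensor_pure (S n) A.T (face_degree I + 1, face_boundary I) (j, x)"
  proof -
    have "tensor_pure (S n) A.T (face_degree I + 1, face_boundary I) (j, x) \<in> carrier (tensor (S n) A.T (d + 1))"
      by (rule X.tensor_pure_closed[OF bc x]) (use d in simp)
    then show ?thesis
      using XS.tensor_map_pure[OF simplex_diff_graded graded_maps_id _ d[symmetric] frag_of_simplex[OF I] x, of "d + 1"]
      by (simp add: b)
  qed
  moreover have "tensor_map (S n) A.T 0 1 graded_id DA d (tensor_pure (S n) A.T (face_degree I, frag_of I) (j, x))
    = tensor_pure (S n) A.T (face_degree I, frag_of I) (j + 1, DA j x) [^]\<^bsub>tensor (S n) A.T (d + 1)\<^esub> sgn_pow (face_degree I)"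
    using XS.tensor_map_pure[OF graded_maps_id DA_graded _ d[symmetric] frag_of_simplex[OF I] x, of "d + 1"] by simp
  ultimately show ?thesis by (simp add: dgcog_tensor_diff simplex_dgcog_module)
qed

lemma C_diff_graded: "diff (C n) \<in> graded_maps 1 (tensor (S n) A.T) (tensor (S n) A.T)"
  unfolding dgcog_tensor_diff[abs_def] simplex_dgcog_module
  using graded_maps_times[OF XS.tensor_map_graded[OF simplex_diff_graded graded_maps_id, of 1]
      XS.tensor_map_graded[OF graded_maps_id DA_graded, of 1] X.graded_module_tensor]
  by simp

lemma diff_iff:
  assumes r: "represents n f F"
  shows "(\<forall>d. \<forall>t\<in>carrier (tensor (S n) A.T d). f (d + 1) (diff (C n) d t) = DB d (f d t))
    \<longleftrightarrow> (\<forall>I\<in>faces n. \<forall>j. \<forall>x\<in>carrier (A.T j). differential_rule F I j x)"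
proof -
  have fh: "f d \<in> hom (tensor (S n) A.T d) (B.T d)" for d using r by (simp add: represents_def)
  have key: "(f (d + 1) (diff (C n) d (tensor_pure (S n) A.T (face_degree I, frag_of I) (j, x)))
      = DB d (f d (tensor_pure (S n) A.T (face_degree I, frag_of I) (j, x)))) \<longleftrightarrow> differential_rule F I j x"
    if I: "I \<in> faces n" and x: "x \<in> carrier (A.T j)" and d: "d = j + face_degree I" for I j x d
  proof -
    have d': "d = face_degree I + j" using d by simp
    have Dx: "DA j x \<in> carrier (A.T (j + 1))" by (rule graded_maps_closed[OF DA_graded x refl])
    have bc: "face_boundary I \<in> carrier (S n (face_degree I + 1))"
      using graded_maps_closed[OF simplex_diff_graded frag_of_simplex[OF I] refl] by (simp add: simplex_dgcog_def)
    have c: "tensor_pure (S n) A.T (face_degree I + 1, face_boundary I) (j, x) \<in> carrier (tensor (S n) A.T (d + 1))"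
      "tensor_pure (S n) A.T (face_degree I, frag_of I) (j + 1, DA j x) \<in> carrier (tensor (S n) A.T (d + 1))"
      by (rule X.tensor_pure_closed[OF bc x], use d in simp)
         (rule X.tensor_pure_closed[OF frag_of_simplex[OF I] Dx], use d in simp)
    interpret K: comm_group "tensor (S n) A.T (d + 1)" by (rule X.tensor_group)
    have "f (d + 1) (diff (C n) d (tensor_pure (S n) A.T (face_degree I, frag_of I) (j, x)))
      = f (d + 1) (tensor_pure (S n) A.T (face_degree I + 1, face_boundary I) (j, x))
        \<otimes>\<^bsub>B.T (d + 1)\<^esub> f (d + 1) (tensor_pure (S n) A.T (face_degree I, frag_of I) (j + 1, DA j x)) [^]\<^bsub>B.T (d + 1)\<^esub> sgn_pow (face_degree I)"
      unfolding C_diff_face[OF I x d'] hom_mult[OF fh c(1) K.int_pow_closed[OF c(2)]]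
        hom_int_pow[OF fh c(2) K.is_group graded_module_group[OF B.graded_module_Tbar]] ..
    also have "\<dots> = free_lift (B.T (d + 1)) (\<lambda>J. F J j x) (face_boundary I)
        \<otimes>\<^bsub>B.T (d + 1)\<^esub> F I (j + 1) (DA j x) [^]\<^bsub>B.T (d + 1)\<^esub> sgn_pow (face_degree I)"
      using represents_chain[OF r bc x, of "d + 1"] represents_face[OF r I Dx, of "d + 1"] d by simp
    finally show ?thesis
      using represents_face[OF r I x d'] unfolding differential_rule_def d by metis
  qed
  show ?thesis
  proof (intro iffI ballI allI)
    fix I j x assume "\<forall>d. \<forall>t\<in>carrier (tensor (S n) A.T d). f (d + 1) (diff (C n) d t) = DB d (f d t)"
      and I: "I \<in> faces n" and x: "x \<in> carrier (A.T j)"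
    moreover have "tensor_pure (S n) A.T (face_degree I, frag_of I) (j, x) \<in> carrier (tensor (S n) A.T (j + face_degree I))"
      by (rule X.tensor_pure_closed[OF frag_of_simplex[OF I] x]) simp
    ultimately show "differential_rule F I j x" using key[OF I x refl] by blast
  next
    fix d t assume *: "\<forall>I\<in>faces n. \<forall>j. \<forall>x\<in>carrier (A.T j). differential_rule F I j x"
      and t: "t \<in> carrier (tensor (S n) A.T d)"
    show "f (d + 1) (diff (C n) d t) = DB d (f d t)"
    proof (rule simplex_tensor_hom_eq[OF B.Tbar_group _ _ _ t])
      show "(\<lambda>t. f (d + 1) (diff (C n) d t)) \<in> hom (tensor (S n) A.T d) (B.T (d + 1))"
        by (rule hom_comp[OF graded_maps_hom[OF C_diff_graded refl] fh])
      show "(\<lambda>t. DB d (f d t)) \<in> hom (tensor (S n) A.T d) (B.T (d + 1))"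
        by (rule hom_comp[OF fh graded_maps_hom[OF DB_graded refl]])
      show "f (d + 1) (diff (C n) d (tensor_pure (S n) A.T (face_degree I, frag_of I) (j, x)))
        = DB d (f d (tensor_pure (S n) A.T (face_degree I, frag_of I) (j, x)))"
        if "I \<in> faces n" "face_degree I + j = d" "x \<in> carrier (A.T j)" for I j x
        using key[OF that(1,3), of d] * that by (simp add: add.commute)
    qed
  qed
qed

lemma C_coprod_graded: "coprod (C n) \<in> graded_maps 0 (tensor (S n) A.T) (tensor (tensor (S n) A.T) (tensor (S n) A.T))"
  using X.dgcog_tensor_coprod_hom[of "simplex_dgcog n" n CA] simplex_coprod_graded[of n] A.deconcat_graded
  by (simp add: graded_maps_def simplex_dgcog_module)

text \<open>The sign of the exchange, that of moving the second face past the first element, is the Koszul sign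
  of \<open>F J \<otimes> F K\<close>.\<close>

lemma tensor_map_exchange_face:
  assumes r: "represents n f F" and J: "J \<in> faces n" and K: "K \<in> faces n"
    and t: "t \<in> carrier (A.TT j)" and d: "face_degree J + face_degree K + j = d"
  shows "tensor_map B.T B.T 0 0 f f d (exchange_pure (S n) A.T d (face_degree J, frag_of J) (face_degree K, frag_of K) t)
    = pair_map F J K j t"
proof -
  note fg = represents_graded[OF r] and fam = represents_family[OF r]
  note FJ = family_graded[OF fam J] and FK = family_graded[OF fam K]
  note SJ = frag_of_simplex[OF J] and SK = frag_of_simplex[OF K]
  interpret T: comm_group "B.TT d" by (rule B.TP.tensor_group)
  interpret Q: comm_group "tensor (tensor (S n) A.T) (tensor (S n) A.T) d" by (rule X.Q.tensor_group)
  have fh: "tensor_map B.T B.T 0 0 f f d \<in> hom (tensor (tensor (S n) A.T) (tensor (S n) A.T) d) (B.TT d)"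
    by (rule XX.tensor_map_hom[OF fg fg]) simp
  have dd: "d = j + face_degree J + face_degree K" using d by simp
  show ?thesis
  proof (rule A.TP.tensor_hom_eq[OF T.comm_group_axioms hom_comp[OF X.exchange_pure_hom[OF SJ SK d] fh]
        AB.MP.tensor_map_hom[OF FJ FK dd] _ t])
    fix j1 y1 j2 y2 assume j: "j1 + j2 = j" and y: "y1 \<in> carrier (A.T j1)" "y2 \<in> carrier (A.T j2)"
    note c1 = X.tensor_pure_closed[OF SJ y(1) refl] and c2 = X.tensor_pure_closed[OF SK y(2) refl]
    have dd': "face_degree J + j1 + (face_degree K + j2) = d" using d j by simp
    have c: "tensor_pure B.T B.T (j1 + face_degree J, F J j1 y1) (j2 + face_degree K, F K j2 y2) \<in> carrier (B.TT d)"
      by (rule B.TP.tensor_pure_closed[OF family_closed[OF fam J y(1) refl] family_closed[OF fam K y(2) refl]]) (use dd' in simp)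
    have "tensor_map B.T B.T 0 0 f f d (tensor_pure (tensor (S n) A.T) (tensor (S n) A.T)
         (face_degree J + j1, tensor_pure (S n) A.T (face_degree J, frag_of J) (j1, y1))
         (face_degree K + j2, tensor_pure (S n) A.T (face_degree K, frag_of K) (j2, y2)))
       = tensor_pure B.T B.T (j1 + face_degree J, F J j1 y1) (j2 + face_degree K, F K j2 y2)"
      using XX.tensor_map_pure[OF fg fg _ dd' c1 c2, of d] represents_face[OF r J y(1) refl] represents_face[OF r K y(2) refl] c
      by (simp add: add.commute)
    then show "tensor_map B.T B.T 0 0 f f d (exchange_pure (S n) A.T d (face_degree J, frag_of J) (face_degree K, frag_of K) (tensor_pure A.T A.T (j1, y1) (j2, y2)))
      = pair_map F J K j (tensor_pure A.T A.T (j1, y1) (j2, y2))"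
      unfolding X.exchange_pure_pure[OF SJ SK d j y] AB.MP.tensor_map_pure[OF FJ FK dd j y]
      using hom_int_pow[OF fh X.Q.tensor_pure_closed[OF c1 c2 dd'[symmetric]] Q.is_group T.is_group] by simp
  qed
qed

lemma coprod_iff:
  assumes r: "represents n f F"
  shows "(\<forall>d. \<forall>t\<in>carrier (tensor (S n) A.T d). tensor_map B.T B.T 0 0 f f d (coprod (C n) d t) = B.\<Delta> d (f d t))
    \<longleftrightarrow> (\<forall>I\<in>faces n. \<forall>j. \<forall>x\<in>carrier (A.T j). coproduct_rule F I j x)"
proof -
  note fg = represents_graded[OF r] and fam = represents_family[OF r]
  have fh: "f d \<in> hom (tensor (S n) A.T d) (B.T d)" for d using r by (simp add: represents_def)
  have ffh: "tensor_map B.T B.T 0 0 f f d \<in> hom (tensor (tensor (S n) A.T) (tensor (S n) A.T) d) (B.TT d)" for d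
    by (rule XX.tensor_map_hom[OF fg fg]) simp
  have key: "(tensor_map B.T B.T 0 0 f f d (coprod (C n) d (tensor_pure (S n) A.T (face_degree I, frag_of I) (j, x)))
      = B.\<Delta> d (f d (tensor_pure (S n) A.T (face_degree I, frag_of I) (j, x)))) \<longleftrightarrow> coproduct_rule F I j x"
    if I: "I \<in> faces n" and x: "x \<in> carrier (A.T j)" and d: "d = j + face_degree I" for I j x d
  proof -
    have d': "face_degree I + j = d" using d by simp
    have fin: "finite I" by (rule finite_face[OF I])
    interpret T: comm_group "B.TT d" by (rule B.TP.tensor_group)
    interpret Q: comm_group "tensor (tensor (S n) A.T) (tensor (S n) A.T) d" by (rule X.Q.tensor_group)
    interpret SS: comm_group "tensor (S n) (S n) (face_degree I)" by (rule X.MM.tensor_group)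
    let ?L = "\<lambda>v. {u \<in> I. u \<le> v}" and ?R = "\<lambda>v. {u \<in> I. v \<le> u}"
    have LR: "?L v \<in> faces n" "?R v \<in> faces n" "face_degree (?L v) + face_degree (?R v) = face_degree I" if "v \<in> I" for v
      using faces_subset[OF I, of "?L v"] faces_subset[OF I, of "?R v"] that aw_face_degree[OF fin that] by auto
    have Dx: "A.\<Delta> j x \<in> carrier (A.TT j)" by (rule A.deconcat_closed[OF x])
    have deg: "face_degree (?L v) + face_degree (?R v) + j = d" if "v \<in> I" for v using LR[OF that] d' by simp
    have tc: "pair_map F (?L v) (?R v) j (A.\<Delta> j x) \<in> carrier (B.TT d)"
      if "v \<in> I" for v
      by (rule AB.MP.tensor_map_closed[OF family_graded[OF fam LR(1)[OF that]] family_graded[OF fam LR(2)[OF that]] Dx])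
         (use deg[OF that] in simp)
    have ec: "exchange_pure (S n) A.T d (face_degree (?L v), frag_of (?L v)) (face_degree (?R v), frag_of (?R v)) (A.\<Delta> j x)
        \<in> carrier (tensor (tensor (S n) A.T) (tensor (S n) A.T) d)" if "v \<in> I" for v
      using X.exchange_pure_hom[OF frag_of_simplex[OF LR(1)[OF that]] frag_of_simplex[OF LR(2)[OF that]] deg[OF that]] Dx
      by (auto simp: hom_def)
    have "coprod (C n) d (tensor_pure (S n) A.T (face_degree I, frag_of I) (j, x))
      = exchange (S n) A.T d (alexander_whitney n I) (A.\<Delta> j x)"
      using X.dgcog_tensor_coprod_pure[of "simplex_dgcog n" n CA "face_degree I" j d "frag_of I" x]
        simplex_coprod_graded[of n] A.deconcat_graded d' frag_of_simplex[OF I] x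
      by (simp add: simplex_dgcog_module simplex_coprod_face[OF I])
    also have "\<dots> = finprod (tensor (tensor (S n) A.T) (tensor (S n) A.T) d) (\<lambda>v. exchange (S n) A.T d
        (tensor_pure (S n) (S n) (face_degree (?L v), frag_of (?L v)) (face_degree (?R v), frag_of (?R v))) (A.\<Delta> j x)) I"
      unfolding alexander_whitney_def Let_def
      by (rule hom_finprod[OF SS.comm_group_axioms Q.comm_group_axioms X.exchange_hom_left[OF Dx d']])
         (use LR in \<open>auto intro!: X.MM.tensor_pure_closed frag_of_simplex\<close>)
    also have "\<dots> = finprod (tensor (tensor (S n) A.T) (tensor (S n) A.T) d) (\<lambda>v.
        exchange_pure (S n) A.T d (face_degree (?L v), frag_of (?L v)) (face_degree (?R v), frag_of (?R v)) (A.\<Delta> j x)) I"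
      by (rule Q.finprod_cong'[OF refl])
         (use ec X.exchange_tensor_pure[OF Dx d' LR(3) frag_of_simplex[OF LR(1)] frag_of_simplex[OF LR(2)]] in auto)
    finally have cop: "coprod (C n) d (tensor_pure (S n) A.T (face_degree I, frag_of I) (j, x))
      = finprod (tensor (tensor (S n) A.T) (tensor (S n) A.T) d) (\<lambda>v.
        exchange_pure (S n) A.T d (face_degree (?L v), frag_of (?L v)) (face_degree (?R v), frag_of (?R v)) (A.\<Delta> j x)) I" .
    have "tensor_map B.T B.T 0 0 f f d (coprod (C n) d (tensor_pure (S n) A.T (face_degree I, frag_of I) (j, x)))
      = finprod (B.TT d) (\<lambda>v. tensor_map B.T B.T 0 0 f f d
         (exchange_pure (S n) A.T d (face_degree (?L v), frag_of (?L v)) (face_degree (?R v), frag_of (?R v)) (A.\<Delta> j x))) I"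
      unfolding cop
      by (rule hom_finprod[OF Q.comm_group_axioms T.comm_group_axioms ffh]) (use ec in auto)
    also have "\<dots> = finprod (B.TT d) (\<lambda>v. pair_map F (?L v) (?R v) j (A.\<Delta> j x)) I"
      by (rule T.finprod_cong'[OF refl])
         (use tc tensor_map_exchange_face[OF r LR(1) LR(2) Dx deg] in auto)
    also have "\<dots> = free_lift (B.TT d) (\<lambda>(J, K). pair_map F J K j (A.\<Delta> j x)) (aw_chain I)"
    proof -
      have "free_lift (B.TT d) (\<lambda>(J, K). pair_map F J K j (A.\<Delta> j x)) (aw_chain I)
        = finprod (B.TT d) (\<lambda>v. free_lift (B.TT d) (\<lambda>(J, K). pair_map F J K j (A.\<Delta> j x))
             (frag_of (?L v, ?R v))) I"
        unfolding aw_chain_def by (rule T.free_lift_sum[OF fin]) (use tc in \<open>auto split: if_splits\<close>)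
      also have "\<dots> = finprod (B.TT d) (\<lambda>v. pair_map F (?L v) (?R v) j (A.\<Delta> j x)) I"
        by (rule T.finprod_cong'[OF refl]) (use tc in \<open>auto simp: T.free_lift_frag_of\<close>)
      finally show ?thesis by simp
    qed
    finally show ?thesis
      using represents_face[OF r I x d'[symmetric]] unfolding coproduct_rule_def d by metis
  qed
  show ?thesis
  proof (intro iffI ballI allI)
    fix I j x assume "\<forall>d. \<forall>t\<in>carrier (tensor (S n) A.T d). tensor_map B.T B.T 0 0 f f d (coprod (C n) d t) = B.\<Delta> d (f d t)"
      and I: "I \<in> faces n" and x: "x \<in> carrier (A.T j)"
    moreover have "tensor_pure (S n) A.T (face_degree I, frag_of I) (j, x) \<in> carrier (tensor (S n) A.T (j + face_degree I))"
      by (rule X.tensor_pure_closed[OF frag_of_simplex[OF I] x]) simp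
    ultimately show "coproduct_rule F I j x" using key[OF I x refl] by blast
  next
    fix d t assume *: "\<forall>I\<in>faces n. \<forall>j. \<forall>x\<in>carrier (A.T j). coproduct_rule F I j x"
      and t: "t \<in> carrier (tensor (S n) A.T d)"
    show "tensor_map B.T B.T 0 0 f f d (coprod (C n) d t) = B.\<Delta> d (f d t)"
    proof (rule simplex_tensor_hom_eq[OF B.TP.tensor_group _ _ _ t])
      show "(\<lambda>t. tensor_map B.T B.T 0 0 f f d (coprod (C n) d t)) \<in> hom (tensor (S n) A.T d) (B.TT d)"
        by (rule hom_comp[OF graded_maps_hom[OF C_coprod_graded] ffh]) simp
      show "(\<lambda>t. B.\<Delta> d (f d t)) \<in> hom (tensor (S n) A.T d) (B.TT d)"
        by (rule hom_comp[OF fh B.deconcat_hom])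
      show "tensor_map B.T B.T 0 0 f f d (coprod (C n) d (tensor_pure (S n) A.T (face_degree I, frag_of I) (j, x)))
        = B.\<Delta> d (f d (tensor_pure (S n) A.T (face_degree I, frag_of I) (j, x)))"
        if "I \<in> faces n" "face_degree I + j = d" "x \<in> carrier (A.T j)" for I j x
        using key[OF that(1,3), of d] * that by (simp add: add.commute)
    qed
  qed
qed

definition morphism_family :: "nat set set \<Rightarrow> (nat set \<Rightarrow> int \<Rightarrow> 'a words \<Rightarrow> 'b words) \<Rightarrow> bool" where
  "morphism_family Is F \<longleftrightarrow> family Is F
     \<and> (\<forall>I\<in>Is. \<forall>d. \<forall>x\<in>carrier (A.T d). coproduct_rule F I d x \<and> differential_rule F I d x)"

text \<open>All conditions on \<open>f\<close> are equations between homomorphisms, and it suffices to test them on the tensors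
  of a face with an element.\<close>

lemma dgcog_Hom_iff:
  assumes r: "represents n f F" and e: "\<And>d. f d \<in> extensional (carrier (tensor (S n) A.T d))"
  shows "f \<in> dgcog_Hom (C n) CB \<longleftrightarrow> morphism_family (faces n) F"
  using represents_graded[OF r] represents_family[OF r] diff_iff[OF r] coprod_iff[OF r] e
  unfolding dgcog_Hom_def morphism_family_def by (simp add: C_module) blast

definition face_family :: "nat \<Rightarrow> (int \<Rightarrow> (nat set \<Rightarrow>\<^sub>0 int, 'a words) tens \<Rightarrow> 'b words)
     \<Rightarrow> nat set \<Rightarrow> int \<Rightarrow> 'a words \<Rightarrow> 'b words" where
  "face_family n f I j x = f (face_degree I + j) (tensor_pure (S n) A.T (face_degree I, frag_of I) (j, x))"

lemma dgcog_Hom_represents: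
  assumes "f \<in> dgcog_Hom (C n) CB"
  shows "represents n f (face_family n f)" "f d \<in> extensional (carrier (tensor (S n) A.T d))"
  using assms by (auto simp: dgcog_Hom_def represents_def face_family_def graded_maps_def C_module)

lemma dgcog_Hom_family:
  assumes f: "f \<in> dgcog_Hom (C n) CB" shows "morphism_family (faces n) (face_family n f)"
  using dgcog_Hom_iff[OF dgcog_Hom_represents[OF f]] f by blast

lemma dgcog_Hom_eqI:
  assumes f: "f \<in> dgcog_Hom (C n) CB" and g: "g \<in> dgcog_Hom (C n) CB"
    and eq: "\<And>I j x. I \<in> faces n \<Longrightarrow> x \<in> carrier (A.T j) \<Longrightarrow> face_family n f I j x = face_family n g I j x"
  shows "f = g"
proof (rule ext)
  fix d
  have "represents n g (face_family n f)"
    using dgcog_Hom_represents(1)[OF g] eq by (simp add: represents_def)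
  then show "f d = g d"
    using represents_unique[OF dgcog_Hom_represents(1)[OF f]] dgcog_Hom_represents(2)[OF f, of d]
      dgcog_Hom_represents(2)[OF g, of d] by (auto intro: extensionalityI)
qed

end


section \<open>The simplicial structure\<close>

lemma face_degree_image: "inj_on \<theta> I \<Longrightarrow> face_degree (\<theta> ` I) = face_degree I"
  by (simp add: face_degree_def card_image)

lemma faces_image: "I \<in> faces m \<Longrightarrow> \<theta> \<in> {0..m} \<rightarrow> {0..n} \<Longrightarrow> \<theta> ` I \<in> faces n"
  by (fastforce simp: faces_def Pi_def)

lemma ord_maps_D: "\<theta> \<in> ord_maps m n \<Longrightarrow> \<theta> \<in> {0..m} \<rightarrow> {0..n}" "\<theta> \<in> ord_maps m n \<Longrightarrow> mono_on {0..m} \<theta>"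
  by (auto simp: ord_maps_def PiE_def)

lemma compose_ord_maps:
  assumes \<eta>: "\<eta> \<in> ord_maps l m" and \<theta>: "\<theta> \<in> ord_maps m n"
  shows "compose {0..l} \<theta> \<eta> \<in> ord_maps l n"
proof -
  have e: "\<eta> x \<in> {0..m}" if "x \<in> {0..l}" for x using ord_maps_D(1)[OF \<eta>] that by (rule funcset_mem)
  have t: "\<theta> x \<in> {0..n}" if "x \<in> {0..m}" for x using ord_maps_D(1)[OF \<theta>] that by (rule funcset_mem)
  have "mono_on {0..l} (compose {0..l} \<theta> \<eta>)"
  proof (rule mono_onI)
    fix x y assume xy: "x \<in> {0..l}" "y \<in> {0..l}" "x \<le> y"
    have "\<eta> x \<le> \<eta> y" by (rule mono_onD[OF ord_maps_D(2)[OF \<eta>] xy])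
    then have "\<theta> (\<eta> x) \<le> \<theta> (\<eta> y)" by (rule mono_onD[OF ord_maps_D(2)[OF \<theta>] e[OF xy(1)] e[OF xy(2)]])
    then show "compose {0..l} \<theta> \<eta> x \<le> compose {0..l} \<theta> \<eta> y" using xy by (simp add: compose_def)
  qed
  moreover have "compose {0..l} \<theta> \<eta> \<in> {0..l} \<rightarrow>\<^sub>E {0..n}"
    unfolding compose_def by (intro restrict_PiE_iff[THEN iffD2] ballI t e)
  ultimately show ?thesis by (simp add: ord_maps_def)
qed

lemma compose_image: "I \<subseteq> {0..l} \<Longrightarrow> compose {0..l} \<theta> \<eta> ` I = \<theta> ` \<eta> ` I"
  unfolding image_image by (rule image_cong[OF refl]) (auto simp: compose_def)

lemma inj_on_compose_iff:
  assumes "I \<subseteq> {0..l}"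
  shows "inj_on (compose {0..l} \<theta> \<eta>) I \<longleftrightarrow> inj_on \<eta> I \<and> inj_on \<theta> (\<eta> ` I)"
proof -
  have "inj_on (compose {0..l} \<theta> \<eta>) I \<longleftrightarrow> inj_on (\<theta> \<circ> \<eta>) I"
    by (rule inj_on_cong) (use assms in \<open>auto simp: compose_def\<close>)
  also have "\<dots> \<longleftrightarrow> inj_on \<eta> I \<and> inj_on \<theta> (\<eta> ` I)"
  proof (intro iffI conjI; (elim conjE)?)
    show "inj_on (\<theta> \<circ> \<eta>) I \<Longrightarrow> inj_on \<eta> I" by (rule inj_on_imageI2)
    show "inj_on (\<theta> \<circ> \<eta>) I \<Longrightarrow> inj_on \<theta> (\<eta> ` I)" by (rule inj_on_imageI)
    show "inj_on \<eta> I \<Longrightarrow> inj_on \<theta> (\<eta> ` I) \<Longrightarrow> inj_on (\<theta> \<circ> \<eta>) I" by (rule comp_inj_on)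
  qed
  finally show ?thesis .
qed

lemma keys_push_face: "J \<in> Poly_Mapping.keys (push_face \<theta> I) \<Longrightarrow> inj_on \<theta> I \<and> J = \<theta> ` I"
  by (auto simp: push_face_def split: if_splits)

lemma simplex_push_eq: "simplex_push \<theta> d = frag_extend (push_face \<theta>)"
  by (simp add: simplex_push_def push_face_def[abs_def])

lemma simplex_push_graded:
  assumes "\<theta> \<in> {0..m} \<rightarrow> {0..n}"
  shows "simplex_push \<theta> \<in> graded_maps 0 (simplex_module m) (simplex_module n)"
  unfolding graded_maps_def mem_Collect_eq
proof (intro allI homI)
  fix i a b assume a: "a \<in> carrier (simplex_module m i)"
  have "J \<in> faces n \<and> face_degree J = i" if J: "J \<in> Poly_Mapping.keys (frag_extend (push_face \<theta>) a)" for J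
  proof -
    obtain I where I: "I \<in> Poly_Mapping.keys a" "J \<in> Poly_Mapping.keys (push_face \<theta> I)"
      using subsetD[OF keys_frag_extend J] by blast
    then have "I \<in> faces m" "face_degree I = i" using a by (auto simp: simplex_module_carrier)
    then show ?thesis using keys_push_face[OF I(2)] faces_image[OF _ assms] face_degree_image by auto
  qed
  then show "simplex_push \<theta> i a \<in> carrier (simplex_module n (i + 0))"
    by (auto simp: simplex_module_carrier simplex_push_eq)
  show "simplex_push \<theta> i (a \<otimes>\<^bsub>simplex_module m i\<^esub> b)
    = simplex_push \<theta> i a \<otimes>\<^bsub>simplex_module n (i + 0)\<^esub> simplex_push \<theta> i b"
    by (simp add: simplex_push_eq simplex_module_def frag_extend_add)
qed

context graded_pair_maps
begin

lemma tensor_map_one_left: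
  assumes f: "f \<in> graded_maps p M M'" and g: "g \<in> graded_maps q N N'"
    and f1: "\<And>i x. x \<in> carrier (M i) \<Longrightarrow> f i x = \<one>\<^bsub>M' (i + p)\<^esub>"
    and t: "t \<in> carrier (tensor M N n)" and m: "m = n + p + q"
  shows "tensor_map M' N' p q f g n t = \<one>\<^bsub>tensor M' N' m\<^esub>"
proof (rule tensor_hom_eq[OF target.tensor_group tensor_map_hom[OF f g m] hom_one_pointwise _ t])
  interpret K: comm_group "tensor M' N' m" by (rule target.tensor_group)
  show "group (tensor M' N' m)" ..
  fix i x j y assume *: "i + j = n" "x \<in> carrier (M i)" "y \<in> carrier (N j)"
  have "m = i + p + (j + q)" using * m by simp
  note one = target.tensor_pure_one_left[OF graded_maps_closed[OF g *(3) refl] this]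
  show "tensor_map M' N' p q f g n (tensor_pure M N (i, x) (j, y)) = \<one>\<^bsub>tensor M' N' m\<^esub>"
    unfolding tensor_map_pure[OF f g m *] f1[OF *(2)] one by simp
qed

lemma tensor_map_one_right:
  assumes f: "f \<in> graded_maps p M M'" and g: "g \<in> graded_maps q N N'"
    and g1: "\<And>i x. x \<in> carrier (N i) \<Longrightarrow> g i x = \<one>\<^bsub>N' (i + q)\<^esub>"
    and t: "t \<in> carrier (tensor M N n)" and m: "m = n + p + q"
  shows "tensor_map M' N' p q f g n t = \<one>\<^bsub>tensor M' N' m\<^esub>"
proof (rule tensor_hom_eq[OF target.tensor_group tensor_map_hom[OF f g m] hom_one_pointwise _ t])
  interpret K: comm_group "tensor M' N' m" by (rule target.tensor_group)
  show "group (tensor M' N' m)" ..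
  fix i x j y assume *: "i + j = n" "x \<in> carrier (M i)" "y \<in> carrier (N j)"
  have "m = i + p + (j + q)" using * m by simp
  note one = target.tensor_pure_one_right[OF graded_maps_closed[OF f *(2) refl] this]
  show "tensor_map M' N' p q f g n (tensor_pure M N (i, x) (j, y)) = \<one>\<^bsub>tensor M' N' m\<^esub>"
    unfolding tensor_map_pure[OF f g m *] g1[OF *(3)] one by simp
qed

end

context bar_pair
begin

definition pullback_family :: "(nat \<Rightarrow> nat) \<Rightarrow> (nat set \<Rightarrow> int \<Rightarrow> 'a words \<Rightarrow> 'b words)
     \<Rightarrow> nat set \<Rightarrow> int \<Rightarrow> 'a words \<Rightarrow> 'b words" where
  "pullback_family \<theta> F I d x = (if inj_on \<theta> I then F (\<theta> ` I) d x else \<one>\<^bsub>B.T (d + face_degree I)\<^esub>)"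

text \<open>The action of a monotone map on higher morphisms; on families it is \<open>pullback_family\<close>.\<close>

definition pullback :: "nat \<Rightarrow> nat \<Rightarrow> (nat \<Rightarrow> nat) \<Rightarrow> (int \<Rightarrow> (nat set \<Rightarrow>\<^sub>0 int, 'a words) tens \<Rightarrow> 'b words)
     \<Rightarrow> int \<Rightarrow> (nat set \<Rightarrow>\<^sub>0 int, 'a words) tens \<Rightarrow> 'b words" where
  "pullback m n \<theta> f = (\<lambda>d. restrict (\<lambda>t. f d (tensor_map (S n) A.T 0 0 (simplex_push \<theta>) graded_id d t))
     (carrier (tensor (S m) A.T d)))"

lemma represents_pullback:
  assumes \<theta>: "\<theta> \<in> {0..m} \<rightarrow> {0..n}" and r: "represents n f F"
  shows "represents m (pullback m n \<theta> f) (pullback_family \<theta> F)"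
  unfolding represents_def
proof (intro conjI allI ballI)
  note pg = simplex_push_graded[OF \<theta>]
  have fh: "f d \<in> hom (tensor (S n) A.T d) (B.T d)" for d using r by (simp add: represents_def)
  fix d show "pullback m n \<theta> f d \<in> hom (tensor (S m) A.T d) (B.T d)"
  proof (rule hom_transfer[OF graded_module_group[OF X.graded_module_tensor]])
    show "(\<lambda>t. f d (tensor_map (S n) A.T 0 0 (simplex_push \<theta>) graded_id d t)) \<in> hom (tensor (S m) A.T d) (B.T d)"
      by (rule hom_comp[OF XS.tensor_map_hom[OF pg graded_maps_id] fh]) simp
  qed (simp add: pullback_def)
next
  fix I j x assume I: "I \<in> faces m" and x: "x \<in> carrier (A.T j)"
  let ?d = "face_degree I + j"
  note pg = simplex_push_graded[OF \<theta>]
  note c = X.tensor_pure_closed[OF frag_of_simplex[OF I] x refl]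
  interpret K: comm_group "tensor (S n) A.T ?d" by (rule X.tensor_group)
  have p: "push_face \<theta> I \<in> carrier (S n (face_degree I))"
    using graded_maps_closed[OF pg frag_of_simplex[OF I], of "face_degree I"] by (simp add: simplex_push_eq)
  have "tensor_map (S n) A.T 0 0 (simplex_push \<theta>) graded_id ?d (tensor_pure (S m) A.T (face_degree I, frag_of I) (j, x))
    = tensor_pure (S n) A.T (face_degree I, push_face \<theta> I) (j, x)"
    using XS.tensor_map_pure[OF pg graded_maps_id _ refl frag_of_simplex[OF I] x, of ?d]
      X.tensor_pure_closed[OF p x refl] by (simp add: simplex_push_eq)
  then have "pullback m n \<theta> f ?d (tensor_pure (S m) A.T (face_degree I, frag_of I) (j, x))
    = f ?d (tensor_pure (S n) A.T (face_degree I, push_face \<theta> I) (j, x))"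
    using c by (simp add: pullback_def)
  also have "\<dots> = pullback_family \<theta> F I j x"
  proof (cases "inj_on \<theta> I")
    case True
    then show ?thesis
      using represents_face[OF r faces_image[OF I \<theta>] x, of ?d] face_degree_image[OF True]
      by (simp add: pullback_family_def push_face_def)
  next
    case False
    interpret L: comm_group "B.T ?d" by (rule B.Tbar_group)
    have "f ?d \<one>\<^bsub>tensor (S n) A.T ?d\<^esub> = \<one>\<^bsub>B.T ?d\<^esub>"
      by (rule hom_one[OF _ K.is_group L.is_group]) (use r in \<open>simp add: represents_def\<close>)
    moreover have "tensor_pure (S n) A.T (face_degree I, push_face \<theta> I) (j, x) = \<one>\<^bsub>tensor (S n) A.T ?d\<^esub>"
      using X.tensor_pure_one_left[OF x refl, of n "face_degree I"] False by (simp add: push_face_def simplex_module_def)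
    ultimately show ?thesis using False by (simp add: pullback_family_def add.commute)
  qed
  finally show "pullback m n \<theta> f ?d (tensor_pure (S m) A.T (face_degree I, frag_of I) (j, x)) = pullback_family \<theta> F I j x" .
qed

text \<open>The two rules are compatible with pulling back along a monotone map, because pushing faces
  forward is a map of dg-coalgebras. In the injective case the rules for \<open>I\<close> and for its image are
  equivalent, so that they can be transported in both directions.\<close>

context
  fixes \<theta> F G I Is and U :: "nat set"
  assumes I: "finite I" "I \<noteq> {}" and mono: "mono_on U \<theta>" "I \<subseteq> U"
    and F: "family Is F" and Is: "\<And>J. J \<subseteq> I \<Longrightarrow> J \<noteq> {} \<Longrightarrow> inj_on \<theta> J \<Longrightarrow> \<theta> ` J \<in> Is"
    and G: "\<And>J. J \<subseteq> I \<Longrightarrow> J \<noteq> {} \<Longrightarrow> G J \<in> graded_maps (face_degree J) A.T B.T"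
    and GF: "\<And>J d x. J \<subseteq> I \<Longrightarrow> J \<noteq> {} \<Longrightarrow> x \<in> carrier (A.T d) \<Longrightarrow> G J d x = pullback_family \<theta> F J d x"
begin

lemma pullback_boundary:
  assumes x: "x \<in> carrier (A.T d)" and e: "e = d + face_degree I + 1"
  shows "free_lift (B.T e) (\<lambda>J. G J d x) (face_boundary I)
    = free_lift (B.T e) (\<lambda>J. F J d x) (frag_extend face_boundary (push_face \<theta> I))"
proof -
  interpret K: comm_group "B.T e" by (rule B.Tbar_group)
  have *: "J \<subseteq> I" "J \<noteq> {}" "d + face_degree J = e" if "J \<in> Poly_Mapping.keys (face_boundary I)" for J
    using keys_face_boundary[OF I(1) that] e by auto
  have Fc: "F K d x \<in> carrier (B.T e)"
    if J: "J \<in> Poly_Mapping.keys (face_boundary I)" and K: "K \<in> Poly_Mapping.keys (push_face \<theta> J)" for J K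
    using family_closed[OF F Is[OF *(1,2)[OF J]] x] keys_push_face[OF K] *(3)[OF J] face_degree_image by auto
  have "free_lift (B.T e) (\<lambda>J. G J d x) (face_boundary I)
    = free_lift (B.T e) (\<lambda>J. free_lift (B.T e) (\<lambda>K. F K d x) (push_face \<theta> J)) (face_boundary I)"
  proof (rule K.free_lift_cong)
    fix J assume J: "J \<in> Poly_Mapping.keys (face_boundary I)"
    show "G J d x = free_lift (B.T e) (\<lambda>K. F K d x) (push_face \<theta> J)"
      using GF[OF *(1,2)[OF J] x] Fc[OF J] K.free_lift_frag_of[of "\<lambda>K. F K d x" "\<theta> ` J"] *(3)[OF J]
      by (auto simp: pullback_family_def push_face_def split: if_splits)
    show "free_lift (B.T e) (\<lambda>K. F K d x) (push_face \<theta> J) \<in> carrier (B.T e)"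
      by (rule K.free_lift_closed) (rule Fc[OF J])
  qed
  also have "\<dots> = free_lift (B.T e) (\<lambda>K. F K d x) (frag_extend (push_face \<theta>) (face_boundary I))"
    by (rule K.free_lift_extend[symmetric]) (rule Fc)
  finally show ?thesis using push_face_boundary[OF I(1) mono] by simp
qed

lemma pullback_aw:
  assumes t: "t \<in> carrier (A.TT d)" and e: "e = d + face_degree I"
  shows "free_lift (B.TT e) (\<lambda>(J, K). pair_map G J K d t) (aw_chain I)
    = free_lift (B.TT e) (\<lambda>(J, K). pair_map F J K d t)
        (frag_extend aw_chain (push_face \<theta> I))"
proof -
  interpret T: comm_group "B.TT e" by (rule B.TP.tensor_group)
  let ?f = "\<lambda>(J, K). pair_map F J K d t"
  let ?g = "\<lambda>(J, K). pair_map G J K d t"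
  let ?p = "\<lambda>(J, K). if inj_on \<theta> J \<and> inj_on \<theta> K then frag_of (\<theta> ` J, \<theta> ` K) else 0"
  have fc: "?f p \<in> carrier (B.TT e)" if s: "s \<in> Poly_Mapping.keys (aw_chain I)" and p: "p \<in> Poly_Mapping.keys (?p s)" for s p
  proof -
    obtain J K where JK: "s = (J, K)" by (cases s)
    note k = keys_aw_chain_props[OF I(1) s[unfolded JK]]
    have i: "inj_on \<theta> J" "inj_on \<theta> K" and p': "p = (\<theta> ` J, \<theta> ` K)" using p by (auto simp: JK split: if_splits)
    show ?thesis unfolding p' prod.case
      by (rule AB.MP.tensor_map_closed[OF family_graded[OF F Is[OF k(1,3) i(1)]] family_graded[OF F Is[OF k(2,4) i(2)]] t])
         (use k(5) e face_degree_image[OF i(1)] face_degree_image[OF i(2)] in simp)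
  qed
  have "free_lift (B.TT e) ?g (aw_chain I) = free_lift (B.TT e) (\<lambda>s. free_lift (B.TT e) ?f (?p s)) (aw_chain I)"
  proof (rule T.free_lift_cong)
    fix s assume s: "s \<in> Poly_Mapping.keys (aw_chain I)"
    show "free_lift (B.TT e) ?f (?p s) \<in> carrier (B.TT e)"
      by (rule T.free_lift_closed) (rule fc[OF s])
    obtain J K where JK: "s = (J, K)" by (cases s)
    note k = keys_aw_chain_props[OF I(1) s[unfolded JK]]
    have ee: "e = d + face_degree J + face_degree K" using k(5) e by simp
    note GJ = G[OF k(1,3)] and GK = G[OF k(2,4)]
    show "?g s = free_lift (B.TT e) ?f (?p s)"
    proof (cases "inj_on \<theta> J \<and> inj_on \<theta> K")
      case True
      have ps: "?p s = frag_of (\<theta> ` J, \<theta> ` K)" using True by (simp add: JK)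
      have FJ: "F (\<theta> ` J) \<in> graded_maps (face_degree J) A.T B.T" and FK: "F (\<theta> ` K) \<in> graded_maps (face_degree K) A.T B.T"
        using family_graded[OF F Is[OF k(1,3)]] family_graded[OF F Is[OF k(2,4)]] True face_degree_image by metis+
      have "?g s = tensor_map B.T B.T (face_degree J) (face_degree K) (F (\<theta> ` J)) (F (\<theta> ` K)) d t"
        unfolding JK prod.case
        by (rule AB.MP.tensor_map_cong[OF GJ FJ GK FK _ _ t])
           (use GF[OF k(1,3)] GF[OF k(2,4)] True in \<open>auto simp: pullback_family_def\<close>)
      also have "\<dots> = ?f (\<theta> ` J, \<theta> ` K)" using True face_degree_image by simp
      also have "\<dots> = free_lift (B.TT e) ?f (?p s)"
        unfolding ps by (rule T.free_lift_frag_of[symmetric], rule fc[OF s]) (simp add: ps)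
      finally show ?thesis .
    next
      case False
      then have ps: "?p s = 0" by (simp add: JK)
      have "?g s = \<one>\<^bsub>B.TT e\<^esub>"
      proof (cases "inj_on \<theta> J")
        case True
        with False have "\<not> inj_on \<theta> K" by simp
        then show ?thesis unfolding JK prod.case
          by (intro AB.MP.tensor_map_one_right[OF GJ GK _ t ee]) (use GF[OF k(2,4)] in \<open>simp add: pullback_family_def\<close>)
      next
        case False
        then show ?thesis unfolding JK prod.case
          by (intro AB.MP.tensor_map_one_left[OF GJ GK _ t ee]) (use GF[OF k(1,3)] in \<open>simp add: pullback_family_def\<close>)
      qed
      then show ?thesis by (simp only: ps T.free_lift_zero)
    qed
  qed
  also have "\<dots> = free_lift (B.TT e) ?f (frag_extend ?p (aw_chain I))"
    by (rule T.free_lift_extend[symmetric]) (rule fc)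
  finally show ?thesis using push_face_aw[OF I(1) mono] by simp
qed

lemma pullback_rules_inj:
  assumes x: "x \<in> carrier (A.T d)" and i: "inj_on \<theta> I"
  shows "coproduct_rule G I d x \<longleftrightarrow> coproduct_rule F (\<theta> ` I) d x"
    "differential_rule G I d x \<longleftrightarrow> differential_rule F (\<theta> ` I) d x"
proof -
  have Dx: "DA d x \<in> carrier (A.T (d + 1))" by (rule graded_maps_closed[OF DA_graded x refl])
  have p: "push_face \<theta> I = frag_of (\<theta> ` I)" using i by (simp add: push_face_def)
  have g: "G I d x = F (\<theta> ` I) d x" "G I (d + 1) (DA d x) = F (\<theta> ` I) (d + 1) (DA d x)"
    using GF[OF order_refl I(2) x] GF[OF order_refl I(2) Dx] i by (auto simp: pullback_family_def)
  show "coproduct_rule G I d x \<longleftrightarrow> coproduct_rule F (\<theta> ` I) d x"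
    unfolding coproduct_rule_def pullback_aw[OF A.deconcat_closed[OF x] refl] p g face_degree_image[OF i] by simp
  show "differential_rule G I d x \<longleftrightarrow> differential_rule F (\<theta> ` I) d x"
    unfolding differential_rule_def pullback_boundary[OF x refl] p g face_degree_image[OF i] by simp
qed

lemma pullback_rules_degenerate:
  assumes x: "x \<in> carrier (A.T d)" and i: "\<not> inj_on \<theta> I"
  shows "coproduct_rule G I d x" "differential_rule G I d x"
proof -
  have Dx: "DA d x \<in> carrier (A.T (d + 1))" by (rule graded_maps_closed[OF DA_graded x refl])
  have p: "push_face \<theta> I = 0" using i by (simp add: push_face_def)
  let ?e = "d + face_degree I"
  have ee: "d + 1 + face_degree I = ?e + 1" by simp
  have g: "G I d x = \<one>\<^bsub>B.T ?e\<^esub>" "G I (d + 1) (DA d x) = \<one>\<^bsub>B.T (?e + 1)\<^esub>"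
    using GF[OF order_refl I(2) x] GF[OF order_refl I(2) Dx] i unfolding pullback_family_def ee by auto
  interpret K: comm_group "B.T ?e" by (rule B.Tbar_group)
  interpret K1: comm_group "B.T (?e + 1)" by (rule B.Tbar_group)
  interpret T: comm_group "B.TT ?e" by (rule B.TP.tensor_group)
  have "B.\<Delta> ?e \<one>\<^bsub>B.T ?e\<^esub> = \<one>\<^bsub>B.TT ?e\<^esub>"
    by (rule hom_one[OF B.deconcat_hom K.is_group T.is_group])
  then show "coproduct_rule G I d x"
    unfolding coproduct_rule_def pullback_aw[OF A.deconcat_closed[OF x] refl] p g by simp
  have "DB ?e \<one>\<^bsub>B.T ?e\<^esub> = \<one>\<^bsub>B.T (?e + 1)\<^esub>"
    by (rule hom_one[OF graded_maps_hom[OF DB_graded refl] K.is_group K1.is_group])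
  then show "differential_rule G I d x"
    unfolding differential_rule_def pullback_boundary[OF x refl] p g by simp
qed

end

lemma pullback_Hom:
  assumes \<theta>: "\<theta> \<in> ord_maps m n" and f: "f \<in> dgcog_Hom (C n) CB"
  shows "pullback m n \<theta> f \<in> dgcog_Hom (C m) CB"
    and "\<And>I d x. I \<in> faces m \<Longrightarrow> x \<in> carrier (A.T d)
      \<Longrightarrow> face_family m (pullback m n \<theta> f) I d x = pullback_family \<theta> (face_family n f) I d x"
proof -
  note \<theta>' = ord_maps_D[OF \<theta>]
  let ?F = "face_family n f" and ?G = "pullback_family \<theta> (face_family n f)"
  have r: "represents m (pullback m n \<theta> f) ?G"
    by (rule represents_pullback[OF \<theta>'(1) dgcog_Hom_represents(1)[OF f]])
  have fam: "family (faces m) ?G" by (rule represents_family[OF r])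
  have mf: "morphism_family (faces n) ?F" by (rule dgcog_Hom_family[OF f])
  then have F: "family (faces n) ?F" by (simp add: morphism_family_def)
  have "coproduct_rule ?G I d x \<and> differential_rule ?G I d x" if I: "I \<in> faces m" and x: "x \<in> carrier (A.T d)" for I d x
  proof -
    have sub: "I \<subseteq> {0..m}" "I \<noteq> {}" using I by (auto simp: faces_def)
    have a: "\<theta> ` J \<in> faces n" if "J \<subseteq> I" "J \<noteq> {}" "inj_on \<theta> J" for J
      by (rule faces_image[OF faces_subset[OF I that(1,2)] \<theta>'(1)])
    have b: "?G J \<in> graded_maps (face_degree J) A.T B.T" if "J \<subseteq> I" "J \<noteq> {}" for J
      by (rule family_graded[OF fam faces_subset[OF I that]])
    show ?thesis
    proof (cases "inj_on \<theta> I")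
      case True
      have "coproduct_rule ?F (\<theta> ` I) d x \<and> differential_rule ?F (\<theta> ` I) d x"
        using mf faces_image[OF I \<theta>'(1)] x by (simp add: morphism_family_def)
      then show ?thesis
        using pullback_rules_inj[OF finite_face[OF I] sub(2) \<theta>'(2) sub(1) F a b refl x True] by blast
    next
      case False
      show ?thesis
        using pullback_rules_degenerate[OF finite_face[OF I] sub(2) \<theta>'(2) sub(1) F a b refl x False] by blast
    qed
  qed
  then have "morphism_family (faces m) ?G" using fam by (simp add: morphism_family_def)
  then show "pullback m n \<theta> f \<in> dgcog_Hom (C m) CB"
    by (subst dgcog_Hom_iff[OF r]) (simp_all add: pullback_def)
  show "face_family m (pullback m n \<theta> f) I d x = pullback_family \<theta> (face_family n f) I d x"
    if "I \<in> faces m" "x \<in> carrier (A.T d)" for I d x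
    using represents_face[OF r that refl] by (simp add: face_family_def)
qed

definition HOM where
  "HOM = \<lparr>simplices = (\<lambda>n. dgcog_Hom (C n) CB), act = pullback\<rparr>"

lemma simplicial_set_HOM: "simplicial_set HOM"
  unfolding simplicial_set_def
proof (intro conjI allI ballI)
  show "act HOM m n \<theta> \<in> simplices HOM n \<rightarrow> simplices HOM m" if "\<theta> \<in> ord_maps m n" for m n \<theta>
    using pullback_Hom(1)[OF that] by (simp add: HOM_def)
next
  fix n f assume "f \<in> simplices HOM n"
  then have f: "f \<in> dgcog_Hom (C n) CB" by (simp add: HOM_def)
  have id: "restrict id {0..n} \<in> ord_maps n n" by (simp add: ord_maps_def mono_on_def)
  have "pullback n n (restrict id {0..n}) f = f"
  proof (rule dgcog_Hom_eqI[OF pullback_Hom(1)[OF id f] f])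
    fix I j x assume I: "I \<in> faces n" and x: "x \<in> carrier (A.T j)"
    have I': "I \<subseteq> {0..n}" using I by (simp add: faces_def)
    have "restrict id {0..n} ` I = id ` I" by (rule image_cong[OF refl]) (use I' in auto)
    moreover have "inj_on (restrict id {0..n}) I \<longleftrightarrow> inj_on id I"
      by (rule inj_on_cong) (use I' in auto)
    ultimately show "face_family n (pullback n n (restrict id {0..n}) f) I j x = face_family n f I j x"
      using pullback_Hom(2)[OF id f I x] by (simp add: pullback_family_def)
  qed
  then show "act HOM n n (restrict id {0..n}) f = f" by (simp add: HOM_def)
next
  fix l m n \<eta> \<theta> f assume \<eta>: "\<eta> \<in> ord_maps l m" and \<theta>: "\<theta> \<in> ord_maps m n" and "f \<in> simplices HOM n"
  then have f: "f \<in> dgcog_Hom (C n) CB" by (simp add: HOM_def)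
  note c = compose_ord_maps[OF \<eta> \<theta>]
  note f' = pullback_Hom(1)[OF \<theta> f]
  have "pullback l n (compose {0..l} \<theta> \<eta>) f = pullback l m \<eta> (pullback m n \<theta> f)"
  proof (rule dgcog_Hom_eqI[OF pullback_Hom(1)[OF c f] pullback_Hom(1)[OF \<eta> f']])
    fix I j x assume I: "I \<in> faces l" and x: "x \<in> carrier (A.T j)"
    have sub: "I \<subseteq> {0..l}" using I by (simp add: faces_def)
    show "face_family l (pullback l n (compose {0..l} \<theta> \<eta>) f) I j x = face_family l (pullback l m \<eta> (pullback m n \<theta> f)) I j x"
      unfolding pullback_Hom(2)[OF c f I x] pullback_Hom(2)[OF \<eta> f' I x]
      using pullback_Hom(2)[OF \<theta> f faces_image[OF I ord_maps_D(1)[OF \<eta>]] x]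
      by (simp add: pullback_family_def compose_image[OF sub] inj_on_compose_iff[OF sub] face_degree_image)
  qed
  then show "act HOM l n (compose {0..l} \<theta> \<eta>) f = act HOM l m \<eta> (act HOM m n \<theta> f)" by (simp add: HOM_def)
qed

end


section \<open>Families determined by their one-letter parts\<close>

text \<open>Interchange of summation over \<open>v \<le> u\<close>.\<close>

lemma (in comm_group) finprod_triangle:
  fixes I :: "nat set"
  assumes I: "finite I" and c: "\<And>v u. v \<in> I \<Longrightarrow> u \<in> I \<Longrightarrow> v \<le> u \<Longrightarrow> c v u \<in> carrier G"
  shows "finprod G (\<lambda>v. finprod G (c v) {u \<in> I. v \<le> u}) I = finprod G (\<lambda>u. finprod G (\<lambda>v. c v u) {v \<in> I. v \<le> u}) I"
proof -
  let ?c = "\<lambda>v u. if v \<le> u then c v u else \<one>"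
  have cc: "?c v u \<in> carrier G" if "v \<in> I" "u \<in> I" for v u using c that by simp
  have "finprod G (\<lambda>v. finprod G (c v) {u \<in> I. v \<le> u}) I = finprod G (\<lambda>v. finprod G (?c v) I) I"
  proof (rule finprod_cong'[OF refl])
    show "(\<lambda>v. finprod G (?c v) I) \<in> I \<rightarrow> carrier G" using cc by (auto intro!: finprod_closed)
    show "finprod G (c v) {u \<in> I. v \<le> u} = finprod G (?c v) I" if "v \<in> I" for v
      by (rule finprod_mono_neutral_cong_left) (use I cc that in auto)
  qed
  also have "\<dots> = finprod G (\<lambda>u. finprod G (\<lambda>v. ?c v u) I) I"
    by (rule finprod_swap[OF I I]) (rule cc)
  also have "\<dots> = finprod G (\<lambda>u. finprod G (\<lambda>v. c v u) {v \<in> I. v \<le> u}) I"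
  proof (rule finprod_cong'[OF refl])
    show "(\<lambda>u. finprod G (\<lambda>v. c v u) {v \<in> I. v \<le> u}) \<in> I \<rightarrow> carrier G" using c by (auto intro!: finprod_closed)
    show "finprod G (\<lambda>v. ?c v u) I = finprod G (\<lambda>v. c v u) {v \<in> I. v \<le> u}" if "u \<in> I" for u
      by (rule finprod_mono_neutral_cong_right) (use I cc that in auto)
  qed
  finally show ?thesis .
qed

lemma (in comm_group) free_lift_sum_frag_of:
  assumes A: "finite A" and b: "\<And>a. a \<in> A \<Longrightarrow> b (h a) \<in> carrier G"
  shows "free_lift G b (\<Sum>a\<in>A. frag_of (h a)) = finprod G (\<lambda>a. b (h a)) A"
proof -
  have "free_lift G b (\<Sum>a\<in>A. frag_of (h a)) = finprod G (\<lambda>a. free_lift G b (frag_of (h a))) A"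
    by (rule free_lift_sum[OF A]) (use b in \<open>auto split: if_splits\<close>)
  also have "\<dots> = finprod G (\<lambda>a. b (h a)) A"
    by (rule finprod_cong'[OF refl]) (use b in \<open>auto simp: free_lift_frag_of\<close>)
  finally show ?thesis .
qed

lemma (in comm_group) free_lift_sum_frags:
  assumes "finite A" "\<And>a. a \<in> A \<Longrightarrow> b a \<in> carrier G"
  shows "free_lift G b (\<Sum>a\<in>A. frag_of a) = finprod G b A"
  using free_lift_sum_frag_of[of A b "\<lambda>a. a"] assms by simp

lemma keys_sum_frag_of: "Poly_Mapping.keys (\<Sum>a\<in>A. frag_of a) \<subseteq> A"
  using keys_sum[of frag_of A] by auto

context graded_pair_maps
begin

lemma tensor_map_sum_left:
  assumes A: "finite A" and f: "\<And>s. s \<in> A \<Longrightarrow> f s \<in> graded_maps p M M'" and g: "g \<in> graded_maps q N N'"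
    and t: "t \<in> carrier (tensor M N n)" and m: "m = n + p + q"
  shows "tensor_map M' N' p q (\<lambda>i x. finprod (M' (i + p)) (\<lambda>s. f s i x) A) g n t
    = finprod (tensor M' N' m) (\<lambda>s. tensor_map M' N' p q (f s) g n t) A"
proof -
  interpret K: comm_group "tensor M' N' m" by (rule target.tensor_group)
  let ?a = "\<Sum>a\<in>A. frag_of a"
  have fa: "f s \<in> graded_maps p M M'" if "s \<in> Poly_Mapping.keys ?a" for s
    by (rule f[OF subsetD[OF keys_sum_frag_of that]])
  have "tensor_map M' N' p q (\<lambda>i x. finprod (M' (i + p)) (\<lambda>s. f s i x) A) g n t
    = tensor_map M' N' p q (\<lambda>i x. free_lift (M' (i + p)) (\<lambda>s. f s i x) ?a) g n t"
  proof (rule tensor_map_cong[OF graded_maps_sum[OF f target.M] graded_maps_combination[where f = f, OF fa target.M] g g _ refl t])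
    fix i x assume x: "x \<in> carrier (M i)"
    interpret L: comm_group "M' (i + p)" by (rule graded_moduleD[OF target.M])
    show "finprod (M' (i + p)) (\<lambda>s. f s i x) A = free_lift (M' (i + p)) (\<lambda>s. f s i x) ?a"
      by (rule L.free_lift_sum_frags[symmetric, OF A]) (rule graded_maps_closed[OF f x refl])
  qed
  also have "\<dots> = free_lift (tensor M' N' m) (\<lambda>s. tensor_map M' N' p q (f s) g n t) ?a"
    by (rule tensor_map_combination_left[where f = f, OF fa g t m])
  also have "\<dots> = finprod (tensor M' N' m) (\<lambda>s. tensor_map M' N' p q (f s) g n t) A"
    by (rule K.free_lift_sum_frags[OF A]) (rule tensor_map_closed[OF f g t m])
  finally show ?thesis .
qed

lemma tensor_map_sum_right:
  assumes A: "finite A" and f: "f \<in> graded_maps p M M'" and g: "\<And>s. s \<in> A \<Longrightarrow> g s \<in> graded_maps q N N'"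
    and t: "t \<in> carrier (tensor M N n)" and m: "m = n + p + q"
  shows "tensor_map M' N' p q f (\<lambda>i x. finprod (N' (i + q)) (\<lambda>s. g s i x) A) n t
    = finprod (tensor M' N' m) (\<lambda>s. tensor_map M' N' p q f (g s) n t) A"
proof -
  interpret K: comm_group "tensor M' N' m" by (rule target.tensor_group)
  let ?a = "\<Sum>a\<in>A. frag_of a"
  have ga: "g s \<in> graded_maps q N N'" if "s \<in> Poly_Mapping.keys ?a" for s
    by (rule g[OF subsetD[OF keys_sum_frag_of that]])
  have "tensor_map M' N' p q f (\<lambda>i x. finprod (N' (i + q)) (\<lambda>s. g s i x) A) n t
    = tensor_map M' N' p q f (\<lambda>i x. free_lift (N' (i + q)) (\<lambda>s. g s i x) ?a) n t"
  proof (rule tensor_map_cong[OF f f graded_maps_sum[OF g target.N] graded_maps_combination[where f = g, OF ga target.N] refl _ t])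
    fix i x assume x: "x \<in> carrier (N i)"
    interpret L: comm_group "N' (i + q)" by (rule graded_moduleD[OF target.N])
    show "finprod (N' (i + q)) (\<lambda>s. g s i x) A = free_lift (N' (i + q)) (\<lambda>s. g s i x) ?a"
      by (rule L.free_lift_sum_frags[symmetric, OF A]) (rule graded_maps_closed[OF g x refl])
  qed
  also have "\<dots> = free_lift (tensor M' N' m) (\<lambda>s. tensor_map M' N' p q f (g s) n t) ?a"
    by (rule tensor_map_combination_right[where g = g, OF f ga t m])
  also have "\<dots> = finprod (tensor M' N' m) (\<lambda>s. tensor_map M' N' p q f (g s) n t) A"
    by (rule K.free_lift_sum_frags[OF A]) (rule tensor_map_closed[OF f g t m])
  finally show ?thesis .
qed

end

lemma (in comm_group) free_lift_aw_chain:
  assumes I: "finite I" and b: "\<And>v. v \<in> I \<Longrightarrow> b ({u \<in> I. u \<le> v}, {u \<in> I. v \<le> u}) \<in> carrier G"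
  shows "free_lift G b (aw_chain I) = finprod G (\<lambda>v. b ({u \<in> I. u \<le> v}, {u \<in> I. v \<le> u})) I"
  unfolding aw_chain_def
  by (rule free_lift_sum_frag_of[where b = b and h = "\<lambda>v. ({u \<in> I. u \<le> v}, {u \<in> I. v \<le> u})", OF I b])

text \<open>Sets of simplices that form a simplicial complex: the faces of a simplex and those of a horn.\<close>

definition face_closed :: "nat set set \<Rightarrow> bool" where
  "face_closed Is \<longleftrightarrow> (\<forall>I\<in>Is. finite I \<and> I \<noteq> {} \<and> (\<forall>J. J \<subseteq> I \<and> J \<noteq> {} \<longrightarrow> J \<in> Is))"

lemma face_closedD:
  assumes "face_closed Is" "I \<in> Is"
  shows "finite I" "I \<noteq> {}" "\<And>J. J \<subseteq> I \<Longrightarrow> J \<noteq> {} \<Longrightarrow> J \<in> Is"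
  using assms unfolding face_closed_def by blast+

lemma face_closed_faces: "face_closed (faces n)"
  unfolding face_closed_def
proof (intro ballI conjI allI impI; (elim conjE)?)
  fix I assume I: "I \<in> faces n"
  show "finite I" by (rule finite_face[OF I])
  show "I \<noteq> {}" using I by (simp add: faces_def)
  fix J assume "J \<subseteq> I" "J \<noteq> {}"
  then show "J \<in> faces n" by (rule faces_subset[OF I])
qed

context bar_pair
begin

definition aw_sum :: "(nat set \<Rightarrow> int \<Rightarrow> 'a words \<Rightarrow> 'b words) \<Rightarrow> nat set \<Rightarrow> int \<Rightarrow> ('a words, 'a words) tens \<Rightarrow> ('b words, 'b words) tens" where
  "aw_sum F I d t = free_lift (B.TT (d + face_degree I))
     (\<lambda>(J, K). pair_map F J K d t) (aw_chain I)"

lemma coproduct_rule_aw_sum: "coproduct_rule F I d x \<longleftrightarrow> B.\<Delta> (d + face_degree I) (F I d x) = aw_sum F I d (A.\<Delta> d x)"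
  by (simp add: coproduct_rule_def aw_sum_def)

text \<open>The part of a family that a coalgebra map forces on words with at least two letters.\<close>

definition tail_part :: "(nat set \<Rightarrow> int \<Rightarrow> 'a words \<Rightarrow> 'b words) \<Rightarrow> nat set \<Rightarrow> int \<Rightarrow> 'a words \<Rightarrow> 'b words" where
  "tail_part F I d x = attach VB (d + face_degree I) (aw_sum F I d (A.\<Delta> d x))"

context
  fixes Is F
  assumes cl: "face_closed Is" and fam: "family Is F"
begin

lemma aw_sum_graded:
  assumes I: "I \<in> Is"
  shows "aw_sum F I \<in> graded_maps (face_degree I) A.TT B.TT"
  unfolding aw_sum_def[abs_def]
proof (rule graded_maps_combination)
  show "graded_module B.TT" by (rule B.TP.graded_module_tensor)
  fix s assume s: "s \<in> Poly_Mapping.keys (aw_chain I)"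
  obtain J K where JK: "s = (J, K)" by (cases s)
  note k = keys_aw_chain_props[OF face_closedD(1)[OF cl I] s[unfolded JK]]
  have "pair_map F J K \<in> graded_maps (face_degree I) A.TT B.TT"
    by (rule AB.MP.tensor_map_graded[OF family_graded[OF fam face_closedD(3)[OF cl I k(1,3)]]
          family_graded[OF fam face_closedD(3)[OF cl I k(2,4)]]]) (use k(5) in simp)
  then show "(\<lambda>d t. case s of (J, K) \<Rightarrow> pair_map F J K d t)
      \<in> graded_maps (face_degree I) A.TT B.TT" by (simp add: JK)
qed

lemma tail_part_graded: "I \<in> Is \<Longrightarrow> tail_part F I \<in> graded_maps (face_degree I) A.T B.T"
  unfolding tail_part_def[abs_def]
  using graded_maps_comp[OF graded_maps_comp[OF A.deconcat_graded aw_sum_graded refl] B.attach_graded refl, of I] by simp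

lemma head_tail_part: "I \<in> Is \<Longrightarrow> x \<in> carrier (A.T d) \<Longrightarrow> e = d + face_degree I
    \<Longrightarrow> head_word VB e (tail_part F I d x) = \<one>\<^bsub>B.T e\<^esub>"
  unfolding tail_part_def
  by (simp, rule B.head_word_attach, rule graded_maps_closed[OF aw_sum_graded A.deconcat_closed]) simp_all

lemma aw_sum_finprod:
  assumes I: "I \<in> Is" and t: "t \<in> carrier (A.TT d)" and e: "e = d + face_degree I"
  shows "aw_sum F I d t = finprod (B.TT e) (\<lambda>v. tensor_map B.T B.T
      (face_degree {u \<in> I. u \<le> v}) (face_degree {u \<in> I. v \<le> u}) (F {u \<in> I. u \<le> v}) (F {u \<in> I. v \<le> u}) d t) I"
proof -
  interpret T: comm_group "B.TT e" by (rule B.TP.tensor_group)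
  have fin: "finite I" by (rule face_closedD(1)[OF cl I])
  show ?thesis unfolding aw_sum_def e[symmetric]
  proof (subst T.free_lift_aw_chain[OF fin])
    fix v assume v: "v \<in> I"
    then have "{u \<in> I. u \<le> v} \<in> Is" "{u \<in> I. v \<le> u} \<in> Is"
      using face_closedD(3)[OF cl I, of "{u \<in> I. u \<le> v}"] face_closedD(3)[OF cl I, of "{u \<in> I. v \<le> u}"] by auto
    then show "(case ({u \<in> I. u \<le> v}, {u \<in> I. v \<le> u}) of
         (J, K) \<Rightarrow> pair_map F J K d t) \<in> carrier (B.TT e)"
      unfolding prod.case
      by (intro AB.MP.tensor_map_closed[OF family_graded[OF fam] family_graded[OF fam] t])
         (use e aw_face_degree[OF fin v] in auto)
  qed simp
qed

lemma coproduct_rule_reconstruct: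
  assumes I: "I \<in> Is" and x: "x \<in> carrier (A.T d)" and c: "coproduct_rule F I d x" and e: "e = d + face_degree I"
  shows "F I d x = head_word VB e (F I d x) \<otimes>\<^bsub>B.T e\<^esub> tail_part F I d x"
  using B.reconstruct[OF family_closed[OF fam I x e]] c e by (simp add: coproduct_rule_aw_sum tail_part_def)

end

text \<open>The tensor coalgebra is cofree: a family whose parts on longer words are the forced ones
  satisfies the coproduct rule. The induction is on word length, and the two sides agree because
  cutting a face and a word twice does not depend on the order of the two cuts.\<close>

theorem cofreeness:
  assumes cl: "face_closed Is" and fam: "family Is F"
    and H: "\<And>I d x. I \<in> Is \<Longrightarrow> x \<in> carrier (A.T d)
      \<Longrightarrow> F I d x = head_word VB (d + face_degree I) (F I d x) \<otimes>\<^bsub>B.T (d + face_degree I)\<^esub> tail_part F I d x"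
    and I: "I \<in> Is" and x: "x \<in> carrier (A.T d)"
  shows "coproduct_rule F I d x"
proof -
  have words: "coproduct_rule F I d (word_elem VA w)" if "w \<in> word_gens VA d" "I \<in> Is" for w d I
    using that
  proof (induction "length w" arbitrary: w d I rule: less_induct)
    case less
    note w = \<open>w \<in> word_gens VA d\<close> and I = \<open>I \<in> Is\<close>
    define x where "x = word_elem VA w"
    have x: "x \<in> carrier (A.T d)" unfolding x_def by (rule A.word_elem_closed[OF w])
    define t where "t = A.\<Delta> d x"
    have t: "t \<in> carrier (A.TT d)" unfolding t_def by (rule A.deconcat_closed[OF x])
    define e where "e = d + face_degree I"
    have fin: "finite I" by (rule face_closedD(1)[OF cl I])
    interpret TT: comm_group "B.TT e" by (rule B.TP.tensor_group)
    interpret T: comm_group "B.T e" by (rule B.Tbar_group)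
    interpret T3: comm_group "tensor B.T B.TT e" by (rule B.TTP.tensor_group)
    let ?L = "\<lambda>v. {u \<in> I. u \<le> v}" and ?R = "\<lambda>v. {u \<in> I. v \<le> u}"
    let ?M = "\<lambda>v u. {x \<in> I. v \<le> x \<and> x \<le> u}"
    have LR: "?L v \<in> Is" "?R v \<in> Is" "face_degree (?L v) + face_degree (?R v) = face_degree I" if "v \<in> I" for v
      using face_closedD(3)[OF cl I, of "?L v"] face_closedD(3)[OF cl I, of "?R v"] that aw_face_degree[OF fin that] by auto
    have Mf: "?M v u \<in> Is" if "v \<in> I" "u \<in> I" "v \<le> u" for v u
      using face_closedD(3)[OF cl I, of "?M v u"] that by auto
    have Mset: "{x \<in> ?R v. x \<le> u} = ?M v u" "{x \<in> ?L u. v \<le> x} = ?M v u" for v u by auto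
    have Lset: "{x \<in> ?L u. x \<le> v} = ?L v" and Rset: "{x \<in> ?R v. u \<le> x} = ?R u" if "v \<le> u" for v u using that by auto
    have degs: "face_degree (?L v) + face_degree (?M v u) = face_degree (?L u)"
      "face_degree (?M v u) + face_degree (?R u) = face_degree (?R v)" if "v \<in> I" "u \<in> I" "v \<le> u" for v u
      using aw_face_degree[of "?L u" v] aw_face_degree[of "?R v" u] fin that Mset Lset[OF that(3)] Rset[OF that(3)] by auto
    note gr = family_graded[OF fam]
    let ?Y = "\<lambda>v. pair_map F (?L v) (?R v) d t"
    have ev: "e = d + face_degree (?L v) + face_degree (?R v)" if "v \<in> I" for v using LR(3)[OF that] by (simp add: e_def)
    have Y: "?Y v \<in> carrier (B.TT e)" if "v \<in> I" for v
      by (rule AB.MP.tensor_map_closed[OF gr[OF LR(1)[OF that]] gr[OF LR(2)[OF that]] t ev[OF that]])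
    have aw: "aw_sum F I d t = finprod (B.TT e) ?Y I" by (rule aw_sum_finprod[OF cl fam I t e_def])
    have awc: "aw_sum F I d t \<in> carrier (B.TT e)" unfolding aw using Y by (intro TT.finprod_closed) auto
    let ?h = "\<lambda>v. tensor_map B.T B.T (face_degree (?L v)) (face_degree (?R v)) (\<lambda>i x. head_word VB (i + face_degree (?L v)) (F (?L v) i x)) (F (?R v)) d t"
    let ?a = "\<lambda>v u i x. attach VB (i + face_degree (?L u)) (pair_map F (?L v) (?M v u) i (A.\<Delta> i x))"
    let ?c = "\<lambda>v u. tensor_map B.T B.T (face_degree (?L u)) (face_degree (?R u)) (?a v u) (F (?R u)) d t"
    have hg: "(\<lambda>i x. head_word VB (i + face_degree (?L v)) (F (?L v) i x)) \<in> graded_maps (face_degree (?L v)) A.T B.T" if "v \<in> I" for v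
      using graded_maps_comp[OF gr[OF LR(1)[OF that]] B.head_word_graded refl] by simp
    have h: "?h v \<in> carrier (B.TT e)" if "v \<in> I" for v
      by (rule AB.MP.tensor_map_closed[OF hg[OF that] gr[OF LR(2)[OF that]] t ev[OF that]])
    have ag: "?a v u \<in> graded_maps (face_degree (?L u)) A.T B.T" if "v \<in> I" "u \<in> I" "v \<le> u" for v u
      using attach_tensor_graded[OF gr[OF LR(1)[OF that(1)]] gr[OF Mf[OF that]]] by (simp only: degs(1)[OF that])
    have c: "?c v u \<in> carrier (B.TT e)" if "v \<in> I" "u \<in> I" "v \<le> u" for v u
      by (rule AB.MP.tensor_map_closed[OF ag[OF that] gr[OF LR(2)[OF that(2)]] t ev[OF that(2)]])
    (* On the right hand side, the left piece of each cut is split into its head and its tail. *)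
    have split: "?Y u = ?h u \<otimes>\<^bsub>B.TT e\<^esub> finprod (B.TT e) (\<lambda>v. ?c v u) (?L u)" if u: "u \<in> I" for u
    proof -
      have sub: "v \<in> I" "v \<le> u" if "v \<in> ?L u" for v using that by auto
      have tg: "tail_part F (?L u) \<in> graded_maps (face_degree (?L u)) A.T B.T" by (rule tail_part_graded[OF cl fam LR(1)[OF u]])
      have sg: "(\<lambda>i x. finprod (B.T (i + face_degree (?L u))) (\<lambda>v. ?a v u i x) (?L u)) \<in> graded_maps (face_degree (?L u)) A.T B.T"
        by (rule graded_maps_sum[OF ag[OF sub(1) u sub(2)] B.graded_module_Tbar])
      have "?Y u = tensor_map B.T B.T (face_degree (?L u)) (face_degree (?R u))
        (\<lambda>i x. head_word VB (i + face_degree (?L u)) (F (?L u) i x) \<otimes>\<^bsub>B.T (i + face_degree (?L u))\<^esub> tail_part F (?L u) i x) (F (?R u)) d t"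
        by (rule AB.MP.tensor_map_cong[OF gr[OF LR(1)[OF u]] graded_maps_times[OF hg[OF u] tg B.graded_module_Tbar]
              gr[OF LR(2)[OF u]] gr[OF LR(2)[OF u]] H[OF LR(1)[OF u]] refl t])
      also have "\<dots> = ?h u \<otimes>\<^bsub>B.TT e\<^esub> tensor_map B.T B.T (face_degree (?L u)) (face_degree (?R u)) (tail_part F (?L u)) (F (?R u)) d t"
        by (rule AB.MP.tensor_map_times_left[OF hg[OF u] tg gr[OF LR(2)[OF u]] t ev[OF u]])
      also have "tensor_map B.T B.T (face_degree (?L u)) (face_degree (?R u)) (tail_part F (?L u)) (F (?R u)) d t
        = tensor_map B.T B.T (face_degree (?L u)) (face_degree (?R u)) (\<lambda>i x. finprod (B.T (i + face_degree (?L u))) (\<lambda>v. ?a v u i x) (?L u)) (F (?R u)) d t"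
      proof (rule AB.MP.tensor_map_cong[OF tg sg gr[OF LR(2)[OF u]] gr[OF LR(2)[OF u]] _ refl t])
        fix i y assume y: "y \<in> carrier (A.T i)"
        let ?e = "i + face_degree (?L u)"
        have Dy: "A.\<Delta> i y \<in> carrier (A.TT i)" by (rule A.deconcat_closed[OF y])
        have tc: "pair_map F (?L v) (?M v u) i (A.\<Delta> i y) \<in> carrier (B.TT ?e)"
          if "v \<in> ?L u" for v
          by (rule AB.MP.tensor_map_closed[OF gr[OF LR(1)[OF sub(1)[OF that]]] gr[OF Mf[OF sub(1)[OF that] u sub(2)[OF that]]] Dy])
             (use degs(1)[OF sub(1)[OF that] u sub(2)[OF that]] in simp)
        interpret E: comm_group "B.TT ?e" by (rule B.TP.tensor_group)
        have "aw_sum F (?L u) i (A.\<Delta> i y) = finprod (B.TT ?e) (\<lambda>v. pair_map F (?L v) (?M v u) i (A.\<Delta> i y)) (?L u)"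
          unfolding aw_sum_finprod[OF cl fam LR(1)[OF u] Dy refl]
        proof (rule E.finprod_cong'[OF refl])
          fix v assume v: "v \<in> ?L u"
          show "tensor_map B.T B.T (face_degree {x \<in> ?L u. x \<le> v}) (face_degree {x \<in> ?L u. v \<le> x}) (F {x \<in> ?L u. x \<le> v}) (F {x \<in> ?L u. v \<le> x}) i (A.\<Delta> i y)
            = pair_map F (?L v) (?M v u) i (A.\<Delta> i y)"
            unfolding Lset[OF sub(2)[OF v]] Mset ..
        qed (use tc in auto)
        then show "tail_part F (?L u) i y = finprod (B.T ?e) (\<lambda>v. ?a v u i y) (?L u)"
          unfolding tail_part_def using hom_finprod[OF E.comm_group_axioms B.Tbar_group B.attach_hom, of _ "?L u"] tc by simp
      qed
      also have "\<dots> = finprod (B.TT e) (\<lambda>v. ?c v u) (?L u)"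
        by (rule AB.MP.tensor_map_sum_left[OF _ ag[OF sub(1) u sub(2)] gr[OF LR(2)[OF u]] t ev[OF u]]) (use fin in auto)
      finally show ?thesis .
    qed
    (* The remaining terms of the left hand side come from deconcat_attach; there the rule for shorter
       words applies, and coassociativity turns the result into the terms c v u of the right hand side. *)
    have left: "attach_left VB e (tensor_map B.T B.TT 0 0 graded_id B.\<Delta> e (?Y v)) = finprod (B.TT e) (?c v) (?R v)" if v: "v \<in> I" for v
    proof -
      have sub: "u \<in> I" "v \<le> u" if "u \<in> ?R v" for u using that by auto
      let ?p = "face_degree (?L v)" and ?q = "face_degree (?R v)"
      let ?m = "\<lambda>u i x. pair_map F (?M v u) (?R u) i (A.\<Delta> i x)"
      have Dg: "(\<lambda>i x. B.\<Delta> (i + ?q) (F (?R v) i x)) \<in> graded_maps ?q A.T B.TT"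
        using graded_maps_comp[OF gr[OF LR(2)[OF v]] B.deconcat_graded refl] by simp
      have mg: "?m u \<in> graded_maps ?q A.T B.TT" if "u \<in> ?R v" for u
        using tensor_deconcat_graded[OF gr[OF Mf[OF v sub[OF that]]] gr[OF LR(2)[OF sub(1)[OF that]]]]
        by (simp only: degs(2)[OF v sub[OF that]])
      have Sg: "(\<lambda>i x. finprod (B.TT (i + ?q)) (\<lambda>u. ?m u i x) (?R v)) \<in> graded_maps ?q A.T B.TT"
        by (rule graded_maps_sum[OF mg B.TP.graded_module_tensor])
      have "tensor_map B.T B.TT 0 0 graded_id B.\<Delta> e (?Y v)
        = tensor_map B.T B.TT ?p ?q (F (?L v)) (\<lambda>i x. B.\<Delta> (i + ?q) (F (?R v) i x)) d t [^]\<^bsub>tensor B.T B.TT e\<^esub> sgn_pow (0 * ?p)"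
        using tensor_map_comp[OF A.graded_module_Tbar A.graded_module_Tbar B.graded_module_Tbar B.graded_module_Tbar
            B.graded_module_Tbar B.TP.graded_module_tensor gr[OF LR(1)[OF v]] gr[OF LR(2)[OF v]]
            graded_maps_id B.deconcat_graded t ev[OF v], of e ?p ?q] by simp
      also have "\<dots> = tensor_map B.T B.TT ?p ?q (F (?L v)) (\<lambda>i x. B.\<Delta> (i + ?q) (F (?R v) i x)) d t"
        using ABB.MP.tensor_map_closed[OF gr[OF LR(1)[OF v]] Dg t ev[OF v]] by simp
      also have "\<dots> = tensor_map B.T B.TT ?p ?q (F (?L v)) (\<lambda>i x. finprod (B.TT (i + ?q)) (\<lambda>u. ?m u i x) (?R v)) d t"
        unfolding t_def x_def
      proof (rule ABB.tensor_map_deconcat_cong[OF gr[OF LR(1)[OF v]] gr[OF LR(1)[OF v]] Dg Sg w refl])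
        fix i z assume z: "z \<in> word_gens VA i" "length z < length w"
        have zc: "word_elem VA z \<in> carrier (A.T i)" by (rule A.word_elem_closed[OF z(1)])
        have Dz: "A.\<Delta> i (word_elem VA z) \<in> carrier (A.TT i)" by (rule A.deconcat_closed[OF zc])
        interpret E: comm_group "B.TT (i + ?q)" by (rule B.TP.tensor_group)
        have "B.\<Delta> (i + ?q) (F (?R v) i (word_elem VA z)) = aw_sum F (?R v) i (A.\<Delta> i (word_elem VA z))"
          using less.hyps[OF z(2,1) LR(2)[OF v]] by (simp add: coproduct_rule_aw_sum)
        also have "\<dots> = finprod (B.TT (i + ?q)) (\<lambda>u. ?m u i (word_elem VA z)) (?R v)"
          unfolding aw_sum_finprod[OF cl fam LR(2)[OF v] Dz refl]
        proof (rule E.finprod_cong'[OF refl])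
          fix u assume u: "u \<in> ?R v"
          show "tensor_map B.T B.T (face_degree {x \<in> ?R v. x \<le> u}) (face_degree {x \<in> ?R v. u \<le> x}) (F {x \<in> ?R v. x \<le> u}) (F {x \<in> ?R v. u \<le> x}) i (A.\<Delta> i (word_elem VA z))
            = ?m u i (word_elem VA z)"
            unfolding Rset[OF sub(2)[OF u]] Mset ..
        qed (use graded_maps_closed[OF mg zc refl] in auto)
        finally show "B.\<Delta> (i + ?q) (F (?R v) i (word_elem VA z)) = finprod (B.TT (i + ?q)) (\<lambda>u. ?m u i (word_elem VA z)) (?R v)" .
      qed
      also have "\<dots> = finprod (tensor B.T B.TT e) (\<lambda>u. tensor_map B.T B.TT ?p ?q (F (?L v)) (?m u) d t) (?R v)"
        by (rule ABB.MP.tensor_map_sum_right[OF _ gr[OF LR(1)[OF v]] mg t ev[OF v]]) (use fin in auto)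
      finally have 1: "tensor_map B.T B.TT 0 0 graded_id B.\<Delta> e (?Y v)
        = finprod (tensor B.T B.TT e) (\<lambda>u. tensor_map B.T B.TT ?p ?q (F (?L v)) (?m u) d t) (?R v)" .
      have tc: "tensor_map B.T B.TT ?p ?q (F (?L v)) (?m u) d t \<in> carrier (tensor B.T B.TT e)" if "u \<in> ?R v" for u
        by (rule ABB.MP.tensor_map_closed[OF gr[OF LR(1)[OF v]] mg[OF that] t ev[OF v]])
      have "attach_left VB e (tensor_map B.T B.TT 0 0 graded_id B.\<Delta> e (?Y v))
        = finprod (B.TT e) (\<lambda>u. attach_left VB e (tensor_map B.T B.TT ?p ?q (F (?L v)) (?m u) d t)) (?R v)"
        unfolding 1 by (rule hom_finprod[OF T3.comm_group_axioms TT.comm_group_axioms B.attach_left_hom]) (use tc in auto)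
      also have "\<dots> = finprod (B.TT e) (?c v) (?R v)"
      proof (rule TT.finprod_cong'[OF refl])
        show "?c v \<in> ?R v \<rightarrow> carrier (B.TT e)" using c[OF v] by auto
        fix u assume u: "u \<in> ?R v"
        note d1 = degs[OF v sub[OF u]]
        have "e = d + ?p + (face_degree (?M v u) + face_degree (?R u))" using ev[OF v] d1(2) by simp
        from coassociativity[OF gr[OF LR(1)[OF v]] gr[OF Mf[OF v sub[OF u]]] gr[OF LR(2)[OF sub(1)[OF u]]] x this]
        show "attach_left VB e (tensor_map B.T B.TT ?p ?q (F (?L v)) (?m u) d t) = ?c v u"
          unfolding d1 t_def .
      qed
      finally show ?thesis .
    qed
    have lefth: "tensor_map B.T B.T 0 0 (head_word VB) graded_id e (?Y v) = ?h v" if v: "v \<in> I" for v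
    proof -
      have "tensor_map B.T B.T 0 0 (head_word VB) graded_id e (?Y v) = ?h v [^]\<^bsub>B.TT e\<^esub> sgn_pow (0 * face_degree (?L v))"
        using tensor_map_comp[OF A.graded_module_Tbar A.graded_module_Tbar B.graded_module_Tbar B.graded_module_Tbar
            B.graded_module_Tbar B.graded_module_Tbar gr[OF LR(1)[OF v]] gr[OF LR(2)[OF v]]
            B.head_word_graded graded_maps_id t ev[OF v], of e "face_degree (?L v)" "face_degree (?R v)"] by simp
      then show ?thesis using h[OF v] by simp
    qed
    have "B.\<Delta> e (F I d x) = B.\<Delta> e (head_word VB e (F I d x)) \<otimes>\<^bsub>B.TT e\<^esub> B.\<Delta> e (tail_part F I d x)"
    proof -
      have Fc: "F I d x \<in> carrier (B.T e)" by (rule family_closed[OF fam I x e_def])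
      have hc: "head_word VB e (F I d x) \<in> carrier (B.T e)" using B.head_word_hom[of e] Fc by (auto simp: hom_def)
      have tc: "tail_part F I d x \<in> carrier (B.T e)" by (rule graded_maps_closed[OF tail_part_graded[OF cl fam I] x e_def])
      have "F I d x = head_word VB e (F I d x) \<otimes>\<^bsub>B.T e\<^esub> tail_part F I d x" using H[OF I x] by (simp add: e_def)
      then have "B.\<Delta> e (F I d x) = B.\<Delta> e (head_word VB e (F I d x) \<otimes>\<^bsub>B.T e\<^esub> tail_part F I d x)" by simp
      then show ?thesis by (simp only: hom_mult[OF B.deconcat_hom hc tc])
    qed
    also have "\<dots> = B.\<Delta> e (attach VB e (aw_sum F I d t))"
      using B.deconcat_head_word[OF family_closed[OF fam I x e_def]]
        B.deconcat_closed[OF graded_maps_closed[OF B.attach_graded awc, of e]]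
      by (simp add: tail_part_def e_def[symmetric] t_def[symmetric])
    also have "\<dots> = tensor_map B.T B.T 0 0 (head_word VB) graded_id e (aw_sum F I d t)
        \<otimes>\<^bsub>B.TT e\<^esub> attach_left VB e (tensor_map B.T B.TT 0 0 graded_id B.\<Delta> e (aw_sum F I d t))"
      by (rule B.deconcat_attach[OF awc])
    also have "tensor_map B.T B.T 0 0 (head_word VB) graded_id e (aw_sum F I d t) = finprod (B.TT e) ?h I"
    proof -
      have "tensor_map B.T B.T 0 0 (head_word VB) graded_id e (aw_sum F I d t)
        = finprod (B.TT e) (\<lambda>v. tensor_map B.T B.T 0 0 (head_word VB) graded_id e (?Y v)) I"
        unfolding aw
        by (rule hom_finprod[OF TT.comm_group_axioms TT.comm_group_axioms B.TM.tensor_map_hom[OF B.head_word_graded graded_maps_id]])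
           (use Y in auto)
      also have "\<dots> = finprod (B.TT e) ?h I" by (rule TT.finprod_cong'[OF refl]) (use h lefth in auto)
      finally show ?thesis .
    qed
    also have "attach_left VB e (tensor_map B.T B.TT 0 0 graded_id B.\<Delta> e (aw_sum F I d t)) = finprod (B.TT e) (\<lambda>v. finprod (B.TT e) (?c v) (?R v)) I"
    proof -
      have h2: "(\<lambda>y. attach_left VB e (tensor_map B.T B.TT 0 0 graded_id B.\<Delta> e y)) \<in> hom (B.TT e) (B.TT e)"
        by (rule hom_comp[OF B.TTM.tensor_map_hom[OF graded_maps_id B.deconcat_graded] B.attach_left_hom]) simp
      have "attach_left VB e (tensor_map B.T B.TT 0 0 graded_id B.\<Delta> e (aw_sum F I d t))
        = finprod (B.TT e) (\<lambda>v. attach_left VB e (tensor_map B.T B.TT 0 0 graded_id B.\<Delta> e (?Y v))) I"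
        unfolding aw by (rule hom_finprod[OF TT.comm_group_axioms TT.comm_group_axioms h2]) (use Y in auto)
      also have "\<dots> = finprod (B.TT e) (\<lambda>v. finprod (B.TT e) (?c v) (?R v)) I"
        by (rule TT.finprod_cong'[OF refl]) (use c left in \<open>auto intro!: TT.finprod_closed\<close>)
      finally show ?thesis .
    qed
    also have "finprod (B.TT e) (\<lambda>v. finprod (B.TT e) (?c v) (?R v)) I = finprod (B.TT e) (\<lambda>u. finprod (B.TT e) (\<lambda>v. ?c v u) (?L u)) I"
      by (rule TT.finprod_triangle[OF fin c])
    also have "finprod (B.TT e) ?h I \<otimes>\<^bsub>B.TT e\<^esub> finprod (B.TT e) (\<lambda>u. finprod (B.TT e) (\<lambda>v. ?c v u) (?L u)) I
      = finprod (B.TT e) (\<lambda>u. ?h u \<otimes>\<^bsub>B.TT e\<^esub> finprod (B.TT e) (\<lambda>v. ?c v u) (?L u)) I"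
      by (rule TT.finprod_multf[symmetric]) (use h c in \<open>auto intro!: TT.finprod_closed\<close>)
    also have "\<dots> = finprod (B.TT e) ?Y I"
      by (rule TT.finprod_cong'[OF refl]) (use Y split in auto)
    also have "\<dots> = aw_sum F I d t" using aw by simp
    finally show "coproduct_rule F I d (word_elem VA w)"
      by (simp add: coproduct_rule_aw_sum e_def t_def x_def)
  qed
  show ?thesis
    unfolding coproduct_rule_aw_sum
  proof (rule A.word_hom_eq[OF B.TP.tensor_group _ _ _ x])
    show "(\<lambda>x. B.\<Delta> (d + face_degree I) (F I d x)) \<in> hom (A.T d) (B.TT (d + face_degree I))"
      by (rule hom_comp[OF graded_maps_hom[OF family_graded[OF fam I] refl] B.deconcat_hom])
    show "(\<lambda>x. aw_sum F I d (A.\<Delta> d x)) \<in> hom (A.T d) (B.TT (d + face_degree I))"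
      by (rule hom_comp[OF A.deconcat_hom graded_maps_hom[OF aw_sum_graded[OF cl fam I] refl]])
  qed (use words[OF _ I] in \<open>simp add: coproduct_rule_aw_sum\<close>)
qed

end


section \<open>The differential rule and the coproduct\<close>

context graded_pair_maps
begin

lemma tensor_map_pow_left:
  assumes f: "f \<in> graded_maps p M M'" and g: "g \<in> graded_maps q N N'"
    and t: "t \<in> carrier (tensor M N n)" and m: "m = n + p + q"
  shows "tensor_map M' N' p q (\<lambda>i x. f i x [^]\<^bsub>M' (i + p)\<^esub> (z::int)) g n t = tensor_map M' N' p q f g n t [^]\<^bsub>tensor M' N' m\<^esub> z"
proof (rule tensor_hom_eq[OF target.tensor_group tensor_map_hom[OF graded_maps_power[OF f target.M] g m]
      hom_pow_pointwise[OF target.tensor_group tensor_map_hom[OF f g m]] _ t])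
  interpret K: comm_group "tensor M' N' m" by (rule target.tensor_group)
  fix i x j y assume *: "i + j = n" "x \<in> carrier (M i)" "y \<in> carrier (N j)"
  have mm: "m = (i + p) + (j + q)" using * m by simp
  note fc = graded_maps_closed[OF f *(2) refl] and gc = graded_maps_closed[OF g *(3) refl]
  note c = target.tensor_pure_closed[OF fc gc mm]
  show "tensor_map M' N' p q (\<lambda>i x. f i x [^]\<^bsub>M' (i + p)\<^esub> z) g n (tensor_pure M N (i, x) (j, y))
    = tensor_map M' N' p q f g n (tensor_pure M N (i, x) (j, y)) [^]\<^bsub>tensor M' N' m\<^esub> z"
    unfolding tensor_map_pure[OF graded_maps_power[OF f target.M] g m *] tensor_map_pure[OF f g m *]
      target.tensor_pure_pow_left[OF fc gc mm] K.int_pow_pow[OF c] by (simp only: mult.commute)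
qed

lemma tensor_map_pow_right:
  assumes f: "f \<in> graded_maps p M M'" and g: "g \<in> graded_maps q N N'"
    and t: "t \<in> carrier (tensor M N n)" and m: "m = n + p + q"
  shows "tensor_map M' N' p q f (\<lambda>i x. g i x [^]\<^bsub>N' (i + q)\<^esub> (z::int)) n t = tensor_map M' N' p q f g n t [^]\<^bsub>tensor M' N' m\<^esub> z"
proof (rule tensor_hom_eq[OF target.tensor_group tensor_map_hom[OF f graded_maps_power[OF g target.N] m]
      hom_pow_pointwise[OF target.tensor_group tensor_map_hom[OF f g m]] _ t])
  interpret K: comm_group "tensor M' N' m" by (rule target.tensor_group)
  fix i x j y assume *: "i + j = n" "x \<in> carrier (M i)" "y \<in> carrier (N j)"
  have mm: "m = (i + p) + (j + q)" using * m by simp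
  note fc = graded_maps_closed[OF f *(2) refl] and gc = graded_maps_closed[OF g *(3) refl]
  note c = target.tensor_pure_closed[OF fc gc mm]
  show "tensor_map M' N' p q f (\<lambda>i x. g i x [^]\<^bsub>N' (i + q)\<^esub> z) n (tensor_pure M N (i, x) (j, y))
    = tensor_map M' N' p q f g n (tensor_pure M N (i, x) (j, y)) [^]\<^bsub>tensor M' N' m\<^esub> z"
    unfolding tensor_map_pure[OF f graded_maps_power[OF g target.N] m *] tensor_map_pure[OF f g m *]
      target.tensor_pure_pow_right[OF fc gc mm] K.int_pow_pow[OF c] by (simp only: mult.commute)
qed

end

lemma keys_frag_extend_frag_of:
  assumes "u \<in> Poly_Mapping.keys (frag_extend (\<lambda>s. frag_of (h s)) a)"
  obtains s where "s \<in> Poly_Mapping.keys a" "u = h s"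
  using subsetD[OF keys_frag_extend assms] by auto

lemma (in comm_group) free_lift_power:
  assumes "\<And>s. s \<in> Poly_Mapping.keys a \<Longrightarrow> b s \<in> carrier G"
  shows "free_lift G (\<lambda>s. b s [^] (z::int)) a = free_lift G b a [^] z"
  using hom_free_lift[OF comm_group_axioms comm_group_axioms int_pow_hom, of a b z] assms by simp

context bar_pair
begin

definition diff_rhs :: "(nat set \<Rightarrow> int \<Rightarrow> 'a words \<Rightarrow> 'b words) \<Rightarrow> nat set \<Rightarrow> int \<Rightarrow> 'a words \<Rightarrow> 'b words" where
  "diff_rhs F I d x = free_lift (B.T (d + (face_degree I + 1))) (\<lambda>J. F J d x) (face_boundary I)
     \<otimes>\<^bsub>B.T (d + (face_degree I + 1))\<^esub> F I (d + 1) (DA d x) [^]\<^bsub>B.T (d + (face_degree I + 1))\<^esub> sgn_pow (face_degree I)"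

lemma differential_rule_rhs: "differential_rule F I d x \<longleftrightarrow> DB (d + face_degree I) (F I d x) = diff_rhs F I d x"
  by (simp add: differential_rule_def diff_rhs_def add.assoc)

context
  fixes Is F
  assumes cl: "face_closed Is" and fam: "family Is F"
begin

lemma boundary_part_graded:
  assumes I: "I \<in> Is"
  shows "(\<lambda>d x. free_lift (B.T (d + (face_degree I + 1))) (\<lambda>J. F J d x) (face_boundary I)) \<in> graded_maps (face_degree I + 1) A.T B.T"
proof (rule graded_maps_combination[OF _ B.graded_module_Tbar])
  fix J assume J: "J \<in> Poly_Mapping.keys (face_boundary I)"
  note k = keys_face_boundary[OF face_closedD(1)[OF cl I] J]
  show "F J \<in> graded_maps (face_degree I + 1) A.T B.T"
    using family_graded[OF fam face_closedD(3)[OF cl I k(1,2)]] k(3) by simp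
qed

lemma source_part_graded:
  assumes I: "I \<in> Is"
  shows "(\<lambda>d x. F I (d + 1) (DA d x)) \<in> graded_maps (face_degree I + 1) A.T B.T"
  by (rule graded_maps_comp[OF DA_graded family_graded[OF fam I]]) simp

lemma diff_rhs_graded: "I \<in> Is \<Longrightarrow> diff_rhs F I \<in> graded_maps (face_degree I + 1) A.T B.T"
  unfolding diff_rhs_def[abs_def]
  by (rule graded_maps_times[OF boundary_part_graded graded_maps_power[OF source_part_graded B.graded_module_Tbar] B.graded_module_Tbar])

lemma target_part_graded:
  assumes I: "I \<in> Is"
  shows "(\<lambda>d x. DB (d + face_degree I) (F I d x)) \<in> graded_maps (face_degree I + 1) A.T B.T"
  by (rule graded_maps_comp[OF family_graded[OF fam I] DB_graded refl])

text \<open>If the differential rule holds on shorter words, then both of its sides have the same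
  coproduct on the next word: the failure of the rule is a coderivation along the family.\<close>

lemma differential_rule_deconcat:
  assumes co: "\<And>I d x. I \<in> Is \<Longrightarrow> x \<in> carrier (A.T d) \<Longrightarrow> coproduct_rule F I d x"
    and I: "I \<in> Is" and w: "w \<in> word_gens VA d"
    and IH: "\<And>J i z. J \<in> Is \<Longrightarrow> z \<in> word_gens VA i \<Longrightarrow> length z < length w \<Longrightarrow> differential_rule F J i (word_elem VA z)"
    and e: "e = d + (face_degree I + 1)"
  shows "B.\<Delta> e (DB (d + face_degree I) (F I d (word_elem VA w))) = B.\<Delta> e (diff_rhs F I d (word_elem VA w))"
proof -
  define x where "x = word_elem VA w"
  have x: "x \<in> carrier (A.T d)" unfolding x_def by (rule A.word_elem_closed[OF w])
  have Dx: "DA d x \<in> carrier (A.T (d + 1))" by (rule graded_maps_closed[OF DA_graded x refl])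
  define t where "t = A.\<Delta> d x"
  have t: "t \<in> carrier (A.TT d)" unfolding t_def by (rule A.deconcat_closed[OF x])
  define e0 where "e0 = d + face_degree I"
  have e1: "e = e0 + 1" using e by (simp add: e0_def)
  interpret G: comm_group "B.TT e" by (rule B.TP.tensor_group)
  interpret G0: comm_group "B.TT e0" by (rule B.TP.tensor_group)
  interpret T: comm_group "B.T e" by (rule B.Tbar_group)
  have fin: "finite I" by (rule face_closedD(1)[OF cl I])
  note gr = family_graded[OF fam]
  let ?P = "\<lambda>J K. pair_map F J K d t"
  let ?a = "\<lambda>J K. tensor_map B.T B.T (face_degree J + 1) (face_degree K) (\<lambda>i x. F J (i + 1) (DA i x)) (F K) d t"
  let ?b = "\<lambda>J K. tensor_map B.T B.T (face_degree J) (face_degree K + 1) (F J) (\<lambda>i x. F K (i + 1) (DA i x)) d t"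
  let ?U = "\<lambda>J K. free_lift (B.TT e) (\<lambda>J'. ?P J' K) (face_boundary J)"
  let ?W = "\<lambda>J K. free_lift (B.TT e) (\<lambda>K'. ?P J K') (face_boundary K)"
  have k: "J \<in> Is" "K \<in> Is" "face_degree J + face_degree K = face_degree I" if "(J, K) \<in> Poly_Mapping.keys (aw_chain I)" for J K
    using keys_aw_chain_props[OF fin that] face_closedD(3)[OF cl I] by auto
  have kb: "J' \<in> Is" "face_degree J' = face_degree J + 1" if "J \<in> Is" "J' \<in> Poly_Mapping.keys (face_boundary J)" for J J'
    using keys_face_boundary[OF face_closedD(1)[OF cl that(1)] that(2)] face_closedD(3)[OF cl that(1)] by auto
  have Pc: "?P J K \<in> carrier (B.TT e')" if "J \<in> Is" "K \<in> Is" "e' = d + face_degree J + face_degree K" for J K e'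
    by (rule AB.MP.tensor_map_closed[OF gr[OF that(1)] gr[OF that(2)] t that(3)])
  have ac: "?a J K \<in> carrier (B.TT e)" and bc: "?b J K \<in> carrier (B.TT e)"
    if JK: "(J, K) \<in> Poly_Mapping.keys (aw_chain I)" for J K
    by (rule AB.MP.tensor_map_closed[OF source_part_graded[OF k(1)[OF JK]] gr[OF k(2)[OF JK]] t], use k(3)[OF JK] e in simp)
       (rule AB.MP.tensor_map_closed[OF gr[OF k(1)[OF JK]] source_part_graded[OF k(2)[OF JK]] t], use k(3)[OF JK] e in simp)
  have Uc: "?U J K \<in> carrier (B.TT e)" and Wc: "?W J K \<in> carrier (B.TT e)"
    if JK: "(J, K) \<in> Poly_Mapping.keys (aw_chain I)" for J K
    by (rule G.free_lift_closed, rule Pc; use kb[OF k(1)[OF JK]] k[OF JK] e in simp)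
       (rule G.free_lift_closed, rule Pc; use kb[OF k(2)[OF JK]] k[OF JK] e in simp)
  let ?C = "\<lambda>J K. (?U J K \<otimes>\<^bsub>B.TT e\<^esub> ?a J K [^]\<^bsub>B.TT e\<^esub> sgn_pow (face_degree J))
        \<otimes>\<^bsub>B.TT e\<^esub> (?W J K \<otimes>\<^bsub>B.TT e\<^esub> ?b J K [^]\<^bsub>B.TT e\<^esub> sgn_pow (face_degree K)) [^]\<^bsub>B.TT e\<^esub> sgn_pow (face_degree J)"
  (* On the left hand side the rule for shorter words replaces DB after F J and DB after F K. *)
  have left: "tensor_map B.T B.T 1 0 DB graded_id e0 (?P J K) \<otimes>\<^bsub>B.TT e\<^esub> tensor_map B.T B.T 0 1 graded_id DB e0 (?P J K) = ?C J K"
    if JK: "(J, K) \<in> Poly_Mapping.keys (aw_chain I)" for J K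
  proof -
    note kJ = k(1)[OF JK] and kK = k(2)[OF JK]
    have ed: "e0 = d + face_degree J + face_degree K" using k(3)[OF JK] by (simp add: e0_def)
    have el: "e = d + (face_degree J + 1) + face_degree K" and er: "e = d + face_degree J + (face_degree K + 1)"
      using ed e1 by auto
    have "tensor_map B.T B.T 1 0 DB graded_id e0 (?P J K)
      = tensor_map B.T B.T (face_degree J + 1) (face_degree K) (\<lambda>i x. DB (i + face_degree J) (F J i x)) (F K) d t [^]\<^bsub>B.TT e\<^esub> sgn_pow (0 * face_degree J)"
      by (rule tensor_map_comp[OF A.graded_module_Tbar A.graded_module_Tbar B.graded_module_Tbar B.graded_module_Tbar
            B.graded_module_Tbar B.graded_module_Tbar gr[OF kJ] gr[OF kK] DB_graded graded_maps_id t ed]) (use e1 in simp_all)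
    also have "\<dots> = tensor_map B.T B.T (face_degree J + 1) (face_degree K) (\<lambda>i x. DB (i + face_degree J) (F J i x)) (F K) d t"
      using AB.MP.tensor_map_closed[OF target_part_graded[OF kJ] gr[OF kK] t el] by simp
    also have "\<dots> = tensor_map B.T B.T (face_degree J + 1) (face_degree K) (diff_rhs F J) (F K) d t"
      unfolding t_def x_def
      by (rule AB.tensor_map_deconcat_cong[OF target_part_graded[OF kJ] diff_rhs_graded[OF kJ] gr[OF kK] gr[OF kK] w])
         (use IH[OF kJ] in \<open>simp_all add: differential_rule_rhs\<close>)
    also have "\<dots> = ?U J K \<otimes>\<^bsub>B.TT e\<^esub> ?a J K [^]\<^bsub>B.TT e\<^esub> sgn_pow (face_degree J)"
    proof -
      note s = source_part_graded[OF kJ]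
      have "tensor_map B.T B.T (face_degree J + 1) (face_degree K) (\<lambda>d x. free_lift (B.T (d + (face_degree J + 1))) (\<lambda>J'. F J' d x) (face_boundary J)) (F K) d t
        = free_lift (B.TT e) (\<lambda>J'. tensor_map B.T B.T (face_degree J + 1) (face_degree K) (F J') (F K) d t) (face_boundary J)"
        by (rule AB.MP.tensor_map_combination_left[where f = F, OF _ gr[OF kK] t el])
           (use gr[OF kb(1)[OF kJ]] kb(2)[OF kJ] in simp)
      also have "\<dots> = ?U J K"
      proof (rule G.free_lift_cong)
        fix J' assume J': "J' \<in> Poly_Mapping.keys (face_boundary J)"
        show "tensor_map B.T B.T (face_degree J + 1) (face_degree K) (F J') (F K) d t = ?P J' K"
          unfolding kb(2)[OF kJ J'] ..
        show "?P J' K \<in> carrier (B.TT e)"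
          by (rule Pc[OF kb(1)[OF kJ J'] kK]) (use kb(2)[OF kJ J'] el in simp)
      qed
      finally show ?thesis
        unfolding diff_rhs_def[abs_def]
        using AB.MP.tensor_map_times_left[OF boundary_part_graded[OF kJ] graded_maps_power[OF s B.graded_module_Tbar] gr[OF kK] t el]
          AB.MP.tensor_map_pow_left[OF s gr[OF kK] t el] by simp
    qed
    finally have 1: "tensor_map B.T B.T 1 0 DB graded_id e0 (?P J K) = ?U J K \<otimes>\<^bsub>B.TT e\<^esub> ?a J K [^]\<^bsub>B.TT e\<^esub> sgn_pow (face_degree J)" .
    have "tensor_map B.T B.T 0 1 graded_id DB e0 (?P J K)
      = tensor_map B.T B.T (face_degree J) (face_degree K + 1) (F J) (\<lambda>i x. DB (i + face_degree K) (F K i x)) d t [^]\<^bsub>B.TT e\<^esub> sgn_pow (1 * face_degree J)"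
      by (rule tensor_map_comp[OF A.graded_module_Tbar A.graded_module_Tbar B.graded_module_Tbar B.graded_module_Tbar
            B.graded_module_Tbar B.graded_module_Tbar gr[OF kJ] gr[OF kK] graded_maps_id DB_graded t ed]) (use e1 in simp_all)
    also have "tensor_map B.T B.T (face_degree J) (face_degree K + 1) (F J) (\<lambda>i x. DB (i + face_degree K) (F K i x)) d t
      = tensor_map B.T B.T (face_degree J) (face_degree K + 1) (F J) (diff_rhs F K) d t"
      unfolding t_def x_def
      by (rule AB.tensor_map_deconcat_cong[OF gr[OF kJ] gr[OF kJ] target_part_graded[OF kK] diff_rhs_graded[OF kK] w])
         (use IH[OF kK] in \<open>simp_all add: differential_rule_rhs\<close>)
    also have "\<dots> = ?W J K \<otimes>\<^bsub>B.TT e\<^esub> ?b J K [^]\<^bsub>B.TT e\<^esub> sgn_pow (face_degree K)"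
    proof -
      note s = source_part_graded[OF kK]
      have "tensor_map B.T B.T (face_degree J) (face_degree K + 1) (F J) (\<lambda>d x. free_lift (B.T (d + (face_degree K + 1))) (\<lambda>K'. F K' d x) (face_boundary K)) d t
        = free_lift (B.TT e) (\<lambda>K'. tensor_map B.T B.T (face_degree J) (face_degree K + 1) (F J) (F K') d t) (face_boundary K)"
        by (rule AB.MP.tensor_map_combination_right[where g = F, OF gr[OF kJ] _ t er])
           (use gr[OF kb(1)[OF kK]] kb(2)[OF kK] in simp)
      also have "\<dots> = ?W J K"
      proof (rule G.free_lift_cong)
        fix K' assume K': "K' \<in> Poly_Mapping.keys (face_boundary K)"
        show "tensor_map B.T B.T (face_degree J) (face_degree K + 1) (F J) (F K') d t = ?P J K'"
          unfolding kb(2)[OF kK K'] ..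
        show "?P J K' \<in> carrier (B.TT e)"
          by (rule Pc[OF kJ kb(1)[OF kK K']]) (use kb(2)[OF kK K'] er in simp)
      qed
      finally show ?thesis
        unfolding diff_rhs_def[abs_def]
        using AB.MP.tensor_map_times_right[OF gr[OF kJ] boundary_part_graded[OF kK] graded_maps_power[OF s B.graded_module_Tbar] t er]
          AB.MP.tensor_map_pow_right[OF gr[OF kJ] s t er] by simp
    qed
    finally show ?thesis unfolding 1 by simp
  qed
  have lhs: "B.\<Delta> e (DB e0 (F I d x)) = free_lift (B.TT e) (\<lambda>(J, K). ?C J K) (aw_chain I)"
  proof -
    have Fc: "F I d x \<in> carrier (B.T e0)" by (rule family_closed[OF fam I x e0_def])
    have aw: "B.\<Delta> e0 (F I d x) = free_lift (B.TT e0) (\<lambda>(J, K). ?P J K) (aw_chain I)"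
      using co[OF I x] by (simp add: coproduct_rule_aw_sum aw_sum_def e0_def t_def)
    let ?D = "\<lambda>y. tensor_map B.T B.T 1 0 DB graded_id e0 y \<otimes>\<^bsub>B.TT e\<^esub> tensor_map B.T B.T 0 1 graded_id DB e0 y"
    have Dh: "?D \<in> hom (B.TT e0) (B.TT e)"
      by (rule hom_mult_pointwise[OF G.comm_group_axioms B.TM.tensor_map_hom[OF DB_graded graded_maps_id]
            B.TM.tensor_map_hom[OF graded_maps_id DB_graded]]) (use e1 in simp_all)
    have "B.\<Delta> e (DB e0 (F I d x)) = ?D (B.\<Delta> e0 (F I d x))"
      using DB Fc by (simp add: coderivation_def e1)
    also have "\<dots> = free_lift (B.TT e) (\<lambda>s. ?D (case s of (J, K) \<Rightarrow> ?P J K)) (aw_chain I)"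
      unfolding aw by (rule hom_free_lift[OF G0.comm_group_axioms G.comm_group_axioms Dh])
        (use k in \<open>auto simp: e0_def intro!: Pc\<close>)
    also have "\<dots> = free_lift (B.TT e) (\<lambda>(J, K). ?C J K) (aw_chain I)"
    proof (rule G.free_lift_cong)
      fix s assume s: "s \<in> Poly_Mapping.keys (aw_chain I)"
      obtain J K where JK: "s = (J, K)" by (cases s)
      show "?D (case s of (J, K) \<Rightarrow> ?P J K) = (case s of (J, K) \<Rightarrow> ?C J K)"
        using left[OF s[unfolded JK]] by (simp add: JK)
      show "(case s of (J, K) \<Rightarrow> ?C J K) \<in> carrier (B.TT e)"
        using Uc[OF s[unfolded JK]] Wc[OF s[unfolded JK]] ac[OF s[unfolded JK]] bc[OF s[unfolded JK]] by (simp add: JK)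
    qed
    finally show ?thesis .
  qed
  (* On the right hand side the boundary terms are rearranged with the chain map property of the
     Alexander-Whitney coproduct, the others with the coderivation property of DA. *)
  have r1: "B.\<Delta> e (free_lift (B.T e) (\<lambda>J. F J d x) (face_boundary I))
    = free_lift (B.TT e) (\<lambda>(J, K). ?U J K \<otimes>\<^bsub>B.TT e\<^esub> ?W J K [^]\<^bsub>B.TT e\<^esub> sgn_pow (face_degree J)) (aw_chain I)"
  proof -
    let ?P' = "\<lambda>(J, K). ?P J K"
    have Fc: "F J d x \<in> carrier (B.T e)" if "J \<in> Poly_Mapping.keys (face_boundary I)" for J
      by (rule family_closed[OF fam kb(1)[OF I that] x]) (use kb(2)[OF I that] e in simp)
    have pc: "?P' s \<in> carrier (B.TT e)"
      if J: "J \<in> Poly_Mapping.keys (face_boundary I)" and s: "s \<in> Poly_Mapping.keys (aw_chain J)" for J s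
    proof -
      obtain L K where LK: "s = (L, K)" by (cases s)
      note kJ = kb[OF I J]
      note q = keys_aw_chain_props[OF face_closedD(1)[OF cl kJ(1)] s[unfolded LK]]
      show ?thesis unfolding LK prod.case
        by (rule Pc[OF face_closedD(3)[OF cl kJ(1) q(1,3)] face_closedD(3)[OF cl kJ(1) q(2,4)]]) (use q(5) kJ(2) e in simp)
    qed
    have "B.\<Delta> e (free_lift (B.T e) (\<lambda>J. F J d x) (face_boundary I))
      = free_lift (B.TT e) (\<lambda>J. B.\<Delta> e (F J d x)) (face_boundary I)"
      by (rule hom_free_lift[OF T.comm_group_axioms G.comm_group_axioms B.deconcat_hom Fc])
    also have "\<dots> = free_lift (B.TT e) (\<lambda>J. free_lift (B.TT e) ?P' (aw_chain J)) (face_boundary I)"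
    proof (rule G.free_lift_cong)
      fix J assume J: "J \<in> Poly_Mapping.keys (face_boundary I)"
      note kJ = kb[OF I J]
      have "d + face_degree J = e" using kJ(2) e by simp
      then show "B.\<Delta> e (F J d x) = free_lift (B.TT e) ?P' (aw_chain J)"
        using co[OF kJ(1) x] by (simp add: coproduct_rule_aw_sum aw_sum_def t_def)
      show "free_lift (B.TT e) ?P' (aw_chain J) \<in> carrier (B.TT e)"
        by (rule G.free_lift_closed) (rule pc[OF J])
    qed
    also have "\<dots> = free_lift (B.TT e) ?P' (frag_extend aw_chain (face_boundary I))"
      by (rule G.free_lift_extend[symmetric]) (rule pc)
    also have "\<dots> = free_lift (B.TT e) (\<lambda>s. free_lift (B.TT e) ?P' ((\<lambda>(J, K). frag_extend (\<lambda>J'. frag_of (J', K)) (face_boundary J)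
        + frag_cmul (sgn_pow (face_degree J)) (frag_extend (\<lambda>K'. frag_of (J, K')) (face_boundary K))) s)) (aw_chain I)"
      unfolding aw_chain_boundary[OF fin]
    proof (rule G.free_lift_extend)
      fix s u assume s: "s \<in> Poly_Mapping.keys (aw_chain I)"
        and u: "u \<in> Poly_Mapping.keys ((\<lambda>(J, K). frag_extend (\<lambda>J'. frag_of (J', K)) (face_boundary J)
        + frag_cmul (sgn_pow (face_degree J)) (frag_extend (\<lambda>K'. frag_of (J, K')) (face_boundary K))) s)"
      obtain J K where JK: "s = (J, K)" by (cases s)
      note kJK = k[OF s[unfolded JK]]
      have Pb: "?P' (J', K) \<in> carrier (B.TT e)" if "J' \<in> Poly_Mapping.keys (face_boundary J)" for J'
        unfolding prod.case by (rule Pc[OF kb(1)[OF kJK(1) that] kJK(2)]) (use kb(2)[OF kJK(1) that] kJK(3) e in simp)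
      have Pd: "?P' (J, K') \<in> carrier (B.TT e)" if "K' \<in> Poly_Mapping.keys (face_boundary K)" for K'
        unfolding prod.case by (rule Pc[OF kJK(1) kb(1)[OF kJK(2) that]]) (use kb(2)[OF kJK(2) that] kJK(3) e in simp)
      have "u \<in> Poly_Mapping.keys (frag_extend (\<lambda>J'. frag_of (J', K)) (face_boundary J))
        \<union> Poly_Mapping.keys (frag_cmul (sgn_pow (face_degree J)) (frag_extend (\<lambda>K'. frag_of (J, K')) (face_boundary K)))"
        using u unfolding JK prod.case by (rule subsetD[OF keys_add])
      then show "?P' u \<in> carrier (B.TT e)"
      proof
        assume "u \<in> Poly_Mapping.keys (frag_extend (\<lambda>J'. frag_of (J', K)) (face_boundary J))"
        then show ?thesis by (rule keys_frag_extend_frag_of) (use Pb in simp)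
      next
        assume "u \<in> Poly_Mapping.keys (frag_cmul (sgn_pow (face_degree J)) (frag_extend (\<lambda>K'. frag_of (J, K')) (face_boundary K)))"
        then have "u \<in> Poly_Mapping.keys (frag_extend (\<lambda>K'. frag_of (J, K')) (face_boundary K))" by (rule subsetD[OF keys_cmul])
        then show ?thesis by (rule keys_frag_extend_frag_of) (use Pd in simp)
      qed
    qed
    also have "\<dots> = free_lift (B.TT e) (\<lambda>(J, K). ?U J K \<otimes>\<^bsub>B.TT e\<^esub> ?W J K [^]\<^bsub>B.TT e\<^esub> sgn_pow (face_degree J)) (aw_chain I)"
    proof (rule G.free_lift_cong)
      fix s assume s: "s \<in> Poly_Mapping.keys (aw_chain I)"
      obtain J K where JK: "s = (J, K)" by (cases s)
      note kJK = k[OF s[unfolded JK]]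
      show "(case s of (J, K) \<Rightarrow> ?U J K \<otimes>\<^bsub>B.TT e\<^esub> ?W J K [^]\<^bsub>B.TT e\<^esub> sgn_pow (face_degree J)) \<in> carrier (B.TT e)"
        using Uc[OF s[unfolded JK]] Wc[OF s[unfolded JK]] by (simp add: JK)
      let ?u = "frag_extend (\<lambda>J'. frag_of (J', K)) (face_boundary J)" and ?v = "frag_extend (\<lambda>K'. frag_of (J, K')) (face_boundary K)"
      have Pb: "?P J' K \<in> carrier (B.TT e)" if "J' \<in> Poly_Mapping.keys (face_boundary J)" for J'
        by (rule Pc[OF kb(1)[OF kJK(1) that] kJK(2)]) (use kb(2)[OF kJK(1) that] kJK(3) e in simp)
      have Pd: "?P J K' \<in> carrier (B.TT e)" if "K' \<in> Poly_Mapping.keys (face_boundary K)" for K'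
        by (rule Pc[OF kJK(1) kb(1)[OF kJK(2) that]]) (use kb(2)[OF kJK(2) that] kJK(3) e in simp)
      have cu: "?P' u \<in> carrier (B.TT e)" if "u \<in> Poly_Mapping.keys ?u" for u
        using that by (rule keys_frag_extend_frag_of) (use Pb in simp)
      have cv: "?P' u \<in> carrier (B.TT e)" if "u \<in> Poly_Mapping.keys ?v" for u
        using that by (rule keys_frag_extend_frag_of) (use Pd in simp)
      have U: "free_lift (B.TT e) ?P' ?u = ?U J K"
      proof -
        have "free_lift (B.TT e) ?P' ?u = free_lift (B.TT e) (\<lambda>J'. free_lift (B.TT e) ?P' (frag_of (J', K))) (face_boundary J)"
          by (rule G.free_lift_extend) (use Pb in \<open>simp split: if_splits\<close>)
        also have "\<dots> = ?U J K"
          by (rule G.free_lift_cong) (use Pb in \<open>simp_all add: G.free_lift_frag_of[of ?P' "(J', K)" for J']\<close>)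
        finally show ?thesis .
      qed
      have W: "free_lift (B.TT e) ?P' ?v = ?W J K"
      proof -
        have "free_lift (B.TT e) ?P' ?v = free_lift (B.TT e) (\<lambda>K'. free_lift (B.TT e) ?P' (frag_of (J, K'))) (face_boundary K)"
          by (rule G.free_lift_extend) (use Pd in \<open>simp split: if_splits\<close>)
        also have "\<dots> = ?W J K"
          by (rule G.free_lift_cong) (use Pd in \<open>simp_all add: G.free_lift_frag_of[of ?P' "(J, K')" for K']\<close>)
        finally show ?thesis .
      qed
      have "free_lift (B.TT e) ?P' (?u + frag_cmul (sgn_pow (face_degree J)) ?v)
        = free_lift (B.TT e) ?P' ?u \<otimes>\<^bsub>B.TT e\<^esub> free_lift (B.TT e) ?P' (frag_cmul (sgn_pow (face_degree J)) ?v)"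
        by (rule G.free_lift_add) (use cu cv in blast)
      then show "free_lift (B.TT e) ?P' ((\<lambda>(J, K). frag_extend (\<lambda>J'. frag_of (J', K)) (face_boundary J)
        + frag_cmul (sgn_pow (face_degree J)) (frag_extend (\<lambda>K'. frag_of (J, K')) (face_boundary K))) s)
        = (case s of (J, K) \<Rightarrow> ?U J K \<otimes>\<^bsub>B.TT e\<^esub> ?W J K [^]\<^bsub>B.TT e\<^esub> sgn_pow (face_degree J))"
        unfolding JK prod.case using G.free_lift_cmul[of ?v ?P' "sgn_pow (face_degree J)"] cv U W by simp
    qed
    finally show ?thesis .
  qed
  have r2: "B.\<Delta> e (F I (d + 1) (DA d x))
    = free_lift (B.TT e) (\<lambda>(J, K). ?a J K [^]\<^bsub>B.TT e\<^esub> sgn_pow (face_degree K) \<otimes>\<^bsub>B.TT e\<^esub> ?b J K) (aw_chain I)"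
  proof -
    let ?l = "tensor_map A.T A.T 1 0 DA graded_id d t" and ?r = "tensor_map A.T A.T 0 1 graded_id DA d t"
    have lc: "?l \<in> carrier (A.TT (d + 1))" by (rule A.TM.tensor_map_closed[OF DA_graded graded_maps_id t]) simp
    have rc: "?r \<in> carrier (A.TT (d + 1))" by (rule A.TM.tensor_map_closed[OF graded_maps_id DA_graded t]) simp
    have Dt: "A.\<Delta> (d + 1) (DA d x) = ?l \<otimes>\<^bsub>A.TT (d + 1)\<^esub> ?r"
      using DA x by (simp add: coderivation_def t_def)
    have "B.\<Delta> e (F I (d + 1) (DA d x)) = free_lift (B.TT e) (\<lambda>(J, K). pair_map F J K (d + 1) (?l \<otimes>\<^bsub>A.TT (d + 1)\<^esub> ?r)) (aw_chain I)"
    proof -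
      have ee: "d + 1 + face_degree I = e" using e by simp
      show ?thesis using co[OF I Dx] unfolding coproduct_rule_aw_sum aw_sum_def ee Dt .
    qed
    also have "\<dots> = free_lift (B.TT e) (\<lambda>(J, K). ?a J K [^]\<^bsub>B.TT e\<^esub> sgn_pow (face_degree K) \<otimes>\<^bsub>B.TT e\<^esub> ?b J K) (aw_chain I)"
    proof (rule G.free_lift_cong)
      fix s assume s: "s \<in> Poly_Mapping.keys (aw_chain I)"
      obtain J K where JK: "s = (J, K)" by (cases s)
      note kJK = k[OF s[unfolded JK]] and a = ac[OF s[unfolded JK]] and b = bc[OF s[unfolded JK]]
      have ee: "e = d + 1 + face_degree J + face_degree K" using kJK(3) e by simp
      have "pair_map F J K (d + 1) ?l
        = tensor_map B.T B.T (face_degree J + 1) (face_degree K) (\<lambda>i x. F J (i + 1) (DA i x)) (\<lambda>i x. F K (i + 0) x) d t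
            [^]\<^bsub>B.TT e\<^esub> sgn_pow (face_degree K * 1)"
        by (rule tensor_map_comp[OF A.graded_module_Tbar A.graded_module_Tbar A.graded_module_Tbar A.graded_module_Tbar
            B.graded_module_Tbar B.graded_module_Tbar DA_graded graded_maps_id gr[OF kJK(1)] gr[OF kJK(2)] t _ ee]) simp_all
      moreover have "pair_map F J K (d + 1) ?r
        = tensor_map B.T B.T (face_degree J) (face_degree K + 1) (\<lambda>i x. F J (i + 0) x) (\<lambda>i x. F K (i + 1) (DA i x)) d t
            [^]\<^bsub>B.TT e\<^esub> sgn_pow (face_degree K * 0)"
        by (rule tensor_map_comp[OF A.graded_module_Tbar A.graded_module_Tbar A.graded_module_Tbar A.graded_module_Tbar
            B.graded_module_Tbar B.graded_module_Tbar graded_maps_id DA_graded gr[OF kJK(1)] gr[OF kJK(2)] t _ ee]) simp_all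
      ultimately show "(case s of (J, K) \<Rightarrow> pair_map F J K (d + 1) (?l \<otimes>\<^bsub>A.TT (d + 1)\<^esub> ?r))
        = (case s of (J, K) \<Rightarrow> ?a J K [^]\<^bsub>B.TT e\<^esub> sgn_pow (face_degree K) \<otimes>\<^bsub>B.TT e\<^esub> ?b J K)"
        unfolding JK prod.case using hom_mult[OF AB.MP.tensor_map_hom[OF gr[OF kJK(1)] gr[OF kJK(2)] ee] lc rc] b by simp
      show "(case s of (J, K) \<Rightarrow> ?a J K [^]\<^bsub>B.TT e\<^esub> sgn_pow (face_degree K) \<otimes>\<^bsub>B.TT e\<^esub> ?b J K) \<in> carrier (B.TT e)"
        using a b by (simp add: JK)
    qed
    finally show ?thesis .
  qed
  let ?r1 = "\<lambda>(J, K). ?U J K \<otimes>\<^bsub>B.TT e\<^esub> ?W J K [^]\<^bsub>B.TT e\<^esub> sgn_pow (face_degree J)"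
  let ?r2 = "\<lambda>(J, K). ?a J K [^]\<^bsub>B.TT e\<^esub> sgn_pow (face_degree K) \<otimes>\<^bsub>B.TT e\<^esub> ?b J K"
  have r1c: "?r1 s \<in> carrier (B.TT e)" and r2c: "?r2 s \<in> carrier (B.TT e)" if "s \<in> Poly_Mapping.keys (aw_chain I)" for s
  proof -
    obtain J K where JK: "s = (J, K)" by (cases s)
    note cc = ac[OF that[unfolded JK]] bc[OF that[unfolded JK]] Uc[OF that[unfolded JK]] Wc[OF that[unfolded JK]]
    show "?r1 s \<in> carrier (B.TT e)" "?r2 s \<in> carrier (B.TT e)" using cc by (simp_all add: JK)
  qed
  have rhs: "B.\<Delta> e (diff_rhs F I d x) = free_lift (B.TT e) (\<lambda>(J, K). ?C J K) (aw_chain I)"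
  proof -
    have c1: "free_lift (B.T e) (\<lambda>J. F J d x) (face_boundary I) \<in> carrier (B.T e)"
      using graded_maps_closed[OF boundary_part_graded[OF I] x e] by (simp add: e)
    have c2: "F I (d + 1) (DA d x) \<in> carrier (B.T e)"
      by (rule graded_maps_closed[OF source_part_graded[OF I] x e])
    have "B.\<Delta> e (diff_rhs F I d x) = B.\<Delta> e (free_lift (B.T e) (\<lambda>J. F J d x) (face_boundary I))
        \<otimes>\<^bsub>B.TT e\<^esub> B.\<Delta> e (F I (d + 1) (DA d x)) [^]\<^bsub>B.TT e\<^esub> sgn_pow (face_degree I)"
      unfolding diff_rhs_def e[symmetric] hom_mult[OF B.deconcat_hom c1 T.int_pow_closed[OF c2]]
        hom_int_pow[OF B.deconcat_hom c2 T.is_group G.is_group] ..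
    also have "\<dots> = free_lift (B.TT e) (\<lambda>s. ?r1 s \<otimes>\<^bsub>B.TT e\<^esub> ?r2 s [^]\<^bsub>B.TT e\<^esub> sgn_pow (face_degree I)) (aw_chain I)"
      unfolding r1 r2 by (subst G.free_lift_mult) (use r1c r2c in \<open>simp_all add: G.free_lift_power\<close>)
    also have "\<dots> = free_lift (B.TT e) (\<lambda>(J, K). ?C J K) (aw_chain I)"
    proof (rule G.free_lift_cong)
      fix s assume s: "s \<in> Poly_Mapping.keys (aw_chain I)"
      obtain J K where JK: "s = (J, K)" by (cases s)
      note cc = ac[OF s[unfolded JK]] bc[OF s[unfolded JK]] Uc[OF s[unfolded JK]] Wc[OF s[unfolded JK]]
      have d: "face_degree I = face_degree J + face_degree K" using k(3)[OF s[unfolded JK]] by simp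
      have s1: "sgn_pow (face_degree K + face_degree I) = sgn_pow (face_degree J)"
        by (rule sgn_pow_cong) (simp add: d)
      have s2: "sgn_pow (face_degree K + face_degree J) = sgn_pow (face_degree I)"
        by (rule sgn_pow_cong) (simp add: d)
      show "(case s of (J, K) \<Rightarrow> ?C J K) \<in> carrier (B.TT e)" using cc by (simp add: JK)
      show "?r1 s \<otimes>\<^bsub>B.TT e\<^esub> ?r2 s [^]\<^bsub>B.TT e\<^esub> sgn_pow (face_degree I) = (case s of (J, K) \<Rightarrow> ?C J K)"
        unfolding JK prod.case using cc
        by (simp add: G.int_pow_distrib G.int_pow_sgn_pow s1 s2 G.m_ac)
    qed
    finally show ?thesis .
  qed
  show ?thesis using lhs rhs by (simp add: e0_def x_def)
qed

end

end


section \<open>Filling a horn of families\<close>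

definition horn_faces :: "nat \<Rightarrow> nat \<Rightarrow> nat set set" where
  "horn_faces n k = {I \<in> faces n. \<exists>i\<in>{0..n}. i \<noteq> k \<and> i \<notin> I}"

text \<open>The boundary of the top face without the term of the face that the horn does not contain.\<close>

definition other_faces :: "nat \<Rightarrow> nat \<Rightarrow> (nat set \<Rightarrow>\<^sub>0 int)" where
  "other_faces n k = (\<Sum>v\<in>{0..n} - {k}. frag_cmul (vertex_sign v {0..n}) (frag_of ({0..n} - {v})))"

lemma vertex_sign_square: "vertex_sign v I * vertex_sign v I = 1"
  by (simp add: vertex_sign_def power_add[symmetric] flip: mult_2)

lemma top_face: "{0..n} \<in> faces n"
  by (simp add: faces_def)

lemma face_closed_horn_faces: "face_closed (horn_faces n k)"
  unfolding face_closed_def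
proof (intro ballI conjI allI impI; (elim conjE)?)
  fix I assume "I \<in> horn_faces n k"
  then obtain i where I: "I \<in> faces n" and i: "i \<in> {0..n}" "i \<noteq> k" "i \<notin> I" unfolding horn_faces_def by blast
  show "finite I" by (rule finite_face[OF I])
  show "I \<noteq> {}" using I by (simp add: faces_def)
  fix J assume J: "J \<subseteq> I" "J \<noteq> {}"
  then show "J \<in> horn_faces n k" using faces_subset[OF I J] i unfolding horn_faces_def by blast
qed

lemma horn_faces_subset: "I \<in> horn_faces n k \<Longrightarrow> I \<in> faces n"
  by (simp add: horn_faces_def)

lemma faces_cases:
  assumes "I \<in> faces n"
  obtains "I \<in> horn_faces n k" | "I = {0..n}" | "I = {0..n} - {k}"
proof -
  have sub: "I \<subseteq> {0..n}" using assms by (simp add: faces_def)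
  have "I \<in> horn_faces n k \<or> I = {0..n} \<or> I = {0..n} - {k}"
  proof (cases "I \<in> horn_faces n k")
    case False
    then have "\<forall>i\<in>{0..n}. i \<noteq> k \<longrightarrow> i \<in> I" using assms unfolding horn_faces_def by blast
    then have sup: "{0..n} - {k} \<subseteq> I" by blast
    show ?thesis
    proof (cases "k \<in> I")
      case True then have "I = {0..n}" using sub sup by blast
      then show ?thesis by simp
    next
      case False then have "I = {0..n} - {k}" using sub sup by blast
      then show ?thesis by simp
    qed
  qed simp
  then show ?thesis using that by blast
qed

lemma top_not_horn: "{0..n} \<notin> horn_faces n k" "{0..n} - {k} \<notin> horn_faces n k"
  unfolding horn_faces_def by blast+

context
  fixes n k :: nat
  assumes n: "1 \<le> n" and k: "k \<le> n"
begin

lemma remove_vertex_nonempty: "{0..n} - {v} \<noteq> {}"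
proof
  assume "{0..n} - {v} = {}"
  then have "0 = v" "n = v" by (metis Diff_iff atLeastAtMost_iff empty_iff le0 order_refl singletonD)+
  then show False using n by simp
qed

lemma missing_face: "{0..n} - {k} \<in> faces n"
  using remove_vertex_nonempty[of k] by (simp add: faces_def)

lemma face_degree_missing: "face_degree ({0..n} - {k}) = face_degree {0..n} + 1"
  using k by (simp add: face_degree_def)

lemma face_boundary_top:
  "face_boundary {0..n} = other_faces n k + frag_cmul (vertex_sign k {0..n}) (frag_of ({0..n} - {k}))"
proof -
  have "face_boundary {0..n} = (\<Sum>v\<in>{0..n}. frag_cmul (vertex_sign v {0..n}) (frag_of ({0..n} - {v})))"
    unfolding face_boundary_sum[OF finite_atLeastAtMost] nonempty_face_def
    using remove_vertex_nonempty by (simp del: Diff_eq_empty_iff)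
  also have "\<dots> = frag_cmul (vertex_sign k {0..n}) (frag_of ({0..n} - {k})) + other_faces n k"
    unfolding other_faces_def by (rule sum.remove) (use k in auto)
  finally show ?thesis by (simp add: add.commute)
qed

lemma keys_other_faces:
  assumes "J \<in> Poly_Mapping.keys (other_faces n k)"
  shows "J \<in> horn_faces n k" "face_degree J = face_degree {0..n} + 1"
proof -
  have "J \<in> (\<Union>v\<in>{0..n} - {k}. Poly_Mapping.keys (frag_cmul (vertex_sign v {0..n}) (frag_of ({0..n} - {v}))))"
    using subsetD[OF keys_sum assms[unfolded other_faces_def]] .
  then obtain v where v: "v \<in> {0..n}" "v \<noteq> k" "J \<in> Poly_Mapping.keys (frag_cmul (vertex_sign v {0..n}) (frag_of ({0..n} - {v})))"
    by blast
  have J: "J = {0..n} - {v}" using subsetD[OF keys_cmul v(3)] by simp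
  show "J \<in> horn_faces n k"
    unfolding J horn_faces_def using remove_vertex_nonempty[of v] v(1,2) by (auto simp: faces_def)
  show "face_degree J = face_degree {0..n} + 1" unfolding J using v(1) by (simp add: face_degree_def)
qed

end

locale horn_filling = bar_pair VA VB DA DB
  for VA :: "'a grmod" and VB :: "'b grmod" and DA DB +
  fixes n k :: nat and g :: "nat set \<Rightarrow> int \<Rightarrow> 'a words \<Rightarrow> 'b words"
  assumes n: "1 \<le> n" and k: "k \<le> n" and g: "morphism_family (horn_faces n k) g"
begin

abbreviation top_face ("\<tau>") where "\<tau> \<equiv> {0..n}"
abbreviation missing_face ("\<kappa>") where "\<kappa> \<equiv> {0..n} - {k}"

lemma g_family: "family (horn_faces n k) g" using g by (simp add: morphism_family_def)

lemmas deg = face_degree_missing[OF n k]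
lemmas kappa = missing_face[OF n k]

text \<open>On the top face the one-letter part is chosen to be zero. The differential rule for the top face
  then determines the one-letter part on the missing face, up to the data on shorter words.\<close>

definition missing_head :: "(nat set \<Rightarrow> int \<Rightarrow> 'a words \<Rightarrow> 'b words) \<Rightarrow> int \<Rightarrow> 'a words \<Rightarrow> 'b words" where
  "missing_head F d x = head_word VB (d + (face_degree \<tau> + 1))
     ((DB (d + face_degree \<tau>) (tail_part F \<tau> d x) \<otimes>\<^bsub>B.T (d + (face_degree \<tau> + 1))\<^esub>
        free_lift (B.T (d + (face_degree \<tau> + 1))) (\<lambda>J. g J d x) (- other_faces n k))
      [^]\<^bsub>B.T (d + (face_degree \<tau> + 1))\<^esub> vertex_sign k \<tau>)"

definition fill_step :: "(nat set \<Rightarrow> int \<Rightarrow> 'a words \<Rightarrow> 'b words) \<Rightarrow> nat set \<Rightarrow> int \<Rightarrow> 'a words \<Rightarrow> 'b words" where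
  "fill_step F I = (if I \<in> horn_faces n k then g I else if I = \<tau> then tail_part F \<tau>
     else (\<lambda>d x. tail_part F \<kappa> d x \<otimes>\<^bsub>B.T (d + (face_degree \<tau> + 1))\<^esub> missing_head F d x))"

text \<open>The family to be constructed is a fixed point of \<open>fill_step\<close>. On words of length \<open>m\<close> the step only
  depends on shorter words, so that the sequence is stationary from stage \<open>m\<close> on, and the fixed point
  is read off on each word at the stage given by its length.\<close>

primrec fill_seq :: "nat \<Rightarrow> nat set \<Rightarrow> int \<Rightarrow> 'a words \<Rightarrow> 'b words" where
  "fill_seq 0 = (\<lambda>I d x. \<one>\<^bsub>B.T (d + face_degree I)\<^esub>)"
| "fill_seq (Suc m) = fill_step (fill_seq m)"

definition fill :: "nat set \<Rightarrow> int \<Rightarrow> 'a words \<Rightarrow> 'b words" where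
  "fill I d = lift (B.T (d + face_degree I)) (\<lambda>w. fill_seq (length w) I d (word_elem VA w))"

lemma fill_step_simps:
  "I \<in> horn_faces n k \<Longrightarrow> fill_step F I = g I"
  "fill_step F \<tau> = tail_part F \<tau>"
  "fill_step F \<kappa> = (\<lambda>d x. tail_part F \<kappa> d x \<otimes>\<^bsub>B.T (d + (face_degree \<tau> + 1))\<^esub> missing_head F d x)"
proof -
  have "k \<in> \<tau>" using k by simp
  then have ne: "\<kappa> \<noteq> \<tau>" by blast
  show "I \<in> horn_faces n k \<Longrightarrow> fill_step F I = g I"
    unfolding fill_step_def by (rule if_P)
  show "fill_step F \<tau> = tail_part F \<tau>"
    unfolding fill_step_def if_not_P[OF top_not_horn(1)] by (rule if_P[OF refl])
  show "fill_step F \<kappa> = (\<lambda>d x. tail_part F \<kappa> d x \<otimes>\<^bsub>B.T (d + (face_degree \<tau> + 1))\<^esub> missing_head F d x)"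
    unfolding fill_step_def if_not_P[OF top_not_horn(2)] by (rule if_not_P[OF ne])
qed

lemma others_graded: "(\<lambda>d x. free_lift (B.T (d + (face_degree \<tau> + 1))) (\<lambda>J. g J d x) (- other_faces n k)) \<in> graded_maps (face_degree \<tau> + 1) A.T B.T"
proof (rule graded_maps_combination[OF _ B.graded_module_Tbar])
  fix J assume "J \<in> Poly_Mapping.keys (- other_faces n k)"
  then have J: "J \<in> Poly_Mapping.keys (other_faces n k)" by simp
  show "g J \<in> graded_maps (face_degree \<tau> + 1) A.T B.T"
    using family_graded[OF g_family keys_other_faces(1)[OF n k J]] keys_other_faces(2)[OF n k J] by simp
qed

lemma missing_head_graded:
  assumes F: "family (faces n) F"
  shows "missing_head F \<in> graded_maps (face_degree \<tau> + 1) A.T B.T"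
proof -
  have D: "(\<lambda>d x. DB (d + face_degree \<tau>) (tail_part F \<tau> d x)) \<in> graded_maps (face_degree \<tau> + 1) A.T B.T"
    by (rule graded_maps_comp[OF tail_part_graded[OF face_closed_faces F top_face] DB_graded refl])
  show ?thesis
    unfolding missing_head_def[abs_def]
    by (rule graded_maps_comp[OF graded_maps_power[OF graded_maps_times[OF D others_graded B.graded_module_Tbar] B.graded_module_Tbar]
          B.head_word_graded]) simp
qed

lemma fill_step_family:
  assumes F: "family (faces n) F" shows "family (faces n) (fill_step F)"
  unfolding family_def
proof
  fix I assume "I \<in> faces n"
  then show "fill_step F I \<in> graded_maps (face_degree I) A.T B.T"
  proof (cases rule: faces_cases[of I n k])
    case 1 then show ?thesis using family_graded[OF g_family] by (simp add: fill_step_simps)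
  next
    case 2 then show ?thesis using tail_part_graded[OF face_closed_faces F top_face] by (simp only: fill_step_simps)
  next
    case 3
    have "tail_part F \<kappa> \<in> graded_maps (face_degree \<tau> + 1) A.T B.T"
      using tail_part_graded[OF face_closed_faces F kappa] unfolding deg .
    from graded_maps_times[OF this missing_head_graded[OF F] B.graded_module_Tbar]
    show ?thesis unfolding 3 fill_step_simps deg .
  qed
qed

lemma tail_part_cong:
  assumes F: "family (faces n) F" and F': "family (faces n) F'" and w: "w \<in> word_gens VA d"
    and eq: "\<And>I i u. I \<in> faces n \<Longrightarrow> u \<in> word_gens VA i \<Longrightarrow> length u < length w
      \<Longrightarrow> F I i (word_elem VA u) = F' I i (word_elem VA u)"
    and I: "I \<in> faces n"
  shows "tail_part F I d (word_elem VA w) = tail_part F' I d (word_elem VA w)"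
proof -
  let ?t = "A.\<Delta> d (word_elem VA w)"
  have t: "?t \<in> carrier (A.TT d)" by (rule A.deconcat_closed[OF A.word_elem_closed[OF w]])
  interpret G: comm_group "B.TT (d + face_degree I)" by (rule B.TP.tensor_group)
  have "aw_sum F I d ?t = aw_sum F' I d ?t"
    unfolding aw_sum_def
  proof (rule G.free_lift_cong)
    fix s assume s: "s \<in> Poly_Mapping.keys (aw_chain I)"
    obtain J K where JK: "s = (J, K)" by (cases s)
    note q = keys_aw_chain_props[OF finite_face[OF I] s[unfolded JK]]
    have J: "J \<in> faces n" and K: "K \<in> faces n" using faces_subset[OF I] q by auto
    show "(case s of (J, K) \<Rightarrow> pair_map F J K d ?t)
      = (case s of (J, K) \<Rightarrow> pair_map F' J K d ?t)"
      unfolding JK prod.case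
      by (rule AB.tensor_map_deconcat_cong[OF family_graded[OF F J] family_graded[OF F' J]
            family_graded[OF F K] family_graded[OF F' K] w eq[OF J] eq[OF K]])
    show "(case s of (J, K) \<Rightarrow> pair_map F' J K d ?t) \<in> carrier (B.TT (d + face_degree I))"
      unfolding JK prod.case
      by (rule AB.MP.tensor_map_closed[OF family_graded[OF F' J] family_graded[OF F' K] t]) (use q(5) in simp)
  qed
  then show ?thesis by (simp add: tail_part_def)
qed

lemma fill_step_cong:
  assumes F: "family (faces n) F" and F': "family (faces n) F'" and w: "w \<in> word_gens VA d"
    and eq: "\<And>I i u. I \<in> faces n \<Longrightarrow> u \<in> word_gens VA i \<Longrightarrow> length u < length w
      \<Longrightarrow> F I i (word_elem VA u) = F' I i (word_elem VA u)"
    and I: "I \<in> faces n"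
  shows "fill_step F I d (word_elem VA w) = fill_step F' I d (word_elem VA w)"
  using I
proof (cases rule: faces_cases[of I n k])
  case 1 then show ?thesis by (simp add: fill_step_simps)
next
  case 2 then show ?thesis using tail_part_cong[OF F F' w eq top_face] by (simp only: fill_step_simps)
next
  case 3
  have "tail_part F \<kappa> d (word_elem VA w) = tail_part F' \<kappa> d (word_elem VA w)"
    by (rule tail_part_cong[OF F F' w _ kappa]) (erule (2) eq)
  moreover have "tail_part F \<tau> d (word_elem VA w) = tail_part F' \<tau> d (word_elem VA w)"
    by (rule tail_part_cong[OF F F' w _ top_face]) (erule (2) eq)
  ultimately show ?thesis unfolding 3 fill_step_simps missing_head_def by simp
qed

lemma fill_seq_family: "family (faces n) (fill_seq m)"
proof (induction m)
  case 0
  show ?case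
    unfolding family_def graded_maps_def fill_seq.simps
    by (auto intro!: hom_one_pointwise graded_module_group[OF B.graded_module_Tbar])
next
  case (Suc m) then show ?case by (simp add: fill_step_family)
qed

lemma fill_seq_stable:
  assumes "I \<in> faces n" "w \<in> word_gens VA d" "length w \<le> m"
  shows "fill_seq (Suc m) I d (word_elem VA w) = fill_seq m I d (word_elem VA w)"
  using assms
proof (induction m arbitrary: I w d)
  case 0
  then show ?case by (simp add: word_gens_def)
next
  case (Suc m)
  show ?case
    unfolding fill_seq.simps(2)[of "Suc m"] fill_seq.simps(2)[of m]
  proof (rule fill_step_cong[OF fill_step_family[OF fill_seq_family] fill_seq_family Suc.prems(2) _ Suc.prems(1)])
    fix J i u assume "J \<in> faces n" "u \<in> word_gens VA i" "length u < length w"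
    then show "fill_step (fill_seq m) J i (word_elem VA u) = fill_seq m J i (word_elem VA u)"
      using Suc.IH[of J u i] Suc.prems(3) by simp
  qed
qed

lemma fill_seq_stable':
  assumes "I \<in> faces n" "w \<in> word_gens VA d" "length w \<le> m"
  shows "fill_seq m I d (word_elem VA w) = fill_seq (length w) I d (word_elem VA w)"
  using assms(3)
proof (induction m rule: dec_induct)
  case (step m) then show ?case using fill_seq_stable[OF assms(1,2), of m] by simp
qed simp

lemma fill_lift:
  assumes I: "I \<in> faces n"
  shows fill_hom: "fill I d \<in> hom (A.T d) (B.T (d + face_degree I))"
    and fill_word: "w \<in> word_gens VA d \<Longrightarrow> fill I d (word_elem VA w) = fill_seq (length w) I d (word_elem VA w)"
proof -
  let ?b = "\<lambda>w. fill_seq (length w) I d (word_elem VA w)"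
  have c: "?b w \<in> carrier (B.T (d + face_degree I))" if "w \<in> word_gens VA d" for w
    by (rule family_closed[OF fill_seq_family I A.word_elem_closed[OF that] refl])
  have l: "?b (us @ (i, x \<otimes>\<^bsub>VA i\<^esub> y) # vs) = ?b (us @ (i, x) # vs) \<otimes>\<^bsub>B.T (d + face_degree I)\<^esub> ?b (us @ (i, y) # vs)"
    if u: "us @ (i, x) # vs \<in> word_gens VA d" "us @ (i, y) # vs \<in> word_gens VA d" for us i x y vs
    using hom_mult[OF graded_maps_hom[OF family_graded[OF fill_seq_family I] refl] A.word_elem_closed[OF u(1)] A.word_elem_closed[OF u(2)]]
      A.word_elem_letter[OF u] by (simp del: fill_seq.simps)
  show "fill I d \<in> hom (A.T d) (B.T (d + face_degree I))"
    unfolding fill_def by (rule A.word_lift_hom[OF B.Tbar_group c l])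
  show "w \<in> word_gens VA d \<Longrightarrow> fill I d (word_elem VA w) = fill_seq (length w) I d (word_elem VA w)"
    unfolding fill_def by (rule A.word_lift_elem[OF B.Tbar_group c l])
qed

lemma fill_family: "family (faces n) fill"
  unfolding family_def graded_maps_def using fill_hom by blast

lemma fill_fixed_point:
  assumes I: "I \<in> faces n" and x: "x \<in> carrier (A.T d)"
  shows "fill I d x = fill_step fill I d x"
proof (rule A.word_hom_eq[OF B.Tbar_group fill_hom[OF I] graded_maps_hom[OF family_graded[OF fill_step_family[OF fill_family] I] refl] _ x])
  fix w assume w: "w \<in> word_gens VA d"
  have "fill I d (word_elem VA w) = fill_seq (Suc (length w)) I d (word_elem VA w)"
    using fill_word[OF I w] fill_seq_stable[OF I w order_refl] by simp
  also have "\<dots> = fill_step fill I d (word_elem VA w)"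
    unfolding fill_seq.simps(2)
  proof (rule fill_step_cong[OF fill_seq_family fill_family w _ I])
    fix J i u assume J: "J \<in> faces n" and u: "u \<in> word_gens VA i" "length u < length w"
    show "fill_seq (length w) J i (word_elem VA u) = fill J i (word_elem VA u)"
      using fill_word[OF J u(1)] fill_seq_stable'[OF J u(1), of "length w"] u(2) by simp
  qed
  finally show "fill I d (word_elem VA w) = fill_step fill I d (word_elem VA w)" .
qed

lemma fill_horn: "I \<in> horn_faces n k \<Longrightarrow> x \<in> carrier (A.T d) \<Longrightarrow> fill I d x = g I d x"
  using fill_fixed_point[OF horn_faces_subset] by (simp add: fill_step_simps)

lemma fill_top: "x \<in> carrier (A.T d) \<Longrightarrow> fill \<tau> d x = tail_part fill \<tau> d x"
  using fill_fixed_point[OF top_face] by (simp only: fill_step_simps)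

lemma fill_missing: "x \<in> carrier (A.T d) \<Longrightarrow> fill \<kappa> d x = tail_part fill \<kappa> d x \<otimes>\<^bsub>B.T (d + (face_degree \<tau> + 1))\<^esub> missing_head fill d x"
  using fill_fixed_point[OF kappa] by (simp only: fill_step_simps)

lemma fill_horn_rules:
  assumes I: "I \<in> horn_faces n k" and x: "x \<in> carrier (A.T d)"
  shows "coproduct_rule fill I d x" "differential_rule fill I d x"
proof -
  note cl = face_closedD[OF face_closed_horn_faces I]
  have m: "mono_on UNIV (id :: nat \<Rightarrow> nat)" by (simp add: mono_on_def)
  have a: "id ` J \<in> horn_faces n k" if "J \<subseteq> I" "J \<noteq> {}" "inj_on id J" for J using cl(3)[OF that(1,2)] by simp
  have b: "fill J \<in> graded_maps (face_degree J) A.T B.T" if "J \<subseteq> I" "J \<noteq> {}" for J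
    by (rule family_graded[OF fill_family horn_faces_subset[OF cl(3)[OF that]]])
  have c: "fill J d x = pullback_family id g J d x" if "J \<subseteq> I" "J \<noteq> {}" "x \<in> carrier (A.T d)" for J d x
    using fill_horn[OF cl(3)[OF that(1,2)] that(3)] by (simp add: pullback_family_def)
  have "coproduct_rule g (id ` I) d x \<and> differential_rule g (id ` I) d x"
    using g I x by (simp add: morphism_family_def)
  then show "coproduct_rule fill I d x" "differential_rule fill I d x"
    using pullback_rules_inj[OF cl(1,2) m subset_UNIV g_family a b c x inj_on_id] by blast+
qed

lemma head_missing:
  assumes x: "x \<in> carrier (A.T d)"
  shows "head_word VB (d + (face_degree \<tau> + 1)) (fill \<kappa> d x) = missing_head fill d x"
proof -
  let ?e = "d + (face_degree \<tau> + 1)"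
  interpret T: comm_group "B.T ?e" by (rule B.Tbar_group)
  have ee: "?e = d + face_degree \<kappa>" by (simp add: deg)
  have mc: "missing_head fill d x \<in> carrier (B.T ?e)" by (rule graded_maps_closed[OF missing_head_graded[OF fill_family] x refl])
  have tc: "tail_part fill \<kappa> d x \<in> carrier (B.T ?e)"
    by (rule graded_maps_closed[OF tail_part_graded[OF face_closed_faces fill_family kappa] x ee])
  have D: "DB (d + face_degree \<tau>) (tail_part fill \<tau> d x) \<in> carrier (B.T ?e)"
    by (rule graded_maps_closed[OF DB_graded graded_maps_closed[OF tail_part_graded[OF face_closed_faces fill_family top_face] x refl]]) simp
  have O: "free_lift (B.T ?e) (\<lambda>J. g J d x) (- other_faces n k) \<in> carrier (B.T ?e)"
    by (rule graded_maps_closed[OF others_graded x refl])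
  have "head_word VB ?e (missing_head fill d x) = missing_head fill d x"
    unfolding missing_head_def by (rule B.head_word_head_word) (use D O in simp)
  then show ?thesis
    unfolding fill_missing[OF x] hom_mult[OF B.head_word_hom tc mc]
      head_tail_part[OF face_closed_faces fill_family kappa x ee] using mc by simp
qed

lemma fill_coproduct_rule:
  assumes I: "I \<in> faces n" and x: "x \<in> carrier (A.T d)"
  shows "coproduct_rule fill I d x"
proof (rule cofreeness[OF face_closed_faces fill_family _ I x])
  fix I d x assume I: "I \<in> faces n" and x: "x \<in> carrier (A.T d)"
  interpret T: comm_group "B.T (d + face_degree I)" by (rule B.Tbar_group)
  have tc: "tail_part fill I d x \<in> carrier (B.T (d + face_degree I))"
    by (rule graded_maps_closed[OF tail_part_graded[OF face_closed_faces fill_family I] x refl])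
  show "fill I d x = head_word VB (d + face_degree I) (fill I d x) \<otimes>\<^bsub>B.T (d + face_degree I)\<^esub> tail_part fill I d x"
    using I
  proof (cases rule: faces_cases[of I n k])
    case 1
    show ?thesis by (rule coproduct_rule_reconstruct[OF face_closed_faces fill_family I x fill_horn_rules(1)[OF 1 x] refl])
  next
    case 2
    have "fill I d x = tail_part fill I d x" unfolding 2 by (rule fill_top[OF x])
    then show ?thesis using head_tail_part[OF face_closed_faces fill_family I x refl] tc by simp
  next
    case 3
    have e: "d + face_degree I = d + (face_degree \<tau> + 1)" unfolding 3 deg ..
    have mc: "missing_head fill d x \<in> carrier (B.T (d + face_degree I))"
      unfolding e by (rule graded_maps_closed[OF missing_head_graded[OF fill_family] x refl])
    have "fill I d x = tail_part fill I d x \<otimes>\<^bsub>B.T (d + face_degree I)\<^esub> missing_head fill d x"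
      unfolding e unfolding 3 by (rule fill_missing[OF x])
    moreover have "head_word VB (d + face_degree I) (fill I d x) = missing_head fill d x"
      unfolding e unfolding 3 by (rule head_missing[OF x])
    ultimately show ?thesis using T.m_comm[OF tc mc] by simp
  qed
qed

text \<open>By the choice of the one-letter part on the missing face, the differential rule for the top face
  holds after projection to words with one letter.\<close>

lemma head_diff_rhs_top:
  assumes x: "x \<in> carrier (A.T d)" and e: "e = d + (face_degree \<tau> + 1)"
  shows "head_word VB e (DB (d + face_degree \<tau>) (fill \<tau> d x)) = head_word VB e (diff_rhs fill \<tau> d x)"
proof -
  interpret T: comm_group "B.T e" by (rule B.Tbar_group)
  have Dx: "DA d x \<in> carrier (A.T (d + 1))" by (rule graded_maps_closed[OF DA_graded x refl])
  have h: "head_word VB e \<in> hom (B.T e) (B.T e)" by (rule B.head_word_hom)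
  have hc: "head_word VB e y \<in> carrier (B.T e)" if "y \<in> carrier (B.T e)" for y using h that by (auto simp: hom_def)
  define Q where "Q = free_lift (B.T e) (\<lambda>J. g J d x) (other_faces n k)"
  define Z where "Z = DB (d + face_degree \<tau>) (fill \<tau> d x)"
  let ?\<epsilon> = "vertex_sign k \<tau>"
  have gc: "g J d x \<in> carrier (B.T e)" if "J \<in> Poly_Mapping.keys (other_faces n k)" for J
    by (rule family_closed[OF g_family keys_other_faces(1)[OF n k that] x]) (use keys_other_faces(2)[OF n k that] e in simp)
  have Q: "Q \<in> carrier (B.T e)" unfolding Q_def by (rule T.free_lift_closed[OF gc])
  have kc: "fill \<kappa> d x \<in> carrier (B.T e)" by (rule family_closed[OF fill_family kappa x]) (simp add: e deg)
  have Z: "Z \<in> carrier (B.T e)" unfolding Z_def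
    by (rule graded_maps_closed[OF target_part_graded[OF face_closed_faces fill_family top_face] x e])
  have fc: "fill J d x \<in> carrier (B.T e)"
    if "J \<in> Poly_Mapping.keys (other_faces n k) \<union> Poly_Mapping.keys (frag_cmul ?\<epsilon> (frag_of \<kappa>))" for J
    using that
  proof
    assume J: "J \<in> Poly_Mapping.keys (other_faces n k)"
    show ?thesis using fill_horn[OF keys_other_faces(1)[OF n k J] x] gc[OF J] by simp
  next
    assume "J \<in> Poly_Mapping.keys (frag_cmul ?\<epsilon> (frag_of \<kappa>))"
    then have "J = \<kappa>" using subsetD[OF keys_cmul] by fastforce
    then show ?thesis using kc by simp
  qed
  have "free_lift (B.T e) (\<lambda>J. fill J d x) (face_boundary \<tau>)
    = free_lift (B.T e) (\<lambda>J. fill J d x) (other_faces n k) \<otimes>\<^bsub>B.T e\<^esub> free_lift (B.T e) (\<lambda>J. fill J d x) (frag_cmul ?\<epsilon> (frag_of \<kappa>))"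
    unfolding face_boundary_top[OF n k] by (rule T.free_lift_add[OF fc])
  also have "free_lift (B.T e) (\<lambda>J. fill J d x) (frag_cmul ?\<epsilon> (frag_of \<kappa>)) = fill \<kappa> d x [^]\<^bsub>B.T e\<^esub> ?\<epsilon>"
    using T.free_lift_cmul[of "frag_of \<kappa>" "\<lambda>J. fill J d x" ?\<epsilon>] T.free_lift_frag_of[of "\<lambda>J. fill J d x" \<kappa>] kc by simp
  also have "free_lift (B.T e) (\<lambda>J. fill J d x) (other_faces n k) = Q"
    unfolding Q_def by (rule T.free_lift_cong[OF fill_horn[OF keys_other_faces(1)[OF n k] x] gc])
  finally have b: "free_lift (B.T e) (\<lambda>J. fill J d x) (face_boundary \<tau>) = Q \<otimes>\<^bsub>B.T e\<^esub> fill \<kappa> d x [^]\<^bsub>B.T e\<^esub> ?\<epsilon>" .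
  have mn: "free_lift (B.T e) (\<lambda>J. g J d x) (- other_faces n k) = inv\<^bsub>B.T e\<^esub> Q"
    unfolding Q_def by (rule T.free_lift_minus) (erule gc)
  have "head_word VB e (fill \<kappa> d x) = head_word VB e ((Z \<otimes>\<^bsub>B.T e\<^esub> inv\<^bsub>B.T e\<^esub> Q) [^]\<^bsub>B.T e\<^esub> ?\<epsilon>)"
    using head_missing[OF x] by (simp add: missing_head_def e[symmetric] Z_def fill_top[OF x] mn)
  also have "\<dots> = (head_word VB e Z \<otimes>\<^bsub>B.T e\<^esub> head_word VB e (inv\<^bsub>B.T e\<^esub> Q)) [^]\<^bsub>B.T e\<^esub> ?\<epsilon>"
    using hom_int_pow[OF h _ T.is_group T.is_group, of "Z \<otimes>\<^bsub>B.T e\<^esub> inv\<^bsub>B.T e\<^esub> Q" ?\<epsilon>] hom_mult[OF h Z, of "inv\<^bsub>B.T e\<^esub> Q"] Q Z by simp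
  finally have hk: "head_word VB e (fill \<kappa> d x) [^]\<^bsub>B.T e\<^esub> ?\<epsilon> = head_word VB e Z \<otimes>\<^bsub>B.T e\<^esub> head_word VB e (inv\<^bsub>B.T e\<^esub> Q)"
    using hc Q Z by (simp add: T.int_pow_pow vertex_sign_square)
  have s: "fill \<tau> (d + 1) (DA d x) \<in> carrier (B.T e)"
    by (rule family_closed[OF fill_family top_face Dx]) (simp add: e)
  have s1: "head_word VB e (fill \<tau> (d + 1) (DA d x)) = \<one>\<^bsub>B.T e\<^esub>"
    unfolding fill_top[OF Dx] by (rule head_tail_part[OF face_closed_faces fill_family top_face Dx]) (simp add: e)
  have "head_word VB e (diff_rhs fill \<tau> d x) = head_word VB e (Q \<otimes>\<^bsub>B.T e\<^esub> fill \<kappa> d x [^]\<^bsub>B.T e\<^esub> ?\<epsilon>)"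
    unfolding diff_rhs_def e[symmetric] b
    using hom_mult[OF h, of "Q \<otimes>\<^bsub>B.T e\<^esub> fill \<kappa> d x [^]\<^bsub>B.T e\<^esub> ?\<epsilon>" "fill \<tau> (d + 1) (DA d x) [^]\<^bsub>B.T e\<^esub> sgn_pow (face_degree \<tau>)"]
      hom_int_pow[OF h s T.is_group T.is_group] s s1 Q kc hc by simp
  also have "\<dots> = head_word VB e Q \<otimes>\<^bsub>B.T e\<^esub> (head_word VB e Z \<otimes>\<^bsub>B.T e\<^esub> head_word VB e (inv\<^bsub>B.T e\<^esub> Q))"
    using hom_mult[OF h Q, of "fill \<kappa> d x [^]\<^bsub>B.T e\<^esub> ?\<epsilon>"] hom_int_pow[OF h kc T.is_group T.is_group] hk kc by simp
  also have "\<dots> = head_word VB e (Q \<otimes>\<^bsub>B.T e\<^esub> (Z \<otimes>\<^bsub>B.T e\<^esub> inv\<^bsub>B.T e\<^esub> Q))"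
    using hom_mult[OF h] Q Z by simp
  also have "Q \<otimes>\<^bsub>B.T e\<^esub> (Z \<otimes>\<^bsub>B.T e\<^esub> inv\<^bsub>B.T e\<^esub> Q) = Z"
    using Q Z T.m_lcomm[of Q Z "inv\<^bsub>B.T e\<^esub> Q"] by simp
  finally show ?thesis by (simp add: Z_def)
qed

text \<open>The differential rule for the missing face is forced by the one for the top face, because both
  differentials and the simplicial boundary square to zero.\<close>

lemma differential_rule_missing:
  assumes x: "x \<in> carrier (A.T d)" and top: "differential_rule fill \<tau> d x" "differential_rule fill \<tau> (d + 1) (DA d x)"
  shows "differential_rule fill \<kappa> d x"
proof -
  define e where "e = d + (face_degree \<tau> + 1)"
  let ?s = "sgn_pow (face_degree \<tau>)" and ?\<epsilon> = "vertex_sign k \<tau>"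
  interpret T: comm_group "B.T e" by (rule B.Tbar_group)
  interpret T1: comm_group "B.T (e + 1)" by (rule B.Tbar_group)
  have Dx: "DA d x \<in> carrier (A.T (d + 1))" by (rule graded_maps_closed[OF DA_graded x refl])
  have D: "DB e \<in> hom (B.T e) (B.T (e + 1))" by (rule graded_maps_hom[OF DB_graded refl])
  have Dc: "DB e y \<in> carrier (B.T (e + 1))" if "y \<in> carrier (B.T e)" for y using D that by (auto simp: hom_def)
  have bk: "J \<in> faces n" "face_degree J = face_degree \<tau> + 1" if "J \<in> Poly_Mapping.keys (face_boundary \<tau>)" for J
    using keys_face_boundary[OF finite_atLeastAtMost that] faces_subset[OF top_face] by auto
  have fc: "fill J d x \<in> carrier (B.T e)" and fc': "fill J (d + 1) (DA d x) \<in> carrier (B.T (e + 1))"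
    if "J \<in> faces n" "face_degree J = face_degree \<tau> + 1" for J
    using family_closed[OF fill_family that(1) x, of e] family_closed[OF fill_family that(1) Dx, of "e + 1"] that(2)
    by (auto simp: e_def)
  let ?Z = "\<lambda>J. DB e (fill J d x) \<otimes>\<^bsub>B.T (e + 1)\<^esub> fill J (d + 1) (DA d x) [^]\<^bsub>B.T (e + 1)\<^esub> ?s"
  let ?Y = "\<lambda>J. free_lift (B.T (e + 1)) (\<lambda>K. fill K d x) (face_boundary J)"
  have Zc: "?Z J \<in> carrier (B.T (e + 1))" if "J \<in> faces n" "face_degree J = face_degree \<tau> + 1" for J
    using fc[OF that] fc'[OF that] Dc by simp
  have bb: "fill K d x \<in> carrier (B.T (e + 1))"
    if J: "J \<in> faces n" "face_degree J = face_degree \<tau> + 1" and K: "K \<in> Poly_Mapping.keys (face_boundary J)" for J K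
  proof -
    note q = keys_face_boundary[OF finite_face[OF J(1)] K]
    show ?thesis by (rule family_closed[OF fill_family faces_subset[OF J(1) q(1,2)] x]) (use q(3) J(2) in \<open>simp add: e_def\<close>)
  qed
  have Yc: "?Y J \<in> carrier (B.T (e + 1))" if "J \<in> faces n" "face_degree J = face_degree \<tau> + 1" for J
    by (rule T1.free_lift_closed) (rule bb[OF that])
  have ok: "J \<in> faces n" "face_degree J = face_degree \<tau> + 1" if "J \<in> Poly_Mapping.keys (other_faces n k)" for J
    using keys_other_faces[OF n k that] horn_faces_subset by auto
  have kk: "\<kappa> \<in> faces n" "face_degree \<kappa> = face_degree \<tau> + 1" by (rule kappa, rule deg)
  have rule_iff: "differential_rule fill J d x \<longleftrightarrow> ?Z J = ?Y J" if J: "J \<in> faces n" "face_degree J = face_degree \<tau> + 1" for J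
  proof -
    let ?f = "fill J (d + 1) (DA d x)"
    have ss: "sgn_pow (face_degree J) = - ?s" using J(2) by (simp add: sgn_pow_def)
    have e': "d + face_degree J = e" "d + (face_degree J + 1) = e + 1" using J(2) by (auto simp: e_def)
    have "differential_rule fill J d x \<longleftrightarrow> DB e (fill J d x) = ?Y J \<otimes>\<^bsub>B.T (e + 1)\<^esub> inv\<^bsub>B.T (e + 1)\<^esub> (?f [^]\<^bsub>B.T (e + 1)\<^esub> ?s)"
      unfolding differential_rule_rhs diff_rhs_def e' ss by (simp add: T1.int_pow_neg[OF fc'[OF J]])
    also have "\<dots> \<longleftrightarrow> ?Z J = ?Y J"
      using T1.inv_solve_right[of "DB e (fill J d x)" "?Y J" "?f [^]\<^bsub>B.T (e + 1)\<^esub> ?s"] Dc[OF fc[OF J]] Yc[OF J] fc'[OF J]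
      by (metis T1.int_pow_closed)
    finally show ?thesis .
  qed
  have split: "free_lift (B.T (e + 1)) b (face_boundary \<tau>)
      = free_lift (B.T (e + 1)) b (other_faces n k) \<otimes>\<^bsub>B.T (e + 1)\<^esub> b \<kappa> [^]\<^bsub>B.T (e + 1)\<^esub> ?\<epsilon>"
    if b: "\<And>J. J \<in> faces n \<Longrightarrow> face_degree J = face_degree \<tau> + 1 \<Longrightarrow> b J \<in> carrier (B.T (e + 1))" for b
  proof -
    have c: "b J \<in> carrier (B.T (e + 1))"
      if "J \<in> Poly_Mapping.keys (other_faces n k) \<union> Poly_Mapping.keys (frag_cmul ?\<epsilon> (frag_of \<kappa>))" for J
      using that
    proof
      assume "J \<in> Poly_Mapping.keys (other_faces n k)"
      then show ?thesis using b ok by blast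
    next
      assume "J \<in> Poly_Mapping.keys (frag_cmul ?\<epsilon> (frag_of \<kappa>))"
      then have "J = \<kappa>" using subsetD[OF keys_cmul] by fastforce
      then show ?thesis using b[OF kk] by simp
    qed
    have "free_lift (B.T (e + 1)) b (face_boundary \<tau>) = free_lift (B.T (e + 1)) b (other_faces n k)
      \<otimes>\<^bsub>B.T (e + 1)\<^esub> free_lift (B.T (e + 1)) b (frag_cmul ?\<epsilon> (frag_of \<kappa>))"
      unfolding face_boundary_top[OF n k] by (rule T1.free_lift_add) (erule c)
    then show ?thesis
      using T1.free_lift_cmul[of "frag_of \<kappa>" b ?\<epsilon>] T1.free_lift_frag_of[of b \<kappa>, OF b[OF kk]] b[OF kk] by simp
  qed
  have Zsum: "free_lift (B.T (e + 1)) ?Z (face_boundary \<tau>) = \<one>\<^bsub>B.T (e + 1)\<^esub>"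
  proof -
    have e0: "d + face_degree \<tau> + 1 = e" "d + 1 + face_degree \<tau> = e" "d + 1 + (face_degree \<tau> + 1) = e + 1" by (auto simp: e_def)
    have ft: "fill \<tau> d x \<in> carrier (B.T (d + face_degree \<tau>))" by (rule family_closed[OF fill_family top_face x refl])
    have fD: "fill \<tau> (d + 1) (DA d x) \<in> carrier (B.T e)" by (rule family_closed[OF fill_family top_face Dx]) (simp add: e_def)
    let ?b = "free_lift (B.T e) (\<lambda>J. fill J d x) (face_boundary \<tau>)"
    let ?b' = "free_lift (B.T (e + 1)) (\<lambda>J. fill J (d + 1) (DA d x)) (face_boundary \<tau>)"
    have bc: "?b \<in> carrier (B.T e)" by (rule T.free_lift_closed) (rule fc[OF bk])
    have bc': "?b' \<in> carrier (B.T (e + 1))" by (rule T1.free_lift_closed) (rule fc'[OF bk])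
    have "\<one>\<^bsub>B.T (e + 1)\<^esub> = DB e (DB (d + face_degree \<tau>) (fill \<tau> d x))"
      using DB_DB[OF ft] by (simp add: e_def add_ac)
    also have "\<dots> = DB e (?b \<otimes>\<^bsub>B.T e\<^esub> fill \<tau> (d + 1) (DA d x) [^]\<^bsub>B.T e\<^esub> ?s)"
      using top(1) unfolding differential_rule_rhs diff_rhs_def e_def[symmetric] by simp
    also have "\<dots> = DB e ?b \<otimes>\<^bsub>B.T (e + 1)\<^esub> DB e (fill \<tau> (d + 1) (DA d x)) [^]\<^bsub>B.T (e + 1)\<^esub> ?s"
      unfolding hom_mult[OF D bc T.int_pow_closed[OF fD]] hom_int_pow[OF D fD T.is_group T1.is_group] ..
    also have "DB e (fill \<tau> (d + 1) (DA d x)) = ?b'"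
    proof -
      have dd: "d + 1 + 1 = d + 2" by simp
      have "DA (d + 1) (DA d x) = \<one>\<^bsub>A.T (d + 1 + 1)\<^esub>" using DA_DA[OF x] by (simp only: dd)
      then have z: "fill \<tau> (d + 1 + 1) (DA (d + 1) (DA d x)) = \<one>\<^bsub>B.T (e + 1)\<^esub>"
        using graded_maps_one[OF family_graded[OF fill_family top_face] A.graded_module_Tbar B.graded_module_Tbar, of "e + 1" "d + 1 + 1"]
        by (simp add: e_def)
      have "DB e (fill \<tau> (d + 1) (DA d x)) = ?b' \<otimes>\<^bsub>B.T (e + 1)\<^esub> fill \<tau> (d + 1 + 1) (DA (d + 1) (DA d x)) [^]\<^bsub>B.T (e + 1)\<^esub> ?s"
        using top(2) unfolding differential_rule_rhs diff_rhs_def e0 .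
      then show ?thesis unfolding z using bc' by simp
    qed
    also have "DB e ?b \<otimes>\<^bsub>B.T (e + 1)\<^esub> ?b' [^]\<^bsub>B.T (e + 1)\<^esub> ?s = free_lift (B.T (e + 1)) ?Z (face_boundary \<tau>)"
    proof -
      have "DB e ?b = free_lift (B.T (e + 1)) (\<lambda>J. DB e (fill J d x)) (face_boundary \<tau>)"
        by (rule hom_free_lift[OF T.comm_group_axioms T1.comm_group_axioms D fc[OF bk]])
      moreover have "?b' [^]\<^bsub>B.T (e + 1)\<^esub> ?s = free_lift (B.T (e + 1)) (\<lambda>J. fill J (d + 1) (DA d x) [^]\<^bsub>B.T (e + 1)\<^esub> ?s) (face_boundary \<tau>)"
        by (rule T1.free_lift_power[symmetric, OF fc'[OF bk]])
      moreover have "free_lift (B.T (e + 1)) ?Z (face_boundary \<tau>) = free_lift (B.T (e + 1)) (\<lambda>J. DB e (fill J d x)) (face_boundary \<tau>)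
        \<otimes>\<^bsub>B.T (e + 1)\<^esub> free_lift (B.T (e + 1)) (\<lambda>J. fill J (d + 1) (DA d x) [^]\<^bsub>B.T (e + 1)\<^esub> ?s) (face_boundary \<tau>)"
        by (rule T1.free_lift_mult[OF Dc[OF fc[OF bk]] T1.int_pow_closed[OF fc'[OF bk]]])
      ultimately show ?thesis by simp
    qed
    finally show ?thesis by simp
  qed
  have Ysum: "free_lift (B.T (e + 1)) ?Y (face_boundary \<tau>) = \<one>\<^bsub>B.T (e + 1)\<^esub>"
    using T1.free_lift_extend[of "face_boundary \<tau>" face_boundary "\<lambda>K. fill K d x"] bb[OF bk] face_boundary_boundary[OF finite_atLeastAtMost, of 0 n]
    by simp
  have ZY: "free_lift (B.T (e + 1)) ?Z (other_faces n k) = free_lift (B.T (e + 1)) ?Y (other_faces n k)"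
  proof (rule T1.free_lift_cong[OF _ Yc[OF ok]])
    fix J assume J: "J \<in> Poly_Mapping.keys (other_faces n k)"
    show "?Z J = ?Y J"
      using rule_iff[OF ok[OF J]] fill_horn_rules(2)[OF keys_other_faces(1)[OF n k J] x] by blast
  qed
  have Oc: "free_lift (B.T (e + 1)) ?Y (other_faces n k) \<in> carrier (B.T (e + 1))"
    by (rule T1.free_lift_closed[OF Yc[OF ok]])
  have "free_lift (B.T (e + 1)) ?Y (other_faces n k) \<otimes>\<^bsub>B.T (e + 1)\<^esub> ?Z \<kappa> [^]\<^bsub>B.T (e + 1)\<^esub> ?\<epsilon>
     = free_lift (B.T (e + 1)) ?Y (other_faces n k) \<otimes>\<^bsub>B.T (e + 1)\<^esub> ?Y \<kappa> [^]\<^bsub>B.T (e + 1)\<^esub> ?\<epsilon>"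
    using split[of ?Z, OF Zc] split[of ?Y, OF Yc] Zsum Ysum ZY by simp
  then have "?Z \<kappa> [^]\<^bsub>B.T (e + 1)\<^esub> ?\<epsilon> = ?Y \<kappa> [^]\<^bsub>B.T (e + 1)\<^esub> ?\<epsilon>"
    using Oc T1.int_pow_closed[OF Zc[OF kk]] T1.int_pow_closed[OF Yc[OF kk]] by (metis T1.Units_eq T1.Units_l_cancel)
  then have "(?Z \<kappa> [^]\<^bsub>B.T (e + 1)\<^esub> ?\<epsilon>) [^]\<^bsub>B.T (e + 1)\<^esub> ?\<epsilon> = (?Y \<kappa> [^]\<^bsub>B.T (e + 1)\<^esub> ?\<epsilon>) [^]\<^bsub>B.T (e + 1)\<^esub> ?\<epsilon>"
    by (rule arg_cong)
  then have "?Z \<kappa> = ?Y \<kappa>"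
    unfolding T1.int_pow_pow[OF Zc[OF kk]] T1.int_pow_pow[OF Yc[OF kk]] vertex_sign_square
      T1.int_pow_1[OF Zc[OF kk]] T1.int_pow_1[OF Yc[OF kk]] .
  then show ?thesis using rule_iff[OF kk] by blast
qed

text \<open>For each length the top face comes first: its rule holds on all words of length at most that of \<open>w\<close>,
  hence on the differential of \<open>w\<close>, and this is what the rule for the missing face requires.\<close>

lemma fill_differential_rule_word:
  "w \<in> word_gens VA d \<Longrightarrow> I \<in> faces n \<Longrightarrow> differential_rule fill I d (word_elem VA w)"
proof (induction "length w" arbitrary: w d I rule: less_induct)
  case less
  note co = fill_coproduct_rule
  have top: "differential_rule fill \<tau> i (word_elem VA u)" if u: "u \<in> word_gens VA i" "length u \<le> length w" for u i
  proof -
    let ?e = "i + (face_degree \<tau> + 1)"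
    have x: "word_elem VA u \<in> carrier (A.T i)" by (rule A.word_elem_closed[OF u(1)])
    have "B.\<Delta> ?e (DB (i + face_degree \<tau>) (fill \<tau> i (word_elem VA u))) = B.\<Delta> ?e (diff_rhs fill \<tau> i (word_elem VA u))"
      by (rule differential_rule_deconcat[OF face_closed_faces fill_family co top_face u(1) _ refl])
         (use less.hyps u(2) in auto)
    then show ?thesis
      unfolding differential_rule_rhs
      by (intro B.eq_from_head_word_and_deconcat[OF _ _ head_diff_rhs_top[OF x refl]]
          graded_maps_closed[OF target_part_graded[OF face_closed_faces fill_family top_face] x refl]
          graded_maps_closed[OF diff_rhs_graded[OF face_closed_faces fill_family top_face] x refl])
  qed
  have x: "word_elem VA w \<in> carrier (A.T d)" by (rule A.word_elem_closed[OF less.prems(1)])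
  show ?case using less.prems(2)
  proof (cases rule: faces_cases[of I n k])
    case 1 then show ?thesis by (rule fill_horn_rules(2)[OF _ x])
  next
    case 2 then show ?thesis using top[OF less.prems(1)] by simp
  next
    case 3
    have "DA d (word_elem VA w) \<in> length_part VA (length w) (d + 1)"
      by (rule A.coderivation_length_part_word[OF DA less.prems(1)])
    then have "DB (d + 1 + face_degree \<tau>) (fill \<tau> (d + 1) (DA d (word_elem VA w))) = diff_rhs fill \<tau> (d + 1) (DA d (word_elem VA w))"
      by (rule A.length_part_hom_eq[OF B.Tbar_group
            graded_maps_hom[OF target_part_graded[OF face_closed_faces fill_family top_face] refl]
            graded_maps_hom[OF diff_rhs_graded[OF face_closed_faces fill_family top_face] refl], rotated])
         (use top in \<open>simp add: differential_rule_rhs\<close>)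
    then have "differential_rule fill \<tau> (d + 1) (DA d (word_elem VA w))" by (simp add: differential_rule_rhs)
    then show ?thesis unfolding 3 by (rule differential_rule_missing[OF x top[OF less.prems(1) order_refl]])
  qed
qed

lemma fill_differential_rule:
  assumes I: "I \<in> faces n" and x: "x \<in> carrier (A.T d)"
  shows "differential_rule fill I d x"
  unfolding differential_rule_rhs
  by (rule A.word_hom_eq[OF B.Tbar_group
            graded_maps_hom[OF target_part_graded[OF face_closed_faces fill_family I] refl]
            graded_maps_hom[OF diff_rhs_graded[OF face_closed_faces fill_family I] refl] _ x])
     (use fill_differential_rule_word[OF _ I] in \<open>simp add: differential_rule_rhs\<close>)

theorem fill_morphism_family: "morphism_family (faces n) fill"
  unfolding morphism_family_def using fill_family fill_coproduct_rule fill_differential_rule by blast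

end


section \<open>Horns as families\<close>

text \<open>The increasing enumeration of a face, as a simplex of the standard simplex.\<close>

definition face_map :: "nat set \<Rightarrow> nat \<Rightarrow> nat" where
  "face_map I = restrict (\<lambda>j. sorted_list_of_set I ! j) {0..card I - 1}"

context
  fixes I :: "nat set"
  assumes I: "finite I" "I \<noteq> {}"
begin

lemma face_map_interval: "{0..card I - 1} = {..<card I}"
proof -
  have "0 < card I" using I by (simp add: card_gt_0_iff)
  then show ?thesis by auto
qed

lemma face_map_image: "face_map I ` {0..card I - 1} = I"
proof -
  have "face_map I ` {0..card I - 1} = (\<lambda>j. sorted_list_of_set I ! j) ` {..<card I}"
    unfolding face_map_def face_map_interval by (rule image_cong) auto
  also have "\<dots> = set (sorted_list_of_set I)"
    by (auto simp: set_conv_nth)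
  finally show ?thesis using I by simp
qed

lemma face_map_less: "i \<in> {0..card I - 1} \<Longrightarrow> j \<in> {0..card I - 1} \<Longrightarrow> i < j \<Longrightarrow> face_map I i < face_map I j"
  using sorted_wrt_nth_less[OF strict_sorted_list_of_set[of I], of i j]
  unfolding face_map_interval face_map_def by simp

lemma face_map_inj: "inj_on (face_map I) {0..card I - 1}"
proof (rule inj_onI)
  fix i j assume ij: "i \<in> {0..card I - 1}" "j \<in> {0..card I - 1}" "face_map I i = face_map I j"
  show "i = j"
  proof (cases i j rule: linorder_cases)
    case less then show ?thesis using face_map_less[OF ij(1,2)] ij(3) by simp
  next
    case greater then show ?thesis using face_map_less[OF ij(2,1)] ij(3) by simp
  qed
qed

lemma face_map_mono: "mono_on {0..card I - 1} (face_map I)"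
proof (rule mono_onI)
  fix i j assume ij: "i \<in> {0..card I - 1}" "j \<in> {0..card I - 1}" "i \<le> j"
  show "face_map I i \<le> face_map I j"
  proof (cases "i = j")
    case False then show ?thesis using less_imp_le[OF face_map_less[OF ij(1,2)]] ij(3) by simp
  qed simp
qed

lemma face_map_ord_maps:
  assumes "I \<subseteq> {0..n}" shows "face_map I \<in> ord_maps (card I - 1) n"
proof -
  have "face_map I j \<in> {0..n}" if "j \<in> {0..card I - 1}" for j
    using face_map_image assms imageI[OF that, of "face_map I"] by blast
  then have "face_map I \<in> {0..card I - 1} \<rightarrow>\<^sub>E {0..n}"
    unfolding face_map_def by (auto simp: restrict_def PiE_def extensional_def)
  then show ?thesis using face_map_mono by (simp add: ord_maps_def)
qed

lemma compose_face_map_inj: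
  assumes m: "mono_on S \<theta>" "I \<subseteq> S" and i: "inj_on \<theta> I"
  shows "compose {0..card I - 1} \<theta> (face_map I) = face_map (\<theta> ` I)"
proof -
  have c: "card (\<theta> ` I) = card I" by (rule card_image[OF i])
  have "sorted_wrt (<) (map \<theta> (sorted_list_of_set I))"
    unfolding sorted_wrt_map
  proof (rule sorted_wrt_mono_rel[OF _ strict_sorted_list_of_set])
    fix x y assume "x \<in> set (sorted_list_of_set I)" "y \<in> set (sorted_list_of_set I)" "x < y"
    then show "\<theta> x < \<theta> y" using mono_inj_less_iff[OF m i] I by simp
  qed
  then have "sorted_list_of_set (set (map \<theta> (sorted_list_of_set I))) = map \<theta> (sorted_list_of_set I)"
    by (intro sorted_list_of_set.idem_if_sorted_distinct) (auto simp: strict_sorted_iff)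
  then have s: "sorted_list_of_set (\<theta> ` I) = map \<theta> (sorted_list_of_set I)" using I by simp
  show ?thesis
  proof
    fix j
    show "compose {0..card I - 1} \<theta> (face_map I) j = face_map (\<theta> ` I) j"
      unfolding face_map_def compose_def s c
      using face_map_interval by (auto simp: restrict_def)
  qed
qed

end

text \<open>If \<open>\<theta>\<close> is not injective, then \<open>s\<close> is not injective either, and \<open>\<theta>\<close> is exhibited as a degenerate
  simplex of the face \<open>K\<close>.\<close>

lemma ord_maps_factor:
  assumes \<theta>: "\<theta> \<in> ord_maps m n" and K: "K = \<theta> ` {0..m}"
  obtains s where "s \<in> ord_maps m (card K - 1)" "compose {0..m} (face_map K) s = \<theta>"
    "inj_on s {0..m} \<longleftrightarrow> inj_on \<theta> {0..m}"
proof -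
  have fin: "finite K" "K \<noteq> {}" using K by auto
  let ?E = "{0..card K - 1}"
  define s where "s = restrict (\<lambda>j. inv_into ?E (face_map K) (\<theta> j)) {0..m}"
  have img: "\<theta> j \<in> face_map K ` ?E" if "j \<in> {0..m}" for j
  proof -
    have "\<theta> j \<in> K" unfolding K using that by (rule imageI)
    then show ?thesis by (simp only: face_map_image[OF fin])
  qed
  have s1: "s j \<in> ?E" and s2: "face_map K (s j) = \<theta> j" if "j \<in> {0..m}" for j
    using inv_into_into[OF img[OF that]] f_inv_into_f[OF img[OF that]] that by (auto simp: s_def)
  have mono: "s i \<le> s j" if "i \<in> {0..m}" "j \<in> {0..m}" "i \<le> j" for i j
  proof (rule ccontr)
    assume "\<not> s i \<le> s j"
    then have "face_map K (s j) < face_map K (s i)" by (intro face_map_less[OF fin s1[OF that(2)] s1[OF that(1)]]) simp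
    then show False using s2[OF that(1)] s2[OF that(2)] mono_onD[OF ord_maps_D(2)[OF \<theta>] that] by simp
  qed
  have "s \<in> {0..m} \<rightarrow>\<^sub>E ?E" using s1 by (auto simp: s_def PiE_def extensional_def restrict_def)
  moreover have "mono_on {0..m} s" using mono by (rule mono_onI)
  ultimately have so: "s \<in> ord_maps m (card K - 1)" unfolding ord_maps_def by blast
  have ext: "\<theta> \<in> extensional {0..m}" using \<theta> by (auto simp: ord_maps_def PiE_def)
  have c: "compose {0..m} (face_map K) s = \<theta>"
    by (rule extensionalityI[OF _ ext]) (auto simp: compose_def s2 simp del: atLeastAtMost_iff)
  have "inj_on s {0..m} \<longleftrightarrow> inj_on \<theta> {0..m}"
  proof
    assume "inj_on \<theta> {0..m}"
    then show "inj_on s {0..m}" using s2 by (metis inj_on_def)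
  next
    assume i: "inj_on s {0..m}"
    show "inj_on \<theta> {0..m}"
    proof (rule inj_onI)
      fix a b assume ab: "a \<in> {0..m}" "b \<in> {0..m}" "\<theta> a = \<theta> b"
      then have "face_map K (s a) = face_map K (s b)" using s2 by simp
      then have "s a = s b" using inj_onD[OF face_map_inj[OF fin]] s1 ab by blast
      then show "a = b" using inj_onD[OF i] ab by blast
    qed
  qed
  with so c show ?thesis using that by blast
qed

lemma horn_simplices: "\<theta> \<in> simplices (horn n k) m \<longleftrightarrow> \<theta> \<in> ord_maps m n \<and> (\<exists>i\<in>{0..n}. i \<noteq> k \<and> i \<notin> \<theta> ` {0..m})"
  by (auto simp: horn_def)

lemma horn_act: "act (horn n k) l m \<eta> \<theta> = compose {0..l} \<theta> \<eta>"
  by (simp add: horn_def std_simplex_def)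

lemma interval_face: "{0..m} \<in> faces m" by (simp add: faces_def)

context bar_pair
begin

text \<open>The member at \<open>I\<close> is the value on the top face of the simplex that the horn assigns to the
  enumeration of \<open>I\<close>.\<close>

definition horn_family :: "(nat \<Rightarrow> (nat \<Rightarrow> nat) \<Rightarrow> int \<Rightarrow> (nat set \<Rightarrow>\<^sub>0 int, 'a words) tens \<Rightarrow> 'b words)
     \<Rightarrow> nat set \<Rightarrow> int \<Rightarrow> 'a words \<Rightarrow> 'b words" where
  "horn_family h I = face_family (card I - 1) (h (card I - 1) (face_map I)) {0..card I - 1}"

context
  fixes n k h
  assumes h: "simplicial_map (horn n k) HOM h"
begin

lemma horn_Hom: "\<theta> \<in> simplices (horn n k) m \<Longrightarrow> h m \<theta> \<in> dgcog_Hom (C m) CB"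
  using h by (auto simp: simplicial_map_def HOM_def)

lemma horn_pullback: "\<eta> \<in> ord_maps l m \<Longrightarrow> \<theta> \<in> simplices (horn n k) m
    \<Longrightarrow> h l (compose {0..l} \<theta> \<eta>) = pullback l m \<eta> (h m \<theta>)"
  using h by (simp add: simplicial_map_def HOM_def horn_act)

text \<open>A horn is determined by its family: if \<open>\<theta>\<close> is injective on \<open>J\<close>, restricting \<open>\<theta>\<close> to \<open>J\<close> gives the
  enumeration of the image; otherwise it gives a degenerate simplex, and degenerate simplices vanish on
  the top face.\<close>

lemma horn_family_simplex:
  assumes \<theta>: "\<theta> \<in> simplices (horn n k) m" and J: "J \<in> faces m" and x: "x \<in> carrier (A.T d)"
  shows "face_family m (h m \<theta>) J d x = pullback_family \<theta> (horn_family h) J d x"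
proof -
  have \<theta>': "\<theta> \<in> ord_maps m n" using \<theta> by (simp add: horn_simplices)
  obtain i where i: "i \<in> {0..n}" "i \<noteq> k" "i \<notin> \<theta> ` {0..m}" using \<theta> unfolding horn_simplices by blast
  have fin: "finite J" "J \<noteq> {}" and sub: "J \<subseteq> {0..m}" using J finite_face[OF J] by (auto simp: faces_def)
  define e where "e = card J - 1"
  have \<eta>: "face_map J \<in> ord_maps e m" unfolding e_def by (rule face_map_ord_maps[OF fin sub])
  have img: "face_map J ` {0..e} = J" unfolding e_def by (rule face_map_image[OF fin])
  have inj: "inj_on (face_map J) {0..e}" unfolding e_def by (rule face_map_inj[OF fin])
  have dg: "face_degree {0..e} = face_degree J" using face_degree_image[OF inj] unfolding img by simp
  have *: "face_family m (h m \<theta>) J d x = face_family e (h e (compose {0..e} \<theta> (face_map J))) {0..e} d x"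
    using pullback_Hom(2)[OF \<eta> horn_Hom[OF \<theta>] interval_face x] inj img
    by (simp add: horn_pullback[OF \<eta> \<theta>] pullback_family_def)
  show ?thesis
  proof (cases "inj_on \<theta> J")
    case True
    have "compose {0..e} \<theta> (face_map J) = face_map (\<theta> ` J)"
      unfolding e_def by (rule compose_face_map_inj[OF fin ord_maps_D(2)[OF \<theta>'] sub True])
    then show ?thesis
      using * True card_image[OF True] by (simp add: pullback_family_def horn_family_def e_def)
  next
    case False
    define \<phi> where "\<phi> = compose {0..e} \<theta> (face_map J)"
    have \<phi>: "\<phi> \<in> ord_maps e n" unfolding \<phi>_def by (rule compose_ord_maps[OF \<eta> \<theta>'])
    have \<phi>img: "\<phi> ` {0..e} = \<theta> ` J" unfolding \<phi>_def compose_image[OF order_refl] img ..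
    have ninj: "\<not> inj_on \<phi> {0..e}" unfolding \<phi>_def inj_on_compose_iff[OF order_refl] img using False by simp
    define K where "K = \<phi> ` {0..e}"
    obtain s where s: "s \<in> ord_maps e (card K - 1)" "compose {0..e} (face_map K) s = \<phi>" "inj_on s {0..e} \<longleftrightarrow> inj_on \<phi> {0..e}"
      by (rule ord_maps_factor[OF \<phi> K_def])
    have Kf: "finite K" "K \<noteq> {}" unfolding K_def by auto
    have "\<phi> ` {0..e} \<subseteq> {0..n}" using ord_maps_D(1)[OF \<phi>] by blast
    then have Ks: "K \<subseteq> {0..n}" by (simp add: K_def)
    have "i \<notin> K" unfolding K_def \<phi>img using i(3) sub by blast
    then have fK: "face_map K \<in> simplices (horn n k) (card K - 1)"
      unfolding horn_simplices face_map_image[OF Kf] using face_map_ord_maps[OF Kf Ks] i by blast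
    have "face_family e (h e \<phi>) {0..e} d x = \<one>\<^bsub>B.T (d + face_degree {0..e})\<^esub>"
      using pullback_Hom(2)[OF s(1) horn_Hom[OF fK] interval_face x] horn_pullback[OF s(1) fK] s(2,3) ninj
      by (simp add: pullback_family_def)
    then show ?thesis using * False by (simp add: pullback_family_def dg \<phi>_def)
  qed
qed

text \<open>Each rule at \<open>I\<close> is the rule at the top face for a higher morphism that the horn contains,
  transported along the enumeration of \<open>I\<close>.\<close>

lemma horn_family_morphism: "morphism_family (horn_faces n k) (horn_family h)"
proof -
  have key: "face_map I \<in> simplices (horn n k) (card I - 1)" "finite I" "I \<noteq> {}" "I \<subseteq> {0..n}" if I: "I \<in> horn_faces n k" for I
  proof -
    show fin: "finite I" "I \<noteq> {}" "I \<subseteq> {0..n}"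
      using face_closedD[OF face_closed_horn_faces I] horn_faces_subset[OF I] by (auto simp: faces_def)
    show "face_map I \<in> simplices (horn n k) (card I - 1)"
      unfolding horn_simplices face_map_image[OF fin(1,2)]
      using face_map_ord_maps[OF fin] I by (simp add: horn_faces_def)
  qed
  have fam: "family (horn_faces n k) (horn_family h)"
    unfolding family_def
  proof
    fix I assume I: "I \<in> horn_faces n k"
    have "face_degree {0..card I - 1} = face_degree I"
      using face_degree_image[OF face_map_inj[OF key(2,3)[OF I]]] unfolding face_map_image[OF key(2,3)[OF I]] by simp
    moreover have "family (faces (card I - 1)) (face_family (card I - 1) (h (card I - 1) (face_map I)))"
      using dgcog_Hom_family[OF horn_Hom[OF key(1)[OF I]]] by (simp add: morphism_family_def)
    ultimately show "horn_family h I \<in> graded_maps (face_degree I) A.T B.T"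
      unfolding horn_family_def using family_graded[OF _ interval_face] by metis
  qed
  have "coproduct_rule (horn_family h) I d x \<and> differential_rule (horn_family h) I d x"
    if I: "I \<in> horn_faces n k" and x: "x \<in> carrier (A.T d)" for I d x
  proof -
    let ?e = "card I - 1"
    let ?G = "face_family ?e (h ?e (face_map I))"
    note q = key[OF I]
    have mf: "morphism_family (faces ?e) ?G" by (rule dgcog_Hom_family[OF horn_Hom[OF q(1)]])
    have fl: "finite {0..?e}" "{0..?e} \<noteq> {}" by auto
    have a: "face_map I ` J \<in> horn_faces n k" if "J \<subseteq> {0..?e}" "J \<noteq> {}" "inj_on (face_map I) J" for J
    proof (rule face_closedD(3)[OF face_closed_horn_faces I])
      show "face_map I ` J \<subseteq> I" using image_mono[OF that(1), of "face_map I"] unfolding face_map_image[OF q(2,3)] .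
    qed (use that in simp)
    have b: "?G J \<in> graded_maps (face_degree J) A.T B.T" if "J \<subseteq> {0..?e}" "J \<noteq> {}" for J
      using mf that by (auto simp: morphism_family_def faces_def intro: family_graded)
    have c: "?G J i y = pullback_family (face_map I) (horn_family h) J i y"
      if "J \<subseteq> {0..?e}" "J \<noteq> {}" "y \<in> carrier (A.T i)" for J i y
      by (rule horn_family_simplex[OF q(1) _ that(3)]) (use that in \<open>simp add: faces_def\<close>)
    have "coproduct_rule ?G {0..?e} d x \<and> differential_rule ?G {0..?e} d x"
      using mf x interval_face by (simp add: morphism_family_def)
    then show ?thesis
      using pullback_rules_inj[OF fl face_map_mono[OF q(2,3)] order_refl fam a b c x face_map_inj[OF q(2,3)]]
      unfolding face_map_image[OF q(2,3)] by blast
  qed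
  then show ?thesis using fam by (simp add: morphism_family_def)
qed

lemma horn_extension:
  assumes n: "1 \<le> n" and k: "k \<le> n"
  obtains G where "simplicial_map (std_simplex n) HOM G"
    "\<And>m \<theta>. \<theta> \<in> simplices (horn n k) m \<Longrightarrow> G m \<theta> = h m \<theta>"
proof -
  interpret F: horn_filling VA VB DA DB n k "horn_family h"
    by (intro horn_filling.intro horn_filling_axioms.intro bar_pair_axioms n k horn_family_morphism)
  obtain f where f: "represents n f F.fill" "\<And>d. f d \<in> extensional (carrier (tensor (S n) A.T d))"
    by (rule represents_exists[OF F.fill_family]) blast
  have fH: "f \<in> dgcog_Hom (C n) CB" using dgcog_Hom_iff[OF f] F.fill_morphism_family by blast
  define G where "G m \<theta> = pullback m n \<theta> f" for m \<theta>
  have "simplicial_map (std_simplex n) HOM G"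
    unfolding simplicial_map_def
  proof (intro conjI allI ballI)
    show "G m \<in> simplices (std_simplex n) m \<rightarrow> simplices HOM m" for m
      using pullback_Hom(1)[OF _ fH] by (auto simp: std_simplex_def HOM_def G_def)
    fix l m \<eta> \<theta> assume \<eta>: "\<eta> \<in> ord_maps l m" and "\<theta> \<in> simplices (std_simplex n) m"
    then have "\<theta> \<in> ord_maps m n" by (simp add: std_simplex_def)
    then have "act HOM l n (compose {0..l} \<theta> \<eta>) f = act HOM l m \<eta> (act HOM m n \<theta> f)"
      using simplicial_set_HOM \<eta> fH unfolding simplicial_set_def by (simp add: HOM_def)
    then show "G l (act (std_simplex n) l m \<eta> \<theta>) = act HOM l m \<eta> (G m \<theta>)"
      by (simp add: std_simplex_def HOM_def G_def)
  qed
  moreover have "G m \<theta> = h m \<theta>" if \<theta>: "\<theta> \<in> simplices (horn n k) m" for m \<theta>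
    unfolding G_def
  proof -
    have \<theta>': "\<theta> \<in> ord_maps m n" using \<theta> by (simp add: horn_simplices)
    obtain i where i: "i \<in> {0..n}" "i \<noteq> k" "i \<notin> \<theta> ` {0..m}" using \<theta> unfolding horn_simplices by blast
    show "pullback m n \<theta> f = h m \<theta>"
    proof (rule dgcog_Hom_eqI[OF pullback_Hom(1)[OF \<theta>' fH] horn_Hom[OF \<theta>]])
      fix J d x assume J: "J \<in> faces m" and x: "x \<in> carrier (A.T d)"
      have JF: "\<theta> ` J \<in> faces n" by (rule faces_image[OF J ord_maps_D(1)[OF \<theta>']])
      have "J \<subseteq> {0..m}" using J by (simp add: faces_def)
      then have "i \<notin> \<theta> ` J" using i(3) by blast
      then have JH: "\<theta> ` J \<in> horn_faces n k" using JF i unfolding horn_faces_def by blast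
      have "face_family n f (\<theta> ` J) d x = horn_family h (\<theta> ` J) d x"
        using represents_face[OF f(1) JF x refl] F.fill_horn[OF JH x] by (simp add: face_family_def)
      then show "face_family m (pullback m n \<theta> f) J d x = face_family m (h m \<theta>) J d x"
        unfolding pullback_Hom(2)[OF \<theta>' fH J x] horn_family_simplex[OF \<theta> J x] by (simp add: pullback_family_def)
    qed
  qed
  ultimately show ?thesis using that by blast
qed

end

theorem kan_complex_HOM: "kan_complex HOM"
  unfolding kan_complex_def
proof (intro conjI allI impI)
  fix n k h assume "1 \<le> n \<and> k \<le> n \<and> simplicial_map (horn n k) HOM h"
  then have *: "simplicial_map (horn n k) HOM h" "1 \<le> n" "k \<le> n" by auto
  show "\<exists>G. simplicial_map (std_simplex n) HOM G \<and> (\<forall>m. \<forall>\<theta>\<in>simplices (horn n k) m. G m \<theta> = h m \<theta>)"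
    by (rule horn_extension[OF *]) blast
qed (rule simplicial_set_HOM)

end

lemma bar_pair_ainf:
  assumes "A_infinity_algebra A" "A_infinity_algebra B"
  shows "bar_pair (suspension (underlying A)) (suspension (underlying B)) (codiff A) (codiff B)"
proof (intro bar_pair.intro words_pair.intro graded_words.intro bar_pair_axioms.intro)
  show "graded_module (suspension (underlying A))" "graded_module (suspension (underlying B))"
    using assms by (simp_all add: A_infinity_algebra_def Let_def graded_module_def suspension_def)
qed (use assms in \<open>simp_all add: A_infinity_algebra_def Let_def\<close>)

theorem theorem1:
  fixes A :: "'a ainf" and B :: "'b ainf"
  assumes "A_infinity_algebra A" and "A_infinity_algebra B"
  shows "kan_complex (HOM_ainf A B)"
proof -
  interpret bar_pair "suspension (underlying A)" "suspension (underlying B)" "codiff A" "codiff B"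
    by (rule bar_pair_ainf[OF assms])
  have "HOM_ainf A B = HOM"
    by (simp add: HOM_ainf_def HOM_def n_morphisms_def bar_def pullback_def fun_eq_iff)
  then show ?thesis using kan_complex_HOM by simp
qed

end
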